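(* Let $k$ be a commutative ring and let $(A,1,\overline\mu+h+\mu_{\mathrm{su}})$ be an $A_\infty$-algebra with split unit. There is a functor from the category of strictly unital representations of $A$ to the category of curved dg-comodules over $\mathrm{Bar}_{\mathrm u}\overline A$ that sends $(M,\overline p_M)$ to $(\mathrm{Bar}_{\mathrm u}\overline A\otimes M,\phi^{-1}(\overline\lambda_M))$, where $\overline\lambda_M$ is the adjoint family of $\overline p_M$. This functor is fully faithful with image the full subcategory of cofree curved dg-comodules.
   Context: Conventions: modules, maps, tensor products are over $k$; graded means $\mathbb Z$-graded. $\mathrm{Hom}(M,N)_n=\prod_i\mathrm{Hom}(M_i,N_{i+n})$. $(\Pi M)_n=M_{n-1}$, $s:M\to\Pi M$ is the degree $1$ identity map, $[x]=s(x)$, $[x_1|\dots|x_n]=[x_1]\otimes\dots\otimes[x_n]$. Koszul sign rule: $(f\otimes g)(x\otimes y)=(-1)^{|g||x|}f(x)\otimes g(y)$. $CC^n(A,B)=\mathrm{Hom}((\Pi A)^{\otimes n},\Pi B)$, $CC^\bullet(A,B)=\prod_{n\ge1}CC^n(A,B)$ and $CC^\bullet_{\mathsf u}(A,B)=\prod_{n\ge0}CC^n(A,B)=CC^\bullet(A,B)\oplus\Pi B$; elements $f=(f^n)$; a subscript $i$ denotes the degree $i$ part; $f^{\ge1}$ is the $CC^\bullet$-component of $f\in CC^\bullet_{\mathsf u}$. $(g\circ f)^n=\sum_{i=1}^n\sum_{j=0}^{i-1}g^i(1^{\otimes j}\otimes f^{n-i+1}\otimes1^{\otimes i-j-1})$;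 $(f*g)^n=\sum_{i_1+\dots+i_m=n}f^m(g^{i_1}\otimes\dots\otimes g^{i_m})$ for $g$ of degree $0$. An $A_\infty$-structure on $A$ is $\nu\in CC^\bullet(A,A)_{-1}$ with $\nu\circ\nu=0$; an $A_\infty$-morphism $(A,\nu_A)\to(B,\nu_B)$ is $g\in CC^\bullet(A,B)_0$ with $\nu_B*g=g\circ\nu_A$. A graded module with split element is $(A,1)$, where $1\in A_0$ generates a free rank one submodule, with a fixed graded splitting $A\to k$ of $k\to A$, $1\mapsto1$; $\overline A=A/(k\cdot1)\subseteq A$, $A=\overline A\oplus k$. $CC^\bullet(\overline A,B)\subseteq CC^\bullet(A,B)$ and $CC_{\mathsf u}^\bullet(\overline A,B)\subseteq CC_{\mathsf u}^\bullet(A,B)$ via $A\to\overline A$ (extension by zero to tensors with an entry $[1]$). $\mu_{\mathrm{su}}\in CC^\bullet(A,A)_{-1}$ has $\mu_{\mathrm{su}}^n=0$ for $n\ne2$, $\mu_{\mathrm{su}}^2[1|a]=[a]$, $\mu_{\mathrm{su}}^2[a|1]=(-1)^{|a|}[a]$, $\mu_{\mathrm{su}}^2=0$ on $\Pi\overline A\otimes\Pi\overline A$. An $A_\infty$-algebra with split unit is $(A,1,\overline\mu+h+\mu_{\mathrm{su}})$ with $(A,1)$ a module with split element, $\overline\mu\in CC^\bullet(\overline A,\overline A)_{-1}$, $h\in CC^\bullet(\overline A,k)_{-1}$, and $\overline\mu+h+\mu_{\mathrm{su}}$ an $A_\infty$-structure. Representations. For a complex $(M,\delta_M)$, $\mathrm{End}\,M=\mathrm{Hom}(M,M)$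 carries the $A_\infty$-structure $\mu_{\mathrm{End}}$ with $\mu_{\mathrm{End}}^1[\varphi]=[\delta_M\varphi-(-1)^{|\varphi|}\varphi\delta_M]$, $\mu_{\mathrm{End}}^2[\varphi|\varphi']=(-1)^{|\varphi|}[\varphi\varphi']$, $\mu^n_{\mathrm{End}}=0$ for $n\ge3$. The element $g_{\mathrm{su}}\in CC^\bullet(A,\mathrm{End}\,M)_0$ has $g_{\mathrm{su}}^1[1]=[1_M]$, $g_{\mathrm{su}}^1=0$ on $\Pi\overline A$, and $g_{\mathrm{su}}^n=0$ for $n\ge2$. A strictly unital representation $(M,\overline p)$ of $A$ is a graded module $M$ with $\overline p\in CC_{\mathsf u}^\bullet(\overline A,\mathrm{End}\,M)_0$ such that $\delta_M=-s^{-1}\overline p^0\in\mathrm{End}(M)_{-1}$ satisfies $\delta_M^2=0$ and $\overline p^{\ge1}+g_{\mathrm{su}}$ is an $A_\infty$-morphism from $A$ to $(\mathrm{End}\,M,\mu_{\mathrm{End}})$ for the complex $(M,\delta_M)$. For $\alpha\in CC_{\mathsf u}^\bullet(A,\mathrm{Hom}(N,P))$, $\beta\in CC_{\mathsf u}^\bullet(A,\mathrm{Hom}(M,N))$: $(\alpha\star\beta)^n=\gamma\sum_{j=0}^n\alpha^j\otimes\beta^{n-j}$, where $\gamma=s\,c\,(s^{-1}\otimes s^{-1})$ and $c$ is composition. With $\mu=\overline\mu+h+\mu_{\mathrm{su}}$, $p_M=\overline p_M+g_{\mathrm{su}}$, $p_N=\overline p_N+g_{\mathrm{su}}$, a morphism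 $(M,\overline p_M)\to(N,\overline p_N)$ of strictly unital representations is $f\in CC^\bullet_{\mathsf u}(\overline A,\mathrm{Hom}(M,N))_1$ with $p_N\star f-f^{\ge1}\circ\mu+f\star p_M=0$. The composite of $f$ with a second morphism $\widetilde f:(N,\overline p_N)\to(P,\overline p_P)$ is $\widetilde f\star f$ (with the sign conventions above, the identity of $(M,\overline p_M)$ is the element with $f^0=-[1_M]$ and $f^n=0$ for $n\ge1$). Adjoints. The adjoint of $q^n\in CC^n(\overline A,\mathrm{Hom}(M,N))$, $n\ge0$, is $\lambda^{n+1}=\mathrm{ev}(s^{-1}q^n\otimes1):(\Pi\overline A)^{\otimes n}\otimes M\to N$, $\mathrm{ev}(\varphi\otimes m)=\varphi(m)$. The adjoint family $(\lambda^{n+1})_{n\ge0}$ is viewed as a map $T_{\mathsf{co,u}}(\Pi\overline A)\otimes M\to N$. Coalgebras. $T_{\mathsf{co,u}}(V)=\bigoplus_{n\ge0}V^{\otimes n}$ is the counital tensor coalgebra with deconcatenation coproduct $\Delta(v_1\otimes\dots\otimes v_n)=\sum_{i=0}^n(v_1\otimes\dots\otimes v_i)\otimes(v_{i+1}\otimes\dots\otimes v_n)$. $\mathrm{Bar}_{\mathrm u}\overline A=(T_{\mathsf{co,u}}(\Pi\overline A),d,\xi)$, where $d$ is zero on $k=(\Pi\overline A)^{\otimes0}$ and $\sum_{i,j}1^{\otimes j}\otimes\overline\mu^{\,i}\otimes1^{\otimes n-i-j}$ on $(\Pi\overline A)^{\otimes n}$, and $\xi=-s^{-1}h$ (zero on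 $(\Pi\overline A)^{\otimes0}$); it is a curved dg-coalgebra, i.e. $d$ is a degree $-1$ coderivation, $\xi$ has degree $-2$, $d^2=(\xi\otimes1)\Delta-(1\otimes\xi)\Delta$ and $\xi d=0$. A coderivation of a graded (left) $C$-comodule $P$ with respect to $d$ is a homogeneous $d_P:P\to P$, $|d_P|=|d|$, with $(d\otimes1+1\otimes d_P)\Delta_P=\Delta_Pd_P$. A curved dg-comodule over $(C,d,\xi)$ is $(P,d_P)$ with $d_P$ a degree $-1$ coderivation with respect to $d$ and $d_P^2=(\xi\otimes1)\Delta_P$ (identifying $k\otimes P\cong P$). A morphism of curved dg-comodules is a degree zero graded comodule morphism commuting with the coderivations. The cofree comodule on a graded module $M$ is $C\otimes M$ with coaction $\Delta_C\otimes1$; a curved dg-comodule is cofree if its underlying graded comodule is cofree. For $m:C\otimes M\to M$ of degree $-1$, $\phi^{-1}(m)=d\otimes1+(1\otimes m)(\Delta_C\otimes1)$. *)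

theory Defs
  imports "HOL-Algebra.Module" "HOL-Algebra.AbelCoset"
begin

section \<open>Categories\<close>

record ('o, 'f) precat =
  Ob  :: "'o set"
  Arr :: "'o \<Rightarrow> 'o \<Rightarrow> 'f set"
  Idt :: "'o \<Rightarrow> 'f"
  Cmp :: "'o \<Rightarrow> 'o \<Rightarrow> 'o \<Rightarrow> 'f \<Rightarrow> 'f \<Rightarrow> 'f"

text \<open>\<open>Cmp C X Y Z g f\<close> is the composite of \<open>f : X \<rightarrow> Y\<close> and \<open>g : Y \<rightarrow> Z\<close>.\<close>

definition is_category :: "('o, 'f) precat \<Rightarrow> bool" where
  "is_category C \<longleftrightarrow>
     (\<forall>X\<in>Ob C. Idt C X \<in> Arr C X X) \<and>
     (\<forall>X\<in>Ob C. \<forall>Y\<in>Ob C. \<forall>Z\<in>Ob C. \<forall>f\<in>Arr C X Y. \<forall>g\<in>Arr C Y Z. Cmp C X Y Z g f \<in> Arr C X Z) \<and>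
     (\<forall>X\<in>Ob C. \<forall>Y\<in>Ob C. \<forall>f\<in>Arr C X Y.
        Cmp C X X Y f (Idt C X) = f \<and> Cmp C X Y Y (Idt C Y) f = f) \<and>
     (\<forall>W\<in>Ob C. \<forall>X\<in>Ob C. \<forall>Y\<in>Ob C. \<forall>Z\<in>Ob C. \<forall>f\<in>Arr C W X. \<forall>g\<in>Arr C X Y. \<forall>h\<in>Arr C Y Z.
        Cmp C W Y Z h (Cmp C W X Y g f) = Cmp C W X Z (Cmp C X Y Z h g) f)"

definition is_functor ::
  "('o, 'f) precat \<Rightarrow> ('p, 'g) precat \<Rightarrow> ('o \<Rightarrow> 'p) \<Rightarrow> ('o \<Rightarrow> 'o \<Rightarrow> 'f \<Rightarrow> 'g) \<Rightarrow> bool" where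
  "is_functor C D Fo Fa \<longleftrightarrow>
     is_category C \<and> is_category D \<and>
     (\<forall>X\<in>Ob C. Fo X \<in> Ob D) \<and>
     (\<forall>X\<in>Ob C. \<forall>Y\<in>Ob C. \<forall>f\<in>Arr C X Y. Fa X Y f \<in> Arr D (Fo X) (Fo Y)) \<and>
     (\<forall>X\<in>Ob C. Fa X X (Idt C X) = Idt D (Fo X)) \<and>
     (\<forall>X\<in>Ob C. \<forall>Y\<in>Ob C. \<forall>Z\<in>Ob C. \<forall>f\<in>Arr C X Y. \<forall>g\<in>Arr C Y Z.
        Fa X Z (Cmp C X Y Z g f) = Cmp D (Fo X) (Fo Y) (Fo Z) (Fa Y Z g) (Fa X Y f))"

definition fully_faithful ::
  "('o, 'f) precat \<Rightarrow> ('p, 'g) precat \<Rightarrow> ('o \<Rightarrow> 'p) \<Rightarrow> ('o \<Rightarrow> 'o \<Rightarrow> 'f \<Rightarrow> 'g) \<Rightarrow> bool" where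
  "fully_faithful C D Fo Fa \<longleftrightarrow>
     (\<forall>X\<in>Ob C. \<forall>Y\<in>Ob C. bij_betw (Fa X Y) (Arr C X Y) (Arr D (Fo X) (Fo Y)))"

definition isomorphic_in :: "('o, 'f) precat \<Rightarrow> 'o \<Rightarrow> 'o \<Rightarrow> bool" where
  "isomorphic_in C X Y \<longleftrightarrow>
     (\<exists>f\<in>Arr C X Y. \<exists>g\<in>Arr C Y X. Cmp C X Y X g f = Idt C X \<and> Cmp C Y X Y f g = Idt C Y)"


section \<open>Graded modules\<close>

text \<open>
  A graded module is a family of modules indexed by the degree. A homogeneous map of degree \<open>n\<close>
  is a family \<open>f i : M i \<rightarrow> N (i + n)\<close>; maps are extensional (\<open>undefined\<close> outside of the
  carriers), so that equality of maps is equality in HOL. A homogeneous element is passed as a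
  pair \<open>(degree, element)\<close> where its degree is needed.
\<close>

type_synonym ('k, 'm) gmod = "int \<Rightarrow> ('k, 'm) module"
type_synonym ('m, 'n) gmap = "int \<Rightarrow> 'm \<Rightarrow> 'n"

text \<open>Module records inherit unused multiplicative fields from the ring records.\<close>

definition mk_module ::
  "'m set \<Rightarrow> 'm \<Rightarrow> ('m \<Rightarrow> 'm \<Rightarrow> 'm) \<Rightarrow> ('k \<Rightarrow> 'm \<Rightarrow> 'm) \<Rightarrow> ('k, 'm) module" where
  "mk_module S z a s = \<lparr>carrier = S, mult = undefined, one = undefined, zero = z, add = a, smult = s\<rparr>"

definition gmodule :: "'k ring \<Rightarrow> ('k, 'm) gmod \<Rightarrow> bool" where
  "gmodule R M \<longleftrightarrow> (\<forall>i. module R (M i))"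

definition linear_maps :: "'k ring \<Rightarrow> ('k, 'm) module \<Rightarrow> ('k, 'n) module \<Rightarrow> ('m \<Rightarrow> 'n) set" where
  "linear_maps R M N = {f \<in> carrier M \<rightarrow>\<^sub>E carrier N.
     (\<forall>x\<in>carrier M. \<forall>y\<in>carrier M. f (x \<oplus>\<^bsub>M\<^esub> y) = f x \<oplus>\<^bsub>N\<^esub> f y) \<and>
     (\<forall>r\<in>carrier R. \<forall>x\<in>carrier M. f (r \<odot>\<^bsub>M\<^esub> x) = r \<odot>\<^bsub>N\<^esub> f x)}"

definition HOM :: "'k ring \<Rightarrow> ('k, 'm) gmod \<Rightarrow> ('k, 'n) gmod \<Rightarrow> ('k, ('m, 'n) gmap) gmod" where
  "HOM R M N n = mk_module
     {f. \<forall>i. f i \<in> linear_maps R (M i) (N (i + n))}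
     (\<lambda>i. \<lambda>x\<in>carrier (M i). \<zero>\<^bsub>N (i + n)\<^esub>)
     (\<lambda>f g i. \<lambda>x\<in>carrier (M i). f i x \<oplus>\<^bsub>N (i + n)\<^esub> g i x)
     (\<lambda>r f i. \<lambda>x\<in>carrier (M i). r \<odot>\<^bsub>N (i + n)\<^esub> f i x)"

definition gid :: "('k, 'm) gmod \<Rightarrow> ('m, 'm) gmap" where
  "gid M = (\<lambda>i. \<lambda>x\<in>carrier (M i). x)"

text \<open>\<open>gcomp M b g f\<close> is \<open>g\<close> after \<open>f\<close>, where \<open>f\<close> has source \<open>M\<close> and degree \<open>b\<close>.\<close>

definition gcomp :: "('k, 'm) gmod \<Rightarrow> int \<Rightarrow> ('n, 'p) gmap \<Rightarrow> ('m, 'n) gmap \<Rightarrow> ('m, 'p) gmap" where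
  "gcomp M b g f = (\<lambda>i. \<lambda>x\<in>carrier (M i). g (i + b) (f i x))"

text \<open>The suspension \<open>\<Pi>\<close>; the degree one map \<open>s : M \<rightarrow> \<Pi> M\<close> does not change the underlying element.\<close>

definition susp :: "('k, 'm) gmod \<Rightarrow> ('k, 'm) gmod" where
  "susp M = (\<lambda>n. M (n - 1))"

definition kmod :: "'k ring \<Rightarrow> ('k, 'k) gmod" where
  "kmod R i = mk_module (if i = 0 then carrier R else {\<zero>\<^bsub>R\<^esub>}) \<zero>\<^bsub>R\<^esub> (add R) (mult R)"

text \<open>The isomorphism \<open>k \<otimes> M \<rightarrow> M\<close> on pairs of homogeneous elements.\<close>

definition kact :: "('k, 'm) gmod \<Rightarrow> int \<times> 'k \<Rightarrow> int \<times> 'm \<Rightarrow> 'm" where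
  "kact M = (\<lambda>(i, r) (j, x). if i = 0 then r \<odot>\<^bsub>M j\<^esub> x else \<zero>\<^bsub>M (i + j)\<^esub>)"

text \<open>\<open>sgn_pow R n\<close> is \<open>(-1)\<^sup>n\<close>.\<close>

definition sgn_pow :: "'k ring \<Rightarrow> int \<Rightarrow> 'k" where
  "sgn_pow R n = (if even n then \<one>\<^bsub>R\<^esub> else \<ominus>\<^bsub>R\<^esub> \<one>\<^bsub>R\<^esub>)"


section \<open>Modules given by generators and relations\<close>

definition free_module :: "'k ring \<Rightarrow> 'g set \<Rightarrow> ('k, 'g \<Rightarrow> 'k) module" where
  "free_module R G = mk_module
     {u. finite {g. u g \<noteq> \<zero>\<^bsub>R\<^esub>} \<and> (\<forall>g\<in>G. u g \<in> carrier R) \<and> (\<forall>g. g \<notin> G \<longrightarrow> u g = \<zero>\<^bsub>R\<^esub>)}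
     (\<lambda>g. \<zero>\<^bsub>R\<^esub>)
     (\<lambda>u v g. u g \<oplus>\<^bsub>R\<^esub> v g)
     (\<lambda>r u g. r \<otimes>\<^bsub>R\<^esub> u g)"

definition basis_elt :: "'k ring \<Rightarrow> 'g \<Rightarrow> 'g \<Rightarrow> 'k" where
  "basis_elt R g = (\<lambda>h. if h = g then \<one>\<^bsub>R\<^esub> else \<zero>\<^bsub>R\<^esub>)"

definition submodule_span :: "'k ring \<Rightarrow> ('k, 'm) module \<Rightarrow> 'm set \<Rightarrow> 'm set" where
  "submodule_span R M S = \<Inter>{H. submodule H R M \<and> S \<subseteq> H}"

definition quotient_module :: "('k, 'm) module \<Rightarrow> 'm set \<Rightarrow> ('k, 'm set) module" where
  "quotient_module M H = mk_module (a_rcosets\<^bsub>M\<^esub> H) H (set_add M)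
     (\<lambda>r X. \<Union>x\<in>X. H +>\<^bsub>M\<^esub> (r \<odot>\<^bsub>M\<^esub> x))"

definition presented :: "'k ring \<Rightarrow> 'g set \<Rightarrow> ('g \<Rightarrow> 'k) set \<Rightarrow> ('k, ('g \<Rightarrow> 'k) set) module" where
  "presented R G S = quotient_module (free_module R G) (submodule_span R (free_module R G) S)"

definition presented_gen :: "'k ring \<Rightarrow> 'g set \<Rightarrow> ('g \<Rightarrow> 'k) set \<Rightarrow> 'g \<Rightarrow> ('g \<Rightarrow> 'k) set" where
  "presented_gen R G S g =
     submodule_span R (free_module R G) S +>\<^bsub>free_module R G\<^esub> basis_elt R g"

text \<open>
  The value at \<open>X\<close> of the linear map out of a presented module that is \<open>\<phi>\<close> on generators. It is
  computed on an arbitrary representative of \<open>X\<close>, hence meaningful if \<open>\<phi>\<close> respects the relations.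
\<close>

definition lin_ext :: "'k ring \<Rightarrow> ('k, 'n) module \<Rightarrow> ('g \<Rightarrow> 'n) \<Rightarrow> ('g \<Rightarrow> 'k) set \<Rightarrow> 'n" where
  "lin_ext R N \<phi> X = (let u = (SOME u. u \<in> X) in \<Oplus>\<^bsub>N\<^esub>g\<in>{g. u g \<noteq> \<zero>\<^bsub>R\<^esub>}. u g \<odot>\<^bsub>N\<^esub> \<phi> g)"


section \<open>Tensor products\<close>

text \<open>
  Generators and relations of the degree \<open>d\<close> part of \<open>M \<otimes> N\<close>, i.e. of the direct sum of all
  \<open>M i \<otimes> N j\<close> with \<open>i + j = d\<close>.
\<close>

definition tens_gens :: "('k, 'm) gmod \<Rightarrow> ('k, 'n) gmod \<Rightarrow> int \<Rightarrow> ((int \<times> 'm) \<times> (int \<times> 'n)) set" where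
  "tens_gens M N d =
     {((i, x), (j, y)) | i x j y. x \<in> carrier (M i) \<and> y \<in> carrier (N j) \<and> i + j = d}"

definition tens_rels ::
  "'k ring \<Rightarrow> ('k, 'm) gmod \<Rightarrow> ('k, 'n) gmod \<Rightarrow> int \<Rightarrow> ((int \<times> 'm) \<times> (int \<times> 'n) \<Rightarrow> 'k) set" where
  "tens_rels R M N d = (let F = free_module R (tens_gens M N d); e = (\<lambda>p q. basis_elt R (p, q)) in
     {e (i, x \<oplus>\<^bsub>M i\<^esub> x') (j, y) \<ominus>\<^bsub>F\<^esub> (e (i, x) (j, y) \<oplus>\<^bsub>F\<^esub> e (i, x') (j, y)) | i x x' j y.
        x \<in> carrier (M i) \<and> x' \<in> carrier (M i) \<and> y \<in> carrier (N j) \<and> i + j = d} \<union>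
     {e (i, x) (j, y \<oplus>\<^bsub>N j\<^esub> y') \<ominus>\<^bsub>F\<^esub> (e (i, x) (j, y) \<oplus>\<^bsub>F\<^esub> e (i, x) (j, y')) | i x j y y'.
        x \<in> carrier (M i) \<and> y \<in> carrier (N j) \<and> y' \<in> carrier (N j) \<and> i + j = d} \<union>
     {e (i, r \<odot>\<^bsub>M i\<^esub> x) (j, y) \<ominus>\<^bsub>F\<^esub> (r \<odot>\<^bsub>F\<^esub> e (i, x) (j, y)) | r i x j y.
        r \<in> carrier R \<and> x \<in> carrier (M i) \<and> y \<in> carrier (N j) \<and> i + j = d} \<union>
     {e (i, x) (j, r \<odot>\<^bsub>N j\<^esub> y) \<ominus>\<^bsub>F\<^esub> (r \<odot>\<^bsub>F\<^esub> e (i, x) (j, y)) | r i x j y.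
        r \<in> carrier R \<and> x \<in> carrier (M i) \<and> y \<in> carrier (N j) \<and> i + j = d})"

type_synonym ('k, 'm, 'n) tens = "((int \<times> 'm) \<times> (int \<times> 'n) \<Rightarrow> 'k) set"

definition tens :: "'k ring \<Rightarrow> ('k, 'm) gmod \<Rightarrow> ('k, 'n) gmod \<Rightarrow> ('k, ('k, 'm, 'n) tens) gmod" where
  "tens R M N d = presented R (tens_gens M N d) (tens_rels R M N d)"

definition tens_elt ::
  "'k ring \<Rightarrow> ('k, 'm) gmod \<Rightarrow> ('k, 'n) gmod \<Rightarrow> int \<times> 'm \<Rightarrow> int \<times> 'n \<Rightarrow> ('k, 'm, 'n) tens" where
  "tens_elt R M N p q = (let d = fst p + fst q in
     presented_gen R (tens_gens M N d) (tens_rels R M N d) (p, q))"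

text \<open>The degree \<open>e\<close> map \<open>M \<otimes> N \<rightarrow> W\<close> with prescribed values on elementary tensors.\<close>

definition tens_ext ::
  "'k ring \<Rightarrow> ('k, 'm) gmod \<Rightarrow> ('k, 'n) gmod \<Rightarrow> ('k, 'w) gmod \<Rightarrow> int
     \<Rightarrow> (int \<times> 'm \<Rightarrow> int \<times> 'n \<Rightarrow> 'w) \<Rightarrow> (('k, 'm, 'n) tens, 'w) gmap" where
  "tens_ext R M N W e \<phi> =
     (\<lambda>d. \<lambda>X\<in>carrier (tens R M N d). lin_ext R (W (d + e)) (\<lambda>(p, q). \<phi> p q) X)"

text \<open>\<open>f \<otimes> g : M \<otimes> N \<rightarrow> M' \<otimes> N'\<close> for \<open>f\<close> of degree \<open>a\<close> and \<open>g\<close> of degree \<open>b\<close>, with the Koszul sign.\<close>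

definition tens_map ::
  "'k ring \<Rightarrow> ('k, 'm) gmod \<Rightarrow> ('k, 'n) gmod \<Rightarrow> ('k, 'm2) gmod \<Rightarrow> ('k, 'n2) gmod \<Rightarrow> int \<Rightarrow> int
     \<Rightarrow> ('m, 'm2) gmap \<Rightarrow> ('n, 'n2) gmap \<Rightarrow> (('k, 'm, 'n) tens, ('k, 'm2, 'n2) tens) gmap" where
  "tens_map R M N M' N' a b f g = tens_ext R M N (tens R M' N') (a + b)
     (\<lambda>(i, x) (j, y). sgn_pow R (b * i) \<odot>\<^bsub>tens R M' N' (i + j + (a + b))\<^esub>
        tens_elt R M' N' (i + a, f i x) (j + b, g j y))"

definition tens_assoc ::
  "'k ring \<Rightarrow> ('k, 'l) gmod \<Rightarrow> ('k, 'm) gmod \<Rightarrow> ('k, 'n) gmod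
     \<Rightarrow> (('k, ('k, 'l, 'm) tens, 'n) tens, ('k, 'l, ('k, 'm, 'n) tens) tens) gmap" where
  "tens_assoc R L M N = (let T = tens R L (tens R M N) in
     tens_ext R (tens R L M) N T 0
       (\<lambda>(i, X) (j, z). lin_ext R (T (i + j))
          (\<lambda>(p, q). tens_elt R L (tens R M N) p (fst q + j, tens_elt R M N q (j, z))) X))"

definition tens_lunit ::
  "'k ring \<Rightarrow> ('k, 'm) gmod \<Rightarrow> (('k, 'k, 'm) tens, 'm) gmap" where
  "tens_lunit R M = tens_ext R (kmod R) M M 0 (kact M)"


section \<open>Tensor powers and the tensor coalgebra\<close>

text \<open>
  \<open>V\<^sup>\<otimes>\<^sup>n\<close> in degree \<open>d\<close> is generated by the words \<open>[(i\<^sub>1, v\<^sub>1), \<dots>, (i\<^sub>n, v\<^sub>n)]\<close> with \<open>v\<^sub>j \<in> V i\<^sub>j\<close> and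
  \<open>i\<^sub>1 + \<dots> + i\<^sub>n = d\<close>, subject to multilinearity.
\<close>

definition wdeg :: "(int \<times> 'v) list \<Rightarrow> int" where
  "wdeg w = sum_list (map fst w)"

definition words :: "('k, 'v) gmod \<Rightarrow> nat \<Rightarrow> int \<Rightarrow> (int \<times> 'v) list set" where
  "words V n d = {w. length w = n \<and> (\<forall>(i, x)\<in>set w. x \<in> carrier (V i)) \<and> wdeg w = d}"

definition word_rels :: "'k ring \<Rightarrow> ('k, 'v) gmod \<Rightarrow> nat \<Rightarrow> int \<Rightarrow> ((int \<times> 'v) list \<Rightarrow> 'k) set" where
  "word_rels R V n d = (let F = free_module R (words V n d); e = basis_elt R in
     {e (u @ (i, x \<oplus>\<^bsub>V i\<^esub> y) # v) \<ominus>\<^bsub>F\<^esub> (e (u @ (i, x) # v) \<oplus>\<^bsub>F\<^esub> e (u @ (i, y) # v)) | u i x y v.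
        u @ (i, x) # v \<in> words V n d \<and> y \<in> carrier (V i)} \<union>
     {e (u @ (i, r \<odot>\<^bsub>V i\<^esub> x) # v) \<ominus>\<^bsub>F\<^esub> (r \<odot>\<^bsub>F\<^esub> e (u @ (i, x) # v)) | u i r x v.
        r \<in> carrier R \<and> u @ (i, x) # v \<in> words V n d})"

type_synonym ('k, 'v) tpow = "((int \<times> 'v) list \<Rightarrow> 'k) set"

definition tpow :: "'k ring \<Rightarrow> ('k, 'v) gmod \<Rightarrow> nat \<Rightarrow> ('k, ('k, 'v) tpow) gmod" where
  "tpow R V n d = presented R (words V n d) (word_rels R V n d)"

definition tword :: "'k ring \<Rightarrow> ('k, 'v) gmod \<Rightarrow> (int \<times> 'v) list \<Rightarrow> ('k, 'v) tpow" where
  "tword R V w = (let n = length w; d = wdeg w in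
     presented_gen R (words V n d) (word_rels R V n d) w)"

definition tpow_ext ::
  "'k ring \<Rightarrow> ('k, 'v) gmod \<Rightarrow> nat \<Rightarrow> ('k, 'w) gmod \<Rightarrow> int \<Rightarrow> ((int \<times> 'v) list \<Rightarrow> 'w)
     \<Rightarrow> (('k, 'v) tpow, 'w) gmap" where
  "tpow_ext R V n W e \<phi> = (\<lambda>d. \<lambda>X\<in>carrier (tpow R V n d). lin_ext R (W (d + e)) \<phi> X)"

definition tco :: "'k ring \<Rightarrow> ('k, 'v) gmod \<Rightarrow> ('k, nat \<Rightarrow> ('k, 'v) tpow) gmod" where
  "tco R V d = mk_module
     {t. (\<forall>n. t n \<in> carrier (tpow R V n d)) \<and> finite {n. t n \<noteq> \<zero>\<^bsub>tpow R V n d\<^esub>}}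
     (\<lambda>n. \<zero>\<^bsub>tpow R V n d\<^esub>)
     (\<lambda>t u n. t n \<oplus>\<^bsub>tpow R V n d\<^esub> u n)
     (\<lambda>r t n. r \<odot>\<^bsub>tpow R V n d\<^esub> t n)"

definition tco_word :: "'k ring \<Rightarrow> ('k, 'v) gmod \<Rightarrow> (int \<times> 'v) list \<Rightarrow> nat \<Rightarrow> ('k, 'v) tpow" where
  "tco_word R V w = (\<lambda>n. if n = length w then tword R V w else \<zero>\<^bsub>tpow R V n (wdeg w)\<^esub>)"

text \<open>The degree \<open>e\<close> map on the direct sum given by a family of degree \<open>e\<close> maps \<open>\<phi> n : V\<^sup>\<otimes>\<^sup>n \<rightarrow> W\<close>.\<close>

definition tco_ext ::
  "'k ring \<Rightarrow> ('k, 'v) gmod \<Rightarrow> ('k, 'w) gmod \<Rightarrow> int \<Rightarrow> (nat \<Rightarrow> (('k, 'v) tpow, 'w) gmap)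
     \<Rightarrow> (nat \<Rightarrow> ('k, 'v) tpow, 'w) gmap" where
  "tco_ext R V W e \<phi> = (\<lambda>d. \<lambda>t\<in>carrier (tco R V d).
     \<Oplus>\<^bsub>W (d + e)\<^esub>n\<in>{n. t n \<noteq> \<zero>\<^bsub>tpow R V n d\<^esub>}. \<phi> n d (t n))"

definition tco_delta ::
  "'k ring \<Rightarrow> ('k, 'v) gmod
     \<Rightarrow> (nat \<Rightarrow> ('k, 'v) tpow, ('k, nat \<Rightarrow> ('k, 'v) tpow, nat \<Rightarrow> ('k, 'v) tpow) tens) gmap" where
  "tco_delta R V = (let T = tco R V; TT = tens R T T in
     tco_ext R V TT 0 (\<lambda>n. tpow_ext R V n TT 0 (\<lambda>w. \<Oplus>\<^bsub>TT (wdeg w)\<^esub>i\<in>{..length w}.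
       tens_elt R T T (wdeg (take i w), tco_word R V (take i w))
                      (wdeg (drop i w), tco_word R V (drop i w)))))"

definition tco_counit :: "'k ring \<Rightarrow> ('k, 'v) gmod \<Rightarrow> (nat \<Rightarrow> ('k, 'v) tpow, 'k) gmap" where
  "tco_counit R V = tco_ext R V (kmod R) 0
     (\<lambda>n. tpow_ext R V n (kmod R) 0 (\<lambda>w. if w = [] then \<one>\<^bsub>R\<^esub> else \<zero>\<^bsub>R\<^esub>))"


section \<open>Hochschild cochains\<close>

type_synonym ('k, 'a, 'b) cochain = "nat \<Rightarrow> (('k, 'a) tpow, 'b) gmap"

definition CCu :: "'k ring \<Rightarrow> ('k, 'a) gmod \<Rightarrow> ('k, 'b) gmod \<Rightarrow> int \<Rightarrow> ('k, 'a, 'b) cochain set" where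
  "CCu R A B e = {f. \<forall>n. f n \<in> carrier (HOM R (tpow R (susp A) n) (susp B) e)}"

definition cc_zero :: "'k ring \<Rightarrow> ('k, 'a) gmod \<Rightarrow> ('k, 'b) gmod \<Rightarrow> int \<Rightarrow> ('k, 'a, 'b) cochain" where
  "cc_zero R A B e = (\<lambda>n. \<zero>\<^bsub>HOM R (tpow R (susp A) n) (susp B) e\<^esub>)"

text \<open>\<open>CC\<close> is the direct summand of \<open>CCu\<close> of the cochains without component in tensor degree zero.\<close>

definition CC :: "'k ring \<Rightarrow> ('k, 'a) gmod \<Rightarrow> ('k, 'b) gmod \<Rightarrow> int \<Rightarrow> ('k, 'a, 'b) cochain set" where
  "CC R A B e = {f \<in> CCu R A B e. f 0 = cc_zero R A B e 0}"

definition cc_add ::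
  "'k ring \<Rightarrow> ('k, 'a) gmod \<Rightarrow> ('k, 'b) gmod \<Rightarrow> int
     \<Rightarrow> ('k, 'a, 'b) cochain \<Rightarrow> ('k, 'a, 'b) cochain \<Rightarrow> ('k, 'a, 'b) cochain" where
  "cc_add R A B e f g = (\<lambda>n. f n \<oplus>\<^bsub>HOM R (tpow R (susp A) n) (susp B) e\<^esub> g n)"

definition cc_minus ::
  "'k ring \<Rightarrow> ('k, 'a) gmod \<Rightarrow> ('k, 'b) gmod \<Rightarrow> int
     \<Rightarrow> ('k, 'a, 'b) cochain \<Rightarrow> ('k, 'a, 'b) cochain \<Rightarrow> ('k, 'a, 'b) cochain" where
  "cc_minus R A B e f g = (\<lambda>n. f n \<ominus>\<^bsub>HOM R (tpow R (susp A) n) (susp B) e\<^esub> g n)"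

definition cc_ge1 ::
  "'k ring \<Rightarrow> ('k, 'a) gmod \<Rightarrow> ('k, 'b) gmod \<Rightarrow> int \<Rightarrow> ('k, 'a, 'b) cochain \<Rightarrow> ('k, 'a, 'b) cochain" where
  "cc_ge1 R A B e f = f(0 := cc_zero R A B e 0)"

text \<open>\<open>cc_at R A f w\<close> is \<open>f\<^sup>n[x\<^sub>1|\<dots>|x\<^sub>n]\<close> for the word \<open>w = [x\<^sub>1, \<dots>, x\<^sub>n]\<close> in \<open>\<Pi> A\<close> (degrees are those in \<open>\<Pi> A\<close>).\<close>

definition cc_at :: "'k ring \<Rightarrow> ('k, 'a) gmod \<Rightarrow> ('k, 'a, 'b) cochain \<Rightarrow> (int \<times> 'a) list \<Rightarrow> 'b" where
  "cc_at R A f w = f (length w) (wdeg w) (tword R (susp A) w)"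

text \<open>The cochain of degree \<open>e\<close> with prescribed values on words.\<close>

definition cc_of ::
  "'k ring \<Rightarrow> ('k, 'a) gmod \<Rightarrow> ('k, 'b) gmod \<Rightarrow> int \<Rightarrow> ((int \<times> 'a) list \<Rightarrow> 'b) \<Rightarrow> ('k, 'a, 'b) cochain" where
  "cc_of R A B e \<phi> = (\<lambda>n. tpow_ext R (susp A) n (susp B) e \<phi>)"

text \<open>
  \<open>g \<circ> f\<close> for \<open>g\<close> of degree \<open>b\<close> from \<open>A\<close> to \<open>B\<close> and \<open>f\<close> of degree \<open>a\<close> from \<open>A\<close> to \<open>A\<close>; the summand is
  \<open>g\<^sup>i (1\<^sup>\<otimes>\<^sup>j \<otimes> f\<^sup>n\<^sup>-\<^sup>i\<^sup>+\<^sup>1 \<otimes> 1\<^sup>\<otimes>\<^sup>i\<^sup>-\<^sup>j\<^sup>-\<^sup>1)\<close> evaluated on a word of length \<open>n\<close>.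
\<close>

definition cc_circ ::
  "'k ring \<Rightarrow> ('k, 'a) gmod \<Rightarrow> ('k, 'b) gmod \<Rightarrow> int \<Rightarrow> int
     \<Rightarrow> ('k, 'a, 'b) cochain \<Rightarrow> ('k, 'a, 'a) cochain \<Rightarrow> ('k, 'a, 'b) cochain" where
  "cc_circ R A B b a g f = cc_of R A B (b + a) (\<lambda>w.
     let n = length w; W = susp B (wdeg w + (b + a)) in
     \<Oplus>\<^bsub>W\<^esub>i\<in>{1..n}. \<Oplus>\<^bsub>W\<^esub>j\<in>{..<i}.
       let u = take j w; m = take (n - i + 1) (drop j w); v = drop (j + (n - i + 1)) w in
       sgn_pow R (a * wdeg u) \<odot>\<^bsub>W\<^esub> cc_at R A g (u @ (wdeg m + a, cc_at R A f m) # v))"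

fun blocks :: "nat list \<Rightarrow> 'w list \<Rightarrow> 'w list list" where
  "blocks [] w = []"
| "blocks (i # is) w = take i w # blocks is (drop i w)"

text \<open>
  \<open>f * g\<close> for \<open>g\<close> of degree \<open>0\<close> from \<open>A\<close> to \<open>B\<close> and \<open>f\<close> of degree \<open>e\<close> from \<open>B\<close> to \<open>C\<close>. Cochains in \<open>CC\<close> have
  no component in tensor degree zero, so the sum is over positive \<open>i\<^sub>1, \<dots>, i\<^sub>m\<close>; since \<open>g\<close> has degree
  \<open>0\<close> there are no signs.
\<close>

definition cc_star0 ::
  "'k ring \<Rightarrow> ('k, 'a) gmod \<Rightarrow> ('k, 'b) gmod \<Rightarrow> ('k, 'c) gmod \<Rightarrow> int
     \<Rightarrow> ('k, 'b, 'c) cochain \<Rightarrow> ('k, 'a, 'b) cochain \<Rightarrow> ('k, 'a, 'c) cochain" where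
  "cc_star0 R A B C e f g = cc_of R A C e (\<lambda>w.
     \<Oplus>\<^bsub>susp C (wdeg w + e)\<^esub>is\<in>{is. sum_list is = length w \<and> (\<forall>i\<in>set is. 1 \<le> i)}.
       cc_at R B f (map (\<lambda>u. (wdeg u, cc_at R A g u)) (blocks is w)))"

definition Ainf_structure :: "'k ring \<Rightarrow> ('k, 'a) gmod \<Rightarrow> ('k, 'a, 'a) cochain \<Rightarrow> bool" where
  "Ainf_structure R A \<nu> \<longleftrightarrow>
     \<nu> \<in> CC R A A (-1) \<and> cc_circ R A A (-1) (-1) \<nu> \<nu> = cc_zero R A A (-2)"

definition Ainf_morphism ::
  "'k ring \<Rightarrow> ('k, 'a) gmod \<Rightarrow> ('k, 'a, 'a) cochain \<Rightarrow> ('k, 'b) gmod \<Rightarrow> ('k, 'b, 'b) cochain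
     \<Rightarrow> ('k, 'a, 'b) cochain \<Rightarrow> bool" where
  "Ainf_morphism R A \<nu>\<^sub>A B \<nu>\<^sub>B g \<longleftrightarrow>
     g \<in> CC R A B 0 \<and> cc_star0 R A B B (-1) \<nu>\<^sub>B g = cc_circ R A B 0 (-1) g \<nu>\<^sub>A"


section \<open>Algebras with split unit\<close>

definition unit_map :: "('k, 'a) gmod \<Rightarrow> 'a \<Rightarrow> ('k, 'a) gmap" where
  "unit_map A e = (\<lambda>i r. kact A (i, r) (0, e))"

text \<open>\<open>e\<close> is the element written \<open>1\<close> and \<open>\<epsilon>\<close> is the fixed splitting \<open>A \<rightarrow> k\<close>.\<close>

definition split_element :: "'k ring \<Rightarrow> ('k, 'a) gmod \<Rightarrow> 'a \<Rightarrow> ('a, 'k) gmap \<Rightarrow> bool" where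
  "split_element R A e \<epsilon> \<longleftrightarrow>
     gmodule R A \<and> e \<in> carrier (A 0) \<and>
     (\<forall>r\<in>carrier R. r \<odot>\<^bsub>A 0\<^esub> e = \<zero>\<^bsub>A 0\<^esub> \<longrightarrow> r = \<zero>\<^bsub>R\<^esub>) \<and>
     \<epsilon> \<in> carrier (HOM R A (kmod R) 0) \<and> \<epsilon> 0 e = \<one>\<^bsub>R\<^esub>"

text \<open>\<open>A/(k \<cdot> 1)\<close>, identified by means of the splitting with the submodule \<open>ker \<epsilon>\<close> of \<open>A\<close>.\<close>

definition bar_mod :: "'k ring \<Rightarrow> ('k, 'a) gmod \<Rightarrow> ('a, 'k) gmap \<Rightarrow> ('k, 'a) gmod" where
  "bar_mod R A \<epsilon> = (\<lambda>i. (A i)\<lparr>carrier := {x \<in> carrier (A i). \<epsilon> i x = \<zero>\<^bsub>R\<^esub>}\<rparr>)"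

definition bar_proj :: "('k, 'a) gmod \<Rightarrow> 'a \<Rightarrow> ('a, 'k) gmap \<Rightarrow> ('a, 'a) gmap" where
  "bar_proj A e \<epsilon> = (\<lambda>i x. x \<ominus>\<^bsub>A i\<^esub> unit_map A e i (\<epsilon> i x))"

text \<open>The inclusion of the cochains (of degree \<open>n\<close>) on \<open>bar_mod R A \<epsilon>\<close> into the cochains on \<open>A\<close>.\<close>

definition cc_incl ::
  "'k ring \<Rightarrow> ('k, 'a) gmod \<Rightarrow> 'a \<Rightarrow> ('a, 'k) gmap \<Rightarrow> ('k, 'b) gmod \<Rightarrow> int
     \<Rightarrow> ('k, 'a, 'b) cochain \<Rightarrow> ('k, 'a, 'b) cochain" where
  "cc_incl R A e \<epsilon> B n f = cc_of R A B n
     (\<lambda>w. cc_at R (bar_mod R A \<epsilon>) f (map (\<lambda>(i, x). (i, bar_proj A e \<epsilon> (i - 1) x)) w))"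

text \<open>
  The bilinear extension of \<open>[1|a] \<mapsto> [a]\<close>, \<open>[a|1] \<mapsto> (-1)\<^sup>|\<^sup>a\<^sup>| [a]\<close>, \<open>0\<close> on words in \<open>bar_mod R A \<epsilon>\<close>: for
  \<open>x, y \<in> A\<close> it is \<open>\<epsilon>(x) y + (-1)\<^sup>|\<^sup>x\<^sup>| \<epsilon>(y) x - \<epsilon>(x) \<epsilon>(y) 1\<close>.
\<close>

definition mu_su :: "'k ring \<Rightarrow> ('k, 'a) gmod \<Rightarrow> 'a \<Rightarrow> ('a, 'k) gmap \<Rightarrow> ('k, 'a, 'a) cochain" where
  "mu_su R A e \<epsilon> = cc_of R A A (-1) (\<lambda>w. case w of
       [(i, x), (j, y)] \<Rightarrow>
         let a = i - 1; b = j - 1; r = (a, \<epsilon> a x); t = (b, \<epsilon> b y) in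
         kact A r (b, y) \<oplus>\<^bsub>A (a + b)\<^esub> (sgn_pow R a \<odot>\<^bsub>A (a + b)\<^esub> kact A t (a, x))
           \<ominus>\<^bsub>A (a + b)\<^esub> kact A r (b, kact A t (0, e))
     | _ \<Rightarrow> \<zero>\<^bsub>susp A (wdeg w - 1)\<^esub>)"

text \<open>A \<open>k\<close>-valued cochain of degree \<open>-1\<close> regarded as an \<open>A\<close>-valued one via \<open>k \<rightarrow> A\<close>.\<close>

definition cc_unit ::
  "'k ring \<Rightarrow> ('k, 'a) gmod \<Rightarrow> 'a \<Rightarrow> ('k, 'a, 'k) cochain \<Rightarrow> ('k, 'a, 'a) cochain" where
  "cc_unit R A e h =
     (\<lambda>n d. \<lambda>X\<in>carrier (tpow R (susp A) n d). unit_map A e (d - 2) (h n d X))"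

definition total_mu ::
  "'k ring \<Rightarrow> ('k, 'a) gmod \<Rightarrow> 'a \<Rightarrow> ('a, 'k) gmap \<Rightarrow> ('k, 'a, 'a) cochain \<Rightarrow> ('k, 'a, 'k) cochain
     \<Rightarrow> ('k, 'a, 'a) cochain" where
  "total_mu R A e \<epsilon> \<mu> h =
     cc_add R A A (-1)
       (cc_add R A A (-1)
          (cc_incl R A e \<epsilon> A (-1) \<mu>)
          (cc_unit R A e (cc_incl R A e \<epsilon> (kmod R) (-1) h)))
       (mu_su R A e \<epsilon>)"

definition Ainf_algebra_split_unit ::
  "'k ring \<Rightarrow> ('k, 'a) gmod \<Rightarrow> 'a \<Rightarrow> ('a, 'k) gmap \<Rightarrow> ('k, 'a, 'a) cochain \<Rightarrow> ('k, 'a, 'k) cochain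
     \<Rightarrow> bool" where
  "Ainf_algebra_split_unit R A e \<epsilon> \<mu> h \<longleftrightarrow>
     split_element R A e \<epsilon> \<and>
     \<mu> \<in> CC R (bar_mod R A \<epsilon>) (bar_mod R A \<epsilon>) (-1) \<and>
     h \<in> CC R (bar_mod R A \<epsilon>) (kmod R) (-1) \<and>
     Ainf_structure R A (total_mu R A e \<epsilon> \<mu> h)"


section \<open>Strictly unital representations\<close>

definition mu_End :: "'k ring \<Rightarrow> ('k, 'm) gmod \<Rightarrow> ('m, 'm) gmap \<Rightarrow> ('k, ('m, 'm) gmap, ('m, 'm) gmap) cochain"
  where
  "mu_End R M \<delta> = (let E = HOM R M M in cc_of R E E (-1) (\<lambda>w. case w of
       [(i, \<phi>)] \<Rightarrow> let a = i - 1 in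
         gcomp M a \<delta> \<phi> \<ominus>\<^bsub>E (a - 1)\<^esub> (sgn_pow R a \<odot>\<^bsub>E (a - 1)\<^esub> gcomp M (-1) \<phi> \<delta>)
     | [(i, \<phi>), (j, \<psi>)] \<Rightarrow> let a = i - 1; b = j - 1 in
         sgn_pow R a \<odot>\<^bsub>E (a + b)\<^esub> gcomp M b \<phi> \<psi>
     | _ \<Rightarrow> \<zero>\<^bsub>susp E (wdeg w - 1)\<^esub>))"

definition g_su ::
  "'k ring \<Rightarrow> ('k, 'a) gmod \<Rightarrow> ('a, 'k) gmap \<Rightarrow> ('k, 'm) gmod \<Rightarrow> ('k, 'a, ('m, 'm) gmap) cochain" where
  "g_su R A \<epsilon> M = (let E = HOM R M M in cc_of R A E 0 (\<lambda>w. case w of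
       [(i, x)] \<Rightarrow> kact E (i - 1, \<epsilon> (i - 1) x) (0, gid M)
     | _ \<Rightarrow> \<zero>\<^bsub>susp E (wdeg w)\<^esub>))"

type_synonym ('k, 'a, 'm) rep = "('k, 'm) gmod \<times> ('k, 'a, ('m, 'm) gmap) cochain"

definition rep_diff :: "'k ring \<Rightarrow> ('k, 'a) gmod \<Rightarrow> ('a, 'k) gmap \<Rightarrow> ('k, 'a, 'm) rep \<Rightarrow> ('m, 'm) gmap" where
  "rep_diff R A \<epsilon> = (\<lambda>(M, p). \<ominus>\<^bsub>HOM R M M (-1)\<^esub> cc_at R (bar_mod R A \<epsilon>) p [])"

definition su_rep ::
  "'k ring \<Rightarrow> ('k, 'a) gmod \<Rightarrow> 'a \<Rightarrow> ('a, 'k) gmap \<Rightarrow> ('k, 'a, 'a) cochain \<Rightarrow> ('k, 'a, 'k) cochain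
     \<Rightarrow> ('k, 'a, 'm) rep \<Rightarrow> bool" where
  "su_rep R A e \<epsilon> \<mu> h = (\<lambda>(M, p).
     let E = HOM R M M; \<delta> = rep_diff R A \<epsilon> (M, p) in
     gmodule R M \<and>
     p \<in> CCu R (bar_mod R A \<epsilon>) E 0 \<and>
     gcomp M (-1) \<delta> \<delta> = \<zero>\<^bsub>HOM R M M (-2)\<^esub> \<and>
     Ainf_morphism R A (total_mu R A e \<epsilon> \<mu> h) E (mu_End R M \<delta>)
       (cc_add R A E 0 (cc_ge1 R A E 0 (cc_incl R A e \<epsilon> E 0 p)) (g_su R A \<epsilon> M)))"

text \<open>
  The map \<open>\<gamma> = s c (s\<inverse> \<otimes> s\<inverse>)\<close> applied to \<open>[\<phi>] \<otimes> [\<psi>]\<close>, with \<open>\<phi> : N \<rightarrow> P\<close> and \<open>\<psi> : M \<rightarrow> N\<close>; \<open>i\<close> and \<open>j\<close> are the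
  degrees of \<open>[\<phi>]\<close> and \<open>[\<psi>]\<close>, and the sign comes from moving \<open>s\<inverse>\<close> past \<open>[\<phi>]\<close>.
\<close>

definition gam ::
  "'k ring \<Rightarrow> ('k, 'm) gmod \<Rightarrow> ('k, 'p) gmod
     \<Rightarrow> int \<times> ('n, 'p) gmap \<Rightarrow> int \<times> ('m, 'n) gmap \<Rightarrow> ('m, 'p) gmap" where
  "gam R M P = (\<lambda>(i, \<phi>) (j, \<psi>). sgn_pow R i \<odot>\<^bsub>HOM R M P (i + j - 2)\<^esub> gcomp M (j - 1) \<phi> \<psi>)"

text \<open>\<open>\<alpha> \<star> \<beta>\<close> for \<open>\<alpha>\<close> of degree \<open>a\<close> and \<open>\<beta>\<close> of degree \<open>b\<close>; it has degree \<open>a + b - 1\<close> because \<open>\<gamma>\<close> has degree \<open>-1\<close>.\<close>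

definition cc_star ::
  "'k ring \<Rightarrow> ('k, 'a) gmod \<Rightarrow> ('k, 'm) gmod \<Rightarrow> ('k, 'p) gmod \<Rightarrow> int \<Rightarrow> int
     \<Rightarrow> ('k, 'a, ('n, 'p) gmap) cochain \<Rightarrow> ('k, 'a, ('m, 'n) gmap) cochain
     \<Rightarrow> ('k, 'a, ('m, 'p) gmap) cochain" where
  "cc_star R A M P a b \<alpha> \<beta> = (let H = HOM R M P in cc_of R A H (a + b - 1) (\<lambda>w.
     let W = susp H (wdeg w + (a + b - 1)) in
     \<Oplus>\<^bsub>W\<^esub>j\<in>{..length w}. let u = take j w; v = drop j w in
       sgn_pow R (b * wdeg u) \<odot>\<^bsub>W\<^esub>
         gam R M P (wdeg u + a, cc_at R A \<alpha> u) (wdeg v + b, cc_at R A \<beta> v)))"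

definition full_p ::
  "'k ring \<Rightarrow> ('k, 'a) gmod \<Rightarrow> 'a \<Rightarrow> ('a, 'k) gmap \<Rightarrow> ('k, 'a, 'm) rep
     \<Rightarrow> ('k, 'a, ('m, 'm) gmap) cochain" where
  "full_p R A e \<epsilon> = (\<lambda>(M, p).
     cc_add R A (HOM R M M) 0 (cc_incl R A e \<epsilon> (HOM R M M) 0 p) (g_su R A \<epsilon> M))"

definition rep_mor ::
  "'k ring \<Rightarrow> ('k, 'a) gmod \<Rightarrow> 'a \<Rightarrow> ('a, 'k) gmap \<Rightarrow> ('k, 'a, 'a) cochain \<Rightarrow> ('k, 'a, 'k) cochain
     \<Rightarrow> ('k, 'a, 'm) rep \<Rightarrow> ('k, 'a, 'm) rep \<Rightarrow> ('k, 'a, ('m, 'm) gmap) cochain set" where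
  "rep_mor R A e \<epsilon> \<mu> h X Y = (let M = fst X; N = fst Y; H = HOM R M N in
     {f \<in> CCu R (bar_mod R A \<epsilon>) H 1.
        let F = cc_incl R A e \<epsilon> H 1 f in
        cc_add R A H 0
          (cc_minus R A H 0
             (cc_star R A M N 0 1 (full_p R A e \<epsilon> Y) F)
             (cc_circ R A H 1 (-1) (cc_ge1 R A H 1 F) (total_mu R A e \<epsilon> \<mu> h)))
          (cc_star R A M N 1 0 F (full_p R A e \<epsilon> X))
        = cc_zero R A H 0})"

definition rep_id ::
  "'k ring \<Rightarrow> ('k, 'a) gmod \<Rightarrow> ('a, 'k) gmap \<Rightarrow> ('k, 'a, 'm) rep
     \<Rightarrow> ('k, 'a, ('m, 'm) gmap) cochain" where
  "rep_id R A \<epsilon> = (\<lambda>(M, p). let E = HOM R M M in cc_of R (bar_mod R A \<epsilon>) E 1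
     (\<lambda>w. if w = [] then \<ominus>\<^bsub>E 0\<^esub> gid M else \<zero>\<^bsub>susp E (wdeg w + 1)\<^esub>))"

definition SURep ::
  "'k ring \<Rightarrow> ('k, 'a) gmod \<Rightarrow> 'a \<Rightarrow> ('a, 'k) gmap \<Rightarrow> ('k, 'a, 'a) cochain \<Rightarrow> ('k, 'a, 'k) cochain
     \<Rightarrow> (('k, 'a, 'm) rep, ('k, 'a, ('m, 'm) gmap) cochain) precat" where
  "SURep R A e \<epsilon> \<mu> h = \<lparr>
     Ob = {X. su_rep R A e \<epsilon> \<mu> h X},
     Arr = rep_mor R A e \<epsilon> \<mu> h,
     Idt = rep_id R A \<epsilon>,
     Cmp = (\<lambda>X Y Z g f. cc_star R (bar_mod R A \<epsilon>) (fst X) (fst Z) 1 1 g f)\<rparr>"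


section \<open>Curved dg-comodules\<close>

text \<open>
  Only the data of a curved dg-coalgebra; its axioms play no role in the definition of comodules.
\<close>

record ('k, 'c) curved_coalg =
  coalg_mod    :: "('k, 'c) gmod"
  coalg_delta  :: "('c, ('k, 'c, 'c) tens) gmap"
  coalg_counit :: "('c, 'k) gmap"
  coalg_diff   :: "('c, 'c) gmap"
  coalg_curv   :: "('c, 'k) gmap"

type_synonym ('k, 'c, 'p) comod = "('k, 'p) gmod \<times> ('p, ('k, 'c, 'p) tens) gmap"
type_synonym ('k, 'c, 'p) cdg_comod = "('k, 'c, 'p) comod \<times> ('p, 'p) gmap"

definition graded_comodule :: "'k ring \<Rightarrow> ('k, 'c) curved_coalg \<Rightarrow> ('k, 'c, 'p) comod \<Rightarrow> bool" where
  "graded_comodule R K = (\<lambda>(P, \<rho>). let C = coalg_mod K in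
     gmodule R P \<and>
     \<rho> \<in> carrier (HOM R P (tens R C P) 0) \<and>
     gcomp P 0 (tens_assoc R C C P)
         (gcomp P 0 (tens_map R C P (tens R C C) P 0 0 (coalg_delta K) (gid P)) \<rho>)
       = gcomp P 0 (tens_map R C P C (tens R C P) 0 0 (gid C) \<rho>) \<rho> \<and>
     gcomp P 0 (tens_lunit R P)
         (gcomp P 0 (tens_map R C P (kmod R) P 0 0 (coalg_counit K) (gid P)) \<rho>)
       = gid P)"

definition comodule_mor ::
  "'k ring \<Rightarrow> ('k, 'c) curved_coalg \<Rightarrow> ('k, 'c, 'p) comod \<Rightarrow> ('k, 'c, 'q) comod
     \<Rightarrow> ('p, 'q) gmap set" where
  "comodule_mor R K = (\<lambda>(P, \<rho>) (Q, \<sigma>). let C = coalg_mod K in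
     {f \<in> carrier (HOM R P Q 0).
        gcomp P 0 (tens_map R C P C Q 0 0 (gid C) f) \<rho> = gcomp P 0 \<sigma> f})"

definition is_coderivation ::
  "'k ring \<Rightarrow> ('k, 'c) curved_coalg \<Rightarrow> ('k, 'c, 'p) comod \<Rightarrow> ('p, 'p) gmap \<Rightarrow> bool" where
  "is_coderivation R K = (\<lambda>(P, \<rho>) D. let C = coalg_mod K in
     D \<in> carrier (HOM R P P (-1)) \<and>
     gcomp P 0
       (tens_map R C P C P (-1) 0 (coalg_diff K) (gid P)
          \<oplus>\<^bsub>HOM R (tens R C P) (tens R C P) (-1)\<^esub> tens_map R C P C P 0 (-1) (gid C) D) \<rho>
     = gcomp P (-1) \<rho> D)"

definition cdg_comodule :: "'k ring \<Rightarrow> ('k, 'c) curved_coalg \<Rightarrow> ('k, 'c, 'p) cdg_comod \<Rightarrow> bool" where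
  "cdg_comodule R K = (\<lambda>((P, \<rho>), D). let C = coalg_mod K in
     graded_comodule R K (P, \<rho>) \<and>
     is_coderivation R K (P, \<rho>) D \<and>
     gcomp P (-1) D D =
       gcomp P (-2) (tens_lunit R P)
         (gcomp P 0 (tens_map R C P (kmod R) P (-2) 0 (coalg_curv K) (gid P)) \<rho>))"

definition Comod ::
  "'k ring \<Rightarrow> ('k, 'c) curved_coalg \<Rightarrow> (('k, 'c, 'p) comod, ('p, 'p) gmap) precat" where
  "Comod R K = \<lparr>
     Ob = {X. graded_comodule R K X},
     Arr = comodule_mor R K,
     Idt = (\<lambda>X. gid (fst X)),
     Cmp = (\<lambda>X Y Z g f. gcomp (fst X) 0 g f)\<rparr>"

definition CDGComod ::
  "'k ring \<Rightarrow> ('k, 'c) curved_coalg \<Rightarrow> (('k, 'c, 'p) cdg_comod, ('p, 'p) gmap) precat" where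
  "CDGComod R K = \<lparr>
     Ob = {X. cdg_comodule R K X},
     Arr = (\<lambda>X Y. {f \<in> comodule_mor R K (fst X) (fst Y).
        gcomp (fst (fst X)) 0 (snd Y) f = gcomp (fst (fst X)) (-1) f (snd X)}),
     Idt = (\<lambda>X. gid (fst (fst X))),
     Cmp = (\<lambda>X Y Z g f. gcomp (fst (fst X)) 0 g f)\<rparr>"

definition cofree_comod ::
  "'k ring \<Rightarrow> ('k, 'c) curved_coalg \<Rightarrow> ('k, 'm) gmod \<Rightarrow> ('k, 'c, ('k, 'c, 'm) tens) comod" where
  "cofree_comod R K M = (let C = coalg_mod K in
     (tens R C M,
      gcomp (tens R C M) 0 (tens_assoc R C C M)
        (tens_map R C M (tens R C C) M 0 0 (coalg_delta K) (gid M))))"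

text \<open>The coderivation \<open>d \<otimes> 1 + (1 \<otimes> m)(\<Delta> \<otimes> 1)\<close> of the cofree comodule.\<close>

definition phi_inv ::
  "'k ring \<Rightarrow> ('k, 'c) curved_coalg \<Rightarrow> ('k, 'm) gmod \<Rightarrow> (('k, 'c, 'm) tens, 'm) gmap
     \<Rightarrow> (('k, 'c, 'm) tens, ('k, 'c, 'm) tens) gmap" where
  "phi_inv R K M m = (let C = coalg_mod K; P = tens R C M in
     tens_map R C M C M (-1) 0 (coalg_diff K) (gid M)
       \<oplus>\<^bsub>HOM R P P (-1)\<^esub>
     gcomp P 0 (tens_map R C P C M 0 (-1) (gid C) m) (snd (cofree_comod R K M)))"


section \<open>The bar construction and the functor on objects\<close>

definition bar_diff ::
  "'k ring \<Rightarrow> ('k, 'a) gmod \<Rightarrow> ('k, 'a, 'a) cochain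
     \<Rightarrow> (nat \<Rightarrow> ('k, 'a) tpow, nat \<Rightarrow> ('k, 'a) tpow) gmap" where
  "bar_diff R B \<mu> = (let V = susp B; T = tco R V in
     tco_ext R V T (-1) (\<lambda>n. tpow_ext R V n T (-1) (\<lambda>w.
       \<Oplus>\<^bsub>T (wdeg w - 1)\<^esub>i\<in>{1..n}. \<Oplus>\<^bsub>T (wdeg w - 1)\<^esub>j\<in>{..n - i}.
         let u = take j w; m = take i (drop j w); v = drop (j + i) w in
         sgn_pow R (- wdeg u) \<odot>\<^bsub>T (wdeg w - 1)\<^esub>
           tco_word R V (u @ (wdeg m - 1, cc_at R B \<mu> m) # v))))"

text \<open>\<open>\<xi> = - s\<inverse> h\<close>; the component of \<open>h\<close> in tensor degree zero vanishes.\<close>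

definition bar_curv ::
  "'k ring \<Rightarrow> ('k, 'a) gmod \<Rightarrow> ('k, 'a, 'k) cochain \<Rightarrow> (nat \<Rightarrow> ('k, 'a) tpow, 'k) gmap" where
  "bar_curv R B h = tco_ext R (susp B) (kmod R) (-2) (\<lambda>n d X. \<ominus>\<^bsub>kmod R (d - 2)\<^esub> h n d X)"

definition Bar_u ::
  "'k ring \<Rightarrow> ('k, 'a) gmod \<Rightarrow> ('a, 'k) gmap \<Rightarrow> ('k, 'a, 'a) cochain \<Rightarrow> ('k, 'a, 'k) cochain
     \<Rightarrow> ('k, nat \<Rightarrow> ('k, 'a) tpow) curved_coalg" where
  "Bar_u R A \<epsilon> \<mu> h = (let B = bar_mod R A \<epsilon> in \<lparr>
     coalg_mod = tco R (susp B),
     coalg_delta = tco_delta R (susp B),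
     coalg_counit = tco_counit R (susp B),
     coalg_diff = bar_diff R B \<mu>,
     coalg_curv = bar_curv R B h\<rparr>)"

text \<open>
  \<open>ev (s\<inverse> q\<^sup>n \<otimes> 1) : (\<Pi> B)\<^sup>\<otimes>\<^sup>n \<otimes> M \<rightarrow> N\<close> for a cochain \<open>q\<close> of degree \<open>e\<close> with values in \<open>Hom(M, N)\<close>.
\<close>

definition cc_adjoint ::
  "'k ring \<Rightarrow> ('k, 'a) gmod \<Rightarrow> ('k, 'm) gmod \<Rightarrow> ('k, 'n) gmod \<Rightarrow> int
     \<Rightarrow> ('k, 'a, ('m, 'n) gmap) cochain \<Rightarrow> nat \<Rightarrow> (('k, ('k, 'a) tpow, 'm) tens, 'n) gmap" where
  "cc_adjoint R B M N e q n = tens_ext R (tpow R (susp B) n) M N (e - 1)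
     (\<lambda>(i, X) (j, x). q n i X j x)"

definition cc_adjoint_family ::
  "'k ring \<Rightarrow> ('k, 'a) gmod \<Rightarrow> ('k, 'm) gmod \<Rightarrow> ('k, 'n) gmod \<Rightarrow> int
     \<Rightarrow> ('k, 'a, ('m, 'n) gmap) cochain \<Rightarrow> (('k, nat \<Rightarrow> ('k, 'a) tpow, 'm) tens, 'n) gmap" where
  "cc_adjoint_family R B M N e q = (let V = susp B in
     tens_ext R (tco R V) M N (e - 1) (\<lambda>(i, t) (j, x).
       \<Oplus>\<^bsub>N (i + j + (e - 1))\<^esub>n\<in>{n. t n \<noteq> \<zero>\<^bsub>tpow R V n i\<^esub>}.
         cc_adjoint R B M N e q n (i + j) (tens_elt R (tpow R V n) M (i, t n) (j, x))))"

definition bar_obj ::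
  "'k ring \<Rightarrow> ('k, 'a) gmod \<Rightarrow> ('a, 'k) gmap \<Rightarrow> ('k, 'a, 'a) cochain \<Rightarrow> ('k, 'a, 'k) cochain
     \<Rightarrow> ('k, 'a, 'm) rep
     \<Rightarrow> ('k, nat \<Rightarrow> ('k, 'a) tpow, ('k, nat \<Rightarrow> ('k, 'a) tpow, 'm) tens) cdg_comod" where
  "bar_obj R A \<epsilon> \<mu> h = (\<lambda>(M, p). let K = Bar_u R A \<epsilon> \<mu> h in
     (cofree_comod R K M,
      phi_inv R K M (cc_adjoint_family R (bar_mod R A \<epsilon>) M M 0 p)))"

end

(*
A graded map C (x) M -> N into a cofree comodule C (x) N over the tensor coalgebra extends uniquely
to a comodule morphism, and a map C (x) M -> M extends uniquely to a coderivation; both are recovered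
by composing with counit (x) 1. So curved dg-comodule structures on C (x) M, and morphisms between
them, are families of multilinear maps on words, and the identities for them can be tested after
composing with counit (x) 1. For a coderivation D the difference of D^2 and the curvature term is
again determined by this projection because d^2 = (xi (x) 1) Delta - (1 (x) xi) Delta.

On the other side, a strictly unital representation (or morphism) is a cochain on the words in A that
factors through words in ker epsilon except for the prescribed value on the unit. On a word in A the
contributions of mu_su to the A-infinity relations telescope: only the terms removing the first and
the last letter survive, and these cancel against the terms containing g_su. What remains is the
relation on words in ker epsilon, which is the projected comodule identity. Essential surjectivity
follows by transporting a coderivation along an isomorphism of comodules.
*)
theory Submission
 imports Defs
begin

text \<open>The modules here are quotients of free modules on words and on elementary tensors, so a
  map is handled through its values on words, and every identity becomes an equality of sums over
  the ways of cutting a word. Coassociativity, the coderivation rule and the square of the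
  differential are regroupings of cuts with Koszul signs. The comodule half knows only a block
  operation \<open>bm\<close>, a curvature \<open>xi\<close> and one quadratic relation between
  them. That relation is the A-infinity relation projected to \<open>ker \<epsilon>\<close>; its
  curvature terms come from \<open>mu_su\<close> acting on the unit component \<open>h\<close> of
  the inner operation. On the algebra side the empty word stands apart: the A-infinity morphism
  equation says nothing there, and the missing relation is \<open>\<delta>^2 = 0\<close>. Signs
  force the functor to send a morphism to its negated adjoint. The axioms of the category of
  representations are pulled back from comodules along this injective and multiplicative
  assignment.\<close>

abbreviation carrier_member :: "'m \<Rightarrow> ('m, 'b) partial_object_scheme \<Rightarrow> bool" (infix "<:" 50) where
 "x <: M \<equiv> x \<in> carrier M"

abbreviation add_in ("(_ +[_] _)" [65, 0, 66] 65) where "x +[M] y \<equiv> x \<oplus>\<^bsub>M\<^esub> y"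
abbreviation minus_in ("(_ -[_] _)" [65, 0, 66] 65) where "x -[M] y \<equiv> x \<ominus>\<^bsub>M\<^esub> y"
abbreviation uminus_in ("(-[_] _)" [0, 81] 80) where "-[M] x \<equiv> \<ominus>\<^bsub>M\<^esub> x"
abbreviation smult_in ("(_ *[_] _)" [71, 0, 70] 70) where "r *[M] x \<equiv> r \<odot>\<^bsub>M\<^esub> x"
abbreviation zero_in ("\<zero>[_]") where "\<zero>[M] \<equiv> \<zero>\<^bsub>M\<^esub>"

lemma mk_module_simps [simp]:
 "carrier (mk_module S z a s) = S" "zero (mk_module S z a s) = z"
 "add (mk_module S z a s) = a" "smult (mk_module S z a s) = s" by (simp_all add: mk_module_def)

text \<open>Linearity without the extensionality that \<open>linear_maps\<close> demands, so that a
  plain lambda term such as a composite or a slot of a word function qualifies. Extensionality is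
  dealt with only when a member of \<open>HOM\<close> is built.\<close>

definition lin :: "'k ring \<Rightarrow> ('k, 'm) module \<Rightarrow> ('k, 'n) module \<Rightarrow> ('m \<Rightarrow> 'n) \<Rightarrow> bool" where
 "lin R M N f \<longleftrightarrow> (\<forall>x\<in>carrier M. f x <: N) \<and>
   (\<forall>x\<in>carrier M. \<forall>y\<in>carrier M. f (x +[M] y) = f x +[N] f y) \<and>
   (\<forall>r\<in>carrier R. \<forall>x\<in>carrier M. f (r *[M] x) = r *[N] f x)"

lemma linI:
 assumes "!!x. x <: M ==> f x <: N"
  "!!x y. x <: M ==> y <: M ==> f (x +[M] y) = f x +[N] f y"
  "!!r x. r <: R ==> x <: M ==> f (r *[M] x) = r *[N] f x"
 shows "lin R M N f" using assms by (simp add: lin_def)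

lemma lin_closed: "lin R M N f ==> x <: M ==> f x <: N"
 and lin_add: "lin R M N f ==> x <: M ==> y <: M ==> f (x +[M] y) = f x +[N] f y"
 and lin_smult: "lin R M N f ==> r <: R ==> x <: M ==> f (r *[M] x) = r *[N] f x" by (simp_all add: lin_def)

lemma lin_compose: "lin R M N f ==> lin R N P g ==> lin R M P (%x. g (f x))" by (simp add: lin_def)

lemma linear_maps_iff: "f \<in> linear_maps R M N \<longleftrightarrow> lin R M N f \<and> f \<in> extensional (carrier M)"
 by (auto simp: linear_maps_def lin_def PiE_def Pi_def)

section \<open>Arithmetic and finite sums in modules over a commutative ring\<close>

locale ground = cring R for R :: "'k ring"
begin

abbreviation "dg \<equiv> wdeg"
abbreviation "fm \<equiv> free_module R"
abbreviation "gm \<equiv> gmodule R"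
abbreviation "md \<equiv> module R"
abbreviation "sg \<equiv> sgn_pow R"
abbreviation "sw w \<equiv> sg (dg w)"
abbreviation "Hom \<equiv> HOM R"
abbreviation "tns \<equiv> tens R"
abbreviation "telt \<equiv> tens_elt R"
abbreviation "tmap \<equiv> tens_map R"

text \<open>The modules in play are graded pieces such as \<open>M i\<close> with symbolic
  \<open>i\<close>, so the module axioms enter each rule as a premise instead of through one fixed
  interpretation.\<close>

context fixes M assumes M: "module R M" begin

interpretation MM: module R M by (rule M)

lemma m_add [simp]: "[|x <: M; y <: M|] ==> x +[M] y <: M" by (simp add: MM.M.r_neg MM.M.l_neg)

lemma m_zero [simp]: "\<zero>[M] <: M" by (simp add: MM.M.r_neg MM.M.l_neg)

lemma m_neg [simp]: "x <: M ==> -[M] x <: M" by (simp add: MM.M.r_neg MM.M.l_neg)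

lemma m_minus [simp]: "[|x <: M; y <: M|] ==> x -[M] y <: M" by (simp add: MM.M.r_neg MM.M.l_neg)

lemma m_smult [simp]: "[|r <: R; x <: M|] ==> r *[M] x <: M" by (simp add: MM.M.r_neg MM.M.l_neg)

lemma m_lzero [simp]: "x <: M ==> \<zero>[M] +[M] x = x" by (simp add: MM.M.r_neg MM.M.l_neg)

lemma m_rzero [simp]: "x <: M ==> x +[M] \<zero>[M] = x" by (simp add: MM.M.r_neg MM.M.l_neg)

lemma m_lneg [simp]: "x <: M ==> -[M] x +[M] x = \<zero>[M]" by (simp add: MM.M.r_neg MM.M.l_neg)

lemma m_rneg [simp]: "x <: M ==> x +[M] -[M] x = \<zero>[M]" by (simp add: MM.M.r_neg MM.M.l_neg)

lemma m_negneg [simp]: "x <: M ==> -[M] (-[M] x) = x" by (simp add: MM.M.r_neg MM.M.l_neg)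

lemma m_negzero [simp]: "-[M] \<zero>[M] = \<zero>[M]" by (simp add: MM.M.r_neg MM.M.l_neg)

lemma m_negadd: "[|x <: M; y <: M|] ==> -[M] (x +[M] y) = -[M] x +[M] -[M] y" by (rule MM.M.minus_add)

lemma m_assoc': "[|x <: M; y <: M; z <: M|] ==> (x +[M] y) +[M] z = x +[M] (y +[M] z)" by (rule MM.M.a_assoc)

lemma m_comm': "[|x <: M; y <: M|] ==> x +[M] y = y +[M] x" by (rule MM.M.a_comm)

lemma m_lcomm': "[|x <: M; y <: M; z <: M|] ==> x +[M] (y +[M] z) = y +[M] (x +[M] z)" by (rule MM.M.a_lcomm)

lemma m_rneg2 [simp]: "[|x <: M; y <: M|] ==> x +[M] (-[M] x +[M] y) = y" by (simp add: MM.M.a_assoc[symmetric] MM.M.r_neg MM.M.l_neg)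

lemma m_lneg2 [simp]: "[|x <: M; y <: M|] ==> -[M] x +[M] (x +[M] y) = y" by (simp add: MM.M.a_assoc[symmetric] MM.M.r_neg MM.M.l_neg)

lemma m_lcancel [simp]: "[|x <: M; y <: M; z <: M|] ==> x +[M] y = x +[M] z \<longleftrightarrow> y = z" by simp

lemma m_sl: "[|r <: R; s <: R; x <: M|] ==> (r +[R] s) *[M] x = r *[M] x +[M] s *[M] x"
 by (simp add: MM.smult_l_distr MM.smult_r_distr MM.smult_assoc1 MM.smult_l_minus MM.smult_r_minus)

lemma m_sr: "[|r <: R; x <: M; y <: M|] ==> r *[M] (x +[M] y) = r *[M] x +[M] r *[M] y"
 by (simp add: MM.smult_l_distr MM.smult_r_distr MM.smult_assoc1 MM.smult_l_minus MM.smult_r_minus)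

lemma m_ss: "[|r <: R; s <: R; x <: M|] ==> (r \<otimes>\<^bsub>R\<^esub> s) *[M] x = r *[M] (s *[M] x)"
 by (simp add: MM.smult_l_distr MM.smult_r_distr MM.smult_assoc1 MM.smult_l_minus MM.smult_r_minus)

lemma m_one [simp]: "x <: M ==> \<one>\<^bsub>R\<^esub> *[M] x = x" by (simp add: MM.M.r_neg MM.M.l_neg)

lemma m_szero [simp]: "x <: M ==> \<zero>[R] *[M] x = \<zero>[M]"
 by (simp add: MM.smult_l_distr MM.smult_r_distr MM.smult_assoc1 MM.smult_l_minus MM.smult_r_minus)

lemma m_zeros [simp]: "r <: R ==> r *[M] \<zero>[M] = \<zero>[M]"
 by (simp add: MM.smult_l_distr MM.smult_r_distr MM.smult_assoc1 MM.smult_l_minus MM.smult_r_minus)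

lemma m_sneg: "[|r <: R; x <: M|] ==> (-[R] r) *[M] x = -[M] (r *[M] x)"
 by (simp add: MM.smult_l_distr MM.smult_r_distr MM.smult_assoc1 MM.smult_l_minus MM.smult_r_minus)

lemma m_negs: "[|r <: R; x <: M|] ==> r *[M] (-[M] x) = -[M] (r *[M] x)"
 by (simp add: MM.smult_l_distr MM.smult_r_distr MM.smult_assoc1 MM.smult_l_minus MM.smult_r_minus)

lemma m_eq_neg: "[|x <: M; y <: M; x +[M] y = \<zero>[M]|] ==> x = -[M] y" by (metis MM.M.minus_equality)

lemma m_minus_zero: "[|x <: M; y <: M|] ==> x -[M] y = \<zero>[M] \<longleftrightarrow> x = y"
 by (metis MM.M.minus_equality MM.M.minus_minus MM.M.r_neg MM.M.a_inv_closed a_minus_def)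

end

lemmas m_ac = m_assoc' m_comm' m_lcomm'

context fixes N assumes N: "module R N" begin

interpretation MM: module R N by (rule N)

lemma fs_closed [simp]: "(!!s. s \<in> S ==> f s <: N) ==> finsum N f S <: N" by (simp add: Pi_def)

lemma fs_cong: "[|S = T; !!s. s \<in> T ==> f s = g s; !!s. s \<in> T ==> g s <: N|] ==> finsum N f S = finsum N g T"
 by (intro MM.M.finsum_cong') (auto simp: Pi_def)

lemma fs_empty [simp]: "finsum N f {} = \<zero>[N]" by simp

lemma fs_insert: "[|finite S; a \<notin> S; !!s. s \<in> S ==> f s <: N; f a <: N|] ==> finsum N f (insert a S) = f a +[N] finsum N f S"
 by (simp add: Pi_def)

lemma fs_zero: "(!!s. s \<in> S ==> f s = \<zero>[N]) ==> finsum N f S = \<zero>[N]" by (rule MM.M.add.finprod_one_eqI)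

lemma fs_union: "[|finite S; finite T; S \<inter> T = {}; !!s. s \<in> S ==> f s <: N; !!s. s \<in> T ==> f s <: N|] ==> finsum N f (S \<union> T) = finsum N f S +[N] finsum N f T"
 by (intro MM.M.finsum_Un_disjoint) (auto simp: Pi_def)

lemma fs_add: "[|!!s. s \<in> S ==> f s <: N; !!s. s \<in> S ==> g s <: N|] ==> finsum N (%s. f s +[N] g s) S = finsum N f S +[N] finsum N g S"
 by (intro MM.M.finsum_addf) (auto simp: Pi_def)

lemma fs_neutral: "[|finite T; S \<subseteq> T; !!s. s \<in> T - S ==> f s = \<zero>[N]; !!s. s \<in> S ==> f s <: N|] ==> finsum N f T = finsum N f S"
 by (intro MM.M.add.finprod_mono_neutral_cong_right) (auto simp: Pi_def, metis MM.M.zero_closed)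

lemma fs_bij:
 assumes b: "bij_betw h S T" and e: "!!s. s \<in> S ==> f s = g (h s)" and t: "!!t. t \<in> T ==> g t <: N"
 shows "finsum N f S = finsum N g T"
proof -
 have hS: "h ` S = T" "inj_on h S" using b by (auto simp: bij_betw_def)
 have "finsum N g (h ` S) = finsum N (%s. g (h s)) S" by (rule MM.M.finsum_reindex) (use hS t in auto)
 also have "... = finsum N f S" by (rule fs_cong) (use e t hS in auto)
 finally show ?thesis using hS by simp
qed

lemma fs_single [simp]: "f a <: N ==> finsum N f {a} = f a" by (simp add: Pi_def)

end

lemma lin_zero: assumes "md M" "md N" "lin R M N f" shows "f \<zero>[M] = \<zero>[N]"
proof -
 have "f (\<zero>[R] *[M] \<zero>[M]) = \<zero>[R] *[N] f \<zero>[M]" using assms by (intro lin_smult) auto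
 then show ?thesis using assms lin_closed[OF assms(3)] by simp
qed

lemma lin_neg: assumes "md M" "md N" "lin R M N f" "x <: M"
 shows "f (-[M] x) = -[N] f x"
proof -
 have "f (-[M] x) +[N] f x = f (-[M] x +[M] x)" by (rule lin_add[OF assms(3), symmetric]) (use assms in auto)
 then have "f (-[M] x) +[N] f x = \<zero>[N]" using assms by (simp add: lin_zero[OF assms(1-3)])
 then show ?thesis using assms by (intro m_eq_neg) (auto intro: lin_closed)
qed

lemma lin_minus: assumes "md M" "md N" "lin R M N f" "x <: M" "y <: M"
 shows "f (x -[M] y) = f x -[N] f y" using assms by (simp add: a_minus_def lin_add[OF assms(3)] lin_neg[OF assms(1-3)])

lemma lin_finsum:
 assumes "md M" "md N" "lin R M N f" "finite S" "!!s. s \<in> S ==> g s <: M"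
 shows "f (finsum M g S) = finsum N (%s. f (g s)) S" using assms(4,5)
proof (induction rule: finite_induct)
 case empty then show ?case using assms by (simp add: lin_zero[OF assms(1-3)])
next
 case (insert a S)
 then show ?case using assms by (simp add: fs_insert lin_add[OF assms(3)] lin_closed[OF assms(3)])
qed

lemma lin_const0: "md N ==> lin R M N (%_. \<zero>[N])" by (rule linI) auto

lemma lin_scale: assumes "md N" "r <: R" "lin R M N f"
 shows "lin R M N (%x. r *[N] f x)"
proof (rule linI)
 fix s x assume "s <: R" "x <: M"
 then show "r *[N] f (s *[M] x) = s *[N] (r *[N] f x)"
  using assms by (simp add: lin_smult[OF assms(3)] lin_closed[OF assms(3)] m_ss[symmetric] m_comm)
qed (use assms in \<open>auto simp: lin_add[OF assms(3)] lin_closed[OF assms(3)] m_sr\<close>)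

lemma lin_plus: assumes "md N" "lin R M N f" "lin R M N g"
 shows "lin R M N (%x. f x +[N] g x)"
 by (rule linI) (use assms in \<open>auto simp: lin_add[OF assms(2)] lin_closed[OF assms(2)] lin_add[OF assms(3)] lin_closed[OF assms(3)] m_ac lin_smult[OF assms(2)] lin_smult[OF assms(3)] m_sr\<close>)

lemma lin_uminus: assumes "md N" "lin R M N f"
 shows "lin R M N (%x. -[N] f x)"
 by (rule linI) (use assms in \<open>auto simp: lin_add[OF assms(2)] lin_closed[OF assms(2)] m_negadd lin_smult[OF assms(2)] m_negs\<close>)

lemma lin_diff: assumes "md N" "lin R M N f" "lin R M N g"
 shows "lin R M N (%x. f x -[N] g x)" unfolding a_minus_def using assms by (intro lin_plus lin_uminus)

lemma lin_cong: assumes "md M" "lin R M N f" "!!x. x <: M ==> g x = f x"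
 shows "lin R M N g" using assms by (auto simp: lin_def)

lemma lin_sum:
 assumes "md M" "md N" "finite S" "!!s. s \<in> S ==> lin R M N (f s)"
 shows "lin R M N (%x. finsum N (%s. f s x) S)" using assms(3,4)
proof (induction rule: finite_induct)
 case empty then show ?case using assms lin_const0 by simp
next
 case (insert a S)
 show ?case by (rule lin_cong[OF assms(1) lin_plus[OF assms(2), of M "f a" "%x. finsum N (%s. f s x) S"]],
    (use insert in auto)[2], rule fs_insert[OF assms(2)]) (use insert in \<open>auto intro: lin_closed\<close>)
qed

lemma lin_id: "lin R M M (%x. x)" by (rule linI) auto

lemma fs_smult: fixes N :: "('k,'n) module" assumes "md N" "finite S" "r <: R" "!!s. s \<in> S ==> f s <: N"
 shows "r *[N] finsum N f S = finsum N (%s. r *[N] f s) S" by (rule lin_finsum[OF assms(1,1)]) (use assms lin_scale[OF _ _ lin_id] in auto)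

lemma fs_neg: fixes N :: "('k,'n) module" assumes "md N" "finite S" "!!s. s \<in> S ==> f s <: N"
 shows "-[N] finsum N f S = finsum N (%s. -[N] f s) S" by (rule lin_finsum[OF assms(1,1)]) (use assms lin_uminus[OF _ lin_id] in auto)

lemma fs_Sigma:
 assumes N: "md N" and S: "finite S" "!!s. s \<in> S ==> finite (T s)"
  and c: "!!s t. s \<in> S ==> t \<in> T s ==> f s t <: N"
 shows "finsum N (%s. finsum N (f s) (T s)) S = finsum N (%(s,t). f s t) (Sigma S T)" using S c
proof (induction rule: finite_induct)
 case empty then show ?case using N by simp
next
 case (insert a S)
 have e: "Sigma (insert a S) T = Pair a ` T a \<union> Sigma S T" by auto
 have "finsum N (f a) (T a) = finsum N (%(s,t). f s t) (Pair a ` T a)"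
  by (rule fs_bij[OF N]) (use insert in \<open>auto simp: bij_betw_def inj_on_def\<close>)
 moreover have "finsum N (%s. finsum N (f s) (T s)) (insert a S) =
   finsum N (f a) (T a) +[N] finsum N (%s. finsum N (f s) (T s)) S" using insert N by (intro fs_insert) auto
 moreover have "finsum N (%(s,t). f s t) (Pair a ` T a \<union> Sigma S T) =
   finsum N (%(s,t). f s t) (Pair a ` T a) +[N] finsum N (%(s,t). f s t) (Sigma S T)" using insert N by (intro fs_union) auto
 ultimately show ?case unfolding e using insert by auto
qed

text \<open>Turns two decompositions of one sum, as \<open>fs_tele\<close> gives them, into a
  statement about differences: the bulk terms \<open>x\<close> and \<open>y\<close> differ by the
  boundary terms.\<close>

lemma m_swap:
 assumes M: "md M" and e: "x +[M] a = y +[M] b"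
  and c: "x <: M" "y <: M" "a <: M" "b <: M"
 shows "x +[M] -[M] y = b -[M] a"
proof -
 have "x = x +[M] a +[M] -[M] a" unfolding m_assoc'[OF M c(1,3) m_neg[OF M c(3)]] using M c by simp
 also have "... = y +[M] (b +[M] -[M] a)" unfolding e using M c by (simp add: m_assoc')
 finally have "x +[M] -[M] y = (b +[M] -[M] a) +[M] (y +[M] -[M] y)" using M c by (simp only: m_ac m_add m_neg)
 then show ?thesis using M c by (simp add: a_minus_def)
qed

text \<open>Both sides are the sum over all of \<open>S\<close>. Telescoping sums are evaluated with
  it: for \<open>A\<close> and \<open>B\<close> the boundary cases at the two ends of a word, the
  sums over the complements differ by boundary terms only.\<close>

lemma fs_tele:
 assumes N: "md N" and S: "finite S" "A \<subseteq> S" "B \<subseteq> S"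
  and c: "!!s. s \<in> S ==> f s <: N"
 shows "finsum N f (S - A) +[N] finsum N f A = finsum N f (S - B) +[N] finsum N f B"
proof -
 have "finsum N f (S - X) +[N] finsum N f X = finsum N f S" if "X \<subseteq> S" for X
 proof -
  have "finsum N f (S - X) +[N] finsum N f X = finsum N f ((S - X) \<union> X)" using that assms finite_subset by (subst fs_union) auto
  then show ?thesis using that by (simp add: Un_absorb2)
 qed
 then show ?thesis using S by simp
qed

subsection \<open>Presented modules\<close>

lemma free_simps [simp]:
 "zero (fm G) = (%g. \<zero>[R])"
 "u +[fm G] v = (%g. u g +[R] v g)"
 "r *[fm G] u = (%g. r \<otimes>\<^bsub>R\<^esub> u g)" by (simp_all add: free_module_def)

lemma free_carrier: "u <: fm G \<longleftrightarrow>
  finite {g. u g ~= \<zero>[R]} \<and> (\<forall>g. u g <: R) \<and> (\<forall>g. g \<notin> G --> u g = \<zero>[R])"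
 by (force simp add: free_module_def)

lemma free_module [simp]: "md (fm G)"
proof (rule moduleI)
 show "abelian_group (fm G)"
 proof (rule abelian_groupI)
  fix u assume u: "u <: fm G"
  then have "(%g. -[R] u g) <: fm G" by (auto simp: free_carrier intro: rev_finite_subset)
  then show "\<exists>v\<in>carrier (fm G). v +[fm G] u = zero (fm G)"
   using u by (intro bexI[of _ "%g. -[R] u g"]) (auto simp: free_carrier l_neg)
 next
  fix u v assume "u <: fm G" "v <: fm G"
  then show "u +[fm G] v <: fm G" by (auto simp: free_carrier
     intro: rev_finite_subset[of "{g. u g ~= \<zero>[R]} \<union> {g. v g ~= \<zero>[R]}"])
 qed (auto simp: free_carrier a_ac)
 fix r u assume "r <: R" "u <: fm G"
 then show "r *[fm G] u <: fm G" by (auto simp: free_carrier intro: rev_finite_subset)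
qed (auto simp: free_carrier is_cring l_distr r_distr m_assoc)

lemma basis_elt_closed [simp]: "g \<in> G ==> basis_elt R g <: fm G" by (auto simp: free_carrier basis_elt_def)

text \<open>Induction over a finite set containing the support, splitting off one generator at a
  time. The set is arbitrary and may contain elements outside \<open>G\<close>; there the
  coefficient is zero and nothing is split off.\<close>

lemma free_lin_eq:
 assumes N: "md N" and f: "lin R (fm G) N f" and h: "lin R (fm G) N h"
  and eq: "!!g. g \<in> G ==> f (basis_elt R g) = h (basis_elt R g)"
  and u: "u <: fm G"
 shows "f u = h u"
proof -
 have "\<forall>u\<in>carrier (fm G). {g. u g ~= \<zero>[R]} \<subseteq> S --> f u = h u" if "finite S" for S using that
 proof (induction rule: finite_induct)
  case empty
  have "u = zero (fm G)" if "{g. u g ~= \<zero>[R]} \<subseteq> {}" for u using that by auto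
  then show ?case using lin_zero[OF free_module N f] lin_zero[OF free_module N h] by metis
 next
  case (insert a S)
  show ?case
  proof (intro ballI impI)
   fix u assume u: "u <: fm G" and S: "{g. u g ~= \<zero>[R]} \<subseteq> insert a S"
   have v: "u(a := \<zero>[R]) <: fm G" using u by (auto simp: free_carrier elim!: rev_finite_subset)
   have v': "f (u(a := \<zero>[R])) = h (u(a := \<zero>[R]))"
   proof -
    have "{g. (u(a := \<zero>[R])) g ~= \<zero>[R]} \<subseteq> S" using S by auto
    then show ?thesis using insert.IH v by blast
   qed
   show "f u = h u"
   proof (cases "a \<in> G")
    case False
    then have "u a = \<zero>[R]" using u by (auto simp: free_carrier)
    then have "u(a := \<zero>[R]) = u" by auto
    then show ?thesis using v' by simp
   next
    case True
    have d: "u = u a *[fm G] basis_elt R a +[fm G] u(a := \<zero>[R])" using u by (auto simp: free_carrier basis_elt_def fun_eq_iff)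
    have ua: "u a <: R" using u by (auto simp: free_carrier)
    have c: "u a *[fm G] basis_elt R a <: fm G" using ua True by (intro m_smult) auto
    show ?thesis using True v' ua by (subst d, subst (3) d)
      (simp add: lin_add[OF f c v] lin_add[OF h c v] lin_smult[OF f ua] lin_smult[OF h ua] eq del: free_simps)
   qed
  qed
 qed
 then show ?thesis using u by (auto simp: free_carrier)
qed

text \<open>The extension of \<open>\<phi>\<close> evaluated at a given representative;
  \<open>lin_ext\<close> evaluates it at a chosen one.\<close>

definition free_ext :: "('k,'n) module \<Rightarrow> ('g \<Rightarrow> 'n) \<Rightarrow> ('g \<Rightarrow> 'k) \<Rightarrow> 'n" where
 "free_ext N \<phi> u = finsum N (%g. u g *[N] \<phi> g) {g. u g ~= \<zero>[R]}"

text \<open>The support of a sum or a multiple can be smaller than expected, so values are compared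
  over a common finite set instead of over the supports.\<close>

lemma free_ext_superset:
 assumes N: "md N" and \<phi>: "!!g. g \<in> G ==> \<phi> g <: N"
  and u: "u <: fm G" and S: "finite S" "S \<subseteq> G" "{g. u g ~= \<zero>[R]} \<subseteq> S"
 shows "free_ext N \<phi> u = finsum N (%g. u g *[N] \<phi> g) S" unfolding free_ext_def
 by (rule fs_neutral[OF N, symmetric]) (use assms in \<open>auto simp: free_carrier\<close>)

lemma free_ext_lin:
 assumes N: "md N" and \<phi>: "!!g. g \<in> G ==> \<phi> g <: N"
 shows "lin R (fm G) N (free_ext N \<phi>)"
proof (rule linI)
 fix u assume "u <: fm G"
 then show "free_ext N \<phi> u <: N" unfolding free_ext_def using N \<phi> by (auto simp: free_carrier intro!: fs_closed m_smult)
next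
 fix u v assume u: "u <: fm G" and v: "v <: fm G"
 let ?S = "{g. u g ~= \<zero>[R]} \<union> {g. v g ~= \<zero>[R]}"
 have S: "finite ?S" "?S \<subseteq> G" using u v by (auto simp: free_carrier)
 have uv: "u +[fm G] v <: fm G" using u v by (rule m_add[OF free_module])
 have "free_ext N \<phi> (u +[fm G] v) = finsum N (%g. (u g +[R] v g) *[N] \<phi> g) ?S" by (subst free_ext_superset[OF N \<phi> uv S]) auto
 also have "... = finsum N (%g. u g *[N] \<phi> g +[N] v g *[N] \<phi> g) ?S"
  by (rule fs_cong[OF N refl]) (use u v S N \<phi> in \<open>auto simp: free_carrier m_sl\<close>)
 also have "... = finsum N (%g. u g *[N] \<phi> g) ?S +[N] finsum N (%g. v g *[N] \<phi> g) ?S"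
  by (rule fs_add[OF N]) (use u v S N \<phi> in \<open>auto simp: free_carrier\<close>)
 also have "... = free_ext N \<phi> u +[N] free_ext N \<phi> v"
  using free_ext_superset[OF N \<phi> u S] free_ext_superset[OF N \<phi> v S] by simp
 finally show "free_ext N \<phi> (u +[fm G] v) = free_ext N \<phi> u +[N] free_ext N \<phi> v" .
next
 fix r u assume r: "r <: R" and u: "u <: fm G"
 let ?S = "{g. u g ~= \<zero>[R]}"
 have S: "finite ?S" "?S \<subseteq> G" using u by (auto simp: free_carrier)
 have ru: "r *[fm G] u <: fm G" using r u by (rule m_smult[OF free_module])
 have "free_ext N \<phi> (r *[fm G] u) = finsum N (%g. (r \<otimes>\<^bsub>R\<^esub> u g) *[N] \<phi> g) ?S"
  by (subst free_ext_superset[OF N \<phi> ru S]) (use r in auto)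
 also have "... = finsum N (%g. r *[N] (u g *[N] \<phi> g)) ?S"
  by (rule fs_cong[OF N refl]) (use r u S N \<phi> in \<open>auto simp: free_carrier m_ss\<close>)
 also have "... = r *[N] free_ext N \<phi> u" unfolding free_ext_def
  by (rule fs_smult[OF N, symmetric]) (use r u S N \<phi> in \<open>auto simp: free_carrier\<close>)
 finally show "free_ext N \<phi> (r *[fm G] u) = r *[N] free_ext N \<phi> u" .
qed

lemma free_ext_basis:
 assumes N: "md N" and \<phi>: "!!g. g \<in> G ==> \<phi> g <: N" and g: "g \<in> G"
 shows "free_ext N \<phi> (basis_elt R g) = \<phi> g"
 by (subst free_ext_superset[OF N \<phi>, where G=G and S="{g}"]) (use assms basis_elt_closed[OF g] in \<open>auto simp: basis_elt_def\<close>)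

lemma submodule_span:
 assumes M: "md M" and S: "S \<subseteq> carrier M"
 shows "submodule (submodule_span R M S) R M"
proof -
 interpret M: module R M by fact
 show ?thesis
 proof (rule M.submoduleI)
  show "submodule_span R M S \<subseteq> carrier M" using S M.carrier_is_submodule by (auto simp: submodule_span_def)
  have "\<zero>[M] \<in> H" if "submodule H R M" for H using subgroup.one_closed[OF submodule.axioms(1)[OF that]] by simp
  then show "\<zero>[M] \<in> submodule_span R M S" by (auto simp: submodule_span_def)
 qed (auto simp: submodule_span_def dest: M.submoduleE)
qed

lemma submodule_span_incl: "x \<in> S ==> x \<in> submodule_span R M S" by (auto simp: submodule_span_def)

text \<open>The kernel of \<open>f\<close> is a submodule containing \<open>S\<close>, hence one of
  those whose intersection is the span.\<close>

lemma submodule_span_kernel: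
 assumes M: "md M" and N: "md N" and f: "lin R M N f" and S: "S \<subseteq> carrier M"
  and z: "!!x. x \<in> S ==> f x = \<zero>[N]" and x: "x \<in> submodule_span R M S"
 shows "f x = \<zero>[N]"
proof -
 interpret M: module R M by fact
 have "submodule {x \<in> carrier M. f x = \<zero>[N]} R M" by (rule M.submoduleI)
   (use M N lin_zero[OF M N f] lin_neg[OF M N f] lin_add[OF f] lin_smult[OF f] in auto)
 then show ?thesis using x S z by (auto simp: submodule_span_def)
qed

lemma
 fixes M :: "('k,'m) module"
 assumes M: "md M" and H: "submodule H R M"
 shows quotient_module: "md (quotient_module M H)"
  and quotient_proj: "lin R M (quotient_module M H) (%x. H +>\<^bsub>M\<^esub> x)"
  and quotient_carrier: "carrier (quotient_module M H) = (%x. H +>\<^bsub>M\<^esub> x) ` carrier M"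
  and quotient_zero: "!!x. x \<in> H ==> H +>\<^bsub>M\<^esub> x = \<zero>[quotient_module M H]"
  and quotient_self: "!!x. x <: M ==> x \<in> H +>\<^bsub>M\<^esub> x"
  and quotient_diff: "!!x y. [|x <: M; y \<in> H +>\<^bsub>M\<^esub> x|] ==> y <: M \<and> y -[M] x \<in> H"
proof -
 interpret M: module R M by fact
 have sg: "subgroup H (add_monoid M)" using H by (rule submodule.axioms)
 interpret H: abelian_subgroup H M by (rule abelian_subgroupI3[OF _ M.abelian_group_axioms])
   (use sg in \<open>simp add: additive_subgroup_def\<close>)
 have Hs: "r *[M] x \<in> H" if "r <: R" "x \<in> H" for r x using submodule.smult_closed[OF H] that by auto
 show c: "carrier (quotient_module M H) = (%x. H +>\<^bsub>M\<^esub> x) ` carrier M" by (auto simp: quotient_module_def A_RCOSETS_def' )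
 have add: "(H +>\<^bsub>M\<^esub> x) +[quotient_module M H] (H +>\<^bsub>M\<^esub> y) = H +>\<^bsub>M\<^esub> (x +[M] y)"
  if "x <: M" "y <: M" for x y using that by (simp add: quotient_module_def H.a_rcos_sum)
 show self: "x \<in> H +>\<^bsub>M\<^esub> x" if "x <: M" for x using that by (rule H.a_rcos_self)
 show diff: "y <: M \<and> y -[M] x \<in> H" if "x <: M" "y \<in> H +>\<^bsub>M\<^esub> x" for x y
  using that H.a_elemrcos_carrier H.a_rcos_module_imp by (auto simp: a_minus_def)
 have eq: "H +>\<^bsub>M\<^esub> y = H +>\<^bsub>M\<^esub> x" if "x <: M" "y <: M" "y -[M] x \<in> H" for x y
  using H.a_repr_independence'[of y x] H.a_rcos_module_rev[of x y] that by (auto simp: a_minus_def)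
 \<comment> \<open>The scalar action on cosets is a union over representatives. It collapses to one
   coset because \<open>r (y - x)\<close> lies in \<open>H\<close> for any representative
   \<open>y\<close>.\<close>
 have sm: "r *[quotient_module M H] (H +>\<^bsub>M\<^esub> x) = H +>\<^bsub>M\<^esub> (r *[M] x)"
  if "r <: R" "x <: M" for r x
 proof -
  have "H +>\<^bsub>M\<^esub> (r *[M] y) = H +>\<^bsub>M\<^esub> (r *[M] x)" if y: "y \<in> H +>\<^bsub>M\<^esub> x" for y
  proof (rule eq)
   have d: "y <: M" "y -[M] x \<in> H" using diff[OF \<open>x <: M\<close> y] by auto
   then have "r *[M] (y -[M] x) \<in> H" using Hs \<open>r <: R\<close> by auto
   then show "r *[M] y -[M] r *[M] x \<in> H"
    using d \<open>x <: M\<close> \<open>r <: R\<close> by (simp add: a_minus_def M.smult_r_distr M.smult_r_minus)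
   show "r *[M] y <: M" using d \<open>r <: R\<close> by auto
  qed (use \<open>x <: M\<close> \<open>r <: R\<close> in auto)
  then have "(\<Union>y\<in>H +>\<^bsub>M\<^esub> x. H +>\<^bsub>M\<^esub> (r *[M] y)) = H +>\<^bsub>M\<^esub> (r *[M] x)"
   using self[OF \<open>x <: M\<close>] by blast
  then show ?thesis by (simp add: quotient_module_def)
 qed
 have z: "\<zero>[quotient_module M H] = H +>\<^bsub>M\<^esub> \<zero>[M]" using H.a_subset by (simp add: quotient_module_def)
 show "H +>\<^bsub>M\<^esub> x = \<zero>[quotient_module M H]" if "x \<in> H" for x
  using that by (simp add: quotient_module_def H.a_rcos_const)
 show "md (quotient_module M H)"
 proof (rule moduleI)
  show "abelian_group (quotient_module M H)"
  proof (rule abelian_groupI)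
   fix X assume "X <: quotient_module M H"
   then obtain x where x: "x <: M" "X = H +>\<^bsub>M\<^esub> x" by (auto simp: c)
   then show "\<exists>Y\<in>carrier (quotient_module M H). Y +[quotient_module M H] X = \<zero>[quotient_module M H]"
    by (intro bexI[of _ "H +>\<^bsub>M\<^esub> (-[M] x)"]) (auto simp: c add z M.M.l_neg)
  qed (auto simp: c add z M.M.a_ac)
 qed (auto simp: c add sm is_cring M.smult_l_distr M.smult_r_distr M.smult_assoc1)
 show "lin R M (quotient_module M H) (%x. H +>\<^bsub>M\<^esub> x)" by (rule linI) (auto simp: c add sm)
qed

lemma
 assumes S: "S \<subseteq> carrier (fm G)"
 shows presented_module: "md (presented R G S)"
  and presented_proj: "lin R (fm G) (presented R G S)
   (%x. submodule_span R (fm G) S +>\<^bsub>fm G\<^esub> x)"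
  and presented_gen_closed: "!!g. g \<in> G ==> presented_gen R G S g <: presented R G S"
  and presented_rel: "!!x. x \<in> S ==>
   submodule_span R (fm G) S +>\<^bsub>fm G\<^esub> x = \<zero>[presented R G S]"
proof -
 note sp = submodule_span[OF free_module S]
 show "md (presented R G S)" unfolding presented_def by (rule quotient_module[OF free_module sp])
 show p: "lin R (fm G) (presented R G S)
   (%x. submodule_span R (fm G) S +>\<^bsub>fm G\<^esub> x)" unfolding presented_def by (rule quotient_proj[OF free_module sp])
 show "!!g. g \<in> G ==> presented_gen R G S g <: presented R G S" unfolding presented_gen_def by (rule lin_closed[OF p]) auto
 show "!!x. x \<in> S ==>
   submodule_span R (fm G) S +>\<^bsub>fm G\<^esub> x = \<zero>[presented R G S]"
  unfolding presented_def by (rule quotient_zero[OF free_module sp submodule_span_incl])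
qed

lemma presented_lin_eq:
 assumes S: "S \<subseteq> carrier (fm G)"
  and N: "md N" and f: "lin R (presented R G S) N f" and h: "lin R (presented R G S) N h"
  and eq: "!!g. g \<in> G ==> f (presented_gen R G S g) = h (presented_gen R G S g)"
  and X: "X <: presented R G S"
 shows "f X = h X"
proof -
 let ?q = "%x. submodule_span R (fm G) S +>\<^bsub>fm G\<^esub> x"
 obtain x where x: "x <: fm G" "X = ?q x"
  using X quotient_carrier[OF free_module submodule_span[OF free_module S]] by (auto simp: presented_def)
 have "(%x. f (?q x)) x = (%x. h (?q x)) x"
  by (rule free_lin_eq[OF N lin_compose[OF presented_proj[OF S] f] lin_compose[OF presented_proj[OF S] h] _ x(1)])
   (use eq in \<open>simp add: presented_gen_def\<close>)
 then show ?thesis using x by simp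
qed

text \<open>The representative chosen inside \<open>lin_ext\<close> differs from \<open>x\<close> by
  an element of the span, and the free extension vanishes on the span because it vanishes on the
  relations. Hence the choice does not affect the value, and linearity is inherited from
  \<open>free_ext\<close>.\<close>

lemma
 assumes S: "S \<subseteq> carrier (fm G)"
  and N: "md N" and \<phi>: "!!g. g \<in> G ==> \<phi> g <: N"
  and rel: "!!x. x \<in> S ==> free_ext N \<phi> x = \<zero>[N]"
 shows lin_ext_lin: "lin R (presented R G S) N (lin_ext R N \<phi>)"
  and lin_ext_gen: "!!g. g \<in> G ==> lin_ext R N \<phi> (presented_gen R G S g) = \<phi> g"
proof -
 note sp = submodule_span[OF free_module S]
 let ?q = "%x. submodule_span R (fm G) S +>\<^bsub>fm G\<^esub> x"
 have fl: "lin R (fm G) N (free_ext N \<phi>)" by (rule free_ext_lin[OF N \<phi>])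
 have 1: "lin_ext R N \<phi> (?q x) = free_ext N \<phi> x" if x: "x <: fm G" for x
 proof -
  define u where "u = (SOME u. u \<in> ?q x)"
  have "u \<in> ?q x"  unfolding u_def some_in_eq using quotient_self[OF free_module sp x] by auto
  then have u: "u <: fm G" "u -[fm G] x \<in> submodule_span R (fm G) S" using quotient_diff[OF free_module sp x] by auto
  have "free_ext N \<phi> (u -[fm G] x) = \<zero>[N]" by (rule submodule_span_kernel[OF free_module N fl S rel u(2)])
  then have "free_ext N \<phi> u -[N] free_ext N \<phi> x = \<zero>[N]" unfolding lin_minus[OF free_module N fl u(1) x] .
  then have "free_ext N \<phi> u = free_ext N \<phi> x" unfolding m_minus_zero[OF N lin_closed[OF fl u(1)] lin_closed[OF fl x]] .
  then show ?thesis by (simp add: lin_ext_def Let_def u_def[symmetric] free_ext_def)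
 qed
 show "lin_ext R N \<phi> (presented_gen R G S g) = \<phi> g" if "g \<in> G" for g
  using that by (simp add: presented_gen_def 1 free_ext_basis[OF N \<phi>])
 have c: "carrier (presented R G S) = ?q ` carrier (fm G)" using quotient_carrier[OF free_module sp] by (simp add: presented_def)
 note pl = presented_proj[OF S]
 note F = free_module[of G]
 show "lin R (presented R G S) N (lin_ext R N \<phi>)"
 proof (rule linI, unfold c)
  fix X assume "X \<in> ?q ` carrier (fm G)"
  then show "lin_ext R N \<phi> X <: N" using 1 lin_closed[OF fl] by auto
 next
  fix X Y assume "X \<in> ?q ` carrier (fm G)" "Y \<in> ?q ` carrier (fm G)"
  then obtain x y where xy: "x <: fm G" "y <: fm G" "X = ?q x" "Y = ?q y" by auto
  then show "lin_ext R N \<phi> (X +[presented R G S] Y) = lin_ext R N \<phi> X +[N] lin_ext R N \<phi> Y"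
   using lin_add[OF fl xy(1,2)] 1[OF xy(1)] 1[OF xy(2)] 1[OF m_add[OF F xy(1,2)]]
   unfolding xy(3,4) lin_add[OF pl xy(1,2), symmetric] by (simp only:)
 next
  fix r X assume r: "r <: R" and "X \<in> ?q ` carrier (fm G)"
  then obtain x where x: "x <: fm G" "X = ?q x" by auto
  then show "lin_ext R N \<phi> (r *[presented R G S] X) = r *[N] lin_ext R N \<phi> X"
   using lin_smult[OF fl r x(1)] 1[OF x(1)] 1[OF m_smult[OF F r x(1)]] unfolding x(2) lin_smult[OF pl r x(1), symmetric] by (simp only:)
 qed
qed

text \<open>Both sides evaluate at the same chosen representative, whose support lies in
  \<open>G\<close>; the equality is therefore termwise and holds before either function is known to
  respect the relations.\<close>

lemma lin_ext_cong:
 assumes "S \<subseteq> carrier (fm G)" "md N" "X <: presented R G S"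
  and "!!g. g \<in> G ==> \<phi> g = \<psi> g" "!!g. g \<in> G ==> \<psi> g <: N"
 shows "lin_ext R N \<phi> X = lin_ext R N \<psi> X"
proof -
 note sp = submodule_span[OF free_module assms(1)]
 obtain x where x: "x <: fm G" "X = submodule_span R (fm G) S +>\<^bsub>fm G\<^esub> x"
  using assms(3) quotient_carrier[OF free_module sp] by (auto simp: presented_def)
 define u where "u = (SOME u. u \<in> X)"
 have "x \<in> X" using quotient_self[OF free_module sp x(1)] x(2) by simp
 then have "u \<in> X" unfolding u_def some_in_eq by auto
 then have u: "u <: fm G" using quotient_diff[OF free_module sp x(1)] x(2) by auto
 then have G: "g \<in> G" "u g <: R" if "u g ~= \<zero>[R]" for g using that by (auto simp: free_carrier)
 show ?thesis unfolding lin_ext_def Let_def u_def[symmetric]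
 proof (rule fs_cong[OF assms(2) refl])
  fix g assume "g \<in> {g. u g ~= \<zero>[R]}"
  then have g: "g \<in> G" "u g <: R" using G by auto
  show "u g *[N] \<phi> g = u g *[N] \<psi> g" using assms(4)[OF g(1)] by simp
  show "u g *[N] \<psi> g <: N" using assms(2) assms(5)[OF g(1)] g(2) by simp
 qed
qed

subsection \<open>Graded maps\<close>

lemma gmod_module [simp]: "gm M ==> md (M i)" by (simp add: gmodule_def)

lemma gmodule_susp [simp]: "gm M ==> gm (susp M)" by (simp add: gmodule_def susp_def)

lemma HOM_iff: "f <: Hom M N n \<longleftrightarrow>
  (\<forall>i. lin R (M i) (N (i + n)) (f i) \<and> f i \<in> extensional (carrier (M i)))" by (simp add: HOM_def linear_maps_iff)

text \<open>The target degree is a variable tied down by an equation: degrees agree only up to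
  integer arithmetic, so \<open>N (i + n)\<close> rarely matches a goal as it stands. Many rules
  below are phrased in this way.\<close>

lemma HOM_lin: "f <: Hom M N n ==> i + n = k ==> lin R (M i) (N k) (f i)" by (auto simp: HOM_iff)

lemma HOM_in: "f <: Hom M N n ==> x <: M i ==> i + n = k ==> f i x <: N k" by (auto simp: HOM_iff lin_def)

lemma HOM_I:
 assumes "!!i. lin R (M i) (N (i + n)) (f i)" "!!i x. x \<notin> carrier (M i) ==> f i x = undefined"
 shows "f <: Hom M N n" using assms by (auto simp: HOM_iff extensional_def)

lemma HOM_restrict:
 assumes M: "gm M" and "!!i. lin R (M i) (N (i + n)) (g i)"
 shows "(%i. \<lambda>x\<in>carrier (M i). g i x) <: Hom M N n" by (rule HOM_I, rule lin_cong) (use assms in auto)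

lemma HOM_eqI:
 assumes "f <: Hom M N n" "g <: Hom M N n'"
  and "!!i x. x <: M i ==> f i x = g i x"
 shows "f = g"
proof (intro ext)
 fix i x show "f i x = g i x" by (cases "x <: M i") (use assms in \<open>auto simp: HOM_iff extensional_def\<close>)
qed

lemma HOM_add_apply [simp]: "x <: M i ==> (f +[Hom M N n] g) i x = f i x +[N (i + n)] g i x"
 and HOM_zero_apply [simp]: "x <: M i ==> \<zero>[Hom M N n] i x = \<zero>[N (i + n)]"
 and HOM_smult_apply [simp]: "x <: M i ==> (r *[Hom M N n] f) i x = r *[N (i + n)] f i x" by (simp_all add: HOM_def)

lemma HOM_module:
 assumes M: "gm M" and N: "gm N" shows "md (Hom M N n)"
proof -
 let ?H = "Hom M N n"
 have add: "f +[?H] g <: ?H" if "f <: ?H" "g <: ?H" for f g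
 proof -
  have "(%i. \<lambda>x\<in>carrier (M i). f i x +[N (i + n)] g i x) <: ?H"
   using that M N by (intro HOM_restrict lin_plus HOM_lin[of _ M N n]) auto
  then show ?thesis by (simp add: HOM_def)
 qed
 have zero: "\<zero>[?H] <: ?H"
 proof -
  have "(%i. \<lambda>x\<in>carrier (M i). \<zero>[N (i + n)]) <: ?H" using M N by (intro HOM_restrict lin_const0) auto
  then show ?thesis by (simp add: HOM_def)
 qed
 have smult: "r *[?H] f <: ?H" if "r <: R" "f <: ?H" for f r
 proof -
  have "(%i. \<lambda>x\<in>carrier (M i). r *[N (i + n)] f i x) <: ?H"
   using that M N by (intro HOM_restrict lin_scale HOM_lin[of _ M N n]) auto
  then show ?thesis by (simp add: HOM_def)
 qed
 note c = HOM_in[OF _ _ refl, of _ M N n]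
 show ?thesis
 proof (rule moduleI)
  show "abelian_group ?H"
  proof (rule abelian_groupI)
   fix f g h assume f: "f <: ?H" and g: "g <: ?H" and h: "h <: ?H"
   show "f +[?H] g <: ?H" using f g by (rule add)
   show "(f +[?H] g) +[?H] h = f +[?H] (g +[?H] h)" using N by (intro HOM_eqI[of _ M N n _ n] add f g h) (simp_all add: c f g h m_assoc')
   show "f +[?H] g = g +[?H] f" by (intro HOM_eqI[of _ M N n _ n] add f g h) (use N in \<open>simp add: c f g h m_comm'\<close>)
   show "\<zero>[?H] +[?H] f = f" by (intro HOM_eqI[of _ M N n _ n] add zero f g h) (use N in \<open>simp add: c f g h\<close>)
   \<comment> \<open>The record gives no negation to compute with, so the inverse is exhibited as
     \<open>-1\<close> times \<open>f\<close>.\<close>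
   have "(-[R] \<one>\<^bsub>R\<^esub> *[?H] f) +[?H] f = \<zero>[?H]"
    by (intro HOM_eqI[of _ M N n _ n] add zero smult f g h) (use N in \<open>simp_all add: c f g h m_sneg\<close>)
   then show "\<exists>g\<in>carrier ?H. g +[?H] f = \<zero>[?H]" by (intro bexI[of _ "-[R] \<one>\<^bsub>R\<^esub> *[?H] f"] smult f) auto
  qed (rule zero)
 next
  fix r s f g assume r: "r <: R" and s: "s <: R" and f: "f <: ?H" and g: "g <: ?H"
  show "r *[?H] f <: ?H" by (intro smult r f)
  show "(r +[R] s) *[?H] f = r *[?H] f +[?H] s *[?H] f"
   by (intro HOM_eqI[of _ M N n _ n] add smult r s f g add.m_closed) (use N in \<open>simp add: c f g r s m_sl\<close>)
  show "r *[?H] (f +[?H] g) = r *[?H] f +[?H] r *[?H] g"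
   by (intro HOM_eqI[of _ M N n _ n] add smult r s f g) (use N in \<open>simp add: c f g r s m_sr\<close>)
  show "(r \<otimes>\<^bsub>R\<^esub> s) *[?H] f = r *[?H] (s *[?H] f)"
   by (intro HOM_eqI[of _ M N n _ n] add smult r s f g m_closed) (use N in \<open>simp add: c f g r s m_ss\<close>)
 next
  fix f assume f: "f <: ?H"
  show "\<one>\<^bsub>R\<^esub> *[?H] f = f"
   by (intro HOM_eqI[of _ M N n _ n] add smult f one_closed) (use N in \<open>simp add: c f\<close>)
 qed (rule is_cring)
qed

lemma gmodule_HOM [simp]: "gm M ==> gm N ==> gm (Hom M N)" unfolding gmodule_def[of R "Hom M N"] using HOM_module by blast

text \<open>Evaluation at a point is linear, which is why negatives, differences and finite sums in
  \<open>Hom\<close> are pointwise: these operations are derived from the record and cannot simply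
  be unfolded like addition.\<close>

lemma HOM_ev: "gm N ==> x <: M i ==> i + n = k ==> lin R (Hom M N n) (N k) (%f. f i x)" by (rule linI) (auto simp: HOM_in)

lemma
 assumes M: "gm M" and N: "gm N" and x: "x <: M i" and k: "i + n = k"
 shows HOM_neg_apply: "f <: Hom M N n ==> (-[Hom M N n] f) i x = -[N k] f i x"
  and HOM_minus_apply: "f <: Hom M N n ==> g <: Hom M N n ==>
    (f -[Hom M N n] g) i x = f i x -[N k] g i x"
  and HOM_sum_apply: "finite S ==> (!!s. s \<in> S ==> F s <: Hom M N n) ==>
    (finsum (Hom M N n) F S) i x = finsum (N k) (%s. F s i x) S"
proof -
 note ev = HOM_ev[where M=M and N=N and i=i and n=n and k=k, OF N x k]
 have m: "md (Hom M N n)" "md (N k)" using M N by auto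
 show "f <: Hom M N n ==> (-[Hom M N n] f) i x = -[N k] f i x" by (rule lin_neg[OF m ev])
 show "f <: Hom M N n ==> g <: Hom M N n ==>
    (f -[Hom M N n] g) i x = f i x -[N k] g i x" by (rule lin_minus[OF m ev])
 show "finite S ==> (!!s. s \<in> S ==> F s <: Hom M N n) ==>
    (finsum (Hom M N n) F S) i x = finsum (N k) (%s. F s i x) S" by (rule lin_finsum[OF m ev])
qed

lemma gcomp_apply [simp]: "x <: M i ==> gcomp M b g f i x = g (i + b) (f i x)" by (simp add: gcomp_def)

lemma gcomp_HOM:
 assumes "gm M" "f <: Hom M N b" "g <: Hom N P c" "b + c = e"
 shows "gcomp M b g f <: Hom M P e" unfolding gcomp_def
 by (rule HOM_restrict[OF assms(1)], rule lin_compose, rule HOM_lin[OF assms(2) refl], rule HOM_lin[OF assms(3)])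
  (use assms(4) in auto)

lemma gid_apply [simp]: "x <: M i ==> gid M i x = x" by (simp add: gid_def)

lemma gid_HOM [simp]: "gm M ==> gid M <: Hom M M 0" unfolding gid_def by (rule HOM_restrict) (auto intro: lin_id)

lemma sgn_in [simp]: "sg n <: R" by (simp add: sgn_pow_def)

lemma sgn_sgn [simp]: "md M ==> x <: M ==> sg m *[M] (sg n *[M] x) = sg (m + n) *[M] x" by (auto simp: sgn_pow_def m_sneg)

lemma sgn_even: "md M ==> x <: M ==> even n ==> sg n *[M] x = x"
 and sgn_odd: "md M ==> x <: M ==> odd n ==> sg n *[M] x = -[M] x" by (auto simp: sgn_pow_def m_sneg)

lemma sgn_cong: "even n = even m ==> sg n = sg m" by (simp add: sgn_pow_def)

lemma sgn_0 [simp]: "sg 0 = \<one>\<^bsub>R\<^esub>" by (simp add: sgn_pow_def)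

lemma sgn_uminus [simp]: "sg (- n) = sg n" by (simp add: sgn_pow_def)

lemma sgn_neg: "md M ==> x <: M ==> even m ~= even n ==> sg m *[M] x = -[M] (sg n *[M] x)" by (auto simp: sgn_pow_def m_sneg)

lemma kmod_module [simp]: "gm (kmod R)" unfolding gmodule_def
proof
 fix i show "md (kmod R i)"
 proof (rule moduleI)
  show "abelian_group (kmod R i)"
  proof (rule abelian_groupI)
   fix x assume "x <: kmod R i"
   then show "\<exists>y\<in>carrier (kmod R i). y +[kmod R i] x = \<zero>[kmod R i]"
    by (intro bexI[of _ "-[R] x"]) (auto simp: kmod_def l_neg split: if_splits)
  qed (auto simp: kmod_def a_ac split: if_splits)
 qed (auto simp: kmod_def is_cring l_distr r_distr m_assoc split: if_splits)
qed

lemma kmod_simps [simp]: "r +[kmod R i] s = r +[R] s" "\<zero>[kmod R i] = \<zero>[R]" "r *[kmod R i] s = r \<otimes>\<^bsub>R\<^esub> s"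
 by (simp_all add: kmod_def)

lemma kmod_carrier: "r <: kmod R i \<longleftrightarrow> (if i = 0 then r <: R else r = \<zero>[R])" by (auto simp: kmod_def)

lemma kmodD: "r <: kmod R i ==> r <: R" by (auto simp: kmod_carrier split: if_splits)

lemma kact_lin1: "gm M ==> x <: M j ==> i + j = k ==> lin R (kmod R i) (M k) (%r. kact M (i,r) (j,x))"
 by (rule linI) (auto simp: kact_def kmod_carrier m_sl m_ss split: if_splits)

lemma kact_lin2: "gm M ==> r <: R ==> i + j = k ==> lin R (M j) (M k) (%x. kact M (i,r) (j,x))"
 by (rule linI) (auto simp: kact_def m_sr m_ss[symmetric] m_comm)

lemma kact_closed [simp]: "gm M ==> r <: R ==> x <: M j ==> i + j = k ==> kact M (i,r) (j,x) <: M k" by (auto simp: kact_def)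

subsection \<open>Tensor products\<close>

definition bilin :: "('k,'m) gmod \<Rightarrow> ('k,'n) gmod \<Rightarrow> ('k,'w) gmod \<Rightarrow> int
  \<Rightarrow> (int \<times> 'm \<Rightarrow> int \<times> 'n \<Rightarrow> 'w) \<Rightarrow> bool" where
 "bilin M N W e \<phi> \<longleftrightarrow> (\<forall>i j.
   (\<forall>y\<in>carrier (N j). lin R (M i) (W (i + j + e)) (%x. \<phi> (i,x) (j,y))) \<and>
   (\<forall>x\<in>carrier (M i). lin R (N j) (W (i + j + e)) (%y. \<phi> (i,x) (j,y))))"

lemma bilinI:
 assumes "!!i j y. y <: N j ==> lin R (M i) (W (i + j + e)) (%x. \<phi> (i,x) (j,y))"
  "!!i j x. x <: M i ==> lin R (N j) (W (i + j + e)) (%y. \<phi> (i,x) (j,y))"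
 shows "bilin M N W e \<phi>" using assms by (auto simp: bilin_def)

lemma tens_gens_iff [simp]: "((i,x), (j,y)) \<in> tens_gens M N d \<longleftrightarrow> x <: M i \<and> y <: N j \<and> i + j = d"
 by (auto simp: tens_gens_def)

lemma tens_rels_carrier:
 assumes "gm M" "gm N"
 shows "tens_rels R M N d \<subseteq> carrier (fm (tens_gens M N d))" unfolding tens_rels_def Let_def
 using assms by (auto simp del: free_simps intro!: m_minus[OF free_module] m_add[OF free_module] m_smult[OF free_module])

lemma tens_module [simp]: "gm M ==> gm N ==> gm (tns M N)" by (simp add: gmodule_def tens_def presented_module[OF tens_rels_carrier])

text \<open>A defining relation read as an equation between classes; in this form each family of
  relations becomes a linearity statement.\<close>

lemma presented_eq:
 assumes S: "S \<subseteq> carrier (fm G)"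
  and a: "a <: fm G" and b: "b <: fm G"
  and ab: "a -[fm G] b \<in> S"
 shows "submodule_span R (fm G) S +>\<^bsub>fm G\<^esub> a =
     submodule_span R (fm G) S +>\<^bsub>fm G\<^esub> b"
 using presented_rel[OF S ab] lin_minus[OF free_module presented_module[OF S] presented_proj[OF S] a b]
  m_minus_zero[OF presented_module[OF S] lin_closed[OF presented_proj[OF S] a] lin_closed[OF presented_proj[OF S] b]] by simp

lemma telt_in [simp]:
 assumes "gm M" "gm N" "x <: M i" "y <: N j" "i + j = d"
 shows "telt M N (i,x) (j,y) <: tns M N d" using assms unfolding tens_elt_def tens_def Let_def
 by (auto intro!: presented_gen_closed[OF tens_rels_carrier])

lemma tens_elt_lin1:
 assumes M: "gm M" and N: "gm N" and y: "y <: N j" and d: "i + j = d"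
 shows "lin R (M i) (tns M N d) (%x. telt M N (i,x) (j,y))"
proof (rule linI)
 let ?F = "fm (tens_gens M N d)"
 note rc = tens_rels_carrier[OF M N, of d]
 note pl = presented_proj[OF rc]
 fix x x' assume x: "x <: M i" "x' <: M i"
 have b: "basis_elt R ((i,x), (j,y)) <: ?F" "basis_elt R ((i,x'), (j,y)) <: ?F"
  "basis_elt R ((i, x +[M i] x'), (j,y)) <: ?F" using M x y d by auto
 have r: "basis_elt R ((i, x +[M i] x'), (j,y)) -[?F] (basis_elt R ((i,x), (j,y)) +[?F] basis_elt R ((i,x'), (j,y)))
   \<in> tens_rels R M N d" unfolding tens_rels_def Let_def using x y d by blast
 have "basis_elt R ((i,x), (j,y)) +[?F] basis_elt R ((i,x'), (j,y)) <: ?F" by (rule m_add[OF free_module b(1,2)])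
 then show "telt M N (i, x +[M i] x') (j,y) = telt M N (i,x) (j,y) +[tns M N d] telt M N (i,x') (j,y)"
  using presented_eq[OF rc b(3) _ r] lin_add[OF pl b(1,2)] d by (simp add: tens_elt_def tens_def presented_gen_def Let_def del: free_simps)
next
 let ?F = "fm (tens_gens M N d)"
 note rc = tens_rels_carrier[OF M N, of d]
 note pl = presented_proj[OF rc]
 fix r x assume r: "r <: R" and x: "x <: M i"
 have b: "basis_elt R ((i,x), (j,y)) <: ?F" "basis_elt R ((i, r *[M i] x), (j,y)) <: ?F" using M x y d r by auto
 have rel: "basis_elt R ((i, r *[M i] x), (j,y)) -[?F] (r *[?F] basis_elt R ((i,x), (j,y)))
   \<in> tens_rels R M N d" unfolding tens_rels_def Let_def using x y d r by blast
 have "r *[?F] basis_elt R ((i,x), (j,y)) <: ?F" by (rule m_smult[OF free_module r b(1)])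
 then show "telt M N (i, r *[M i] x) (j,y) = r *[tns M N d] telt M N (i,x) (j,y)"
  using presented_eq[OF rc b(2) _ rel] lin_smult[OF pl r b(1)] d
  by (simp add: tens_elt_def tens_def presented_gen_def Let_def del: free_simps)
qed (use assms in auto)

lemma tens_elt_lin2:
 assumes M: "gm M" and N: "gm N" and x: "x <: M i" and d: "i + j = d"
 shows "lin R (N j) (tns M N d) (%y. telt M N (i,x) (j,y))"
proof (rule linI)
 let ?F = "fm (tens_gens M N d)"
 note rc = tens_rels_carrier[OF M N, of d]
 note pl = presented_proj[OF rc]
 fix y y' assume y: "y <: N j" "y' <: N j"
 have b: "basis_elt R ((i,x), (j,y)) <: ?F" "basis_elt R ((i,x), (j,y')) <: ?F"
  "basis_elt R ((i,x), (j, y +[N j] y')) <: ?F" using N x y d by auto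
 have r: "basis_elt R ((i,x), (j, y +[N j] y')) -[?F] (basis_elt R ((i,x), (j,y)) +[?F] basis_elt R ((i,x), (j,y')))
   \<in> tens_rels R M N d" unfolding tens_rels_def Let_def using x y d by blast
 have "basis_elt R ((i,x), (j,y)) +[?F] basis_elt R ((i,x), (j,y')) <: ?F" by (rule m_add[OF free_module b(1,2)])
 then show "telt M N (i,x) (j, y +[N j] y') = telt M N (i,x) (j,y) +[tns M N d] telt M N (i,x) (j,y')"
  using presented_eq[OF rc b(3) _ r] lin_add[OF pl b(1,2)] d by (simp add: tens_elt_def tens_def presented_gen_def Let_def del: free_simps)
next
 let ?F = "fm (tens_gens M N d)"
 note rc = tens_rels_carrier[OF M N, of d]
 note pl = presented_proj[OF rc]
 fix r y assume r: "r <: R" and y: "y <: N j"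
 have b: "basis_elt R ((i,x), (j,y)) <: ?F" "basis_elt R ((i,x), (j, r *[N j] y)) <: ?F" using N x y d r by auto
 have rel: "basis_elt R ((i,x), (j, r *[N j] y)) -[?F] (r *[?F] basis_elt R ((i,x), (j,y)))
   \<in> tens_rels R M N d" unfolding tens_rels_def Let_def using x y d r by blast
 have "r *[?F] basis_elt R ((i,x), (j,y)) <: ?F" by (rule m_smult[OF free_module r b(1)])
 then show "telt M N (i,x) (j, r *[N j] y) = r *[tns M N d] telt M N (i,x) (j,y)"
  using presented_eq[OF rc b(2) _ rel] lin_smult[OF pl r b(1)] d
  by (simp add: tens_elt_def tens_def presented_gen_def Let_def del: free_simps)
qed (use assms in auto)

lemma tens_lin_eq:
 assumes M: "gm M" and N: "gm N" and W: "md W"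
  and f: "lin R (tns M N d) W f" and g: "lin R (tns M N d) W g"
  and eq: "!!i x j y. [|x <: M i; y <: N j; i + j = d|] ==>
    f (telt M N (i,x) (j,y)) = g (telt M N (i,x) (j,y))"
  and z: "z <: tns M N d"
 shows "f z = g z"
 by (rule presented_lin_eq[OF tens_rels_carrier[OF M N] W f[unfolded tens_def] g[unfolded tens_def] _ z[unfolded tens_def]])
  (use eq in \<open>auto simp: tens_gens_def tens_elt_def\<close>)

lemma tens_HOM_eqI:
 assumes M: "gm M" and N: "gm N" and W: "gm W"
  and f: "f <: Hom (tns M N) W n" and g: "g <: Hom (tns M N) W n"
  and eq: "!!i x j y. [|x <: M i; y \<in> carrier (N j)|] ==>
    f (i + j) (telt M N (i,x) (j,y)) = g (i + j) (telt M N (i,x) (j,y))"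
 shows "f = g"
proof (rule HOM_eqI[OF f g])
 fix d z assume z: "z <: tns M N d"
 show "f d z = g d z" by (rule tens_lin_eq[OF M N _ HOM_lin[OF f refl] HOM_lin[OF g refl] _ z]) (use W eq in auto)
qed

lemma
 assumes M: "gm M" and N: "gm N" and W: "gm W" and b: "bilin M N W e \<phi>"
 shows tens_ext_HOM: "tens_ext R M N W e \<phi> <: Hom (tns M N) W e"
  and tens_ext_elt: "!!i x j y d. [|x <: M i; y <: N j; i + j = d|] ==>
    tens_ext R M N W e \<phi> d (telt M N (i,x) (j,y)) = \<phi> (i,x) (j,y)"
proof -
 have l1: "lin R (M i) (W (d + e)) (%x. \<phi> (i,x) (j,y))" if "y <: N j" "i + j = d" for i j d y using b that by (auto simp: bilin_def)
 have l2: "lin R (N j) (W (d + e)) (%y. \<phi> (i,x) (j,y))" if "x <: M i" "i + j = d" for i j d x using b that by (auto simp: bilin_def)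
 have c: "(%(p,q). \<phi> p q) g <: W (d + e)" if "g \<in> tens_gens M N d" for g d
  using that lin_closed[OF l1] by (auto simp: tens_gens_def)
 have rel: "free_ext (W (d + e)) (%(p,q). \<phi> p q) u = \<zero>[W (d + e)]" if u: "u \<in> tens_rels R M N d" for u d
 proof -
  let ?F = "fm (tens_gens M N d)"
  let ?f = "free_ext (W (d + e)) (%(p,q). \<phi> p q)"
  have Wm: "md (W (d + e))" using W by simp
  have fl: "lin R ?F (W (d + e)) ?f" by (rule free_ext_lin[OF Wm c])
  have fb: "?f (basis_elt R ((i,x), (j,y))) = \<phi> (i,x) (j,y)"
   if "x <: M i" "y <: N j" "i + j = d" for i x j y by (subst free_ext_basis[OF Wm c]) (use that in auto)
  have bc: "basis_elt R ((i,x), (j,y)) <: ?F"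
   if "x <: M i" "y <: N j" "i + j = d" for i x j y using that by auto
  have mn: "?f (a -[?F] b) = ?f a -[W (d + e)] ?f b" if "a <: ?F" "b <: ?F" for a b by (rule lin_minus[OF free_module Wm fl that])
  note s = mn m_add[OF free_module] m_smult[OF free_module] lin_add[OF fl] lin_smult[OF fl] bc fb
    lin_closed[OF l1] lin_add[OF l1] lin_add[OF l2] lin_smult[OF l1] lin_smult[OF l2] M N W m_minus_zero
  \<comment> \<open>Each of the four families of relations is sent to zero by additivity or
    homogeneity of \<open>\<phi>\<close> in one of its two arguments.\<close>
  show ?thesis using u unfolding tens_rels_def Let_def by (elim UnE CollectE exE conjE) (simp_all add: s del: free_simps)
 qed
 have le: "lin R (tns M N d) (W (d + e)) (lin_ext R (W (d + e)) (%(p,q). \<phi> p q))" for d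
  unfolding tens_def by (rule lin_ext_lin[OF tens_rels_carrier[OF M N] gmod_module[OF W] c rel])
 show "tens_ext R M N W e \<phi> <: Hom (tns M N) W e" unfolding tens_ext_def by (rule HOM_restrict) (use le M N in auto)
 fix i x j y d assume xy: "x <: M i" "y <: N j" "i + j = d"
 have "lin_ext R (W (d + e)) (%(p,q). \<phi> p q) (telt M N (i,x) (j,y)) = (%(p,q). \<phi> p q) ((i,x), (j,y))"
  unfolding tens_elt_def Let_def using xy W c rel by (simp add: lin_ext_gen[OF tens_rels_carrier[OF M N]])
 then show "tens_ext R M N W e \<phi> d (telt M N (i,x) (j,y)) = \<phi> (i,x) (j,y)" using xy M N by (simp add: tens_ext_def)
qed

lemma
 assumes M: "gm M" and N: "gm N" and M': "gm M'" and N': "gm N'"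
  and f: "f <: Hom M M' a" and g: "g <: Hom N N' b"
 shows tmap_HOM: "a + b = e ==> tmap M N M' N' a b f g <: Hom (tns M N) (tns M' N') e"
  and tmap_elt: "[|x <: M i; y <: N j; i + j = d; i + j + (a + b) = k|] ==>
    tmap M N M' N' a b f g d (telt M N (i,x) (j,y)) =
    sg (b * i) *[tns M' N' k] telt M' N' (i + a, f i x) (j + b, g j y)"
proof -
 have b: "bilin M N (tns M' N') (a + b) (%(i,x) (j,y). sg (b * i) *[tns M' N' (i + j + (a + b))]
    telt M' N' (i + a, f i x) (j + b, g j y))"
 proof (rule bilinI)
  fix i j y assume y: "y <: N j"
  show "lin R (M i) (tns M' N' (i + j + (a + b))) (%x. (%(i,x) (j,y). sg (b * i) *[tns M' N' (i + j + (a + b))]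
    telt M' N' (i + a, f i x) (j + b, g j y)) (i,x) (j,y))" using M' N' y HOM_in[OF g y refl]
   by (auto intro!: lin_scale lin_compose[OF HOM_lin[OF f refl, of i], where g="%x. telt M' N' (i + a, x) (j + b, g j y)"] tens_elt_lin1)
 next
  fix i j x assume x: "x <: M i"
  show "lin R (N j) (tns M' N' (i + j + (a + b))) (%y. (%(i,x) (j,y). sg (b * i) *[tns M' N' (i + j + (a + b))]
    telt M' N' (i + a, f i x) (j + b, g j y)) (i,x) (j,y))" using M' N' x HOM_in[OF f x refl]
   by (auto intro!: lin_scale lin_compose[OF HOM_lin[OF g refl, of j], where g="%y. telt M' N' (i + a, f i x) (j + b, y)"] tens_elt_lin2)
 qed
 show "a + b = e ==> tmap M N M' N' a b f g <: Hom (tns M N) (tns M' N') e"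
  unfolding tens_map_def using tens_ext_HOM[OF M N _ b] M' N' by auto
 show "[|x <: M i; y <: N j; i + j = d; i + j + (a + b) = k|] ==>
    tmap M N M' N' a b f g d (telt M N (i,x) (j,y)) =
    sg (b * i) *[tns M' N' k] telt M' N' (i + a, f i x) (j + b, g j y)" unfolding tens_map_def using tens_ext_elt[OF M N _ b] M' N' by auto
qed

text \<open>\<open>tens_assoc\<close> nests one extension inside another. For fixed \<open>z\<close>
  the inner one is a degree 0 map into the target shifted by the degree of \<open>z\<close>. Its
  dependence on \<open>z\<close> is linear because two linear maps out of \<open>L (x) M\<close>
  need only be compared on elementary tensors.\<close>

lemma
 assumes L: "gm L" and M: "gm M" and N: "gm N"
 shows tens_assoc_HOM: "tens_assoc R L M N <: Hom (tns (tns L M) N) (tns L (tns M N)) 0"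
  and tens_assoc_elt: "[|x <: L i; y <: M j; z <: N k; d = i + j + k; l = i + j; l' = j + k|] ==>
    tens_assoc R L M N d (telt (tns L M) N (l, telt L M (i,x) (j,y)) (k,z)) =
    telt L (tns M N) (i,x) (l', telt M N (j,y) (k,z))"
proof -
 let ?T = "tns L (tns M N)"
 define \<phi> where "\<phi> = (%j z (p,q). telt L (tns M N) p (fst q + j, telt M N q (j,z)))"
 have b: "bilin L M (%d. ?T (d + j)) 0 (%p q. \<phi> j z (p,q))" if z: "z <: N j" for j z
 proof (rule bilinI)
  fix i l y assume y: "y <: M l"
  show "lin R (L i) (?T (i + l + 0 + j)) (%x. \<phi> j z ((i,x), (l,y)))"
   unfolding \<phi>_def using L M N y z by (auto intro!: tens_elt_lin1)
 next
  fix i l x assume x: "x <: L i"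
  show "lin R (M l) (?T (i + l + 0 + j)) (%y. \<phi> j z ((i,x), (l,y)))"
   unfolding \<phi>_def using L M N x z by (auto intro!: lin_compose[OF tens_elt_lin1 tens_elt_lin2])
 qed
 have gs: "gm (%d. ?T (d + j))" for j using L M N by (subst gmodule_def) simp
 note E = tens_ext_HOM[OF L M gs b] tens_ext_elt[OF L M gs b]
 have le: "lin R (tns L M i) (?T (i + j)) (lin_ext R (?T (i + j)) (\<phi> j z))" if z: "z <: N j" for i j z
  by (rule lin_cong[OF _ HOM_lin[OF E(1)[OF z] refl, of i, simplified]]) (use L M in \<open>auto simp: tens_ext_def\<close>)
 have lv: "lin_ext R (?T (i + l + j)) (\<phi> j z) (telt L M (i,x) (l,y)) = \<phi> j z ((i,x), (l,y))"
  if z: "z <: N j" and xy: "x <: L i" "y <: M l" for i j z x l y using E(2)[OF z xy refl] xy L M by (simp add: tens_ext_def)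
 have b2: "bilin (tns L M) N ?T 0 (%(i,X) (j,z). lin_ext R (?T (i + j)) (\<phi> j z) X)"
 proof (rule bilinI)
  fix i j z assume z: "z <: N j"
  show "lin R (tns L M i) (?T (i + j + 0)) (%x. (%(i,X) (j,z). lin_ext R (?T (i + j)) (\<phi> j z) X) (i,x) (j,z))" using le[OF z] by simp
 next
  fix i j X assume X: "X <: tns L M i"
  have c: "lin_ext R (?T (i + j)) (\<phi> j z) X <: ?T (i + j)" if "z <: N j" for z by (rule lin_closed[OF le[OF that] X])
  have T: "md (?T (i + j))" using L M N by simp
  have "lin R (N j) (?T (i + j)) (%z. lin_ext R (?T (i + j)) (\<phi> j z) X)"
  proof (rule linI)
   fix z z' assume z: "z <: N j" "z' <: N j"
   then have zz: "z +[N j] z' <: N j" using N by simp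
   show "lin_ext R (?T (i + j)) (\<phi> j (z +[N j] z')) X =
     lin_ext R (?T (i + j)) (\<phi> j z) X +[?T (i + j)] lin_ext R (?T (i + j)) (\<phi> j z') X"
   proof (rule tens_lin_eq[OF L M T le[OF zz] lin_plus[OF T le[OF z(1)] le[OF z(2)]] _ X])
    fix a x l y assume xy: "x <: L a" "y <: M l" "a + l = i"
    have "lin R (N j) (?T (i + j)) (%z. \<phi> j z ((a,x), (l,y)))"
     unfolding \<phi>_def using L M N xy by (auto intro!: lin_compose[OF tens_elt_lin2 tens_elt_lin2])
    from lin_add[OF this z]
    show "lin_ext R (?T (i + j)) (\<phi> j (z +[N j] z')) (telt L M (a,x) (l,y)) =
      lin_ext R (?T (i + j)) (\<phi> j z) (telt L M (a,x) (l,y)) +[?T (i + j)]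
      lin_ext R (?T (i + j)) (\<phi> j z') (telt L M (a,x) (l,y))"
     using lv[OF zz xy(1,2)] lv[OF z(1) xy(1,2)] lv[OF z(2) xy(1,2)] xy(3) by simp
   qed
  next
   fix r z assume r: "r <: R" and z: "z <: N j"
   then have rz: "r *[N j] z <: N j" using N by simp
   show "lin_ext R (?T (i + j)) (\<phi> j (r *[N j] z)) X = r *[?T (i + j)] lin_ext R (?T (i + j)) (\<phi> j z) X"
   proof (rule tens_lin_eq[OF L M T le[OF rz] lin_scale[OF T r le[OF z]] _ X])
    fix a x l y assume xy: "x <: L a" "y <: M l" "a + l = i"
    have "lin R (N j) (?T (i + j)) (%z. \<phi> j z ((a,x), (l,y)))"
     unfolding \<phi>_def using L M N xy by (auto intro!: lin_compose[OF tens_elt_lin2 tens_elt_lin2])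
    from lin_smult[OF this r z]
    show "lin_ext R (?T (i + j)) (\<phi> j (r *[N j] z)) (telt L M (a,x) (l,y)) =
      r *[?T (i + j)] lin_ext R (?T (i + j)) (\<phi> j z) (telt L M (a,x) (l,y))" using lv[OF rz xy(1,2)] lv[OF z(1) xy(1,2)] xy(3) by simp
   qed
  qed (rule c)
  then show "lin R (N j) (?T (i + j + 0)) (%z. (%(i,X) (j,z). lin_ext R (?T (i + j)) (\<phi> j z) X) (i,X) (j,z))" by simp
 qed
 have T: "gm ?T" "gm (tns L M)" using L M N by auto
 have eq: "tens_assoc R L M N = tens_ext R (tns L M) N ?T 0 (%(i,X) (j,z). lin_ext R (?T (i + j)) (\<phi> j z) X)"
  unfolding tens_assoc_def Let_def \<phi>_def ..
 show "tens_assoc R L M N <: Hom (tns (tns L M) N) (tns L (tns M N)) 0" unfolding eq by (rule tens_ext_HOM[OF T(2) N T(1) b2])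
 assume a: "x <: L i" "y <: M j" "z <: N k" "d = i + j + k" "l = i + j" "l' = j + k"
 have "tens_assoc R L M N d (telt (tns L M) N (l, telt L M (i,x) (j,y)) (k,z)) =
  lin_ext R (?T (l + k)) (\<phi> k z) (telt L M (i,x) (j,y))" unfolding eq by (subst tens_ext_elt[OF T(2) N T(1) b2]) (use a L M in auto)
 also have "... = \<phi> k z ((i,x), (j,y))" using lv[OF a(3,1,2)] a(5) by simp
 also have "... = telt L (tns M N) (i,x) (l', telt M N (j,y) (k,z))" using a(6) by (simp add: \<phi>_def)
 finally show "tens_assoc R L M N d (telt (tns L M) N (l, telt L M (i,x) (j,y)) (k,z)) =
    telt L (tns M N) (i,x) (l', telt M N (j,y) (k,z))" .
qed

lemma
 assumes M: "gm M"
 shows tens_lunit_HOM: "tens_lunit R M <: Hom (tns (kmod R) M) M 0"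
  and tens_lunit_elt: "[|r <: kmod R i; x <: M j; i + j = d|] ==>
    tens_lunit R M d (telt (kmod R) M (i,r) (j,x)) = kact M (i,r) (j,x)"
proof -
 have b: "bilin (kmod R) M M 0 (kact M)" by (rule bilinI) (use M in \<open>auto intro!: kact_lin1 kact_lin2 dest: kmodD\<close>)
 show "tens_lunit R M <: Hom (tns (kmod R) M) M 0" unfolding tens_lunit_def by (rule tens_ext_HOM[OF kmod_module M M b])
 show "[|r <: kmod R i; x <: M j; i + j = d|] ==>
    tens_lunit R M d (telt (kmod R) M (i,r) (j,x)) = kact M (i,r) (j,x)"
  unfolding tens_lunit_def by (rule tens_ext_elt[OF kmod_module M M b])
qed

end

subsection \<open>Words\<close>

definition vw :: "('k, 'v) gmod \<Rightarrow> (int \<times> 'v) list \<Rightarrow> bool" where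
 "vw V w \<longleftrightarrow> (\<forall>(i, x)\<in>set w. x <: V i)"

lemma vw_simps [simp]: "vw V []" "vw V (p # w) \<longleftrightarrow> snd p <: V (fst p) \<and> vw V w"
 "vw V (u @ v) \<longleftrightarrow> vw V u \<and> vw V v" by (auto simp: vw_def)

lemma wdeg_simps [simp]: "wdeg [] = 0" "wdeg (p # w) = fst p + wdeg w" "wdeg (u @ v) = wdeg u + wdeg v" by (simp_all add: wdeg_def)

lemma words_iff: "w \<in> words V n d \<longleftrightarrow> length w = n \<and> vw V w \<and> wdeg w = d" by (auto simp: words_def vw_def)

text \<open>The empty word has no slot, so its value is constrained separately; for other words
  membership in \<open>W\<close> follows from linearity in the first slot, see
  \<open>mlin_closed\<close>.\<close>

definition mlin :: "'k ring \<Rightarrow> ('k, 'v) gmod \<Rightarrow> ('k, 'w) gmod \<Rightarrow> int \<Rightarrow> ((int \<times> 'v) list \<Rightarrow> 'w) \<Rightarrow> bool" where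
 "mlin R V W e \<phi> \<longleftrightarrow> \<phi> [] <: W e \<and>
   (\<forall>u i v. vw V u --> vw V v -->
    lin R (V i) (W (wdeg u + i + wdeg v + e)) (%x. \<phi> (u @ (i, x) # v)))"

lemma mlinI:
 assumes "\<phi> [] <: W e"
  "!!u i v k. vw V u ==> vw V v ==> k = wdeg u + i + wdeg v + e ==>
    lin R (V i) (W k) (%x. \<phi> (u @ (i, x) # v))"
 shows "mlin R V W e \<phi>" using assms by (auto simp: mlin_def)

lemma mlin_lin: "mlin R V W e \<phi> ==> vw V u ==> vw V v ==> wdeg u + i + wdeg v + e = k ==>
  lin R (V i) (W k) (%x. \<phi> (u @ (i, x) # v))" by (auto simp: mlin_def)

lemma mlin_closed: "mlin R V W e \<phi> ==> vw V w ==> wdeg w + e = k ==> \<phi> w <: W k"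
proof (cases w)
 case (Cons p w')
 assume a: "mlin R V W e \<phi>" "vw V w" "wdeg w + e = k"
 have "lin R (V (fst p)) (W k) (%x. \<phi> ([] @ (fst p, x) # w'))" by (rule mlin_lin[OF a(1)]) (use a Cons in auto)
 then show ?thesis using Cons a lin_closed by fastforce
qed (auto simp: mlin_def)

context ground begin

lemma mlin_cong:
 assumes V: "gm V" and m: "mlin R V W e \<phi>" and eq: "!!w. vw V w ==> \<psi> w = \<phi> w"
 shows "mlin R V W e \<psi>"
proof (rule mlinI)
 fix u i v k assume uv: "vw V u" "vw V v" "k = dg u + i + dg v + e"
 show "lin R (V i) (W k) (%x. \<psi> (u @ (i,x) # v))"
  by (rule lin_cong[OF gmod_module[OF V] mlin_lin[OF m uv(1,2) uv(3)[symmetric]]]) (use uv eq in auto)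
qed (use m eq in \<open>auto simp: mlin_def\<close>)

lemma word_rels_carrier:
 assumes V: "gm V"
 shows "word_rels R V n d \<subseteq> carrier (fm (words V n d))" unfolding word_rels_def Let_def
 using assms by (auto simp: words_iff simp del: free_simps intro!: m_minus[OF free_module] m_add[OF free_module] m_smult[OF free_module])

lemma tpow_module [simp]: "gm V ==> gm (tpow R V n)" by (simp add: gmodule_def tpow_def presented_module[OF word_rels_carrier])

lemma tword_closed [simp]: "gm V ==> vw V w ==> length w = n ==> dg w = d ==> tword R V w <: tpow R V n d"
 unfolding tword_def tpow_def Let_def by (auto intro!: presented_gen_closed[OF word_rels_carrier] simp: words_iff)

lemma tword_lin:
 assumes V: "gm V" and u: "vw V u" and v: "vw V v" and d: "d = dg u + i + dg v" and n: "n = Suc (length u + length v)"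
 shows "lin R (V i) (tpow R V n d) (%x. tword R V (u @ (i,x) # v))"
proof (rule linI)
 let ?F = "fm (words V n d)"
 note rc = word_rels_carrier[OF V, of n d]
 note pl = presented_proj[OF rc]
 have w: "u @ (i,x) # v \<in> words V n d" if "x <: V i" for x using that u v d n by (auto simp: words_iff)
 note tw = tword_def presented_gen_def tpow_def Let_def
 have ln: "length (u @ (i,x) # v) = n" "dg (u @ (i,x) # v) = d" for x using d n by auto
 {
  fix x x' assume x: "x <: V i" "x' <: V i"
  then have xx: "x +[V i] x' <: V i" using V by simp
  note b = basis_elt_closed[OF w[OF x(1)]] basis_elt_closed[OF w[OF x(2)]] basis_elt_closed[OF w[OF xx]]
  have r: "basis_elt R (u @ (i, x +[V i] x') # v) -[?F] (basis_elt R (u @ (i,x) # v) +[?F] basis_elt R (u @ (i,x') # v))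
   \<in> word_rels R V n d" unfolding word_rels_def Let_def using x w by blast
  have "basis_elt R (u @ (i,x) # v) +[?F] basis_elt R (u @ (i,x') # v) <: ?F" by (rule m_add[OF free_module b(1,2)])
  then show "tword R V (u @ (i, x +[V i] x') # v) = tword R V (u @ (i,x) # v) +[tpow R V n d] tword R V (u @ (i,x') # v)"
   using presented_eq[OF rc b(3) _ r] lin_add[OF pl b(1,2)] unfolding tw ln by simp
 next
  fix r x assume r: "r <: R" and x: "x <: V i"
  then have xx: "r *[V i] x <: V i" using V by simp
  note b = basis_elt_closed[OF w[OF x]] basis_elt_closed[OF w[OF xx]]
  have rel: "basis_elt R (u @ (i, r *[V i] x) # v) -[?F] (r *[?F] basis_elt R (u @ (i,x) # v))
   \<in> word_rels R V n d" unfolding word_rels_def Let_def using r x w by blast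
  have "r *[?F] basis_elt R (u @ (i,x) # v) <: ?F" by (rule m_smult[OF free_module r b(1)])
  then show "tword R V (u @ (i, r *[V i] x) # v) = r *[tpow R V n d] tword R V (u @ (i,x) # v)"
   using presented_eq[OF rc b(2) _ rel] lin_smult[OF pl r b(1)] unfolding tw ln by simp
 }
 show "tword R V (u @ (i,x) # v) <: tpow R V n d" if "x <: V i" for x using V u v d n that by (intro tword_closed) auto
qed

lemma tpow_lin_eq:
 assumes V: "gm V" and W: "md W"
  and f: "lin R (tpow R V n d) W f" and g: "lin R (tpow R V n d) W g"
  and eq: "!!w. [|vw V w; length w = n; dg w = d|] ==> f (tword R V w) = g (tword R V w)"
  and z: "z <: tpow R V n d"
 shows "f z = g z" by (rule presented_lin_eq[OF word_rels_carrier[OF V] W f[unfolded tpow_def] g[unfolded tpow_def] _ z[unfolded tpow_def]])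
  (use eq in \<open>auto simp: words_iff tword_def\<close>)

lemma
 assumes V: "gm V" and W: "gm W" and m: "mlin R V W e \<phi>"
 shows tpow_ext_HOM: "tpow_ext R V n W e \<phi> <: Hom (tpow R V n) W e"
  and tpow_ext_word: "!!w. [|vw V w; length w = n; dg w = d|] ==> tpow_ext R V n W e \<phi> d (tword R V w) = \<phi> w"
proof -
 have c: "\<phi> w <: W (d + e)" if "w \<in> words V n d" for w d using that mlin_closed[OF m] by (auto simp: words_iff)
 have rel: "free_ext (W (d + e)) \<phi> r = \<zero>[W (d + e)]" if r: "r \<in> word_rels R V n d" for r d
 proof -
  let ?F = "fm (words V n d)"
  let ?f = "free_ext (W (d + e)) \<phi>"
  have Wm: "md (W (d + e))" using W by simp
  have fl: "lin R ?F (W (d + e)) ?f" by (rule free_ext_lin[OF Wm c])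
  have fb: "?f (basis_elt R w) = \<phi> w" if "w \<in> words V n d" for w by (rule free_ext_basis[OF Wm c that])
  have mn: "?f (a -[?F] b) = ?f a -[W (d + e)] ?f b" if "a <: ?F" "b <: ?F" for a b by (rule lin_minus[OF free_module Wm fl that])
  \<comment> \<open>A relation names the word with \<open>x\<close> in the slot. Replacing
    \<open>x\<close> by any other element of the same degree stays within words of length
    \<open>n\<close> and degree \<open>d\<close>, so one linear map serves all terms of the
    relation.\<close>
  have wx: "u @ (i,y) # v \<in> words V n d \<and> lin R (V i) (W (d + e)) (%x. \<phi> (u @ (i,x) # v))"
   if "u @ (i,x) # v \<in> words V n d" "y <: V i" for u i x y v
  proof -
   have "lin R (V i) (W (dg u + i + dg v + e)) (%x. \<phi> (u @ (i,x) # v))" using that by (intro mlin_lin[OF m]) (auto simp: words_iff)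
   moreover have "dg u + i + dg v = d" using that by (auto simp: words_iff)
   ultimately show ?thesis using that by (auto simp: words_iff)
  qed
  have xV: "x <: V i" if "u @ (i,x) # v \<in> words V n d" for u i x v using that by (auto simp: words_iff)
  consider u i x y v where "r = basis_elt R (u @ (i, x +[V i] y) # v) -[?F] (basis_elt R (u @ (i,x) # v) +[?F] basis_elt R (u @ (i,y) # v))"
    "u @ (i,x) # v \<in> words V n d" "y <: V i"
   | u i s x v where "r = basis_elt R (u @ (i, s *[V i] x) # v) -[?F] (s *[?F] basis_elt R (u @ (i,x) # v))"
    "s <: R" "u @ (i,x) # v \<in> words V n d" using r unfolding word_rels_def Let_def by blast
  then show ?thesis
  proof cases
   case 1
   note x = xV[OF 1(2)]
   have xy: "x +[V i] y <: V i" using x 1(3) V by simp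
   note w = 1(2) wx[OF 1(2) 1(3), THEN conjunct1] wx[OF 1(2) xy, THEN conjunct1]
   note b = basis_elt_closed[OF w(1)] basis_elt_closed[OF w(2)] basis_elt_closed[OF w(3)]
   have l: "lin R (V i) (W (d + e)) (%x. \<phi> (u @ (i,x) # v))" using wx[OF 1(2) x] by simp
   show ?thesis unfolding 1(1) mn[OF b(3) m_add[OF free_module b(1,2)]] lin_add[OF fl b(1,2)] fb[OF w(1)] fb[OF w(2)] fb[OF w(3)]
     lin_add[OF l x 1(3)] using Wm c w by (simp add: m_minus_zero)
  next
   case 2
   note x = xV[OF 2(3)]
   have xy: "s *[V i] x <: V i" using x 2(2) V by simp
   note w = 2(3) wx[OF 2(3) xy, THEN conjunct1]
   note b = basis_elt_closed[OF w(1)] basis_elt_closed[OF w(2)]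
   have l: "lin R (V i) (W (d + e)) (%x. \<phi> (u @ (i,x) # v))" using wx[OF 2(3) x] by simp
   show ?thesis unfolding 2(1) mn[OF b(2) m_smult[OF free_module 2(2) b(1)]] lin_smult[OF fl 2(2) b(1)] fb[OF w(1)] fb[OF w(2)]
     lin_smult[OF l 2(2) x] using Wm c w 2(2) by (simp add: m_minus_zero)
  qed
 qed
 have le: "lin R (tpow R V n d) (W (d + e)) (lin_ext R (W (d + e)) \<phi>)" for d
  unfolding tpow_def by (rule lin_ext_lin[OF word_rels_carrier[OF V] gmod_module[OF W] c rel])
 show "tpow_ext R V n W e \<phi> <: Hom (tpow R V n) W e" unfolding tpow_ext_def by (rule HOM_restrict) (use le V in auto)
 fix w assume w: "vw V w" "length w = n" "dg w = d"
 have "lin_ext R (W (d + e)) \<phi> (tword R V w) = \<phi> w" unfolding tword_def Let_def w(2,3)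
  by (rule lin_ext_gen[OF word_rels_carrier[OF V] gmod_module[OF W] c rel]) (use w in \<open>auto simp: words_iff\<close>)
 then show "tpow_ext R V n W e \<phi> d (tword R V w) = \<phi> w" using w V by (simp add: tpow_ext_def)
qed

lemma tpow_ext_cong:
 assumes V: "gm V" and W: "gm W" and eq: "!!w. vw V w ==> \<phi> w = \<psi> w"
  and c: "!!w. vw V w ==> \<psi> w <: W (dg w + e)"
 shows "tpow_ext R V n W e \<phi> = tpow_ext R V n W e \<psi>"
proof (intro ext)
 fix d X
 show "tpow_ext R V n W e \<phi> d X = tpow_ext R V n W e \<psi> d X"
 proof (cases "X <: tpow R V n d")
  case True
  have "lin_ext R (W (d + e)) \<phi> X = lin_ext R (W (d + e)) \<psi> X"
   by (rule lin_ext_cong[OF word_rels_carrier[OF V] gmod_module[OF W] True[unfolded tpow_def]])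
    (use eq c in \<open>auto simp: words_iff\<close>)
  then show ?thesis using True by (simp add: tpow_ext_def)
 qed (simp add: tpow_ext_def)
qed

subsection \<open>The tensor coalgebra as a graded module\<close>

lemma tco_simps [simp]:
 "zero (tco R V d) = (%n. \<zero>[tpow R V n d])"
 "t +[tco R V d] u = (%n. t n +[tpow R V n d] u n)"
 "r *[tco R V d] t = (%n. r *[tpow R V n d] t n)" by (simp_all add: tco_def)

lemma tco_carrier: "t <: tco R V d \<longleftrightarrow>
  (\<forall>n. t n <: tpow R V n d) \<and> finite {n. t n ~= \<zero>[tpow R V n d]}" by (simp add: tco_def)

lemma tco_module [simp]:
 assumes V: "gm V" shows "gm (tco R V)" unfolding gmodule_def
proof
 fix d
 have m: "md (tpow R V n d)" for n using V by simp
 show "md (tco R V d)"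
 proof (rule moduleI)
  show "abelian_group (tco R V d)"
  proof (rule abelian_groupI)
   fix t assume t: "t <: tco R V d"
   then have "(%n. -[tpow R V n d] t n) <: tco R V d" using m by (auto simp: tco_carrier intro: rev_finite_subset)
   then show "\<exists>u\<in>carrier (tco R V d). u +[tco R V d] t = zero (tco R V d)"
    using t m by (intro bexI[of _ "%n. -[tpow R V n d] t n"]) (auto simp: tco_carrier)
  next
   fix t u assume tu: "t <: tco R V d" "u <: tco R V d"
   then have "finite {n. t n +[tpow R V n d] u n ~= \<zero>[tpow R V n d]}" using m by (auto simp: tco_carrier
     intro: rev_finite_subset[of "{n. t n ~= \<zero>[tpow R V n d]} \<union> {n. u n ~= \<zero>[tpow R V n d]}"])
   then show "t +[tco R V d] u <: tco R V d" using tu m by (auto simp: tco_carrier)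
    next
   fix t u assume "t <: tco R V d" "u <: tco R V d"
   then show "t +[tco R V d] u = u +[tco R V d] t" unfolding tco_simps by (intro ext m_comm'[OF m]) (auto simp: tco_carrier)
  qed (use m in \<open>auto simp: tco_carrier m_assoc'\<close>)
  fix r t assume rt: "r <: R" "t <: tco R V d"
  then have "finite {n. r *[tpow R V n d] t n ~= \<zero>[tpow R V n d]}" using m by (auto simp: tco_carrier intro: rev_finite_subset)
  then show "r *[tco R V d] t <: tco R V d" using rt m by (auto simp: tco_carrier)
 qed (use m in \<open>auto simp: tco_carrier is_cring m_sl m_sr m_ss\<close>)
qed

definition tco_inj :: "('k,'v) gmod \<Rightarrow> nat \<Rightarrow> int \<Rightarrow> ('k,'v) tpow \<Rightarrow> nat \<Rightarrow> ('k,'v) tpow" where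
 "tco_inj V n d X = (%m. if m = n then X else \<zero>[tpow R V m d])"

lemma tco_inj_lin: assumes V: "gm V" shows "lin R (tpow R V n d) (tco R V d) (tco_inj V n d)"
proof -
 have m: "md (tpow R V n d)" for n using V by simp
 have "finite {m. (if m = n then X else \<zero>[tpow R V m d]) ~= \<zero>[tpow R V m d]}" for X by (rule finite_subset[of _ "{n}"]) auto
 then show ?thesis by (intro linI) (use m in \<open>auto simp: tco_carrier tco_inj_def fun_eq_iff\<close>)
qed

lemma tco_word_inj: "d = dg w ==> n = length w ==> tco_word R V w = tco_inj V n d (tword R V w)" by (auto simp: tco_word_def tco_inj_def)

lemma tco_word_lin:
 assumes V: "gm V" and u: "vw V u" and v: "vw V v" and d: "d = dg u + i + dg v"
 shows "lin R (V i) (tco R V d) (%x. tco_word R V (u @ (i,x) # v))"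
proof -
 have "lin R (V i) (tco R V d) (%x. tco_inj V (Suc (length u + length v)) d (tword R V (u @ (i,x) # v)))"
  by (rule lin_compose[OF tword_lin[OF V u v d refl] tco_inj_lin[OF V]])
 moreover have "tco_inj V (Suc (length u + length v)) d (tword R V (u @ (i,x) # v)) = tco_word R V (u @ (i,x) # v)" for x
  by (rule tco_word_inj[symmetric]) (use d in auto)
 ultimately show ?thesis by simp
qed

lemma tco_word_closed [simp]: "gm V ==> vw V w ==> dg w = d ==> tco_word R V w <: tco R V d"
 using lin_closed[OF tco_inj_lin, of V "tword R V w" "length w" d] by (simp add: tco_word_inj)

lemma tco_word_mlin: "gm V ==> mlin R V (tco R V) 0 (tco_word R V)" by (rule mlinI) (auto intro!: tco_word_lin)

text \<open>The induction used for free modules, with one tensor degree split off at a time.\<close>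

lemma tco_lin_eq_inj:
 assumes V: "gm V" and W: "md W"
  and f: "lin R (tco R V d) W f" and g: "lin R (tco R V d) W g"
  and eq: "!!n X. X <: tpow R V n d ==> f (tco_inj V n d X) = g (tco_inj V n d X)"
  and z: "z <: tco R V d"
 shows "f z = g z"
proof -
 have T: "md (tco R V d)" and m: "md (tpow R V n d)" for n using V by simp_all
 have "\<forall>u\<in>carrier (tco R V d). {n. u n ~= \<zero>[tpow R V n d]} \<subseteq> S --> f u = g u" if "finite S" for S using that
 proof (induction rule: finite_induct)
  case empty
  show ?case
  proof (intro ballI impI)
   fix u assume "{n. u n ~= \<zero>[tpow R V n d]} \<subseteq> {}"
   then have u: "u = zero (tco R V d)" by auto
   show "f u = g u" unfolding u lin_zero[OF T W f] lin_zero[OF T W g] ..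
  qed
 next
  case (insert a S)
  show ?case
  proof (intro ballI impI)
   fix u assume u: "u <: tco R V d" and S: "{n. u n ~= \<zero>[tpow R V n d]} \<subseteq> insert a S"
   let ?v = "u(a := \<zero>[tpow R V a d])"
   have v: "?v <: tco R V d" using u m by (auto simp: tco_carrier elim!: rev_finite_subset)
   have v': "f ?v = g ?v"
   proof -
    have "{n. ?v n ~= \<zero>[tpow R V n d]} \<subseteq> S" using S by auto
    then show ?thesis using insert.IH v by blast
   qed
   have ua: "u a <: tpow R V a d" using u by (auto simp: tco_carrier)
   have c: "tco_inj V a d (u a) <: tco R V d" by (rule lin_closed[OF tco_inj_lin[OF V] ua])
   have d: "u = tco_inj V a d (u a) +[tco R V d] ?v" using u m by (auto simp: tco_carrier tco_inj_def fun_eq_iff)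
   show "f u = g u" using arg_cong[OF d, of f] arg_cong[OF d, of g] unfolding lin_add[OF f c v] lin_add[OF g c v] eq[OF ua] v' by simp
  qed
 qed
 then show ?thesis using z by (auto simp: tco_carrier)
qed

lemma tco_lin_eq:
 assumes V: "gm V" and W: "md W"
  and f: "lin R (tco R V d) W f" and g: "lin R (tco R V d) W g"
  and eq: "!!w. [|vw V w; dg w = d|] ==> f (tco_word R V w) = g (tco_word R V w)"
  and z: "z <: tco R V d"
 shows "f z = g z"
proof (rule tco_lin_eq_inj[OF V W f g _ z])
 fix n X assume X: "X <: tpow R V n d"
 show "f (tco_inj V n d X) = g (tco_inj V n d X)"
  by (rule tpow_lin_eq[OF V W lin_compose[OF tco_inj_lin[OF V] f] lin_compose[OF tco_inj_lin[OF V] g] _ X])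
   (use eq in \<open>metis tco_word_inj\<close>)
qed

lemma
 assumes V: "gm V" and W: "gm W" and \<Phi>: "!!n. \<Phi> n <: Hom (tpow R V n) W e"
 shows tco_ext_HOM: "tco_ext R V W e \<Phi> <: Hom (tco R V) W e"
  and tco_ext_inj: "!!X n d. X <: tpow R V n d ==> tco_ext R V W e \<Phi> d (tco_inj V n d X) = \<Phi> n d X"
  and tco_ext_superset: "!!t d S. t <: tco R V d ==> finite S ==> {n. t n ~= \<zero>[tpow R V n d]} \<subseteq> S ==>
    tco_ext R V W e \<Phi> d t = finsum (W (d + e)) (%n. \<Phi> n d (t n)) S"
proof -
 have m: "md (tpow R V n d)" and Wm: "md (W d)" for n d using V W by simp_all
 note l = HOM_lin[OF \<Phi> refl]
 show ss: "tco_ext R V W e \<Phi> d t = finsum (W (d + e)) (%n. \<Phi> n d (t n)) S"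
  if t: "t <: tco R V d" and S: "finite S" "{n. t n ~= \<zero>[tpow R V n d]} \<subseteq> S" for t d S
 proof -
  have "finsum (W (d + e)) (%n. \<Phi> n d (t n)) {n. t n ~= \<zero>[tpow R V n d]} = finsum (W (d + e)) (%n. \<Phi> n d (t n)) S"
  proof (rule fs_neutral[OF Wm, symmetric])
   fix n assume "n \<in> S - {n. t n ~= \<zero>[tpow R V n d]}"
   then show "\<Phi> n d (t n) = \<zero>[W (d + e)]" using lin_zero[OF m Wm l] by simp
  next
   fix n show "\<Phi> n d (t n) <: W (d + e)" using t lin_closed[OF l] by (auto simp: tco_carrier)
  qed (use S in auto)
  then show ?thesis using t by (simp add: tco_ext_def)
 qed
 have "tco_ext R V W e \<Phi> = (%d. \<lambda>t\<in>carrier (tco R V d). tco_ext R V W e \<Phi> d t)" by (simp add: tco_ext_def fun_eq_iff)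
 also have "... <: Hom (tco R V) W e"
 proof (rule HOM_restrict[OF tco_module[OF V]], rule linI)
  fix d t assume t: "t <: tco R V d"
  let ?S = "{n. t n ~= \<zero>[tpow R V n d]}"
  have S: "finite ?S" using t by (auto simp: tco_carrier)
  have c: "\<Phi> n d (t n) <: W (d + e)" for n using t lin_closed[OF l] by (auto simp: tco_carrier)
  show "tco_ext R V W e \<Phi> d t <: W (d + e)" unfolding ss[OF t S order_refl] by (rule fs_closed[OF Wm c])
  fix r assume r: "r <: R"
  have T: "md (tco R V d)" using V by simp
  have "tco_ext R V W e \<Phi> d (r *[tco R V d] t) = finsum (W (d + e)) (%n. \<Phi> n d (r *[tpow R V n d] t n)) ?S"
   by (subst ss[OF m_smult[OF T r t] S]) (use m r in auto)
  also have "... = finsum (W (d + e)) (%n. r *[W (d + e)] \<Phi> n d (t n)) ?S"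
   by (rule fs_cong[OF Wm refl]) (use t r c Wm lin_smult[OF l r] in \<open>auto simp: tco_carrier\<close>)
  also have "... = r *[W (d + e)] tco_ext R V W e \<Phi> d t" unfolding ss[OF t S order_refl] by (rule fs_smult[OF Wm S r c, symmetric])
  finally show "tco_ext R V W e \<Phi> d (r *[tco R V d] t) = r *[W (d + e)] tco_ext R V W e \<Phi> d t" .
 next
  fix d t u assume t: "t <: tco R V d" and u: "u <: tco R V d"
  let ?S = "{n. t n ~= \<zero>[tpow R V n d]} \<union> {n. u n ~= \<zero>[tpow R V n d]}"
  have S: "finite ?S" using t u by (auto simp: tco_carrier)
  have c: "\<Phi> n d (t n) <: W (d + e)" "\<Phi> n d (u n) <: W (d + e)" for n using t u lin_closed[OF l] by (auto simp: tco_carrier)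
  have T: "md (tco R V d)" using V by simp
  have "tco_ext R V W e \<Phi> d (t +[tco R V d] u) = finsum (W (d + e)) (%n. \<Phi> n d (t n +[tpow R V n d] u n)) ?S"
   by (subst ss[OF m_add[OF T t u] S]) (use m in auto)
  also have "... = finsum (W (d + e)) (%n. \<Phi> n d (t n) +[W (d + e)] \<Phi> n d (u n)) ?S"
   by (rule fs_cong[OF Wm refl]) (use t u c Wm lin_add[OF l] in \<open>auto simp: tco_carrier\<close>)
  also have "... = tco_ext R V W e \<Phi> d t +[W (d + e)] tco_ext R V W e \<Phi> d u"
   unfolding ss[OF t S Un_upper1] ss[OF u S Un_upper2] by (rule fs_add[OF Wm c])
  finally show "tco_ext R V W e \<Phi> d (t +[tco R V d] u) = tco_ext R V W e \<Phi> d t +[W (d + e)] tco_ext R V W e \<Phi> d u" .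
 qed
 finally show "tco_ext R V W e \<Phi> <: Hom (tco R V) W e" .
 fix X n d assume X: "X <: tpow R V n d"
 have "tco_ext R V W e \<Phi> d (tco_inj V n d X) = finsum (W (d + e)) (%m. \<Phi> m d (tco_inj V n d X m)) {n}"
  by (rule ss[OF lin_closed[OF tco_inj_lin[OF V] X]]) (auto simp: tco_inj_def)
 also have "... = \<Phi> n d X" using X lin_closed[OF l] Wm by (simp add: tco_inj_def)
 finally show "tco_ext R V W e \<Phi> d (tco_inj V n d X) = \<Phi> n d X" .
qed

lemma
 assumes V: "gm V" and W: "gm W" and m: "mlin R V W e \<phi>"
 shows tco_mext_HOM: "tco_ext R V W e (%n. tpow_ext R V n W e \<phi>) <: Hom (tco R V) W e"
  and tco_mext_word: "!!w d. vw V w ==> dg w = d ==>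
    tco_ext R V W e (%n. tpow_ext R V n W e \<phi>) d (tco_word R V w) = \<phi> w"
 using tco_ext_HOM[OF V W tpow_ext_HOM[OF V W m]] tco_ext_inj[OF V W tpow_ext_HOM[OF V W m]] V
 by (simp_all add: tco_word_inj tpow_ext_word[OF V W m])

declare tco_simps [simp del] free_simps [simp del]

end

subsection \<open>Sums over the splittings of a word\<close>

text \<open>Cuts of a word are recorded by the pieces and not by positions. Nested cuts then regroup
  by concatenation, and the bijections between index sets are explicit list operations.\<close>

definition S2 :: "'p list \<Rightarrow> ('p list \<times> 'p list) set" where
 "S2 w = {(u, v). w = u @ v}"

definition S3 :: "'p list \<Rightarrow> ('p list \<times> 'p list \<times> 'p list) set" where
 "S3 w = {(u, m, v). w = u @ m @ v}"

definition sum2 :: "('k, 'n) module \<Rightarrow> ('p list \<Rightarrow> 'p list \<Rightarrow> 'n) \<Rightarrow> 'p list \<Rightarrow> 'n" where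
 "sum2 N F w = finsum N (%s. F (fst s) (snd s)) (S2 w)"

definition sum3 :: "('k, 'n) module \<Rightarrow> ('p list \<Rightarrow> 'p list \<Rightarrow> 'p list \<Rightarrow> 'n) \<Rightarrow> 'p list \<Rightarrow> 'n" where
 "sum3 N F w = finsum N (%s. F (fst s) (fst (snd s)) (snd (snd s))) (S3 w)"

lemma S2_iff [simp]: "(u, v) \<in> S2 w \<longleftrightarrow> w = u @ v" by (simp add: S2_def)

lemma S3_iff [simp]: "(u, m, v) \<in> S3 w \<longleftrightarrow> w = u @ m @ v" by (simp add: S3_def)

lemma S2_image: "S2 w = (%i. (take i w, drop i w)) ` {..length w}"
proof -
 have "(u, v) \<in> (%i. (take i (u @ v), drop i (u @ v))) ` {..length (u @ v)}" for u v :: "'a list"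
  by (rule image_eqI[of _ _ "length u"]) auto
 then show ?thesis by (auto simp: S2_def)
qed

lemma finite_S2 [simp]: "finite (S2 w)" by (simp add: S2_image)

lemma finite_S3 [simp]: "finite (S3 w)"
proof -
 have "S3 w \<subseteq> (\<Union>(u, r)\<in>S2 w. (%(m, v). (u, m, v)) ` S2 r)" by (auto simp: image_iff intro!: bexI[of _ "(_, _)"])
 then show ?thesis by (rule finite_subset) auto
qed

context ground begin

text \<open>The engine behind the regrouping lemmas: a nested sum is a sum over
  \<open>Sigma S T\<close>, which an explicit bijection carries to a set of tuples of words.\<close>

lemma fs_nest:
 assumes N: "md N" and S: "finite S" "!!s. s \<in> S ==> finite (T s)"
  and h: "bij_betw h (Sigma S T) U"
  and eq: "!!s t. s \<in> S ==> t \<in> T s ==> f s t = g (h (s,t))"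
  and c: "!!u. u \<in> U ==> g u <: N"
 shows "finsum N (%s. finsum N (f s) (T s)) S = finsum N g U"
proof -
 have hU: "h (s,t) \<in> U" if "s \<in> S" "t \<in> T s" for s t using bij_betwE[OF h] that by blast
 have "finsum N (%s. finsum N (f s) (T s)) S = finsum N (%(s,t). f s t) (Sigma S T)" by (rule fs_Sigma[OF N S]) (use c hU eq in auto)
 also have "... = finsum N g U" by (rule fs_bij[OF N h]) (use c eq in auto)
 finally show ?thesis .
qed

context fixes N :: "('k, 'n) module" assumes N: "module R N"
begin

lemma sum2_closed: "(!!u v. w = u @ v ==> F u v <: N) ==> sum2 N F w <: N" unfolding sum2_def by (rule fs_closed[OF N]) auto

lemma sum3_closed: "(!!u m v. w = u @ m @ v ==> F u m v <: N) ==> sum3 N F w <: N" unfolding sum3_def by (rule fs_closed[OF N]) auto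

lemma sum2_cong: "(!!u v. w = u @ v ==> F u v = G u v) ==> (!!u v. w = u @ v ==> G u v <: N) ==>
  sum2 N F w = sum2 N G w" unfolding sum2_def by (rule fs_cong[OF N refl]) auto

lemma sum3_cong: "(!!u m v. w = u @ m @ v ==> F u m v = G u m v) ==> (!!u m v. w = u @ m @ v ==> G u m v <: N) ==>
  sum3 N F w = sum3 N G w" unfolding sum3_def by (rule fs_cong[OF N refl]) auto

lemma sum3_zero: "(!!u m v. w = u @ m @ v ==> F u m v = \<zero>[N]) ==> sum3 N F w = \<zero>[N]"
 unfolding sum3_def by (rule fs_zero[OF N]) auto

lemma sum2_add: "(!!u v. w = u @ v ==> F u v <: N) ==> (!!u v. w = u @ v ==> G u v <: N) ==>
  sum2 N (%u v. F u v +[N] G u v) w = sum2 N F w +[N] sum2 N G w" unfolding sum2_def by (rule fs_add[OF N]) auto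

lemma sum3_add: "(!!u m v. w = u @ m @ v ==> F u m v <: N) ==> (!!u m v. w = u @ m @ v ==> G u m v <: N) ==>
  sum3 N (%u m v. F u m v +[N] G u m v) w = sum3 N F w +[N] sum3 N G w" unfolding sum3_def by (rule fs_add[OF N]) auto

lemma sum2_neg: "(!!u v. w = u @ v ==> F u v <: N) ==>
  -[N] sum2 N F w = sum2 N (%u v. -[N] F u v) w" unfolding sum2_def by (rule fs_neg[OF N]) auto

lemma sum3_neg: "(!!u m v. w = u @ m @ v ==> F u m v <: N) ==>
  -[N] sum3 N F w = sum3 N (%u m v. -[N] F u m v) w" unfolding sum3_def by (rule fs_neg[OF N]) auto

lemma sum2_smult: "r <: R ==> (!!u v. w = u @ v ==> F u v <: N) ==>
  r *[N] sum2 N F w = sum2 N (%u v. r *[N] F u v) w" unfolding sum2_def by (rule fs_smult[OF N]) auto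

lemma sum3_smult: "r <: R ==> (!!u m v. w = u @ m @ v ==> F u m v <: N) ==>
  r *[N] sum3 N F w = sum3 N (%u m v. r *[N] F u m v) w" unfolding sum3_def by (rule fs_smult[OF N]) auto

lemma sum2_restrict:
 assumes "A \<subseteq> S2 w" "!!u v. w = u @ v ==> (u,v) \<notin> A ==> F u v = \<zero>[N]"
  "!!u v. w = u @ v ==> (u,v) \<in> A ==> F u v <: N"
 shows "sum2 N F w = finsum N (%s. F (fst s) (snd s)) A"
 unfolding sum2_def by (rule fs_neutral[OF N finite_S2 assms(1)]) (use assms in auto)

lemma sum3_restrict:
 assumes "A \<subseteq> S3 w" "!!u m v. w = u @ m @ v ==> (u, m, v) \<notin> A ==> F u m v = \<zero>[N]"
  "!!u m v. w = u @ m @ v ==> (u, m, v) \<in> A ==> F u m v <: N"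
 shows "sum3 N F w = finsum N (%s. F (fst s) (fst (snd s)) (snd (snd s))) A"
 unfolding sum3_def by (rule fs_neutral[OF N finite_S3 assms(1)]) (use assms in auto)

lemma sum2_last: "(!!u v. w = u @ v ==> v ~= [] ==> F u v = \<zero>[N]) ==> F w [] <: N ==> sum2 N F w = F w []"
 by (subst sum2_restrict[of "{(w, [])}"]) (auto simp: N)

lemma sum2_first: "(!!u v. w = u @ v ==> u ~= [] ==> F u v = \<zero>[N]) ==> F [] w <: N ==> sum2 N F w = F [] w"
 by (subst sum2_restrict[of "{([], w)}"]) (auto simp: N)

lemma sum2_Nil [simp]: "F [] [] <: N ==> sum2 N F [] = F [] []" by (rule sum2_last) auto

lemma sum3_Nil [simp]: "F [] [] [] <: N ==> sum3 N F [] = F [] [] []" by (subst sum3_restrict[of "{([], [], [])}"]) (auto simp: N)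

lemma sum2_image:
 assumes "!!u v. w = u @ v ==> F u v <: N"
 shows "finsum N (%i. F (take i w) (drop i w)) {..length w} = sum2 N F w" unfolding sum2_def
 by (rule fs_bij[OF N, where h="%i. (take i w, drop i w)"], rule bij_betwI[where g="%s. length (fst s)"])
  (use assms in auto)

lemma sum3_left:
 assumes "!!u m v. w = u @ m @ v ==> F u m v <: N"
 shows "sum2 N (%a b. sum2 N (%u v. F u v b) a) w = sum3 N F w" unfolding sum2_def sum3_def
 by (rule fs_nest[OF N, where h="%s. (fst (snd s), snd (snd s), snd (fst s))"], simp, simp,
   rule bij_betwI[where g="%t. ((fst t @ fst (snd t), snd (snd t)), (fst t, fst (snd t)))"])
  (use assms in auto)

lemma sum3_right:
 assumes "!!u m v. w = u @ m @ v ==> F u m v <: N"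
 shows "sum2 N (%a b. sum2 N (%u v. F a u v) b) w = sum3 N F w" unfolding sum2_def sum3_def
 by (rule fs_nest[OF N, where h="%s. (fst (fst s), fst (snd s), snd (snd s))"], simp, simp,
   rule bij_betwI[where g="%t. ((fst t, fst (snd t) @ snd (snd t)), (fst (snd t), snd (snd t)))"])
  (use assms in auto)

text \<open>Coassociativity of deconcatenation in summed form: both sides run over all cuts into
  three pieces.\<close>

lemma sum2_assoc:
 assumes "!!u m v. w = u @ m @ v ==> F u m v <: N"
 shows "sum2 N (%a b. sum2 N (%u v. F u v b) a) w = sum2 N (%a b. sum2 N (%u v. F a u v) b) w"
 using sum3_left[where w=w and F=F, OF assms] sum3_right[where w=w and F=F, OF assms] by simp

text \<open>Marking a block and cutting to its right amounts to cutting the word and marking a block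
  in the left part. Together with its mirror image \<open>sum3_sum2_left\<close> this makes the bar
  differential a coderivation.\<close>

lemma sum3_sum2_right:
 assumes "!!a b c d. w = a @ b @ c @ d ==> H a b c d <: N"
 shows "sum3 N (%u m v. sum2 N (%v1 v2. H u m v1 v2) v) w = sum2 N (%w1 w2. sum3 N (%a m b. H a m b w2) w1) w"
proof -
 let ?U = "{(a, b, c, d). w = a @ b @ c @ d}"
 let ?g = "%(a, b, c, d). H a b c d"
 have "sum3 N (%u m v. sum2 N (%v1 v2. H u m v1 v2) v) w = finsum N ?g ?U" unfolding sum2_def sum3_def
  by (rule fs_nest[OF N, where h="%s. (fst (fst s), fst (snd (fst s)), fst (snd s), snd (snd s))"], simp, simp,
    rule bij_betwI[where g="%(a, b, c, d). ((a, b, c @ d), (c,d))"])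
   (use assms in auto)
 moreover have "sum2 N (%w1 w2. sum3 N (%a m b. H a m b w2) w1) w = finsum N ?g ?U" unfolding sum2_def sum3_def
  by (rule fs_nest[OF N, where h="%s. (fst (snd s), fst (snd (snd s)), snd (snd (snd s)), snd (fst s))"], simp, simp,
    rule bij_betwI[where g="%(a, b, c, d). ((a @ b @ c, d), (a, b, c))"])
   (use assms in auto)
 ultimately show ?thesis by simp
qed

lemma sum3_sum2_left:
 assumes "!!a b c d. w = a @ b @ c @ d ==> H a b c d <: N"
 shows "sum3 N (%u m v. sum2 N (%u1 u2. H u1 u2 m v) u) w = sum2 N (%w1 w2. sum3 N (%a m b. H w1 a m b) w2) w"
proof -
 let ?U = "{(a, b, c, d). w = a @ b @ c @ d}"
 let ?g = "%(a, b, c, d). H a b c d"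
 have "sum3 N (%u m v. sum2 N (%u1 u2. H u1 u2 m v) u) w = finsum N ?g ?U" unfolding sum2_def sum3_def
  by (rule fs_nest[OF N, where h="%s. (fst (snd s), snd (snd s), fst (snd (fst s)), snd (snd (fst s)))"], simp, simp,
    rule bij_betwI[where g="%(a, b, c, d). ((a @ b, c, d), (a,b))"])
   (use assms in auto)
 moreover have "sum2 N (%w1 w2. sum3 N (%a m b. H w1 a m b) w2) w = finsum N ?g ?U" unfolding sum2_def sum3_def
  by (rule fs_nest[OF N, where h="%s. (fst (fst s), fst (snd s), fst (snd (snd s)), snd (snd (snd s)))"], simp, simp,
    rule bij_betwI[where g="%(a, b, c, d). ((a, b @ c @ d), (b, c, d))"])
   (use assms in auto)
 ultimately show ?thesis by simp
qed

text \<open>Two disjoint blocks can be marked in either order. In the square of the differential the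
  two orders carry opposite signs.\<close>

lemma sum3_sum3:
 assumes "!!a b c d e. w = a @ b @ c @ d @ e ==> H a b c d e <: N"
 shows "sum3 N (%u m v. sum3 N (%v1 n b. H u m v1 n b) v) w = sum3 N (%a n v. sum3 N (%u m v1. H u m v1 n v) a) w"
proof -
 let ?U = "{(a, b, c, d, e). w = a @ b @ c @ d @ e}"
 let ?g = "%(a, b, c, d, e). H a b c d e"
 have "sum3 N (%u m v. sum3 N (%v1 n b. H u m v1 n b) v) w = finsum N ?g ?U" unfolding sum3_def
  by (rule fs_nest[OF N, where h="%s. (fst (fst s), fst (snd (fst s)), fst (snd s), fst (snd (snd s)), snd (snd (snd s)))"], simp, simp,
    rule bij_betwI[where g="%(a, b, c, d, e). ((a, b, c @ d @ e), (c, d, e))"])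
   (use assms in auto)
 moreover have "sum3 N (%a n v. sum3 N (%u m v1. H u m v1 n v) a) w = finsum N ?g ?U" unfolding sum3_def
  by (rule fs_nest[OF N, where h="%s. (fst (snd s), fst (snd (snd s)), snd (snd (snd s)), fst (snd (fst s)), snd (snd (fst s)))"], simp, simp,
    rule bij_betwI[where g="%(a, b, c, d, e). ((a @ b @ c, d, e), (a, b, c))"])
   (use assms in auto)
 ultimately show ?thesis by simp
qed

text \<open>Nested blocks: an inner block \<open>m\<close> extended on both sides, against an outer
  block \<open>c\<close> chosen at once with \<open>m\<close> inside it. It collects the terms to
  which the quadratic relation of the block operation applies.\<close>

lemma sum3_mid:
 assumes "!!a b c d e. w = a @ b @ c @ d @ e ==> H a b c d e <: N"
 shows "sum3 N (%u m v. sum2 N (%a u2. sum2 N (%v1 b. H a u2 m v1 b) v) u) w =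
   sum3 N (%a c b. sum3 N (%u2 m v1. H a u2 m v1 b) c) w"
proof -
 have "sum3 N (%u m v. sum2 N (%a u2. sum2 N (%v1 b. H a u2 m v1 b) v) u) w =
  sum2 N (%a r. sum3 N (%u2 m v. sum2 N (%v1 b. H a u2 m v1 b) v) r) w"
  by (rule sum3_sum2_left[where H="%a u2 m v. sum2 N (%v1 b. H a u2 m v1 b) v"])
   (use assms in \<open>auto intro!: sum2_closed\<close>)
 also have "... = sum2 N (%a r. sum2 N (%c b. sum3 N (%u2 m v1. H a u2 m v1 b) c) r) w"
  by (rule sum2_cong, rule sum3_sum2_right) (use assms in \<open>auto intro!: sum2_closed sum3_closed\<close>)
 also have "... = sum3 N (%a c b. sum3 N (%u2 m v1. H a u2 m v1 b) c) w"
  by (rule sum3_right) (use assms in \<open>auto intro!: sum3_closed\<close>)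
 finally show ?thesis .
qed

lemma sum2_ins:
 assumes "!!a b. u @ p # v = a @ b ==> F a b <: N"
 shows "sum2 N F (u @ p # v) = sum2 N (%a b. F a (b @ p # v)) u +[N] sum2 N (%a b. F (u @ p # a) b) v"
proof -
 let ?A = "(%s. (fst s, snd s @ p # v)) ` S2 u" and ?B = "(%s. (u @ p # fst s, snd s)) ` S2 v"
 have e: "S2 (u @ p # v) = ?A \<union> ?B"
 proof
  show "S2 (u @ p # v) \<subseteq> ?A \<union> ?B"
  proof
   fix s assume "s \<in> S2 (u @ p # v)"
   then obtain a b where s: "s = (a,b)" "u @ p # v = a @ b" by (cases s) auto
   \<comment> \<open>The cut directly before \<open>p\<close> belongs to the left family, hence
     \<open>us ~= []\<close> in the second case.\<close>
   from s(2) consider us where "u = a @ us" "us @ p # v = b" | us where "u @ us = a" "p # v = us @ b" "us ~= []"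
    unfolding append_eq_append_conv2 by (metis append_Nil append_Nil2)
   then show "s \<in> ?A \<union> ?B"
   proof cases
    case 1 then show ?thesis using s by (auto simp: image_iff intro!: bexI[of _ "(a,us)"])
   next
    case 2
    then obtain c where "us = p # c" "v = c @ b" by (cases us) auto
    then show ?thesis using s 2 by (auto simp: image_iff intro!: bexI[of _ "(c,b)"])
   qed
  qed
 qed auto
 have d: "?A \<inter> ?B = {}" by auto
 have "finsum N (%s. F (fst s) (snd s)) ?A = sum2 N (%a b. F a (b @ p # v)) u" unfolding sum2_def
  by (rule fs_bij[OF N, symmetric, where h="%s. (fst s, snd s @ p # v)"])
   (use assms in \<open>auto simp: bij_betw_def inj_on_def\<close>)
 moreover have "finsum N (%s. F (fst s) (snd s)) ?B = sum2 N (%a b. F (u @ p # a) b) v" unfolding sum2_def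
  by (rule fs_bij[OF N, symmetric, where h="%s. (u @ p # fst s, snd s)"])
   (use assms in \<open>auto simp: bij_betw_def inj_on_def\<close>)
 moreover have "sum2 N F (u @ p # v) = finsum N (%s. F (fst s) (snd s)) ?A +[N] finsum N (%s. F (fst s) (snd s)) ?B"
  unfolding sum2_def e by (rule fs_union[OF N]) (use assms d in auto)
 ultimately show ?thesis by simp
qed

text \<open>The block lies left of the letter \<open>p\<close>, contains it, or lies right of it.
  With \<open>p\<close> the output of an inner operation, this separates disjoint insertions from
  nested ones.\<close>

lemma sum3_ins:
 assumes c: "!!a m b. u @ p # v = a @ m @ b ==> F a m b <: N"
 shows "sum3 N F (u @ p # v) = sum3 N (%a m b. F a m (b @ p # v)) u +[N]
  (sum2 N (%a m1. sum2 N (%m2 b. F a (m1 @ p # m2) b) v) u +[N] sum3 N (%a m b. F (u @ p # a) m b) v)"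
proof -
 have "sum3 N F (u @ p # v) = sum2 N (%a r. sum2 N (F a) r) (u @ p # v)" by (rule sum3_right[symmetric]) (use c in auto)
 also have "... = sum2 N (%a b. sum2 N (F a) (b @ p # v)) u +[N] sum2 N (%a b. sum2 N (F (u @ p # a)) b) v"
  by (rule sum2_ins) (use c in \<open>auto intro!: sum2_closed\<close>)
 also have "sum2 N (%a b. sum2 N (F (u @ p # a)) b) v = sum3 N (%a m b. F (u @ p # a) m b) v" by (rule sum3_right) (use c in auto)
 also have "sum2 N (%a b. sum2 N (F a) (b @ p # v)) u =
   sum2 N (%a b. sum2 N (%m b. F a m (b @ p # v)) b +[N] sum2 N (%m2 r. F a (b @ p # m2) r) v) u"
  by (rule sum2_cong, rule sum2_ins) (use c N in \<open>auto intro!: sum2_closed m_add\<close>)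
 also have "... = sum2 N (%a b. sum2 N (%m b. F a m (b @ p # v)) b) u +[N] sum2 N (%a b. sum2 N (%m2 r. F a (b @ p # m2) r) v) u"
  by (rule sum2_add) (use c in \<open>auto intro!: sum2_closed\<close>)
 also have "sum2 N (%a b. sum2 N (%m b. F a m (b @ p # v)) b) u = sum3 N (%a m b. F a m (b @ p # v)) u" by (rule sum3_right) (use c in auto)
 finally show ?thesis using N c by (auto simp: m_assoc' intro!: m_assoc' sum2_closed sum3_closed)
qed

text \<open>\<open>sum3\<close> also counts empty blocks, while the positional sum starts with
  blocks of length 1; the vanishing on \<open>[]\<close> reconciles the two.\<close>

lemma finsum_sum3:
 assumes c: "!!u m v. w = u @ m @ v ==> F u m v <: N" and z: "!!u v. w = u @ v ==> F u [] v = \<zero>[N]"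
 shows "finsum N (%i. finsum N (%j. F (take j w) (take i (drop j w)) (drop (j + i) w)) {..length w - i}) {1..length w} = sum3 N F w"
proof -
 let ?A = "{s \<in> S3 w. fst (snd s) ~= []}"
 have "finsum N (%i. finsum N (%j. F (take j w) (take i (drop j w)) (drop (j + i) w)) {..length w - i}) {1..length w}
   = finsum N (%s. F (fst s) (fst (snd s)) (snd (snd s))) ?A"
  by (rule fs_nest[OF N, where h="%s. (take (snd s) w, take (fst s) (drop (snd s) w), drop (snd s + fst s) w)"], simp, simp,
    rule bij_betwI[where g="%s. (length (fst (snd s)), length (fst s))"])
   (use c in \<open>auto simp: drop_drop[symmetric] add.commute Suc_le_eq simp del: drop_drop\<close>)
 also have "... = sum3 N F w" by (rule sum3_restrict[symmetric]) (use c z in auto)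
 finally show ?thesis .
qed

end

lemma lin_sum2:
 assumes "md M" "md N" "lin R M N f" "!!u v. w = u @ v ==> F u v <: M"
 shows "f (sum2 M F w) = sum2 N (%u v. f (F u v)) w" unfolding sum2_def by (rule lin_finsum[OF assms(1-3)]) (use assms(4) in auto)

lemma lin_sum3:
 assumes "md M" "md N" "lin R M N f" "!!u m v. w = u @ m @ v ==> F u m v <: M"
 shows "f (sum3 M F w) = sum3 N (%u m v. f (F u m v)) w" unfolding sum3_def by (rule lin_finsum[OF assms(1-3)]) (use assms(4) in auto)

lemma lin_pointwise_sum2:
 assumes "md M" "md N" "!!u v. w = u @ v ==> lin R M N (%x. F x u v)"
 shows "lin R M N (%x. sum2 N (F x) w)" unfolding sum2_def by (rule lin_sum[OF assms(1,2)]) (use assms(3) in auto)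

lemma lin_pointwise_sum3:
 assumes "md M" "md N" "!!u m v. w = u @ m @ v ==> lin R M N (%x. F x u m v)"
 shows "lin R M N (%x. sum3 N (F x) w)" unfolding sum3_def by (rule lin_sum[OF assms(1,2)]) (use assms(3) in auto)

text \<open>The index set of the sum depends on the very letter in which linearity is claimed.
  \<open>sum2_ins\<close> rewrites it as sums over the cuts of \<open>u\<close> and of
  \<open>v\<close>, in which that letter is a parameter of the summands only.\<close>

lemma mlin_sum2:
 assumes V: "gm V" and W: "gm W"
  and c: "!!u v k. vw V u ==> vw V v ==> k = dg u + dg v + e ==> F u v <: W k"
  and l1: "!!a i b v k. vw V a ==> vw V b ==> vw V v ==> k = dg a + i + dg b + dg v + e ==>
    lin R (V i) (W k) (%x. F (a @ (i,x) # b) v)"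
  and l2: "!!a i b v k. vw V a ==> vw V b ==> vw V v ==> k = dg v + dg a + i + dg b + e ==>
    lin R (V i) (W k) (%x. F v (a @ (i,x) # b))"
 shows "mlin R V W e (%w. sum2 (W (dg w + e)) F w)"
proof (rule mlinI)
 show "sum2 (W (dg [] + e)) F [] <: W e" using W c[of "[]" "[]" e] by simp
 fix u i v k assume u: "vw V u" and v: "vw V v" and k: "k = dg u + i + dg v + e"
 have W': "md (W k)" and V': "md (V i)" using W V by auto
 have 1: "lin R (V i) (W k) (%x. sum2 (W k) (%a b. F a (b @ (i,x) # v)) u)"
  by (rule lin_pointwise_sum2[OF V' W']) (use u v k in \<open>auto intro!: l2\<close>)
 have 2: "lin R (V i) (W k) (%x. sum2 (W k) (%a b. F (u @ (i,x) # a) b) v)"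
  by (rule lin_pointwise_sum2[OF V' W']) (use u v k in \<open>auto intro!: l1\<close>)
 show "lin R (V i) (W k) (%x. sum2 (W (dg (u @ (i,x) # v) + e)) F (u @ (i,x) # v))"
 proof (rule lin_cong[OF V' lin_plus[OF W' 1 2]])
  fix x assume x: "x <: V i"
  have k': "dg (u @ (i,x) # v) + e = k" using k by simp
  show "sum2 (W (dg (u @ (i,x) # v) + e)) F (u @ (i,x) # v) =
    sum2 (W k) (%a b. F a (b @ (i,x) # v)) u +[W k] sum2 (W k) (%a b. F (u @ (i,x) # a) b) v" unfolding k'
  proof (rule sum2_ins[OF W'])
   fix a b assume ab: "u @ (i,x) # v = a @ b"
   have "vw V (a @ b)" "dg (a @ b) = dg u + i + dg v" unfolding ab[symmetric] using u v x by auto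
   then show "F a b <: W k" using k by (intro c) auto
  qed
 qed
qed

lemma mlin_sum3:
 assumes V: "gm V" and W: "gm W"
  and c: "!!u m v k. vw V u ==> vw V m ==> vw V v ==> k = dg u + dg m + dg v + e ==> F u m v <: W k"
  and l1: "!!a i b m v k. vw V a ==> vw V b ==> vw V m ==> vw V v ==> k = dg a + i + dg b + dg m + dg v + e ==>
    lin R (V i) (W k) (%x. F (a @ (i,x) # b) m v)"
  and l2: "!!a i b u v k. vw V a ==> vw V b ==> vw V u ==> vw V v ==> k = dg u + dg a + i + dg b + dg v + e ==>
    lin R (V i) (W k) (%x. F u (a @ (i,x) # b) v)"
  and l3: "!!a i b u m k. vw V a ==> vw V b ==> vw V u ==> vw V m ==> k = dg u + dg m + dg a + i + dg b + e ==>
    lin R (V i) (W k) (%x. F u m (a @ (i,x) # b))"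
 shows "mlin R V W e (%w. sum3 (W (dg w + e)) F w)"
proof (rule mlinI)
 show "sum3 (W (dg [] + e)) F [] <: W e" using W c[of "[]" "[]" "[]" e] by simp
 fix u i v k assume u: "vw V u" and v: "vw V v" and k: "k = dg u + i + dg v + e"
 have W': "md (W k)" and V': "md (V i)" using W V by auto
 have 1: "lin R (V i) (W k) (%x. sum3 (W k) (%a m b. F a m (b @ (i,x) # v)) u)"
  by (rule lin_pointwise_sum3[OF V' W']) (use u v k in \<open>auto intro!: l3\<close>)
 have 2: "lin R (V i) (W k) (%x. sum2 (W k) (%a m1. sum2 (W k) (%m2 b. F a (m1 @ (i,x) # m2) b) v) u)"
  by (rule lin_pointwise_sum2[OF V' W'], rule lin_pointwise_sum2[OF V' W']) (use u v k in \<open>auto intro!: l2\<close>)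
 have 3: "lin R (V i) (W k) (%x. sum3 (W k) (%a m b. F (u @ (i,x) # a) m b) v)"
  by (rule lin_pointwise_sum3[OF V' W']) (use u v k in \<open>auto intro!: l1\<close>)
 show "lin R (V i) (W k) (%x. sum3 (W (dg (u @ (i,x) # v) + e)) F (u @ (i,x) # v))"
 proof (rule lin_cong[OF V' lin_plus[OF W' 1 lin_plus[OF W' 2 3]]])
  fix x assume x: "x <: V i"
  have k': "dg (u @ (i,x) # v) + e = k" using k by simp
  show "sum3 (W (dg (u @ (i,x) # v) + e)) F (u @ (i,x) # v) =
    sum3 (W k) (%a m b. F a m (b @ (i,x) # v)) u +[W k]
    (sum2 (W k) (%a m1. sum2 (W k) (%m2 b. F a (m1 @ (i,x) # m2) b) v) u +[W k]
    sum3 (W k) (%a m b. F (u @ (i,x) # a) m b) v)" unfolding k'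
  proof (rule sum3_ins[OF W'])
   fix a m b assume ab: "u @ (i,x) # v = a @ m @ b"
   have "vw V (a @ m @ b)" "dg (a @ m @ b) = dg u + i + dg v" unfolding ab[symmetric] using u v x by auto
   then show "F a m b <: W k" using k by (intro c) auto
  qed
 qed
qed

text \<open>Variants whose premises may use that the pieces of a valid word are valid, which is what
  places the summands in the right module.\<close>

lemma vsum2_closed: "md N ==> vw V w ==> (!!u v. vw V u ==> vw V v ==> w = u @ v ==> F u v <: N) ==> sum2 N F w <: N"
 by (rule sum2_closed) auto

lemma vsum3_closed: "md N ==> vw V w ==> (!!u m v. vw V u ==> vw V m ==> vw V v ==> w = u @ m @ v ==> F u m v <: N) ==> sum3 N F w <: N"
 by (rule sum3_closed) auto

lemma vsum2_cong: "md N ==> vw V w ==> (!!u v. vw V u ==> vw V v ==> w = u @ v ==> F u v = G u v) ==>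
  (!!u v. vw V u ==> vw V v ==> w = u @ v ==> G u v <: N) ==> sum2 N F w = sum2 N G w" by (rule sum2_cong) auto

lemma vsum3_cong: "md N ==> vw V w ==> (!!u m v. vw V u ==> vw V m ==> vw V v ==> w = u @ m @ v ==> F u m v = G u m v) ==>
  (!!u m v. vw V u ==> vw V m ==> vw V v ==> w = u @ m @ v ==> G u m v <: N) ==> sum3 N F w = sum3 N G w" by (rule sum3_cong) auto

lemma HOM_sum2:
 assumes "f <: Hom M N n" "gm M" "gm N" "vw V w" "i + n = k"
  "!!u v. vw V u ==> vw V v ==> w = u @ v ==> F u v <: M i"
 shows "f i (sum2 (M i) F w) = sum2 (N k) (%u v. f i (F u v)) w" by (rule lin_sum2[OF _ _ HOM_lin[OF assms(1,5)]]) (use assms in auto)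

lemma HOM_sum3:
 assumes "f <: Hom M N n" "gm M" "gm N" "vw V w" "i + n = k"
  "!!u m v. vw V u ==> vw V m ==> vw V v ==> w = u @ m @ v ==> F u m v <: M i"
 shows "f i (sum3 (M i) F w) = sum3 (N k) (%u m v. f i (F u m v)) w" by (rule lin_sum3[OF _ _ HOM_lin[OF assms(1,5)]]) (use assms in auto)

lemma tens_sum2_l:
 assumes "gm M" "gm N" "vw V w" "y <: N j" "i + j = d"
  "!!u v. vw V u ==> vw V v ==> w = u @ v ==> F u v <: M i"
 shows "telt M N (i, sum2 (M i) F w) (j,y) = sum2 (tns M N d) (%u v. telt M N (i, F u v) (j,y)) w"
 by (rule lin_sum2[OF _ _ tens_elt_lin1[OF assms(1,2,4,5)]]) (use assms in auto)

lemma tens_sum3_l: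
 assumes "gm M" "gm N" "vw V w" "y <: N j" "i + j = d"
  "!!u m v. vw V u ==> vw V m ==> vw V v ==> w = u @ m @ v ==> F u m v <: M i"
 shows "telt M N (i, sum3 (M i) F w) (j,y) = sum3 (tns M N d) (%u m v. telt M N (i, F u m v) (j,y)) w"
 by (rule lin_sum3[OF _ _ tens_elt_lin1[OF assms(1,2,4,5)]]) (use assms in auto)

lemma tens_sum2_r:
 assumes "gm M" "gm N" "vw V w" "x <: M i" "i + j = d"
  "!!u v. vw V u ==> vw V v ==> w = u @ v ==> F u v <: N j"
 shows "telt M N (i,x) (j, sum2 (N j) F w) = sum2 (tns M N d) (%u v. telt M N (i,x) (j, F u v)) w"
 by (rule lin_sum2[OF _ _ tens_elt_lin2[OF assms(1,2,4,5)]]) (use assms in auto)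

lemma tens_smult_l: "gm M ==> gm N ==> r <: R ==> x <: M i ==> y <: N j ==> i + j = d ==>
  telt M N (i, r *[M i] x) (j,y) = r *[tns M N d] telt M N (i,x) (j,y)" by (rule lin_smult[OF tens_elt_lin1])

lemma tens_smult_r: "gm M ==> gm N ==> r <: R ==> x <: M i ==> y <: N j ==> i + j = d ==>
  telt M N (i,x) (j, r *[N j] y) = r *[tns M N d] telt M N (i,x) (j,y)" by (rule lin_smult[OF tens_elt_lin2])

lemma tens_zero_l: "gm M ==> gm N ==> y <: N j ==> i + j = d ==>
  telt M N (i, \<zero>[M i]) (j,y) = \<zero>[tns M N d]" by (rule lin_zero[OF _ _ tens_elt_lin1]) auto

lemma tens_zero_r: "gm M ==> gm N ==> x <: M i ==> i + j = d ==>
  telt M N (i,x) (j, \<zero>[N j]) = \<zero>[tns M N d]" by (rule lin_zero[OF _ _ tens_elt_lin2]) auto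

lemma HOM_add_map: "f <: Hom M N n ==> i + n = k ==> x <: M i ==> y <: M i ==>
  f i (x +[M i] y) = f i x +[N k] f i y" by (rule lin_add[OF HOM_lin])

lemma HOM_smult_map: "f <: Hom M N n ==> i + n = k ==> r <: R ==> x <: M i ==>
  f i (r *[M i] x) = r *[N k] f i x" by (rule lin_smult[OF HOM_lin])

lemma HOM_zero_map: "gm M ==> gm N ==> f <: Hom M N n ==> i + n = k ==> f i \<zero>[M i] = \<zero>[N k]"
 by (rule lin_zero[OF _ _ HOM_lin]) auto

lemma HOM_neg_map: "gm M ==> gm N ==> f <: Hom M N n ==> i + n = k ==> x <: M i ==>
  f i (-[M i] x) = -[N k] f i x" by (rule lin_neg[OF _ _ HOM_lin]) auto

text \<open>On elementary tensors the two signs add up to the exponent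
  \<open>b' * (i + a) + b * i\<close>. This is the exponent of the composite plus
  \<open>b' * a\<close>, the Koszul sign for exchanging \<open>g'\<close> and
  \<open>f\<close>.\<close>

lemma tmap_comp:
 assumes M: "gm M" and N: "gm N" and M': "gm M'" and N': "gm N'"
  and M'': "gm M''" and N'': "gm N''"
  and f: "f <: Hom M M' a" and g: "g <: Hom N N' b"
  and f': "f' <: Hom M' M'' a'" and g': "g' <: Hom N' N'' b'"
  and z: "z <: tns M N d" and k: "d + (a + b) = l" "l + (a' + b') = k" and A: "a + a' = A" "b + b' = B"
 shows "tmap M' N' M'' N'' a' b' f' g' l (tmap M N M' N' a b f g d z) =
  sg (b' * a) *[tns M'' N'' k] tmap M N M'' N'' A B (gcomp M a f' f) (gcomp N b g' g) d z"
proof -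
 note t1 = tmap_HOM[OF M N M' N' f g refl] and t2 = tmap_HOM[OF M' N' M'' N'' f' g' refl]
 have ff: "gcomp M a f' f <: Hom M M'' A" and gg: "gcomp N b g' g <: Hom N N'' B"
  using gcomp_HOM[OF M f f' A(1)] gcomp_HOM[OF N g g' A(2)] .
 note t3 = tmap_HOM[OF M N M'' N'' ff gg refl]
 have T: "gm (tns M'' N'')" using M'' N'' by simp
 have l2: "lin R (tns M N d) (tns M'' N'' k) (%z. sg (b' * a) *[tns M'' N'' k] tmap M N M'' N'' A B (gcomp M a f' f) (gcomp N b g' g) d z)"
  by (rule lin_scale[OF gmod_module[OF T] sgn_in HOM_lin[OF t3]]) (use A k in auto)
 show ?thesis
 proof (rule tens_lin_eq[OF M N gmod_module[OF T] lin_compose[OF HOM_lin[OF t1 k(1)] HOM_lin[OF t2 k(2)]] l2 _ z])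
  fix i x j y assume x: "x <: M i" and y: "y <: N j" and d: "i + j = d"
  have fx: "f i x <: M' (i + a)" and gy: "g j y <: N' (j + b)" using HOM_in[OF f x refl] HOM_in[OF g y refl] .
  have e1: "tmap M N M' N' a b f g d (telt M N (i,x) (j,y)) =
    sg (b * i) *[tns M' N' l] telt M' N' (i + a, f i x) (j + b, g j y)" using d k by (intro tmap_elt[OF M N M' N' f g x y]) auto
  have e2: "tmap M' N' M'' N'' a' b' f' g' l (telt M' N' (i + a, f i x) (j + b, g j y)) =
    sg (b' * (i + a)) *[tns M'' N'' k] telt M'' N'' (i + a + a', f' (i + a) (f i x)) (j + b + b', g' (j + b) (g j y))"
   using d k by (intro tmap_elt[OF M' N' M'' N'' f' g' fx gy]) auto
  have e3: "tmap M N M'' N'' A B (gcomp M a f' f) (gcomp N b g' g) d (telt M N (i,x) (j,y)) =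
    sg (B * i) *[tns M'' N'' k] telt M'' N'' (i + A, gcomp M a f' f i x) (j + B, gcomp N b g' g j y)"
   using d k A by (intro tmap_elt[OF M N M'' N'' ff gg x y]) auto
  have c: "telt M'' N'' (i + A, f' (i + a) (f i x)) (j + B, g' (j + b) (g j y)) <: tns M'' N'' k"
   using d k A by (intro telt_in M'' N'' HOM_in[OF f' fx] HOM_in[OF g' gy]) auto
  have c': "telt M' N' (i + a, f i x) (j + b, g j y) <: tns M' N' l" using d k by (intro telt_in M' N' fx gy) auto
  have A': "i + a + a' = i + A" "j + b + b' = j + B" using A by auto
  show "tmap M' N' M'' N'' a' b' f' g' l (tmap M N M' N' a b f g d (telt M N (i,x) (j,y))) =
   sg (b' * a) *[tns M'' N'' k] tmap M N M'' N'' A B (gcomp M a f' f) (gcomp N b g' g) d (telt M N (i,x) (j,y))"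
   unfolding e1 e3 HOM_smult_map[OF t2 k(2) sgn_in c'] e2 A' using x y c T unfolding A(2)[symmetric] by (simp add: algebra_simps)
 qed
qed

lemma gcomp_gid_left: assumes "gm M" "f <: Hom M N a" shows "gcomp M a (gid N) f = f"
proof (rule HOM_eqI[OF _ assms(2)])
 show "gcomp M a (gid N) f <: Hom M N a" unfolding gcomp_def
  by (rule HOM_restrict[OF assms(1)], rule lin_cong[OF _ HOM_lin[OF assms(2) refl]])
   (use assms(1) HOM_in[OF assms(2) _ refl] in auto)
qed (use HOM_in[OF assms(2) _ refl] in simp)

lemma gcomp_gid_right: assumes "gm M" "f <: Hom M N a" shows "gcomp M 0 f (gid M) = f"
 by (rule HOM_eqI[OF gcomp_HOM[OF assms(1) gid_HOM[OF assms(1)] assms(2)] assms(2)]) auto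

end

text \<open>The bar construction reduced to what the comodule theory consumes: differential and
  curvature are given on words by a block operation \<open>bm\<close> and a function
  \<open>xi\<close>. The relation \<open>bb\<close> is the curved A-infinity relation: composing
  \<open>bm\<close> with itself leaves only the terms in which \<open>xi\<close> absorbs all letters
  but the last, or all but the first. It is what makes the square of the differential a difference
  of curvature terms.\<close>

locale tcoalg = ground R for R :: "'k ring" +
 fixes V :: "('k, 'v) gmod" and K :: "('k, nat \<Rightarrow> ('k, 'v) tpow) curved_coalg"
  and bm :: "(int \<times> 'v) list \<Rightarrow> 'v" and xi :: "(int \<times> 'v) list \<Rightarrow> 'k"
 assumes V [simp]: "gmodule R V"
  and K_mod [simp]: "coalg_mod K = tco R V" and K_delta [simp]: "coalg_delta K = tco_delta R V"
  and K_counit [simp]: "coalg_counit K = tco_counit R V"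
  and K_diff: "coalg_diff K <: HOM R (tco R V) (tco R V) (-1)"
  and K_diff_word: "!!w. vw V w ==> coalg_diff K (wdeg w) (tco_word R V w) =
    sum3 (tco R V (wdeg w - 1)) (%u m v. sgn_pow R (wdeg u) *[tco R V (wdeg w - 1)]
     tco_word R V (u @ (wdeg m - 1, bm m) # v)) w"
  and K_curv: "coalg_curv K <: HOM R (tco R V) (kmod R) (-2)"
  and K_curv_word: "!!w. vw V w ==> coalg_curv K (wdeg w) (tco_word R V w) = xi w"
  and b_mlin: "mlin R V V (-1) bm" and b_Nil: "bm [] = \<zero>[V (-1)]"
  and x_mlin: "mlin R V (kmod R) (-2) xi"
  and bb: "!!w. vw V w ==> w ~= [] ==>
    sum3 (V (wdeg w - 2)) (%u m v. sgn_pow R (wdeg u) *[V (wdeg w - 2)] bm (u @ (wdeg m - 1, bm m) # v)) w =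
    kact V (wdeg (butlast w) - 2, xi (butlast w)) (last w) -[V (wdeg w - 2)] kact V (wdeg (tl w) - 2, xi (tl w)) (hd w)"
begin

abbreviation "C \<equiv> tco R V"
abbreviation "wd w \<equiv> (wdeg w, tco_word R V w)"
abbreviation "tw \<equiv> tco_word R V"
abbreviation "CT \<equiv> tens R C"
abbreviation "cotens P Q n D \<equiv> tens_map R C P C Q 0 n (gid C) D"
abbreviation "wt M w \<equiv> tens_elt R C M (wd w)"
abbreviation "dC \<equiv> coalg_diff K"

lemma C [simp]: "gm C" by simp

section \<open>Cofree comodules over the tensor coalgebra\<close>

lemma CM_HOM_eqI:
 assumes M: "gm M" and W: "gm W"
  and f: "f <: Hom (CT M) W n" and g: "g <: Hom (CT M) W n"
  and eq: "!!w j x. [|vw V w; x \<in> carrier (M j)|] ==>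
    f (dg w + j) (wt M w (j,x)) = g (dg w + j) (wt M w (j,x))"
 shows "f = g"
proof (rule tens_HOM_eqI[OF C M W f g])
 fix i c j x assume c: "c <: C i" and x: "x <: M j"
 show "f (i + j) (telt C M (i,c) (j,x)) = g (i + j) (telt C M (i,c) (j,x))"
  by (rule tco_lin_eq[OF V gmod_module[OF W] lin_compose[OF tens_elt_lin1[OF C M x refl] HOM_lin[OF f refl]]
     lin_compose[OF tens_elt_lin1[OF C M x refl] HOM_lin[OF g refl]] _ c]) (use eq x in auto)
qed

lemma
 shows delta_HOM: "tco_delta R V <: Hom C (CT C) 0"
  and delta_word: "vw V w ==> dg w = d ==> tco_delta R V d (tw w) =
   sum2 (CT C d) (%u v. wt C u (wd v)) w"
proof -
 have m0: "mlin R V (CT C) 0 (%w. sum2 (CT C (dg w + 0)) (%u v. wt C u (wd v)) w)"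
 proof (rule mlin_sum2)
  fix a i b v k assume a: "vw V a" "vw V b" "vw V v" "k = dg a + i + dg b + dg v + 0"
  have "lin R (V i) (CT C k) (%x. telt C C (dg a + i + dg b, tw (a @ (i,x) # b)) (wd v))"
   by (rule lin_compose[where f="%x. tw (a @ (i,x) # b)", OF tco_word_lin[OF V a(1,2) refl]], rule tens_elt_lin1) (use a in auto)
  then show "lin R (V i) (CT C k) (%x. telt C C (wd (a @ (i,x) # b)) (wd v))" by (simp add: add.assoc)
 next
  fix a i b v k assume a: "vw V a" "vw V b" "vw V v" "k = dg v + dg a + i + dg b + 0"
  have "lin R (V i) (CT C k) (%x. wt C v (dg a + i + dg b, tw (a @ (i,x) # b)))"
   by (rule lin_compose[where f="%x. tw (a @ (i,x) # b)", OF tco_word_lin[OF V a(1,2) refl]], rule tens_elt_lin2) (use a in auto)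
  then show "lin R (V i) (CT C k) (%x. wt C v (wd (a @ (i,x) # b)))" by (simp add: add.assoc)
 qed auto
 have m: "mlin R V (CT C) 0 (%w. finsum (CT C (dg w)) (%i.
    wt C (take i w) (wd (drop i w))) {..length w})"
 proof (rule mlin_cong[OF V m0])
  fix w assume "vw V w"
  then show "finsum (CT C (dg w)) (%i. wt C (take i w) (wd (drop i w))) {..length w} =
   sum2 (CT C (dg w + 0)) (%u v. wt C u (wd v)) w" by (simp, intro sum2_image) auto
 qed
 have eq: "tco_delta R V = tco_ext R V (CT C) 0 (%n. tpow_ext R V n (CT C) 0 (%w. finsum (CT C (dg w)) (%i.
    wt C (take i w) (wd (drop i w))) {..length w}))" by (simp add: tco_delta_def Let_def)
 show "tco_delta R V <: Hom C (CT C) 0" unfolding eq by (rule tco_mext_HOM[OF V _ m]) simp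
 assume w: "vw V w" "dg w = d"
 have "tco_delta R V d (tw w) = finsum (CT C (dg w)) (%i. wt C (take i w) (wd (drop i w))) {..length w}"
  unfolding eq by (rule tco_mext_word[OF V _ m w]) simp
 also have "... = sum2 (CT C d) (%u v. wt C u (wd v)) w" unfolding w(2)[symmetric] by (intro sum2_image) (use w in auto)
 finally show "tco_delta R V d (tw w) = sum2 (CT C d) (%u v. wt C u (wd v)) w" .
qed

lemma
 shows counit_HOM: "tco_counit R V <: Hom C (kmod R) 0"
  and counit_word: "vw V w ==> dg w = d ==> tco_counit R V d (tw w) = (if w = [] then \<one>\<^bsub>R\<^esub> else \<zero>[R])"
proof -
 have m: "mlin R V (kmod R) 0 (%w. if w = [] then \<one>\<^bsub>R\<^esub> else \<zero>[R])"
  by (rule mlinI) (use lin_const0[OF gmod_module[OF kmod_module]] in \<open>auto simp: kmod_carrier\<close>)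
 show "tco_counit R V <: Hom C (kmod R) 0" unfolding tco_counit_def by (rule tco_mext_HOM[OF V kmod_module m])
 show "vw V w ==> dg w = d ==> tco_counit R V d (tw w) = (if w = [] then \<one>\<^bsub>R\<^esub> else \<zero>[R])"
  unfolding tco_counit_def by (rule tco_mext_word[OF V kmod_module m])
qed

definition rho :: "('k,'m) gmod \<Rightarrow> (('k, nat \<Rightarrow> ('k,'v) tpow, 'm) tens, ('k, nat \<Rightarrow> ('k,'v) tpow, ('k, nat \<Rightarrow> ('k,'v) tpow, 'm) tens) tens) gmap" where
 "rho M = snd (cofree_comod R K M)"

lemma cofree_eq: "cofree_comod R K M = (CT M, rho M)" by (simp add: rho_def cofree_comod_def Let_def)

lemma rho_HOM: assumes M: "gm M" shows "rho M <: Hom (CT M) (CT (CT M)) 0"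
proof -
 have t: "tmap C M (CT C) M 0 0 (tco_delta R V) (gid M) <: Hom (CT M) (tns (CT C) M) 0" by (rule tmap_HOM) (use M delta_HOM in auto)
 show ?thesis unfolding rho_def cofree_comod_def Let_def using gcomp_HOM[OF _ t tens_assoc_HOM[OF C C M]] M by simp
qed

lemma rho_wt: assumes M: "gm M" and w: "vw V w" and x: "x <: M j" and d: "dg w + j = d"
 shows "rho M d (wt M w (j,x)) =
  sum2 (CT (CT M) d) (%u v. wt (CT M) u (dg v + j, wt M v (j,x))) w"
proof -
 let ?CC = "CT C"
 have e1: "tmap C M ?CC M 0 0 (tco_delta R V) (gid M) d (wt M w (j,x)) =
  sg (0 * dg w) *[tns ?CC M d] telt ?CC M (dg w + 0, tco_delta R V (dg w) (tw w)) (j + 0, gid M j x)"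
  by (rule tmap_elt) (use M w x d delta_HOM in auto)
 also have "... = telt ?CC M (dg w, sum2 (?CC (dg w)) (%u v. wt C u (wd v)) w) (j,x)"
  using M w x d delta_word[OF w refl] by (simp add: vsum2_closed[OF _ w])
 also have "... = sum2 (tns ?CC M d) (%u v. telt ?CC M (dg w, wt C u (wd v)) (j,x)) w" by (rule tens_sum2_l[OF _ M w x d]) auto
 finally have e: "tmap C M ?CC M 0 0 (tco_delta R V) (gid M) d (wt M w (j,x)) =
   sum2 (tns ?CC M d) (%u v. telt ?CC M (dg w, wt C u (wd v)) (j,x)) w" .
 have t: "wt M w (j,x) <: CT M d" using M w x d by auto
 have "rho M d (wt M w (j,x)) = tens_assoc R C C M d (sum2 (tns ?CC M d) (%u v. telt ?CC M (dg w, wt C u (wd v)) (j,x)) w)"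
  unfolding rho_def cofree_comod_def Let_def using t e by simp
 also have "... = sum2 (CT (CT M) d) (%u v. tens_assoc R C C M d (telt ?CC M (dg w, wt C u (wd v)) (j,x))) w"
  by (rule HOM_sum2[OF tens_assoc_HOM[OF C C M] _ _ w]) (use M w x d in auto)
 also have "... = sum2 (CT (CT M) d) (%u v. wt (CT M) u (dg v + j, wt M v (j,x))) w"
 proof (rule vsum2_cong[OF _ w])
  fix u v assume uv: "vw V u" "vw V v" "w = u @ v"
  show "tens_assoc R C C M d (telt ?CC M (dg w, wt C u (wd v)) (j,x)) =
    wt (CT M) u (dg v + j, wt M v (j,x))" by (rule tens_assoc_elt) (use uv M x d in auto)
  show "wt (CT M) u (dg v + j, wt M v (j,x)) <: CT (CT M) d" using uv M x d by auto
 qed (use M in auto)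
 finally show ?thesis .
qed

definition ppi :: "('k,'m) gmod \<Rightarrow> (('k, nat \<Rightarrow> ('k,'v) tpow, 'm) tens, 'm) gmap" where
 "ppi M = gcomp (CT M) 0 (tens_lunit R M) (tmap C M (kmod R) M 0 0 (tco_counit R V) (gid M))"

lemma ppi_HOM: assumes M: "gm M" shows "ppi M <: Hom (CT M) M 0" unfolding ppi_def
 by (rule gcomp_HOM[OF _ tmap_HOM[OF C M kmod_module M counit_HOM gid_HOM[OF M]] tens_lunit_HOM[OF M]])
  (use M in auto)

lemma ppi_wt: assumes M: "gm M" and w: "vw V w" and x: "x <: M j" and d: "dg w + j = d"
 shows "ppi M d (wt M w (j,x)) = (if w = [] then x else \<zero>[M d])"
proof -
 have c: "tco_counit R V (dg w) (tw w) <: kmod R (dg w)" using HOM_in[OF counit_HOM tco_word_closed[OF V w refl]] by simp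
 have "tmap C M (kmod R) M 0 0 (tco_counit R V) (gid M) d (wt M w (j,x)) =
  sg (0 * dg w) *[tns (kmod R) M d] telt (kmod R) M (dg w + 0, tco_counit R V (dg w) (tw w)) (j + 0, gid M j x)"
  by (rule tmap_elt) (use M w x d counit_HOM in auto)
 also have "... = telt (kmod R) M (dg w, tco_counit R V (dg w) (tw w)) (j,x)" using M x c d by simp
 finally have "ppi M d (wt M w (j,x)) = tens_lunit R M d (telt (kmod R) M (dg w, tco_counit R V (dg w) (tw w)) (j,x))"
  unfolding ppi_def using M w x d by simp
 also have "... = kact M (dg w, tco_counit R V (dg w) (tw w)) (j,x)" by (rule tens_lunit_elt[OF M c x d])
 also have "... = (if w = [] then x else \<zero>[M d])" using w x M d by (auto simp: counit_word kact_def)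
 finally show ?thesis .
qed

text \<open>\<open>(1 (x) m) (Delta (x) 1)\<close>, the cofree extension of \<open>m\<close>. In
  degree 0 it is the comodule morphism with projection \<open>m\<close>; in degree -1 it is the part
  of \<open>phi_inv\<close> that depends on \<open>m\<close>.\<close>

definition Phi :: "('k,'m) gmod \<Rightarrow> ('k,'n) gmod \<Rightarrow> int \<Rightarrow> (('k, nat \<Rightarrow> ('k,'v) tpow, 'm) tens, 'n) gmap
  \<Rightarrow> (('k, nat \<Rightarrow> ('k,'v) tpow, 'm) tens, ('k, nat \<Rightarrow> ('k,'v) tpow, 'n) tens) gmap" where
 "Phi M N e m = gcomp (CT M) 0 (tmap C (CT M) C N 0 e (gid C) m) (rho M)"

lemma Phi_HOM:
 assumes M: "gm M" and N: "gm N" and m: "m <: Hom (CT M) N e"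
 shows "Phi M N e m <: Hom (CT M) (CT N) e" unfolding Phi_def
 by (rule gcomp_HOM[OF _ rho_HOM[OF M] tmap_HOM[OF C _ C N gid_HOM[OF C] m refl]]) (use M in auto)

lemma Phi_wt:
 assumes M: "gm M" and N: "gm N" and m: "m <: Hom (CT M) N e"
  and w: "vw V w" and x: "x <: M j" and d: "dg w + j = d" and k: "d + e = k"
 shows "Phi M N e m d (wt M w (j,x)) =
  sum2 (CT N k) (%u v. sg (e * dg u) *[CT N k]
    wt N u (dg v + j + e, m (dg v + j) (wt M v (j,x)))) w"
proof -
 note t = tmap_HOM[OF C _ C N gid_HOM[OF C] m refl]
 have P: "gm (CT M)" using M by simp
 have "Phi M N e m d (wt M w (j,x)) = tmap C (CT M) C N 0 e (gid C) m d (rho M d (wt M w (j,x)))" unfolding Phi_def using M w x d by simp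
 also have "... = sum2 (CT N k) (%u v. tmap C (CT M) C N 0 e (gid C) m d
   (wt (CT M) u (dg v + j, wt M v (j,x)))) w" unfolding rho_wt[OF M w x d] by (rule HOM_sum2[OF t _ _ w]) (use M N x d k in auto)
 also have "... = sum2 (CT N k) (%u v. sg (e * dg u) *[CT N k]
    wt N u (dg v + j + e, m (dg v + j) (wt M v (j,x)))) w"
 proof (rule vsum2_cong[OF _ w])
  fix u v assume uv: "vw V u" "vw V v" "w = u @ v"
  have t: "wt M v (j,x) <: CT M (dg v + j)" using uv M x by simp
  have "tmap C (CT M) C N 0 e (gid C) m d (wt (CT M) u (dg v + j, wt M v (j,x))) =
   sg (e * dg u) *[CT N k] telt C N (dg u + 0, gid C (dg u) (tw u)) (dg v + j + e, m (dg v + j) (wt M v (j,x)))"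
   by (rule tmap_elt[OF C P C N gid_HOM[OF C] m]) (use uv t d k in auto)
  then show "tmap C (CT M) C N 0 e (gid C) m d (wt (CT M) u (dg v + j, wt M v (j,x))) =
   sg (e * dg u) *[CT N k] wt N u (dg v + j + e, m (dg v + j) (wt M v (j,x)))" using uv by simp
  show "sg (e * dg u) *[CT N k]
    wt N u (dg v + j + e, m (dg v + j) (wt M v (j,x))) <: CT N k" using uv N HOM_in[OF m t refl] d k by (intro m_smult telt_in) auto
 qed (use N in auto)
 finally show ?thesis .
qed

text \<open>The counit law seen from the right: the cut with an empty second piece is the only
  survivor. Read backwards, it recovers any element of \<open>C (x) M\<close> from its coaction by
  applying \<open>1 (x) ppi\<close>.\<close>

lemma Phi_ppi: assumes M: "gm M" shows "Phi M M 0 (ppi M) = gid (CT M)"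
proof (rule CM_HOM_eqI[OF M _ Phi_HOM[OF M M ppi_HOM[OF M]] gid_HOM])
 fix w j x assume w: "vw V w" and x: "x <: M j"
 let ?F = "%u v. wt M u (dg v + j, if v = [] then x else \<zero>[M (dg v + j)])"
 have "Phi M M 0 (ppi M) (dg w + j) (wt M w (j,x)) = sum2 (CT M (dg w + j)) ?F w"
  by (subst Phi_wt[OF M M ppi_HOM[OF M] w x refl refl], simp, rule vsum2_cong[OF _ w])
   (use M x in \<open>auto simp: ppi_wt\<close>)
 also have "... = ?F w []" by (subst sum2_last) (use M w x in \<open>auto simp: tens_zero_r add.assoc\<close>)
 finally show "Phi M M 0 (ppi M) (dg w + j) (wt M w (j,x)) = gid (CT M) (dg w + j) (wt M w (j,x))" using M w x by simp
qed (use M in auto)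

text \<open>Coassociativity comes down to \<open>sum2_assoc\<close>, and in the counit law only the
  cut with an empty first piece survives.\<close>

lemma cofree_graded_comodule: assumes M: "gm M" shows "graded_comodule R K (cofree_comod R K M)"
proof -
 let ?P = "CT M"
 have P: "gm ?P" using M by simp
 note rh = rho_HOM[OF M]
 note tD = tmap_HOM[OF C P _ P delta_HOM gid_HOM[OF P], of 0]
 note tr = tmap_HOM[OF C P C _ gid_HOM[OF C] rh, of 0]
 note tc = tmap_HOM[OF C P kmod_module P counit_HOM gid_HOM[OF P], of 0]
 have w1: "rho M d (wt M w (j,x)) <: CT ?P d"
  if "vw V w" "x <: M j" "dg w + j = d" for w j x d using that M by (intro HOM_in[OF rh]) auto
 have a: "gcomp ?P 0 (tens_assoc R C C ?P) (gcomp ?P 0 (tmap C ?P (CT C) ?P 0 0 (tco_delta R V) (gid ?P)) (rho M))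
    = gcomp ?P 0 (cotens ?P (CT ?P) 0 (rho M)) (rho M)"
 proof (rule CM_HOM_eqI[OF M])
  fix w j x assume w: "vw V w" and x: "x <: M j"
  define d where "d = dg w + j"
  let ?T = "CT (CT ?P)"
  \<comment> \<open>\<open>?G a b v\<close> is the word cut into three pieces, bracketed to the
    right; both composites in the coassociativity law are sums of such terms.\<close>
  let ?G = "%a b v. telt C (CT ?P) (wd a) (dg b + (dg v + j), wt ?P b (dg v + j, wt M v (j,x)))"
  have T: "gm ?T" using M by simp
  have G: "?G a b' v <: ?T d" if "vw V a" "vw V b'" "vw V v" "dg a + dg b' + dg v + j = d" for a b' v using that x M by auto
  have "tmap C ?P (CT C) ?P 0 0 (tco_delta R V) (gid ?P) d (rho M d (wt M w (j,x))) =
   sum2 (tns (CT C) ?P d) (%u v. sum2 (tns (CT C) ?P d) (%a b. telt (CT C) ?P (dg u, wt C a (wd b)) (dg v + j, wt M v (j,x))) u) w"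
   unfolding rho_wt[OF M w x d_def[symmetric]]
   apply (subst HOM_sum2[where k=d, OF tD _ _ w]) subgoal by simp subgoal by simp subgoal using P by simp subgoal using P by simp subgoal by simp
    subgoal using M x d_def by auto
   apply (rule vsum2_cong[OF _ w])
   subgoal using P by simp
   subgoal for u v
    apply (subst tmap_elt[OF C P _ P delta_HOM gid_HOM[OF P], where k=d])
       apply (use M x d_def in auto)[5]
    apply (simp add: delta_word P M x)
    apply (subst m_one)
    subgoal using P by simp
    subgoal using M P x d_def by (intro telt_in vsum2_closed[of _ V]) auto
    apply (rule tens_sum2_l[of _ _ V]) using M P x d_def by auto
   subgoal using M P x d_def by (intro vsum2_closed[of _ V]) auto
   done
  then have "gcomp ?P 0 (tens_assoc R C C ?P) (gcomp ?P 0 (tmap C ?P (CT C) ?P 0 0 (tco_delta R V) (gid ?P)) (rho M)) d (wt M w (j,x))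
   = tens_assoc R C C ?P d (sum2 (tns (CT C) ?P d) (%u v. sum2 (tns (CT C) ?P d) (%a b. telt (CT C) ?P (dg u, wt C a (wd b)) (dg v + j, wt M v (j,x))) u) w)"
   using M w x d_def by simp
  also have "... = sum2 (?T d) (%u v. sum2 (?T d) (%a b. ?G a b v) u) w"
   apply (subst HOM_sum2[where k=d, OF tens_assoc_HOM[OF C C P] _ _ w]) subgoal using P by simp subgoal using P by simp subgoal by simp
    subgoal using M P x d_def by (intro vsum2_closed[of _ V]) auto
   apply (rule vsum2_cong[OF _ w])
   subgoal using P by simp
   subgoal for u v
    apply (subst HOM_sum2[where k=d, OF tens_assoc_HOM[OF C C P], of V]) subgoal using P by simp subgoal using P by simp subgoal by simp subgoal by simp
     subgoal using M P x d_def by auto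
    apply (rule vsum2_cong[of _ V])
    subgoal using P by simp
    subgoal by simp
    subgoal for a b by (rule tens_assoc_elt[OF C C P]) (use M P x d_def in auto)
    subgoal using G d_def by auto
    done
   subgoal using G d_def P by (intro vsum2_closed[of _ V]) auto
   done
  also have "... = sum2 (?T d) (%u v. sum2 (?T d) (%a b. ?G u a b) v) w" by (rule sum2_assoc) (use T G w d_def in auto)
  also have "... = cotens ?P (CT ?P) 0 (rho M) d (rho M d (wt M w (j,x)))" unfolding rho_wt[OF M w x d_def[symmetric]]
  proof (subst HOM_sum2[where k=d, OF tr _ _ w])
   show "sum2 (?T d) (%u v. sum2 (?T d) (%a b. ?G u a b) v) w = sum2 (?T d) (%u v. cotens ?P (CT ?P) 0 (rho M) d
     (wt ?P u (dg v + j, wt M v (j,x)))) w"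
   proof (rule vsum2_cong[OF _ w])
    fix u v assume uv: "vw V u" "vw V v" "w = u @ v"
    have t: "wt M v (j,x) <: ?P (dg v + j)" using uv M x by simp
    have r: "rho M (dg v + j) (wt M v (j,x)) <: CT ?P (dg v + j)" using w1 uv x by simp
    have "cotens ?P (CT ?P) 0 (rho M) d (wt ?P u (dg v + j, wt M v (j,x))) =
     sg (0 * dg u) *[?T d] telt C (CT ?P) (dg u + 0, gid C (dg u) (tw u)) (dg v + j + 0, rho M (dg v + j) (wt M v (j,x)))"
     by (rule tmap_elt[OF C P C _ gid_HOM[OF C] rh]) (use uv P t d_def in auto)
    also have "... = telt C (CT ?P) (wd u) (dg v + j, rho M (dg v + j) (wt M v (j,x)))" using uv P r T d_def by simp
    also have "... = sum2 (?T d) (%a b. ?G u a b) v" unfolding rho_wt[OF M uv(2) x refl]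
     by (subst tens_sum2_r[OF C _ uv(2), where d=d], (use uv M P x d_def in auto)[4], rule vsum2_cong[OF _ uv(2)])
      (use uv M P x d_def in \<open>auto simp: add.assoc\<close>)
    finally show "sum2 (?T d) (%a b. ?G u a b) v =
     cotens ?P (CT ?P) 0 (rho M) d (wt ?P u (dg v + j, wt M v (j,x)))" by simp
    show "cotens ?P (CT ?P) 0 (rho M) d (wt ?P u (dg v + j, wt M v (j,x))) <: ?T d" by (rule HOM_in[OF tr]) (use uv P t d_def in auto)
   qed (use T in auto)
  qed (use P M x d_def in auto)
  also have "... = gcomp ?P 0 (cotens ?P (CT ?P) 0 (rho M)) (rho M) d (wt M w (j,x))" using M w x d_def by simp
  finally show "gcomp ?P 0 (tens_assoc R C C ?P) (gcomp ?P 0 (tmap C ?P (CT C) ?P 0 0 (tco_delta R V) (gid ?P)) (rho M)) (dg w + j) (wt M w (j,x))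
    = gcomp ?P 0 (cotens ?P (CT ?P) 0 (rho M)) (rho M) (dg w + j) (wt M w (j,x))" unfolding d_def .
 next
  show "gcomp ?P 0 (tens_assoc R C C ?P) (gcomp ?P 0 (tmap C ?P (CT C) ?P 0 0 (tco_delta R V) (gid ?P)) (rho M)) <: Hom ?P (CT (CT ?P)) 0"
   by (rule gcomp_HOM[OF P gcomp_HOM[OF P rh tD] tens_assoc_HOM[OF C C P]]) auto
  show "gcomp ?P 0 (cotens ?P (CT ?P) 0 (rho M)) (rho M) <: Hom ?P (CT (CT ?P)) 0" by (rule gcomp_HOM[OF P rh tr]) (use P in auto)
 qed (use M in auto)
 have c: "gcomp ?P 0 (tens_lunit R ?P) (gcomp ?P 0 (tmap C ?P (kmod R) ?P 0 0 (tco_counit R V) (gid ?P)) (rho M)) = gid ?P"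
 proof (rule CM_HOM_eqI[OF M P _ gid_HOM[OF P]])
  show "gcomp ?P 0 (tens_lunit R ?P) (gcomp ?P 0 (tmap C ?P (kmod R) ?P 0 0 (tco_counit R V) (gid ?P)) (rho M)) <: Hom ?P ?P 0"
   by (rule gcomp_HOM[OF P gcomp_HOM[OF P rh tc] tens_lunit_HOM[OF P]]) auto
  fix w j x assume w: "vw V w" and x: "x <: M j"
  define d where "d = dg w + j"
  let ?F = "%u v. if u = [] then wt M v (j,x) else \<zero>[?P d]"
  have F: "?F u v <: ?P d" if "w = u @ v" for u v using that w M x d_def by auto
  have wv: "wt M v (j,x) <: ?P (dg v + j)" if "vw V v" for v using that M x by auto
  have "gcomp ?P 0 (tens_lunit R ?P) (gcomp ?P 0 (tmap C ?P (kmod R) ?P 0 0 (tco_counit R V) (gid ?P)) (rho M)) d (wt M w (j,x)) =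
   tens_lunit R ?P d (tmap C ?P (kmod R) ?P 0 0 (tco_counit R V) (gid ?P) d (rho M d (wt M w (j,x))))" using M w x d_def by simp
  also have "... = ppi ?P d (rho M d (wt M w (j,x)))" unfolding ppi_def using w1[OF w x d_def[symmetric]] by simp
  also have "... = sum2 (?P d) ?F w" unfolding rho_wt[OF M w x d_def[symmetric]]
   apply (subst HOM_sum2[where k=d, OF ppi_HOM[OF P] _ _ w]) subgoal using P by simp subgoal using P by simp subgoal by simp
    subgoal using d_def M x by auto
   apply (rule vsum2_cong[OF _ w])
   subgoal using P by simp
   subgoal for u v using ppi_wt[OF P _ wv, of u v d] d_def by auto
   subgoal using F by blast
   done
  also have "... = ?F [] w" by (subst sum2_first) (use M F[of "[]" w] in auto)
  finally show "gcomp ?P 0 (tens_lunit R ?P) (gcomp ?P 0 (tmap C ?P (kmod R) ?P 0 0 (tco_counit R V) (gid ?P)) (rho M)) (dg w + j) (wt M w (j,x)) =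
    gid ?P (dg w + j) (wt M w (j,x))" unfolding d_def using M w x by simp
 qed
 show ?thesis unfolding graded_comodule_def cofree_eq Let_def prod.case K_mod K_delta K_counit using P rh a c by blast
qed

end

lemma gcomp_eq_iff: "gcomp M b g f = gcomp M b' g' f' \<longleftrightarrow> (\<forall>i. \<forall>x\<in>carrier (M i). g (i + b) (f i x) = g' (i + b') (f' i x))"
 unfolding gcomp_def fun_eq_iff restrict_def by metis

context ground begin

lemma tens_map_add_r:
 assumes M: "gm M" and N: "gm N" and M': "gm M'" and N': "gm N'"
  and f: "f <: Hom M M' a" and g: "g <: Hom N N' b" and g': "g' <: Hom N N' b"
  and z: "z <: tns M N d" and k: "d + (a + b) = k"
 shows "tmap M N M' N' a b f (g +[Hom N N' b] g') d z =
  tmap M N M' N' a b f g d z +[tns M' N' k] tmap M N M' N' a b f g' d z"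
proof -
 have gg: "g +[Hom N N' b] g' <: Hom N N' b" using HOM_module[OF N N'] g g' by simp
 note t = tmap_HOM[OF M N M' N' f _ refl, THEN HOM_lin, OF _ k]
 have T: "md (tns M' N' k)" using M' N' by simp
 show ?thesis
 proof (rule tens_lin_eq[OF M N T t[OF gg] lin_plus[OF T t[OF g] t[OF g']] _ z])
  fix i x j y assume x: "x <: M i" and y: "y <: N j" and d: "i + j = d"
  have k': "i + j + (a + b) = k" using d k by simp
  have fx: "f i x <: M' (i + a)" and c: "g j y <: N' (j + b)" "g' j y <: N' (j + b)"
   using HOM_in[OF f x refl] HOM_in[OF g y refl] HOM_in[OF g' y refl] .
  have "i + a + (j + b) = k" using k' by simp
  from lin_add[OF tens_elt_lin2[OF M' N' fx this] c]
  show "tmap M N M' N' a b f (g +[Hom N N' b] g') d (telt M N (i,x) (j,y)) =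
   tmap M N M' N' a b f g d (telt M N (i,x) (j,y)) +[tns M' N' k]
   tmap M N M' N' a b f g' d (telt M N (i,x) (j,y))"
   unfolding tmap_elt[OF M N M' N' f gg x y d k'] tmap_elt[OF M N M' N' f g x y d k'] tmap_elt[OF M N M' N' f g' x y d k']
   using y fx c M' N' k' by (simp add: m_sr)
 qed
qed

lemma HOM_kact:
 assumes M: "gm M" and N: "gm N" and f: "f <: Hom M N n"
  and r: "r <: R" and x: "x <: M j" and d: "i + j = d" "j + n = k"
 shows "f d (kact M (i,r) (j,x)) = kact N (i,r) (k, f j x)" using HOM_smult_map[OF f d(2) r x] HOM_zero_map[OF M N f refl, of d] d
 by (auto simp: kact_def add.assoc)

lemma tens_kact_l:
 assumes M: "gm M" and N: "gm N" and r: "r <: R" and x: "x <: M j" and y: "y <: N k"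
  and d: "i + j = d" "j + k = l"
 shows "telt M N (d, kact M (i,r) (j,x)) (k,y) = kact (tns M N) (i,r) (l, telt M N (j,x) (k,y))"
 using tens_smult_l[OF M N r x y refl] tens_zero_l[OF M N y, of "i + j"] d by (auto simp: kact_def add.assoc)

lemma tens_kact_r:
 assumes M: "gm M" and N: "gm N" and r: "r <: R" and x: "x <: M k" and y: "y <: N j"
  and d: "i + j = d" "k + j = l"
 shows "telt M N (k,x) (d, kact N (i,r) (j,y)) = kact (tns M N) (i,r) (l, telt M N (k,x) (j,y))"
proof -
 have "k + (i + j) = i + l" using d by simp
 then show ?thesis using tens_smult_r[OF M N r x y refl] tens_zero_r[OF M N x, of "i + j" "i + l"] d by (auto simp: kact_def)
qed

lemma kact_sum2:
 assumes M: "gm M" and r: "r <: R" and w: "vw V w" and d: "i + j = d"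
  and F: "!!u v. vw V u ==> vw V v ==> w = u @ v ==> F u v <: M j"
 shows "kact M (i,r) (j, sum2 (M j) F w) = sum2 (M d) (%u v. kact M (i,r) (j, F u v)) w"
 by (rule lin_sum2[OF _ _ kact_lin2[OF M r d]]) (use M F w in auto)

end

section \<open>Coderivations and comodule morphisms determined by their projections\<close>

context tcoalg begin

abbreviation "bl m \<equiv> (wdeg m - 1, bm m)"

lemma bm_closed [simp]: "vw V m ==> dg m - 1 = k ==> bm m <: V k" by (rule mlin_closed[OF b_mlin]) auto

lemma xi_kmod: "vw V m ==> xi m <: kmod R (dg m - 2)" by (rule mlin_closed[OF x_mlin]) auto

lemma xi_closed [simp]: "vw V m ==> xi m <: R" by (rule kmodD[OF xi_kmod])

lemma dC_word: "vw V w ==> dg w = d ==> d - 1 = k ==> dC d (tw w) =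
  sum3 (C k) (%u m v. sw u *[C k] tw (u @ bl m # v)) w" using K_diff_word[of w] by simp

text \<open>Applying \<open>1 (x) ppi\<close> to the coaction of \<open>Y z\<close> and using
  \<open>Phi_ppi\<close> gives \<open>Y z = (1 (x) ppi) (Z z) + (1 (x) ppi Y) (rho z)\<close>, so
  \<open>Y\<close> depends only on \<open>Z\<close> and on \<open>ppi Y\<close>. The term
  \<open>Z\<close> lets one statement cover four situations: zero for comodule morphisms,
  \<open>d (x) 1\<close> for coderivations, \<open>d^2 (x) 1\<close> for their squares and for the
  curvature term, \<open>d (x) F\<close> for the two composites of a morphism with the
  differentials.\<close>

lemma ppi_unique:
 assumes M: "gm M" and N: "gm N"
  and Y: "Y <: Hom (CT M) (CT N) n" and Y': "Y' <: Hom (CT M) (CT N) n"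
  and Z: "!!i z. z <: CT M i ==> Z i z <: CT (CT N) (i + n)"
  and eq: "!!i z. z <: CT M i ==> rho N (i + n) (Y i z) =
    Z i z +[CT (CT N) (i + n)] tmap C (CT M) C (CT N) 0 n (gid C) Y i (rho M i z)"
  and eq': "!!i z. z <: CT M i ==> rho N (i + n) (Y' i z) =
    Z i z +[CT (CT N) (i + n)] tmap C (CT M) C (CT N) 0 n (gid C) Y' i (rho M i z)"
  and pp: "gcomp (CT M) n (ppi N) Y = gcomp (CT M) n (ppi N) Y'"
 shows "Y = Y'"
proof (rule HOM_eqI[OF Y Y'])
 fix i z assume z: "z <: CT M i"
 let ?P = "CT M" and ?Q = "CT N"
 have P: "gm ?P" and Q: "gm ?Q" using M N by auto
 note t = tmap_HOM[OF C Q C N gid_HOM[OF C] ppi_HOM[OF N], of 0, simplified]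
 have rz: "rho M i z <: CT ?P i" using HOM_in[OF rho_HOM[OF M] z] by simp
 have main: "Y i z = cotens ?Q N 0 (ppi N) (i + n) (Z i z) +[?Q (i + n)]
   tmap C ?P C N 0 n (gid C) (gcomp ?P n (ppi N) Y) i (rho M i z)"
  if Y: "Y <: Hom ?P ?Q n" and eq: "rho N (i + n) (Y i z) =
    Z i z +[CT ?Q (i + n)] tmap C ?P C ?Q 0 n (gid C) Y i (rho M i z)" for Y
 proof -
  have Yz: "Y i z <: ?Q (i + n)" by (rule HOM_in[OF Y z refl])
  have c: "tmap C ?P C ?Q 0 n (gid C) Y i (rho M i z) <: CT ?Q (i + n)"
   by (rule HOM_in[OF tmap_HOM[OF C P C Q gid_HOM[OF C] Y refl] rz]) simp
  have "Y i z = Phi N N 0 (ppi N) (i + n) (Y i z)" using Phi_ppi[OF N] Yz by simp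
  also have "... = cotens ?Q N 0 (ppi N) (i + n) (rho N (i + n) (Y i z))" unfolding Phi_def using Yz by simp
  also have "... = cotens ?Q N 0 (ppi N) (i + n) (Z i z) +[?Q (i + n)]
    cotens ?Q N 0 (ppi N) (i + n) (tmap C ?P C ?Q 0 n (gid C) Y i (rho M i z))" unfolding eq by (rule HOM_add_map[OF t _ Z[OF z] c]) simp
  also have "cotens ?Q N 0 (ppi N) (i + n) (tmap C ?P C ?Q 0 n (gid C) Y i (rho M i z)) =
   sg (0 * 0) *[?Q (i + n)] tmap C ?P C N 0 n (gcomp C 0 (gid C) (gid C)) (gcomp ?P n (ppi N) Y) i (rho M i z)"
   by (rule tmap_comp[OF C P C Q C N gid_HOM[OF C] Y gid_HOM[OF C] ppi_HOM[OF N] rz]) auto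
  also have "... = tmap C ?P C N 0 n (gid C) (gcomp ?P n (ppi N) Y) i (rho M i z)"
  proof -
   have "tmap C ?P C N 0 n (gid C) (gcomp ?P n (ppi N) Y) i (rho M i z) <: ?Q (i + n)"
    by (rule HOM_in[OF tmap_HOM[OF C P C N gid_HOM[OF C] gcomp_HOM[OF P Y ppi_HOM[OF N]] refl] rz]) auto
   then show ?thesis using Q by (simp add: gcomp_gid_left[OF C gid_HOM[OF C]])
  qed
  finally show ?thesis .
 qed
 show "Y i z = Y' i z" using main[OF Y eq[OF z]] main[OF Y' eq'[OF z]] pp by simp
qed

definition dP :: "('k,'m) gmod \<Rightarrow> (('k, nat \<Rightarrow> ('k,'v) tpow, 'm) tens, ('k, nat \<Rightarrow> ('k,'v) tpow, 'm) tens) gmap" where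
 "dP M = tmap C M C M (-1) 0 dC (gid M)"

lemma dP_HOM: "gm M ==> dP M <: Hom (CT M) (CT M) (-1)" unfolding dP_def by (rule tmap_HOM[OF C _ C _ K_diff gid_HOM]) auto

lemma dP_wt:
 assumes M: "gm M" and w: "vw V w" and x: "x <: M j" and d: "dg w + j = d" "d - 1 = k"
 shows "dP M d (wt M w (j,x)) =
  sum3 (CT M k) (%u m v. sw u *[CT M k] wt M (u @ bl m # v) (j,x)) w"
proof -
 have c: "dC (dg w) (tw w) <: C (dg w - 1)" by (rule HOM_in[OF K_diff]) (use w in auto)
 have "dP M d (wt M w (j,x)) = sg (0 * dg w) *[CT M k]
   telt C M (dg w + -1, dC (dg w) (tw w)) (j + 0, gid M j x)"
  unfolding dP_def by (rule tmap_elt[OF C M C M K_diff gid_HOM[OF M]]) (use w x d in auto)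
 also have "... = telt C M (dg w - 1, dC (dg w) (tw w)) (j,x)" using M x c d by simp
 also have "... = sum3 (CT M k) (%u m v. telt C M (dg w - 1, sw u *[C (dg w - 1)] tw (u @ bl m # v)) (j,x)) w"
  unfolding dC_word[OF w refl refl] by (rule tens_sum3_l[OF C M w x]) (use d in auto)
 also have "... = sum3 (CT M k) (%u m v. sw u *[CT M k] wt M (u @ bl m # v) (j,x)) w"
 proof (rule vsum3_cong[OF _ w])
  fix u m v assume uv: "vw V u" "vw V m" "vw V v" "w = u @ m @ v"
  have e: "dg w - 1 = dg (u @ bl m # v)" using uv by simp
  have c: "tw (u @ bl m # v) <: C (dg w - 1)" unfolding e using uv by simp
  show "telt C M (dg w - 1, sw u *[C (dg w - 1)] tw (u @ bl m # v)) (j,x) =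
   sw u *[CT M k] wt M (u @ bl m # v) (j,x)" unfolding e[symmetric] by (rule tens_smult_l[OF C M _ c x]) (use d in auto)
  show "sw u *[CT M k] wt M (u @ bl m # v) (j,x) <: CT M k" unfolding e[symmetric] using M c x d by simp
 qed (use M in auto)
 finally show ?thesis .
qed

text \<open>Coassociativity once more. The sign with exponent \<open>e * dg u\<close> is compatible
  with cutting \<open>u\<close> or \<open>v\<close> further because the degree of a word is the sum
  of the degrees of its pieces.\<close>

lemma rho_Phi:
 assumes M: "gm M" and N: "gm N" and m: "m <: Hom (CT M) N e"
  and z: "z <: CT M i" and k: "i + e = k"
 shows "rho N k (Phi M N e m i z) = tmap C (CT M) C (CT N) 0 e (gid C) (Phi M N e m) i (rho M i z)"
proof -
 let ?P = "CT M" and ?Q = "CT N"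
 have P: "gm ?P" and Q: "gm ?Q" and CQ: "gm (CT ?Q)" using M N by auto
 note ph = Phi_HOM[OF M N m]
 note t = tmap_HOM[OF C P C Q gid_HOM[OF C] ph, of e, simplified]
 have "gcomp ?P e (rho N) (Phi M N e m) = gcomp ?P 0 (tmap C ?P C ?Q 0 e (gid C) (Phi M N e m)) (rho M)"
 proof (rule CM_HOM_eqI[OF M CQ gcomp_HOM[OF P ph rho_HOM[OF N]] gcomp_HOM[OF P rho_HOM[OF M] t]])
  fix w j x assume w: "vw V w" and x: "x <: M j"
  define d where "d = dg w + j"
  define k where "k = d + e"
  note dk = d_def k_def
  let ?mx = "%v. (dg v + j + e, m (dg v + j) (wt M v (j,x)))"
  have mx: "m (dg v + j) (wt M v (j,x)) <: N l" if "vw V v" "dg v + j + e = l" for v l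
   by (rule HOM_in[OF m _ that(2)]) (use that M x in auto)
  let ?G = "%a b v. sg (e * (dg a + dg b)) *[CT ?Q k] wt ?Q a (dg b + (dg v + j + e), wt N b (?mx v))"
  have G: "?G a b v <: CT ?Q k" if "vw V a" "vw V b" "vw V v" "dg a + dg b + dg v = dg w" for a b v
   using that mx N dk by (intro m_smult telt_in) auto
  have wt: "wt M v (j,x) <: ?P l" if "vw V v" "dg v + j = l" for v l using that M x by auto
  have "rho N k (Phi M N e m d (wt M w (j,x))) =
   sum2 (CT ?Q k) (%u v. rho N k (sg (e * dg u) *[?Q k] wt N u (?mx v))) w" unfolding Phi_wt[OF M N m w x d_def[symmetric] k_def[symmetric]]
   by (rule HOM_sum2[OF rho_HOM[OF N] Q CQ w]) (use Q mx N dk in \<open>auto intro!: m_smult telt_in\<close>)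
  also have "... = sum2 (CT ?Q k) (%u v. sum2 (CT ?Q k) (%a b. ?G a b v) u) w"
  proof (rule vsum2_cong[OF _ w])
   fix u v assume uv: "vw V u" "vw V v" "w = u @ v"
   have "rho N k (sg (e * dg u) *[?Q k] wt N u (?mx v)) =
     sg (e * dg u) *[CT ?Q k] rho N k (wt N u (?mx v))" by (rule HOM_smult_map[OF rho_HOM[OF N]]) (use uv N mx dk in auto)
   also have "rho N k (wt N u (?mx v)) = sum2 (CT ?Q k) (%a b. wt ?Q a (dg b + (dg v + j + e), wt N b (?mx v))) u"
    by (rule rho_wt[OF N uv(1) mx]) (use uv dk in auto)
   also have "sg (e * dg u) *[CT ?Q k] ... = sum2 (CT ?Q k) (%a b. sg (e * dg u) *[CT ?Q k] wt ?Q a (dg b + (dg v + j + e), wt N b (?mx v))) u"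
    by (rule sum2_smult) (use uv N mx CQ dk in auto)
   also have "... = sum2 (CT ?Q k) (%a b. ?G a b v) u" by (rule vsum2_cong[OF _ uv(1)]) (use uv CQ G in auto)
   finally show "rho N k (sg (e * dg u) *[?Q k] wt N u (?mx v)) = sum2 (CT ?Q k) (%a b. ?G a b v) u" .
   show "sum2 (CT ?Q k) (%a b. ?G a b v) u <: CT ?Q k" by (rule vsum2_closed[OF _ uv(1)]) (use uv CQ G in auto)
  qed (use CQ in auto)
  also have "... = sum2 (CT ?Q k) (%u v. sum2 (CT ?Q k) (%a b. ?G u a b) v) w" by (rule sum2_assoc) (use CQ G w in auto)
  also have "... = sum2 (CT ?Q k) (%u v. tmap C ?P C ?Q 0 e (gid C) (Phi M N e m) d (wt ?P u (dg v + j, wt M v (j,x)))) w"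
  proof (rule vsum2_cong[OF _ w, symmetric])
   fix u v assume uv: "vw V u" "vw V v" "w = u @ v"
   have "tmap C ?P C ?Q 0 e (gid C) (Phi M N e m) d (wt ?P u (dg v + j, wt M v (j,x))) =
    sg (e * dg u) *[CT ?Q k] telt C ?Q (dg u + 0, gid C (dg u) (tw u)) (dg v + j + e, Phi M N e m (dg v + j) (wt M v (j,x)))"
    by (rule tmap_elt[OF C P C Q gid_HOM[OF C] ph]) (use uv wt dk in auto)
   also have "... = sg (e * dg u) *[CT ?Q k] wt ?Q u (dg v + j + e,
     sum2 (?Q (dg v + j + e)) (%a b. sg (e * dg a) *[?Q (dg v + j + e)] wt N a (?mx b)) v)"
    using uv by (simp add: Phi_wt[OF M N m uv(2) x refl refl])
   also have "wt ?Q u (dg v + j + e,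
     sum2 (?Q (dg v + j + e)) (%a b. sg (e * dg a) *[?Q (dg v + j + e)] wt N a (?mx b)) v) =
     sum2 (CT ?Q k) (%a b. wt ?Q u (dg v + j + e, sg (e * dg a) *[?Q (dg v + j + e)] wt N a (?mx b))) v"
    by (rule tens_sum2_r[OF C Q uv(2)]) (use uv N mx dk in auto)
   also have "sg (e * dg u) *[CT ?Q k] ... = sum2 (CT ?Q k) (%a b. sg (e * dg u) *[CT ?Q k] wt ?Q u (dg v + j + e, sg (e * dg a) *[?Q (dg v + j + e)] wt N a (?mx b))) v"
    by (rule sum2_smult) (use uv N mx CQ Q dk in \<open>auto intro!: telt_in m_smult\<close>)
   also have "... = sum2 (CT ?Q k) (%a b. ?G u a b) v"
   proof (rule vsum2_cong[OF _ uv(2)])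
    fix a b assume ab: "vw V a" "vw V b" "v = a @ b"
    have c: "wt N a (?mx b) <: ?Q (dg v + j + e)" using ab N mx by auto
    have c2: "wt ?Q u (dg v + j + e, wt N a (?mx b)) <: CT ?Q k" using uv c Q dk by auto
    have dd: "dg v + j + e = dg a + (dg b + j + e)" using ab by simp
    have "wt ?Q u (dg v + j + e, sg (e * dg a) *[?Q (dg v + j + e)] wt N a (?mx b)) =
     sg (e * dg a) *[CT ?Q k] wt ?Q u (dg v + j + e, wt N a (?mx b))" by (rule tens_smult_r[OF C Q _ _ c]) (use uv dk in auto)
    then show "sg (e * dg u) *[CT ?Q k] wt ?Q u (dg v + j + e, sg (e * dg a) *[?Q (dg v + j + e)] wt N a (?mx b)) = ?G u a b"
     using CQ c2 by (simp add: distrib_left dd)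
    show "?G u a b <: CT ?Q k" using G uv ab by auto
   qed (use CQ in auto)
   finally show "tmap C ?P C ?Q 0 e (gid C) (Phi M N e m) d (wt ?P u (dg v + j, wt M v (j,x))) = sum2 (CT ?Q k) (%a b. ?G u a b) v" .
   show "sum2 (CT ?Q k) (%a b. ?G u a b) v <: CT ?Q k" by (rule vsum2_closed[OF _ uv(2)]) (use uv CQ G in auto)
  qed (use CQ in auto)
  also have "... = tmap C ?P C ?Q 0 e (gid C) (Phi M N e m) d (rho M d (wt M w (j,x)))" unfolding rho_wt[OF M w x d_def[symmetric]]
   by (rule HOM_sum2[OF t _ CQ w, symmetric]) (use M x dk P in auto)
  finally show "gcomp ?P e (rho N) (Phi M N e m) (dg w + j) (wt M w (j,x)) =
   gcomp ?P 0 (tmap C ?P C ?Q 0 e (gid C) (Phi M N e m)) (rho M) (dg w + j) (wt M w (j,x))" using wt[OF w refl] by (simp add: dk)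
 qed auto
 then show ?thesis using z k by (auto simp: gcomp_eq_iff)
qed

lemma ppi_Phi:
 assumes M: "gm M" and N: "gm N" and m: "m <: Hom (CT M) N e"
 shows "gcomp (CT M) e (ppi N) (Phi M N e m) = m"
proof (rule CM_HOM_eqI[OF M N gcomp_HOM[OF _ Phi_HOM[OF M N m] ppi_HOM[OF N]] m])
 fix w j x assume w: "vw V w" and x: "x <: M j"
 define d where "d = dg w + j"
 have mx: "m (dg v + j) (wt M v (j,x)) <: N l" if "vw V v" "dg v + j + e = l" for v l
  by (rule HOM_in[OF m _ that(2)]) (use that M x in auto)
 let ?F = "%u v. if u = [] then m (dg v + j) (wt M v (j,x)) else \<zero>[N (d + e)]"
 have "ppi N (d + e) (Phi M N e m d (wt M w (j,x))) =
  sum2 (N (d + e)) (%u v. ppi N (d + e) (sg (e * dg u) *[CT N (d + e)]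
    wt N u (dg v + j + e, m (dg v + j) (wt M v (j,x))))) w" unfolding Phi_wt[OF M N m w x d_def[symmetric] refl]
  by (rule HOM_sum2[OF ppi_HOM[OF N] _ N w]) (use N mx d_def in \<open>auto intro!: m_smult telt_in\<close>)
 also have "... = sum2 (N (d + e)) ?F w"
 proof (rule vsum2_cong[OF _ w])
  fix u v assume uv: "vw V u" "vw V v" "w = u @ v"
  have "ppi N (d + e) (sg (e * dg u) *[CT N (d + e)]
    wt N u (dg v + j + e, m (dg v + j) (wt M v (j,x)))) =
   sg (e * dg u) *[N (d + e)] ppi N (d + e) (wt N u (dg v + j + e, m (dg v + j) (wt M v (j,x))))"
   by (rule HOM_smult_map[OF ppi_HOM[OF N]]) (use uv N mx d_def in auto)
  also have "... = ?F u v" by (subst ppi_wt[OF N uv(1) mx[OF uv(2) refl]]) (use uv N mx d_def in auto)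
  finally show "ppi N (d + e) (sg (e * dg u) *[CT N (d + e)]
    wt N u (dg v + j + e, m (dg v + j) (wt M v (j,x)))) = ?F u v" .
  show "?F u v <: N (d + e)" using uv N mx d_def by auto
 qed (use N in auto)
 also have "... = ?F [] w" by (subst sum2_first) (use N mx w d_def in auto)
 finally show "gcomp (CT M) e (ppi N) (Phi M N e m) (dg w + j) (wt M w (j,x)) = m (dg w + j) (wt M w (j,x))" using w M x d_def by simp
qed (use M in auto)

text \<open>Every word produced by the differential contains an output letter \<open>bl m\<close>,
  so it is nonempty and the counit kills it.\<close>

lemma ppi_dP: assumes M: "gm M" and z: "z <: CT M i" and k: "i - 1 = k"
 shows "ppi M k (dP M i z) = \<zero>[M k]"
proof -
 let ?P = "CT M"
 have P: "gm ?P" using M by simp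
 have "gcomp ?P (-1) (ppi M) (dP M) = \<zero>[Hom ?P M (-1)]"
 proof (rule CM_HOM_eqI[OF M M gcomp_HOM[OF P dP_HOM[OF M] ppi_HOM[OF M]]])
  show "\<zero>[Hom ?P M (-1)] <: Hom ?P M (-1)" using HOM_module[OF P M] by simp
  fix w j x assume w: "vw V w" and x: "x <: M j"
  define d where "d = dg w + j"
  have "ppi M (d - 1) (dP M d (wt M w (j,x))) = \<zero>[M (d - 1)]" unfolding dP_wt[OF M w x d_def[symmetric] refl]
  proof (subst HOM_sum3[OF ppi_HOM[OF M] P M w, where k="d - 1"])
   show "sum3 (M (d - 1)) (%u m v. ppi M (d - 1) (sw u *[CT M (d - 1)]
     wt M (u @ bl m # v) (j,x))) w = \<zero>[M (d - 1)]"
   proof (rule sum3_zero)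
    fix u m v assume "w = u @ m @ v"
    then have uv: "vw V u" "vw V m" "vw V v" "w = u @ m @ v" using w by auto
    have "ppi M (d - 1) (sw u *[?P (d - 1)] wt M (u @ bl m # v) (j,x)) =
     sw u *[M (d - 1)] ppi M (d - 1) (wt M (u @ bl m # v) (j,x))" by (rule HOM_smult_map[OF ppi_HOM[OF M]]) (use uv M x d_def in auto)
    also have "... = \<zero>[M (d - 1)]" by (subst ppi_wt[OF M _ x]) (use uv M d_def in auto)
    finally show "ppi M (d - 1) (sw u *[?P (d - 1)] wt M (u @ bl m # v) (j,x)) = \<zero>[M (d - 1)]" .
   qed (use M in auto)
  qed (use M x d_def in auto)
  then show "gcomp ?P (-1) (ppi M) (dP M) (dg w + j) (wt M w (j,x)) = \<zero>[Hom ?P M (-1)] (dg w + j) (wt M w (j,x))"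
   using w M x d_def by simp
 qed auto
 from fun_cong[OF fun_cong[OF this, of i], of z] show ?thesis using z k by simp
qed

text \<open>A cut of \<open>u @ bl m # v\<close> falls left or right of the letter
  \<open>bl m\<close> and never inside it. The two cases are the two terms of the coderivation
  rule.\<close>

lemma rho_dP:
 assumes M: "gm M" and z: "z <: CT M i" and k: "i - 1 = k"
 shows "rho M k (dP M i z) = tmap C (CT M) C (CT M) (-1) 0 dC (gid (CT M)) i (rho M i z) +[CT (CT M) k]
   cotens (CT M) (CT M) (-1) (dP M) i (rho M i z)"
proof -
 let ?P = "CT M" and ?Q = "CT (CT M)"
 have P: "gm ?P" and Q: "gm ?Q" using M by auto
 note dp = dP_HOM[OF M] and rh = rho_HOM[OF M]
 note t1 = tmap_HOM[OF C P C P K_diff gid_HOM[OF P], of "-1", simplified]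
 note t2 = tmap_HOM[OF C P C P gid_HOM[OF C] dp, of "-1", simplified]
 note HM = HOM_module[OF P Q, of "-1"]
 have "gcomp ?P (-1) (rho M) (dP M) = gcomp ?P 0 (tmap C ?P C ?P (-1) 0 dC (gid ?P)) (rho M) +[Hom ?P ?Q (-1)]
   gcomp ?P 0 (cotens ?P ?P (-1) (dP M)) (rho M)"
 proof (rule CM_HOM_eqI[OF M Q gcomp_HOM[OF P dp rh] m_add[OF HM gcomp_HOM[OF P rh t1] gcomp_HOM[OF P rh t2]]])
  fix w j x assume w: "vw V w" and x: "x <: M j"
  define d where "d = dg w + j"
  define k where "k = d - 1"
  note dk = d_def k_def
  have wt: "wt M v (j,x) <: ?P l" if "vw V v" "dg v + j = l" for v l using that M x by auto
  let ?H = "%a b l. wt ?P a (l + j, wt M b (j,x))"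
  \<comment> \<open>\<open>?L\<close> has the block in the first factor, \<open>?Rr\<close> in the
    second. In \<open>?Rr\<close> the operation passes the first factor \<open>u\<close> as well, so
    its degree joins the sign.\<close>
  let ?L = "%a m b v. sw a *[?Q k] wt ?P (a @ bl m # b) (dg v + j, wt M v (j,x))"
  let ?Rr = "%u a m b. sg (dg u + dg a) *[?Q k] wt ?P u (dg (a @ bl m # b) + j, wt M (a @ bl m # b) (j,x))"
  have L: "?L a m b v <: ?Q k" if "vw V a" "vw V m" "vw V b" "vw V v" "dg w = dg a + dg m + dg b + dg v" for a m b v
   using that wt Q P M x dk by (intro m_smult telt_in) auto
  have Rr: "?Rr u a m b <: ?Q k" if "vw V a" "vw V m" "vw V b" "vw V u" "dg w = dg a + dg m + dg b + dg u" for a m b u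
   using that wt Q P M x dk by (intro m_smult telt_in) auto
  have "rho M k (dP M d (wt M w (j,x))) = sum3 (?Q k) (%u m v. rho M k (sw u *[?P k] wt M (u @ bl m # v) (j,x))) w"
   unfolding dP_wt[OF M w x d_def[symmetric] k_def[symmetric]]
   by (rule HOM_sum3[OF rh P Q w]) (use P x M dk in \<open>auto intro!: m_smult telt_in\<close>)
  also have "... = sum3 (?Q k) (%u m v. sum2 (?Q k) (%a b. ?Rr a b m v) u +[?Q k] sum2 (?Q k) (%a b. ?L u m a b) v) w"
  proof (rule vsum3_cong[OF _ w])
   fix u m v assume uv: "vw V u" "vw V m" "vw V v" "w = u @ m @ v"
   let ?w' = "u @ bl m # v"
   have w': "vw V ?w'" "dg ?w' + j = k" using uv dk by auto
   let ?F = "%a b. sw u *[?Q k] wt ?P a (dg b + j, wt M b (j,x))"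
   have F: "?F a b <: ?Q k" if "?w' = a @ b" for a b
   proof -
    have "vw V (a @ b)" "dg (a @ b) + j = k" using w' unfolding that by auto
    then show ?thesis using P wt M x by (intro m_smult telt_in) auto
   qed
   have "rho M k (sw u *[?P k] telt C M (wd ?w') (j,x)) = sw u *[?Q k] rho M k (telt C M (wd ?w') (j,x))"
    by (rule HOM_smult_map[OF rh]) (use wt[OF w'] in auto)
   also have "... = sum2 (?Q k) ?F ?w'" unfolding rho_wt[OF M w'(1) x w'(2)] by (rule sum2_smult) (use Q P wt w' in auto)
   also have "... = sum2 (?Q k) (%a b. ?F a (b @ bl m # v)) u +[?Q k] sum2 (?Q k) (%a b. ?F (u @ bl m # a) b) v"
    by (rule sum2_ins) (use Q F in auto)
   also have "sum2 (?Q k) (%a b. ?F a (b @ bl m # v)) u = sum2 (?Q k) (%a b. ?Rr a b m v) u"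
    by (rule vsum2_cong[OF _ uv(1)]) (use uv Rr Q in auto)
   finally show "rho M k (sw u *[?P k] telt C M (wd ?w') (j,x)) =
     sum2 (?Q k) (%a b. ?Rr a b m v) u +[?Q k] sum2 (?Q k) (%a b. ?L u m a b) v" .
   show "sum2 (?Q k) (%a b. ?Rr a b m v) u +[?Q k] sum2 (?Q k) (%a b. ?L u m a b) v <: ?Q k"
    using Q L Rr uv by (intro m_add vsum2_closed[OF _ uv(1)] vsum2_closed[OF _ uv(3)]) auto
  qed (use Q in auto)
  also have "... = sum3 (?Q k) (%u m v. sum2 (?Q k) (%a b. ?Rr a b m v) u) w +[?Q k] sum3 (?Q k) (%u m v. sum2 (?Q k) (%a b. ?L u m a b) v) w"
   by (rule sum3_add) (use Q w L Rr in \<open>auto intro!: sum2_closed\<close>)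
  also have "... = sum3 (?Q k) (%u m v. sum2 (?Q k) (%a b. ?L u m a b) v) w +[?Q k] sum3 (?Q k) (%u m v. sum2 (?Q k) (%a b. ?Rr a b m v) u) w"
   by (rule m_comm') (use Q w L Rr in \<open>auto intro!: sum2_closed sum3_closed\<close>)
  also have "sum3 (?Q k) (%u m v. sum2 (?Q k) (%a b. ?L u m a b) v) w = sum2 (?Q k) (%w1 w2. sum3 (?Q k) (%a m b. ?L a m b w2) w1) w"
   by (rule sum3_sum2_right) (use Q w L in auto)
  also have "sum3 (?Q k) (%u m v. sum2 (?Q k) (%a b. ?Rr a b m v) u) w = sum2 (?Q k) (%w1 w2. sum3 (?Q k) (%a m b. ?Rr w1 a m b) w2) w"
   by (rule sum3_sum2_left) (use Q w Rr in auto)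
  also have "sum2 (?Q k) (%w1 w2. sum3 (?Q k) (%a m b. ?L a m b w2) w1) w =
    tmap C ?P C ?P (-1) 0 dC (gid ?P) d (rho M d (wt M w (j,x)))" unfolding rho_wt[OF M w x d_def[symmetric]]
  proof (subst HOM_sum2[OF t1 _ Q w, where k=k])
   show "sum2 (?Q k) (%w1 w2. sum3 (?Q k) (%a m b. ?L a m b w2) w1) w =
    sum2 (?Q k) (%u v. tmap C ?P C ?P (-1) 0 dC (gid ?P) d (wt ?P u (dg v + j, wt M v (j,x)))) w"
   proof (rule vsum2_cong[OF _ w, symmetric])
    fix u v assume uv: "vw V u" "vw V v" "w = u @ v"
    show "tmap C ?P C ?P (-1) 0 dC (gid ?P) d (wt ?P u (dg v + j, wt M v (j,x))) = sum3 (?Q k) (%a m b. ?L a m b v) u"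
     using dP_wt[OF P uv(1) wt[OF uv(2) refl], of d k] uv dk by (simp add: dP_def)
    show "sum3 (?Q k) (%a m b. ?L a m b v) u <: ?Q k" by (rule vsum3_closed[OF _ uv(1)]) (use uv Q L in auto)
   qed (use Q in auto)
  qed (use P wt dk in auto)
  also have "sum2 (?Q k) (%w1 w2. sum3 (?Q k) (%a m b. ?Rr w1 a m b) w2) w =
    cotens ?P ?P (-1) (dP M) d (rho M d (wt M w (j,x)))" unfolding rho_wt[OF M w x d_def[symmetric]]
  proof (subst HOM_sum2[OF t2 _ Q w, where k=k])
   show "sum2 (?Q k) (%w1 w2. sum3 (?Q k) (%a m b. ?Rr w1 a m b) w2) w =
    sum2 (?Q k) (%u v. cotens ?P ?P (-1) (dP M) d (wt ?P u (dg v + j, wt M v (j,x)))) w"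
   proof (rule vsum2_cong[OF _ w, symmetric])
    fix u v assume uv: "vw V u" "vw V v" "w = u @ v"
    let ?l = "dg v + j - 1"
    have "cotens ?P ?P (-1) (dP M) d (wt ?P u (dg v + j, wt M v (j,x))) =
     sg (-1 * dg u) *[?Q k] telt C ?P (dg u + 0, gid C (dg u) (tw u)) (dg v + j + -1, dP M (dg v + j) (wt M v (j,x)))"
     by (rule tmap_elt[OF C P C P gid_HOM[OF C] dp]) (use uv wt dk in auto)
    also have "... = sw u *[?Q k] wt ?P u (?l, sum3 (?P ?l) (%a m b. sw a *[?P ?l] wt M (a @ bl m # b) (j,x)) v)"
     using uv dP_wt[OF M uv(2) x refl refl] by simp
    also have "... = sw u *[?Q k] sum3 (?Q k) (%a m b. wt ?P u (?l, sw a *[?P ?l] wt M (a @ bl m # b) (j,x))) v"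
     by (subst lin_sum3[OF _ _ tens_elt_lin2[OF C P, where d=k]]) (use uv P M x wt dk in \<open>auto intro!: m_smult\<close>)
    also have "... = sum3 (?Q k) (%a m b. sw u *[?Q k] wt ?P u (?l, sw a *[?P ?l] wt M (a @ bl m # b) (j,x))) v"
     by (rule sum3_smult) (use uv P Q M x wt dk in \<open>auto intro!: m_smult telt_in\<close>)
    also have "... = sum3 (?Q k) (%a m b. ?Rr u a m b) v"
    proof (rule vsum3_cong[OF _ uv(2)])
     fix a m b assume ab: "vw V a" "vw V m" "vw V b" "v = a @ m @ b"
     have l: "dg (a @ bl m # b) + j = ?l" using ab by simp
     have c: "wt M (a @ bl m # b) (j,x) <: ?P ?l" using ab by (intro wt) auto
     have c2: "wt ?P u (?l, wt M (a @ bl m # b) (j,x)) <: ?Q k" by (rule telt_in[OF C P _ c]) (use uv dk in auto)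
     have "wt ?P u (?l, sw a *[?P ?l] wt M (a @ bl m # b) (j,x)) =
      sw a *[?Q k] wt ?P u (?l, wt M (a @ bl m # b) (j,x))" by (rule tens_smult_r[OF C P _ _ c]) (use uv dk in auto)
     then show "sw u *[?Q k] wt ?P u (?l, sw a *[?P ?l] wt M (a @ bl m # b) (j,x)) = ?Rr u a m b" unfolding l using Q c2 by simp
     show "?Rr u a m b <: ?Q k" using Rr uv ab by auto
    qed (use Q in auto)
    finally show "cotens ?P ?P (-1) (dP M) d (wt ?P u (dg v + j, wt M v (j,x))) = sum3 (?Q k) (%a m b. ?Rr u a m b) v" .
    show "sum3 (?Q k) (%a m b. ?Rr u a m b) v <: ?Q k" by (rule vsum3_closed[OF _ uv(2)]) (use uv Q Rr in auto)
   qed (use Q in auto)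
  qed (use P wt dk in auto)
  finally show "gcomp ?P (-1) (rho M) (dP M) (dg w + j) (wt M w (j,x)) =
   (gcomp ?P 0 (tmap C ?P C ?P (-1) 0 dC (gid ?P)) (rho M) +[Hom ?P ?Q (-1)]
   gcomp ?P 0 (cotens ?P ?P (-1) (dP M)) (rho M)) (dg w + j) (wt M w (j,x))" using wt[OF w refl] by (simp add: dk)
 qed auto
 from fun_cong[OF fun_cong[OF this, of i], of z] show ?thesis using z k by auto
qed

lemma phi_inv_eq: "phi_inv R K M m = dP M +[Hom (CT M) (CT M) (-1)] Phi M M (-1) m"
 by (simp add: phi_inv_def Let_def dP_def Phi_def rho_def)

lemma phi_inv_HOM:
 assumes M: "gm M" and m: "m <: Hom (CT M) M (-1)"
 shows "phi_inv R K M m <: Hom (CT M) (CT M) (-1)" unfolding phi_inv_eq using HOM_module dP_HOM[OF M] Phi_HOM[OF M M m] M by simp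

lemma phi_inv_apply:
 "z <: CT M i ==> i - 1 = k ==> phi_inv R K M m i z = dP M i z +[CT M k] Phi M M (-1) m i z" unfolding phi_inv_eq by auto

lemma coder_iff:
 assumes M: "gm M"
 shows "is_coderivation R K (cofree_comod R K M) D \<longleftrightarrow> D <: Hom (CT M) (CT M) (-1) \<and>
  (\<forall>i. \<forall>z\<in>carrier (CT M i). rho M (i - 1) (D i z) =
   tmap C (CT M) C (CT M) (-1) 0 dC (gid (CT M)) i (rho M i z) +[CT (CT M) (i - 1)]
   cotens (CT M) (CT M) (-1) D i (rho M i z))"
proof -
 have "rho M i z <: CT (CT M) i" if "z <: CT M i" for i z by (rule HOM_in[OF rho_HOM[OF M] that]) simp
 then show ?thesis unfolding is_coderivation_def cofree_eq Let_def prod.case K_mod gcomp_eq_iff by (auto simp: eq_commute[of "rho M _ _"])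
qed

lemma coderD:
 assumes "gm M" "is_coderivation R K (cofree_comod R K M) D"
 shows "D <: Hom (CT M) (CT M) (-1)"
  "!!i z k. z <: CT M i ==> i - 1 = k ==> rho M k (D i z) =
   tmap C (CT M) C (CT M) (-1) 0 dC (gid (CT M)) i (rho M i z) +[CT (CT M) k]
   cotens (CT M) (CT M) (-1) D i (rho M i z)" using assms by (auto simp: coder_iff)

lemma coder_phi_inv:
 assumes M: "gm M" and m: "m <: Hom (CT M) M (-1)"
 shows "is_coderivation R K (cofree_comod R K M) (phi_inv R K M m)" unfolding coder_iff[OF M]
proof (intro conjI allI ballI)
 show "phi_inv R K M m <: Hom (CT M) (CT M) (-1)" by (rule phi_inv_HOM[OF M m])
 fix i z assume z: "z <: CT M i"
 let ?P = "CT M" and ?Q = "CT (CT M)"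
 have P: "gm ?P" and Q: "gm ?Q" using M by auto
 note dp = dP_HOM[OF M] and rh = rho_HOM[OF M] and ph = Phi_HOM[OF M M m]
 have rz: "rho M i z <: ?Q i" by (rule HOM_in[OF rh z]) simp
 have c: "dP M i z <: ?P (i - 1)" "Phi M M (-1) m i z <: ?P (i - 1)" using HOM_in[OF dp z] HOM_in[OF ph z] by auto
 have c2: "tmap C ?P C ?P (-1) 0 dC (gid ?P) i (rho M i z) <: ?Q (i - 1)"
  "cotens ?P ?P (-1) (dP M) i (rho M i z) <: ?Q (i - 1)"
  "cotens ?P ?P (-1) (Phi M M (-1) m) i (rho M i z) <: ?Q (i - 1)" using HOM_in[OF tmap_HOM[OF C P C P K_diff gid_HOM[OF P] refl] rz]
   HOM_in[OF tmap_HOM[OF C P C P gid_HOM[OF C] dp refl] rz]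
   HOM_in[OF tmap_HOM[OF C P C P gid_HOM[OF C] ph refl] rz] by auto
 have "rho M (i - 1) (phi_inv R K M m i z) = rho M (i - 1) (dP M i z) +[?Q (i - 1)] rho M (i - 1) (Phi M M (-1) m i z)"
  unfolding phi_inv_apply[OF z refl] by (rule HOM_add_map[OF rh _ c]) simp
 also have "... = (tmap C ?P C ?P (-1) 0 dC (gid ?P) i (rho M i z) +[?Q (i - 1)]
   cotens ?P ?P (-1) (dP M) i (rho M i z)) +[?Q (i - 1)]
   cotens ?P ?P (-1) (Phi M M (-1) m) i (rho M i z)" by (simp add: rho_dP[OF M z] rho_Phi[OF M M m z])
 also have "... = tmap C ?P C ?P (-1) 0 dC (gid ?P) i (rho M i z) +[?Q (i - 1)]
   cotens ?P ?P (-1) (phi_inv R K M m) i (rho M i z)"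
  unfolding phi_inv_eq by (subst tens_map_add_r[OF C P C P gid_HOM[OF C] dp ph rz]) (use Q c2 in \<open>auto simp: m_assoc'\<close>)
 finally show "rho M (i - 1) (phi_inv R K M m i z) = tmap C ?P C ?P (-1) 0 dC (gid ?P) i (rho M i z) +[?Q (i - 1)]
   cotens ?P ?P (-1) (phi_inv R K M m) i (rho M i z)" .
qed

lemma ppi_phi_inv:
 assumes M: "gm M" and m: "m <: Hom (CT M) M (-1)" and z: "z <: CT M i" and k: "i - 1 = k"
 shows "ppi M k (phi_inv R K M m i z) = m i z"
proof -
 have "ppi M k (phi_inv R K M m i z) = ppi M k (dP M i z) +[M k] ppi M k (Phi M M (-1) m i z)" unfolding phi_inv_apply[OF z k]
  by (rule HOM_add_map[OF ppi_HOM[OF M]]) (use HOM_in[OF dP_HOM[OF M] z] HOM_in[OF Phi_HOM[OF M M m] z] k in auto)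
 also have "... = m i z" using ppi_dP[OF M z k] ppi_Phi[OF M M m] z k M HOM_in[OF m z, of k]
  by (auto simp: fun_eq_iff dest!: spec[of _ i] spec[of _ z])
 finally show ?thesis .
qed

text \<open>\<open>D\<close> and \<open>phi_inv\<close> of its projection obey the same coaction
  rule, with \<open>Z\<close> the part \<open>d (x) 1\<close>, and they have the same projection by
  \<open>ppi_phi_inv\<close>.\<close>

lemma coder_eq:
 assumes M: "gm M" and D: "is_coderivation R K (cofree_comod R K M) D"
 shows "D = phi_inv R K M (gcomp (CT M) (-1) (ppi M) D)"
proof -
 let ?P = "CT M" and ?Q = "CT (CT M)"
 have P: "gm ?P" using M by auto
 note cD = coderD[OF M D]
 have m: "gcomp ?P (-1) (ppi M) D <: Hom ?P M (-1)" by (rule gcomp_HOM[OF P cD(1) ppi_HOM[OF M]]) simp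
 note cE = coderD[OF M coder_phi_inv[OF M m]]
 show ?thesis
 proof (rule ppi_unique[OF M M cD(1) cE(1), where Z="%i z. tmap C ?P C ?P (-1) 0 dC (gid ?P) i (rho M i z)"])
  fix i z assume z: "z <: ?P i"
  have rz: "rho M i z <: ?Q i" by (rule HOM_in[OF rho_HOM[OF M] z]) simp
  show "tmap C ?P C ?P (-1) 0 dC (gid ?P) i (rho M i z) <: ?Q (i + -1)"
   using HOM_in[OF tmap_HOM[OF C P C P K_diff gid_HOM[OF P] refl] rz] by auto
 next
  show "gcomp ?P (-1) (ppi M) D = gcomp ?P (-1) (ppi M) (phi_inv R K M (gcomp ?P (-1) (ppi M) D))"
   unfolding gcomp_eq_iff by (auto simp: ppi_phi_inv[OF M m])
 qed (use cD(2) cE(2) in auto)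
qed

lemma comod_mor_iff:
 assumes M: "gm M" and N: "gm N"
 shows "\<Psi> \<in> comodule_mor R K (cofree_comod R K M) (cofree_comod R K N) \<longleftrightarrow>
  \<Psi> <: Hom (CT M) (CT N) 0 \<and>
  (\<forall>i. \<forall>z\<in>carrier (CT M i). rho N i (\<Psi> i z) = cotens (CT M) (CT N) 0 \<Psi> i (rho M i z))"
 unfolding comodule_mor_def cofree_eq Let_def prod.case K_mod mem_Collect_eq gcomp_eq_iff by auto

lemma Phi_mor:
 assumes M: "gm M" and N: "gm N" and m: "m <: Hom (CT M) N 0"
 shows "Phi M N 0 m \<in> comodule_mor R K (cofree_comod R K M) (cofree_comod R K N)"
 unfolding comod_mor_iff[OF M N] using Phi_HOM[OF M N m] rho_Phi[OF M N m] by auto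

lemma mor_eq:
 assumes M: "gm M" and N: "gm N" and \<Psi>: "\<Psi> \<in> comodule_mor R K (cofree_comod R K M) (cofree_comod R K N)"
 shows "\<Psi> = Phi M N 0 (gcomp (CT M) 0 (ppi N) \<Psi>)"
proof -
 let ?P = "CT M" and ?Q = "CT N"
 have P: "gm ?P" and Q: "gm ?Q" and CQ: "gm (CT ?Q)" using M N by auto
 have p: "\<Psi> <: Hom ?P ?Q 0" "!!i z. z <: ?P i ==> rho N i (\<Psi> i z) = cotens ?P ?Q 0 \<Psi> i (rho M i z)"
  using \<Psi> unfolding comod_mor_iff[OF M N] by auto
 have m: "gcomp ?P 0 (ppi N) \<Psi> <: Hom ?P N 0" by (rule gcomp_HOM[OF P p(1) ppi_HOM[OF N]]) simp
 note ph = Phi_HOM[OF M N m]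
 have rz: "rho M i z <: CT ?P i" if z: "z <: ?P i" for i z by (rule HOM_in[OF rho_HOM[OF M] z]) simp
 have t: "cotens ?P ?Q 0 Y i (rho M i z) <: CT ?Q i"
  if "Y <: Hom ?P ?Q 0" "z <: ?P i" for Y i z using HOM_in[OF tmap_HOM[OF C P C Q gid_HOM[OF C] that(1) refl] rz[OF that(2)]] by auto
 show ?thesis by (rule ppi_unique[OF M N p(1) ph, where Z="%i z. \<zero>[CT ?Q i]"])
   (use p(2) rho_Phi[OF M N m] ppi_Phi[OF M N m] CQ t[OF p(1)] t[OF ph] in auto)
qed

subsection \<open>The square of the differential of the tensor coalgebra\<close>

lemma tco_word_kact:
 assumes a: "vw V a" and b: "vw V b" and p: "vw V [p]" and r: "r <: R" and l: "i + fst p = l"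
 shows "tw (a @ (l, kact V (i,r) p) # b) = kact C (i,r) (dg (a @ p # b), tw (a @ p # b))"
proof -
 obtain j y where py: "p = (j,y)" by (cases p)
 have y: "y <: V j" using p py by simp
 show ?thesis
 proof (cases "i = 0")
  case True
  then show ?thesis using lin_smult[OF tco_word_lin[OF V a b refl, of j] r y] l py by (simp add: kact_def add.assoc)
 next
  case False
  have e: "dg a + (i + j) + dg b = i + (dg a + (j + dg b))" by simp
  have "tw (a @ (i + j, \<zero>[V (i + j)]) # b) = \<zero>[C (dg a + (i + j) + dg b)]"
   by (rule lin_zero[OF _ _ tco_word_lin[OF V a b refl]]) auto
  then show ?thesis using False l py unfolding e by (auto simp add: kact_def)
 qed
qed

text \<open>A second insertion is disjoint from the first or encloses its output. Disjoint
  insertions cancel in pairs. Enclosing ones reduce by \<open>bb\<close> to replacing a block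
  \<open>c\<close> by its last letter, minus replacing it by its first letter, with
  \<open>xi\<close> of the other letters as coefficient. Summed over all blocks this telescopes to
  the blocks that start or end the word.\<close>

lemma d2_word:
 assumes w: "vw V w" and k: "dg w - 2 = k" "dg w - 1 = l"
 shows "dC l (dC (dg w) (tw w)) =
  sum2 (C k) (%u v. kact C (dg u - 2, xi u) (wd v)) w -[C k] sum2 (C k) (%u v. kact C (dg v - 2, xi v) (wd u)) w"
proof -
 have m: "md (C k)" by simp
 have canc: "z +[C k] (y +[C k] -[C k] z) = y" if "z <: C k" "y <: C k" for z y using that m m_lcomm'[OF m that m_neg[OF m that(1)]] by simp
 let ?s = "%n z. sg n *[C k] z"
 let ?A = "%a n b m v. tw (a @ bl n # b @ bl m # v)"
 have Ac: "?A a n b m v <: C k" if "vw V a" "vw V n" "vw V b" "vw V m" "vw V v" "dg w = dg a + dg n + dg b + dg m + dg v" for a n b m v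
  using that k by (intro tco_word_closed) auto
 let ?I = "%a m1 m m2 b. tw (a @ bl (m1 @ bl m # m2) # b)"
 have Ic: "?I a m1 m m2 b <: C k" if "vw V a" "vw V m1" "vw V m2" "vw V m" "vw V b" "dg w = dg a + dg m1 + dg m + dg m2 + dg b" for a m1 m m2 b
  using that k by (intro tco_word_closed) auto
 let ?T1 = "sum3 (C k) (%u m v. sum3 (C k) (%a n b. ?s (dg u + dg a) (?A a n b m v)) u) w"
 let ?T3 = "sum3 (C k) (%u m v. sum3 (C k) (%a n b. ?s (dg u + (dg (u @ bl m # a))) (?A u m a n b)) v) w"
 let ?T2 = "sum3 (C k) (%u m v. sum2 (C k) (%a m1. sum2 (C k) (%m2 b. ?s (dg u + dg a) (?I a m1 m m2 b)) v) u) w"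
 have T1: "?T1 <: C k" by (rule vsum3_closed[OF m w], rule vsum3_closed[OF m]) (use Ac m in auto)
 have T2: "?T2 <: C k" by (rule vsum3_closed[OF m w], rule vsum2_closed[OF m], assumption, rule vsum2_closed[OF m]) (use Ic m in auto)
 have T3: "?T3 <: C k" by (rule vsum3_closed[OF m w], rule vsum3_closed[OF m]) (use Ac m in auto)
 have "dC l (dC (dg w) (tw w)) = sum3 (C k) (%u m v. dC l (sw u *[C l] tw (u @ bl m # v))) w"
  unfolding dC_word[OF w refl k(2)] by (rule HOM_sum3[OF K_diff C C w]) (use k in auto)
 also have "... = sum3 (C k) (%u m v. sum3 (C k) (%a n b. ?s (dg u + dg a) (?A a n b m v)) u +[C k]
   (sum2 (C k) (%a m1. sum2 (C k) (%m2 b. ?s (dg u + dg a) (?I a m1 m m2 b)) v) u +[C k]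
    sum3 (C k) (%a n b. ?s (dg u + (dg (u @ bl m # a))) (?A u m a n b)) v)) w"
 proof (rule vsum3_cong[OF m w])
  fix u n v assume uv: "vw V u" "vw V n" "vw V v" "w = u @ n @ v"
  let ?w' = "u @ bl n # v"
  have w': "vw V ?w'" "dg ?w' = l" using uv k by auto
  let ?F = "%a m b. ?s (dg u + dg a) (tw (a @ bl m # b))"
  have F0: "tw (a @ bl m # b) <: C k" if "?w' = a @ m @ b" for a m b
  proof -
   have "vw V (a @ m @ b)" "dg (a @ m @ b) = l" using w' unfolding that by auto
   then show ?thesis using k by (intro tco_word_closed) auto
  qed
  have "dC l (sw u *[C l] tw ?w') = ?s (dg u) (dC l (tw ?w'))" by (rule HOM_smult_map[OF K_diff]) (use w' k in auto)
  also have "dC l (tw ?w') = sum3 (C k) (%a m b. ?s (dg a) (tw (a @ bl m # b))) ?w'" by (rule dC_word[OF w']) (use k in auto)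
  also have "?s (dg u) ... = sum3 (C k) (%a m b. ?s (dg u) (?s (dg a) (tw (a @ bl m # b)))) ?w'"
   by (rule sum3_smult[OF m]) (use F0 m in auto)
  also have "... = sum3 (C k) ?F ?w'" by (rule sum3_cong[OF m]) (use F0 m in auto)
  also have "... = sum3 (C k) (%a m b. ?F a m (b @ bl n # v)) u +[C k]
   (sum2 (C k) (%a m1. sum2 (C k) (%m2 b. ?F a (m1 @ bl n # m2) b) v) u +[C k] sum3 (C k) (%a m b. ?F (u @ bl n # a) m b) v)"
   by (rule sum3_ins[OF m]) (use F0 m in auto)
  finally show "dC l (sw u *[C l] tw ?w') = sum3 (C k) (%a m b. ?s (dg u + dg a) (?A a m b n v)) u +[C k]
   (sum2 (C k) (%a m1. sum2 (C k) (%m2 b. ?s (dg u + dg a) (?I a m1 n m2 b)) v) u +[C k]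
    sum3 (C k) (%a m b. ?s (dg u + (dg (u @ bl n # a))) (?A u n a m b)) v)" by simp
  show "sum3 (C k) (%a m b. ?s (dg u + dg a) (?A a m b n v)) u +[C k]
   (sum2 (C k) (%a m1. sum2 (C k) (%m2 b. ?s (dg u + dg a) (?I a m1 n m2 b)) v) u +[C k]
    sum3 (C k) (%a m b. ?s (dg u + (dg (u @ bl n # a))) (?A u n a m b)) v) <: C k"
   by (intro m_add[OF m], rule vsum3_closed[OF m uv(1)], (use uv Ac m in simp),
     rule vsum2_closed[OF m uv(1)], rule vsum2_closed[OF m uv(3)], (use uv Ic m in simp),
     rule vsum3_closed[OF m uv(3)]) (use uv Ac m in simp)
 qed
 also have "... = ?T1 +[C k] sum3 (C k) (%u m v. sum2 (C k) (%a m1. sum2 (C k) (%m2 b. ?s (dg u + dg a) (?I a m1 m m2 b)) v) u +[C k]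
    sum3 (C k) (%a n b. ?s (dg u + (dg (u @ bl m # a))) (?A u m a n b)) v) w"
  by (rule sum3_add[OF m]) (use w m Ac Ic in \<open>auto intro!: m_add[OF m] sum2_closed[OF m] sum3_closed[OF m] simp del: wdeg_simps, auto\<close>)
 also have "... = ?T1 +[C k] (?T2 +[C k] ?T3)"
  by (subst sum3_add[OF m]) (use w m Ac Ic in \<open>auto intro!: m_add[OF m] sum2_closed[OF m] sum3_closed[OF m] simp del: wdeg_simps, auto\<close>)
 \<comment> \<open>In \<open>?T3\<close> the prefix of the second block already contains
   \<open>bl m\<close>, whose degree is one less than that of \<open>m\<close>; this flips the sign
   against the opposite order of insertion.\<close>
 also have "?T3 = -[C k] ?T1"
 proof -
  have "?T3 = sum3 (C k) (%a n v. sum3 (C k) (%u m v1. ?s (dg u + (dg (u @ bl m # v1))) (?A u m v1 n v)) a) w"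
   by (rule sum3_sum3[OF m]) (use w m Ac in auto)
  also have "... = sum3 (C k) (%u m v. -[C k] sum3 (C k) (%a n b. ?s (dg u + dg a) (?A a n b m v)) u) w"
  proof (rule vsum3_cong[OF m w])
   fix u n v assume uv: "vw V u" "vw V n" "vw V v" "w = u @ n @ v"
   have "-[C k] sum3 (C k) (%a p b. ?s (dg u + dg a) (?A a p b n v)) u = sum3 (C k) (%a p b. -[C k] ?s (dg u + dg a) (?A a p b n v)) u"
    by (rule sum3_neg[OF m]) (use uv m Ac in auto)
   also have "... = sum3 (C k) (%u p v1. ?s (dg u + (dg (u @ bl p # v1))) (?A u p v1 n v)) u"
   proof (rule vsum3_cong[OF m uv(1)])
    fix a p b assume ab: "vw V a" "vw V p" "vw V b" "u = a @ p @ b"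
    have c: "?A a p b n v <: C k" by (rule Ac) (use uv ab in auto)
    show "-[C k] ?s (dg u + dg a) (?A a p b n v) = ?s (dg a + dg (a @ bl p # b)) (?A a p b n v)"
     using sgn_neg[OF m c, of "dg a + dg (a @ bl p # b)" "dg u + dg a"] ab by simp
    show "?s (dg a + dg (a @ bl p # b)) (?A a p b n v) <: C k" using c m by simp
   qed
   finally show "sum3 (C k) (%u p v1. ?s (dg u + (dg (u @ bl p # v1))) (?A u p v1 n v)) u = -[C k] sum3 (C k) (%a p b. ?s (dg u + dg a) (?A a p b n v)) u" by simp
   show "-[C k] sum3 (C k) (%a p b. ?s (dg u + dg a) (?A a p b n v)) u <: C k"
    by (rule m_neg[OF m], rule vsum3_closed[OF m uv(1)]) (use uv m Ac in auto)
  qed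
  also have "... = -[C k] ?T1" by (rule sum3_neg[OF m, symmetric]) (use w m Ac in \<open>auto intro!: sum3_closed[OF m]\<close>)
  finally show ?thesis .
 qed
 also have "?T1 +[C k] (?T2 +[C k] -[C k] ?T1) = ?T2" by (rule canc[OF T1 T2])
 also have "?T2 = sum3 (C k) (%a c b. sum3 (C k) (%m1 m m2. ?s (dg (a @ m1) + dg a) (?I a m1 m m2 b)) c) w"
 proof -
  have "?T2 = sum3 (C k) (%u m v. sum2 (C k) (%a m1. sum2 (C k) (%m2 b. ?s (dg (a @ m1) + dg a) (?I a m1 m m2 b)) v) u) w"
   by (rule vsum3_cong[OF m w], rule vsum2_cong[OF m], assumption, rule vsum2_cong[OF m])
    (use m Ic in \<open>auto intro!: vsum2_closed[OF m]\<close>)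
  also have "... = sum3 (C k) (%a c b. sum3 (C k) (%m1 m m2. ?s (dg (a @ m1) + dg a) (?I a m1 m m2 b)) c) w"
   by (rule sum3_mid[OF m]) (use w m Ic in auto)
  finally show ?thesis .
 qed
 \<comment> \<open>\<open>bb\<close> speaks of nonempty blocks; an empty \<open>c\<close>
   contributes zero because \<open>bm []\<close> vanishes.\<close>
 also have "... = sum3 (C k) (%a c b. if c = [] then \<zero>[C k] else
   kact C (dg (butlast c) - 2, xi (butlast c)) (wd (a @ last c # b)) -[C k] kact C (dg (tl c) - 2, xi (tl c)) (wd (a @ hd c # b))) w"
 proof (rule vsum3_cong[OF m w])
  fix a c b assume uv: "vw V a" "vw V c" "vw V b" "w = a @ c @ b"
  have l: "lin R (V (dg c - 2)) (C k) (%y. tw (a @ (dg c - 2, y) # b))" by (rule tco_word_lin[OF V uv(1,3)]) (use uv k in auto)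
  have Vm: "md (V (dg c - 2))" by simp
  have bc: "sw m1 *[V (dg c - 2)] bm (m1 @ bl n # m2) <: V (dg c - 2)" if "c = m1 @ n @ m2" for m1 n m2
   using that uv Vm by (intro m_smult bm_closed) auto
  have "sum3 (C k) (%m1 m m2. ?s (dg (a @ m1) + dg a) (?I a m1 m m2 b)) c =
   sum3 (C k) (%m1 n m2. tw (a @ (dg c - 2, sw m1 *[V (dg c - 2)] bm (m1 @ bl n # m2)) # b)) c"
  proof (rule vsum3_cong[OF m uv(2)])
   fix m1 n m2 assume mm: "vw V m1" "vw V n" "vw V m2" "c = m1 @ n @ m2"
   have e: "dg (m1 @ bl n # m2) - 1 = dg c - 2" using mm by simp
   have "bm (m1 @ bl n # m2) <: V (dg c - 2)" using mm by (intro bm_closed) auto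
   from lin_smult[OF l sgn_in this]
   show "?s (dg (a @ m1) + dg a) (?I a m1 n m2 b) = tw (a @ (dg c - 2, sw m1 *[V (dg c - 2)] bm (m1 @ bl n # m2)) # b)"
    unfolding e by (simp add: sgn_cong[of "2 * dg a + dg m1" "dg m1"])
   show "tw (a @ (dg c - 2, sw m1 *[V (dg c - 2)] bm (m1 @ bl n # m2)) # b) <: C k" by (rule lin_closed[OF l bc[OF mm(4)]])
  qed
  also have "... = tw (a @ (dg c - 2, sum3 (V (dg c - 2)) (%m1 n m2. sw m1 *[V (dg c - 2)] bm (m1 @ bl n # m2)) c) # b)"
   by (rule lin_sum3[OF Vm m l bc, symmetric])
  also have "... = (if c = [] then \<zero>[C k] else
   kact C (dg (butlast c) - 2, xi (butlast c)) (wd (a @ last c # b)) -[C k] kact C (dg (tl c) - 2, xi (tl c)) (wd (a @ hd c # b)))"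
  proof (cases "c = []")
   case True
   have "lin R (V (-1)) (V (-2)) (%y. bm ([] @ (-1, y) # []))" by (rule mlin_lin[OF b_mlin]) auto
   from lin_zero[OF _ _ this] have "bm [(-1, bm [])] = \<zero>[V (-2)]" by (simp add: b_Nil)
   then show ?thesis using True lin_zero[OF Vm m l] V by (simp del: V) 
  next
   case False
   have "vw V (butlast c @ [last c])" "vw V (hd c # tl c)" using uv(2) False by simp_all
   then have bt: "vw V (butlast c)" "vw V (tl c)" "vw V [last c]" "vw V [hd c]" by simp_all
   have "dg c = dg (butlast c @ [last c])" "dg c = dg (hd c # tl c)" using False by simp_all
   then have dg: "dg (butlast c) - 2 + fst (last c) = dg c - 2" "dg (tl c) - 2 + fst (hd c) = dg c - 2" by simp_all
   have kc: "kact V (dg (butlast c) - 2, xi (butlast c)) (last c) <: V (dg c - 2)"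
    "kact V (dg (tl c) - 2, xi (tl c)) (hd c) <: V (dg c - 2)"
    using bt dg by (auto simp: kact_closed[of V _ "snd (last c)" "fst (last c)", simplified] kact_closed[of V _ "snd (hd c)" "fst (hd c)", simplified])
   show ?thesis using False unfolding bb[OF uv(2) False] lin_minus[OF Vm m l kc]
    by (simp add: tco_word_kact[OF uv(1,3) bt(3) xi_closed[OF bt(1)] dg(1)] tco_word_kact[OF uv(1,3) bt(4) xi_closed[OF bt(2)] dg(2)])
  qed
  finally show e: "sum3 (C k) (%m1 m m2. ?s (dg (a @ m1) + dg a) (?I a m1 m m2 b)) c = (if c = [] then \<zero>[C k] else
   kact C (dg (butlast c) - 2, xi (butlast c)) (wd (a @ last c # b)) -[C k] kact C (dg (tl c) - 2, xi (tl c)) (wd (a @ hd c # b)))" .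
  show "(if c = [] then \<zero>[C k] else
   kact C (dg (butlast c) - 2, xi (butlast c)) (wd (a @ last c # b)) -[C k] kact C (dg (tl c) - 2, xi (tl c)) (wd (a @ hd c # b))) <: C k"
   unfolding e[symmetric] by (rule vsum3_closed[OF m uv(2)]) (use uv m Ic in auto)
 qed
 also have "... = sum2 (C k) (%u v. kact C (dg u - 2, xi u) (wd v)) w -[C k] sum2 (C k) (%u v. kact C (dg v - 2, xi v) (wd u)) w"
 proof -
  \<comment> \<open>\<open>?E (a, c, b)\<close> deletes the block \<open>c\<close> and multiplies by
    \<open>xi c\<close>. Keeping the last letter of a nonempty block means deleting a block with
    something to its right, keeping the first letter means deleting one with something to its left.
    All deletions that fall under both descriptions cancel.\<close>
  let ?E = "%(a, c, b). kact C (dg c - 2, xi c) (wd (a @ b))"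
  have E: "?E s <: C k" if "s \<in> S3 w" for s
  proof -
   obtain a c b where s: "s = (a, c, b)" by (cases s)
   then have "vw V a" "vw V c" "vw V b" "dg w = dg a + dg c + dg b" using that w by auto
   then show ?thesis using k s by (auto intro!: kact_closed)
  qed
  let ?A0 = "{s \<in> S3 w. snd (snd s) = []}" and ?B0 = "{s \<in> S3 w. fst s = []}" and ?N = "{s \<in> S3 w. fst (snd s) ~= []}"
  let ?f = "%s. ?E (fst s, butlast (fst (snd s)), last (fst (snd s)) # snd (snd s))"
  let ?g = "%s. ?E (fst s @ [hd (fst (snd s))], tl (fst (snd s)), snd (snd s))"
  have fb: "bij_betw (%s. (fst s, butlast (fst (snd s)), last (fst (snd s)) # snd (snd s))) ?N (S3 w - ?A0)"
   by (rule bij_betwI[where g="%s. (fst s, fst (snd s) @ [hd (snd (snd s))], tl (snd (snd s)))"]) auto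
  have gb: "bij_betw (%s. (fst s @ [hd (fst (snd s))], tl (fst (snd s)), snd (snd s))) ?N (S3 w - ?B0)"
   by (rule bij_betwI[where g="%s. (butlast (fst s), last (fst s) # fst (snd s), snd (snd s))"]) auto
  have f: "finsum (C k) ?f ?N = finsum (C k) ?E (S3 w - ?A0)" by (rule fs_bij[OF m fb]) (use E in auto)
  have g: "finsum (C k) ?g ?N = finsum (C k) ?E (S3 w - ?B0)" by (rule fs_bij[OF m gb]) (use E in auto)
  have fc: "?f s <: C k" "?g s <: C k" if "s \<in> ?N" for s using bij_betwE[OF fb] bij_betwE[OF gb] that E by blast+
  have "sum3 (C k) (%a c b. if c = [] then \<zero>[C k] else
    kact C (dg (butlast c) - 2, xi (butlast c)) (wd (a @ last c # b)) -[C k] kact C (dg (tl c) - 2, xi (tl c)) (wd (a @ hd c # b))) w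
   = finsum (C k) (%s. ?f s -[C k] ?g s) ?N"
  proof (subst sum3_restrict[OF m, where A="?N"])
   show "finsum (C k) (%s. if fst (snd s) = [] then \<zero>[C k] else
    kact C (dg (butlast (fst (snd s))) - 2, xi (butlast (fst (snd s)))) (wd (fst s @ last (fst (snd s)) # snd (snd s))) -[C k]
    kact C (dg (tl (fst (snd s))) - 2, xi (tl (fst (snd s)))) (wd (fst s @ hd (fst (snd s)) # snd (snd s)))) ?N = finsum (C k) (%s. ?f s -[C k] ?g s) ?N"
    by (rule fs_cong[OF m refl]) (use fc m_minus[OF m] in \<open>auto simp: add.assoc\<close>)
  next
   fix u n v assume "w = u @ n @ v" "(u, n, v) \<in> ?N"
   then show "(if n = [] then \<zero>[C k] else
    kact C (dg (butlast n) - 2, xi (butlast n)) (wd (u @ last n # v)) -[C k] kact C (dg (tl n) - 2, xi (tl n)) (wd (u @ hd n # v))) <: C k"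
    using fc[of "(u, n, v)"] m by (auto simp: add.assoc)
  qed auto
  also have "... = finsum (C k) ?f ?N -[C k] finsum (C k) ?g ?N" unfolding a_minus_def
   by (subst fs_neg[OF m]) (use fc m fs_add[OF m, of ?N ?f "%s. -[C k] ?g s"] in auto)
  also have "... = finsum (C k) ?E ?B0 -[C k] finsum (C k) ?E ?A0"
  proof -
   have t: "finsum (C k) ?E (S3 w - ?A0) +[C k] finsum (C k) ?E ?A0 = finsum (C k) ?E (S3 w - ?B0) +[C k] finsum (C k) ?E ?B0"
    by (rule fs_tele[OF m]) (use E in auto)
   have c: "finsum (C k) ?E X <: C k" if "X \<subseteq> S3 w" for X by (rule fs_closed[OF m]) (use that E in blast)
   have alg: "x -[C k] y = b -[C k] a" if "x +[C k] a = y +[C k] b" "x <: C k" "y <: C k" "a <: C k" "b <: C k" for x y a b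
   proof -
    have "x = y +[C k] b +[C k] -[C k] a" using that m by (metis m_assoc' m_neg m_rneg m_rzero)
    then show ?thesis using that m canc[of y "-[C k] a"] unfolding a_minus_def by (simp add: m_ac)
   qed
   show ?thesis unfolding f g by (rule alg[OF t]; rule c; blast)
  qed
  also have "finsum (C k) ?E ?B0 = sum2 (C k) (%u v. kact C (dg u - 2, xi u) (wd v)) w" unfolding sum2_def
   by (rule fs_bij[OF m, where h=snd], rule bij_betwI[where g="%s. ([], s)"]) (use w k in \<open>auto intro!: kact_closed\<close>)
  also have "finsum (C k) ?E ?A0 = sum2 (C k) (%u v. kact C (dg v - 2, xi v) (wd u)) w" unfolding sum2_def
   by (rule fs_bij[OF m, where h="%s. (fst s, fst (snd s))"], rule bij_betwI[where g="%s. (fst s, snd s, [])"]) (use w k in \<open>auto intro!: kact_closed\<close>)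
  finally show ?thesis .
 qed
 finally show ?thesis .
qed

section \<open>The curvature equation and commutation with the differentials\<close>

definition Xc :: "('k,'m) gmod \<Rightarrow> (('k, nat \<Rightarrow> ('k,'v) tpow, 'm) tens, ('k, nat \<Rightarrow> ('k,'v) tpow, 'm) tens) gmap" where
 "Xc M = gcomp (CT M) (-2) (tens_lunit R (CT M))
   (gcomp (CT M) 0 (tmap C (CT M) (kmod R) (CT M) (-2) 0 (coalg_curv K) (gid (CT M))) (rho M))"

lemma Xc_HOM: assumes M: "gm M" shows "Xc M <: Hom (CT M) (CT M) (-2)"
proof -
 have P: "gm (CT M)" using M by simp
 show ?thesis unfolding Xc_def
  by (rule gcomp_HOM[OF P gcomp_HOM[OF P rho_HOM[OF M] tmap_HOM[OF C P kmod_module P K_curv gid_HOM[OF P] refl]] tens_lunit_HOM[OF P]]) auto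
qed

lemma Xc_wt:
 assumes M: "gm M" and w: "vw V w" and x: "x <: M j" and d: "dg w + j = d" "d - 2 = k"
 shows "Xc M d (wt M w (j,x)) =
  sum2 (CT M k) (%u v. kact (CT M) (dg u - 2, xi u) (dg v + j, wt M v (j,x))) w"
proof -
 let ?P = "CT M"
 have P: "gm ?P" using M by simp
 have kP: "gm (tns (kmod R) ?P)" using P by simp
 note t = tmap_HOM[OF C P kmod_module P K_curv gid_HOM[OF P], of "-2", simplified]
 have wt: "wt M v (j,x) <: ?P l" if "vw V v" "dg v + j = l" for v l using that M x by auto
 have "Xc M d (wt M w (j,x)) = tens_lunit R ?P k (tmap C ?P (kmod R) ?P (-2) 0 (coalg_curv K) (gid ?P) d (rho M d (wt M w (j,x))))"
  unfolding Xc_def using wt[OF w d(1)] d(2) by simp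
 also have "tmap C ?P (kmod R) ?P (-2) 0 (coalg_curv K) (gid ?P) d (rho M d (wt M w (j,x))) =
  sum2 (tns (kmod R) ?P k) (%u v. tmap C ?P (kmod R) ?P (-2) 0 (coalg_curv K) (gid ?P) d (wt ?P u (dg v + j, wt M v (j,x)))) w"
  unfolding rho_wt[OF M w x d(1)] by (rule HOM_sum2[OF t _ kP w]) (use P wt d in auto)
 also have "... = sum2 (tns (kmod R) ?P k) (%u v. telt (kmod R) ?P (dg u - 2, xi u) (dg v + j, wt M v (j,x))) w"
 proof (rule vsum2_cong[OF _ w])
  fix u v assume uv: "vw V u" "vw V v" "w = u @ v"
  show c: "telt (kmod R) ?P (dg u - 2, xi u) (dg v + j, wt M v (j,x)) <: tns (kmod R) ?P k"
   by (rule telt_in[OF kmod_module P xi_kmod[OF uv(1)] wt[OF uv(2) refl]]) (use uv d in auto)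
  have "tmap C ?P (kmod R) ?P (-2) 0 (coalg_curv K) (gid ?P) d (wt ?P u (dg v + j, wt M v (j,x))) =
   sg (0 * dg u) *[tns (kmod R) ?P k] telt (kmod R) ?P (dg u + -2, coalg_curv K (dg u) (tw u)) (dg v + j + 0, gid ?P (dg v + j) (wt M v (j,x)))"
   by (rule tmap_elt[OF C P kmod_module P K_curv gid_HOM[OF P]]) (use uv wt d in auto)
  then show "tmap C ?P (kmod R) ?P (-2) 0 (coalg_curv K) (gid ?P) d (wt ?P u (dg v + j, wt M v (j,x))) =
    telt (kmod R) ?P (dg u - 2, xi u) (dg v + j, wt M v (j,x))" using uv wt c kP by (simp add: K_curv_word)
 qed (use kP in auto)
 also have "tens_lunit R ?P k ... = sum2 (?P k) (%u v. tens_lunit R ?P k (telt (kmod R) ?P (dg u - 2, xi u) (dg v + j, wt M v (j,x)))) w"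
  by (rule HOM_sum2[OF tens_lunit_HOM[OF P] kP P w]) (use P wt xi_kmod d in \<open>auto intro!: telt_in\<close>)
 also have "... = sum2 (?P k) (%u v. kact ?P (dg u - 2, xi u) (dg v + j, wt M v (j,x))) w"
 proof (rule vsum2_cong[OF _ w])
  fix u v assume uv: "vw V u" "vw V v" "w = u @ v"
  show "tens_lunit R ?P k (telt (kmod R) ?P (dg u - 2, xi u) (dg v + j, wt M v (j,x))) = kact ?P (dg u - 2, xi u) (dg v + j, wt M v (j,x))"
   by (rule tens_lunit_elt[OF P xi_kmod[OF uv(1)] wt[OF uv(2) refl]]) (use uv d in auto)
  show "kact ?P (dg u - 2, xi u) (dg v + j, wt M v (j,x)) <: ?P k" using uv P wt d by (intro kact_closed) auto
 qed (use P in auto)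
 finally show ?thesis .
qed

abbreviation "d2 \<equiv> gcomp C (-1) dC dC"

lemma d2_HOM: "d2 <: Hom C C (-2)" by (rule gcomp_HOM[OF C K_diff K_diff]) simp

text \<open>In a cut into three pieces, \<open>xi\<close> may be applied to the first piece
  (\<open>?A\<close>) or to the second (\<open>?B\<close>). The coaction of \<open>Xc\<close> gives
  \<open>?A\<close>, the map \<open>1 (x) Xc\<close> gives \<open>?B\<close>, and
  \<open>d^2 (x) 1\<close> gives \<open>?A - ?B\<close> by \<open>d2_word\<close>. Thus
  \<open>Xc\<close> obeys the coaction rule satisfied by the square of a coderivation.\<close>

lemma rho_Xc:
 assumes M: "gm M" and z: "z <: CT M i" and k: "i - 2 = k"
 shows "rho M k (Xc M i z) = tmap C (CT M) C (CT M) (-2) 0 d2 (gid (CT M)) i (rho M i z) +[CT (CT M) k]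
   tmap C (CT M) C (CT M) 0 (-2) (gid C) (Xc M) i (rho M i z)"
proof -
 let ?P = "CT M" and ?Q = "CT (CT M)"
 have P: "gm ?P" and Q: "gm ?Q" using M by auto
 note xc = Xc_HOM[OF M] and rh = rho_HOM[OF M]
 note t1 = tmap_HOM[OF C P C P d2_HOM gid_HOM[OF P], of "-2", simplified]
 note t2 = tmap_HOM[OF C P C P gid_HOM[OF C] xc, of "-2", simplified]
 note HM = HOM_module[OF P Q, of "-2"]
 have "gcomp ?P (-2) (rho M) (Xc M) = gcomp ?P 0 (tmap C ?P C ?P (-2) 0 d2 (gid ?P)) (rho M) +[Hom ?P ?Q (-2)]
   gcomp ?P 0 (tmap C ?P C ?P 0 (-2) (gid C) (Xc M)) (rho M)"
 proof (rule CM_HOM_eqI[OF M Q gcomp_HOM[OF P xc rh] m_add[OF HM gcomp_HOM[OF P rh t1] gcomp_HOM[OF P rh t2]]])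
  fix w j x assume w: "vw V w" and x: "x <: M j"
  define d where "d = dg w + j"
  define k where "k = d - 2"
  note dk = d_def k_def
  have m: "md (?Q k)" using Q by simp
  have wt: "wt M v (j,x) <: ?P l" if "vw V v" "dg v + j = l" for v l using that M x by auto
  let ?G = "%u a v. kact ?Q (dg u - 2, xi u) (dg a + (dg v + j), wt ?P a (dg v + j, wt M v (j,x)))"
  have G: "?G u a v <: ?Q k" if "vw V u" "vw V a" "vw V v" "dg w = dg u + dg a + dg v" for u a v
   using that wt P Q M x dk by (intro kact_closed telt_in) auto
  let ?A = "sum2 (?Q k) (%w1 w2. sum2 (?Q k) (%u v. ?G u v w2) w1) w"
  let ?B = "sum2 (?Q k) (%w1 w2. sum2 (?Q k) (%u v. ?G v u w2) w1) w"
  have Ac: "?A <: ?Q k" and Bc: "?B <: ?Q k" by (rule vsum2_closed[OF m w], rule vsum2_closed[OF m], use G m in auto)+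
  have "rho M k (Xc M d (wt M w (j,x))) = sum2 (?Q k) (%u v. rho M k (kact ?P (dg u - 2, xi u) (dg v + j, wt M v (j,x)))) w"
   unfolding Xc_wt[OF M w x d_def[symmetric] k_def[symmetric]]
   by (rule HOM_sum2[OF rh P Q w]) (use P M x wt dk in \<open>auto intro!: kact_closed\<close>)
  also have "... = sum2 (?Q k) (%u v. sum2 (?Q k) (%a b. ?G u a b) v) w"
  proof (rule vsum2_cong[OF m w])
   fix u v assume uv: "vw V u" "vw V v" "w = u @ v"
   have "rho M k (kact ?P (dg u - 2, xi u) (dg v + j, wt M v (j,x))) = kact ?Q (dg u - 2, xi u) (dg v + j, rho M (dg v + j) (wt M v (j,x)))"
    by (rule HOM_kact[OF P Q rh]) (use uv wt dk in auto)
   also have "... = sum2 (?Q k) (%a b. kact ?Q (dg u - 2, xi u) (dg v + j, wt ?P a (dg b + j, wt M b (j,x)))) v"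
    unfolding rho_wt[OF M uv(2) x refl] by (rule kact_sum2[OF Q _ uv(2)]) (use uv P wt dk in auto)
   also have "... = sum2 (?Q k) (%a b. ?G u a b) v" by (rule vsum2_cong[OF m uv(2)]) (use uv G in \<open>auto simp: add.assoc\<close>)
   finally show "rho M k (kact ?P (dg u - 2, xi u) (dg v + j, wt M v (j,x))) = sum2 (?Q k) (%a b. ?G u a b) v" .
   show "sum2 (?Q k) (%a b. ?G u a b) v <: ?Q k" by (rule vsum2_closed[OF m uv(2)]) (use uv G in auto)
  qed
  also have "... = ?A" by (rule sum2_assoc[OF m, symmetric]) (use w G in auto)
  finally have L: "rho M k (Xc M d (wt M w (j,x))) = ?A" .
  have R1: "tmap C ?P C ?P (-2) 0 d2 (gid ?P) d (rho M d (wt M w (j,x))) = ?A -[?Q k] ?B"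
  proof -
   have "tmap C ?P C ?P (-2) 0 d2 (gid ?P) d (rho M d (wt M w (j,x))) =
    sum2 (?Q k) (%u v. tmap C ?P C ?P (-2) 0 d2 (gid ?P) d (wt ?P u (dg v + j, wt M v (j,x)))) w"
    unfolding rho_wt[OF M w x d_def[symmetric]] by (rule HOM_sum2[OF t1 _ Q w]) (use P wt dk in auto)
   also have "... = sum2 (?Q k) (%w1 w2. sum2 (?Q k) (%u v. ?G u v w2) w1 +[?Q k] -[?Q k] sum2 (?Q k) (%u v. ?G v u w2) w1) w"
   proof (rule vsum2_cong[OF m w])
    fix p q assume uv: "vw V p" "vw V q" "w = p @ q"
    let ?wq = "(dg q + j, wt M q (j,x))"
    have wq: "wt M q (j,x) <: ?P (dg q + j)" by (rule wt[OF uv(2) refl])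
    have k': "dg p - 2 + (dg q + j) = k" using uv dk by simp
    have mC: "md (C (dg p - 2))" by simp
    have kc: "kact C (dg u - 2, xi u) (wd v) <: C (dg p - 2)" "kact C (dg v - 2, xi v) (wd u) <: C (dg p - 2)"
     if "vw V u" "vw V v" "p = u @ v" for u v using that by (auto intro!: kact_closed)
    have s: "sum2 (C (dg p - 2)) (%u v. kact C (dg u - 2, xi u) (wd v)) p <: C (dg p - 2)"
     "sum2 (C (dg p - 2)) (%u v. kact C (dg v - 2, xi v) (wd u)) p <: C (dg p - 2)" by (rule vsum2_closed[OF mC uv(1)], use kc in auto)+
    have c2: "d2 (dg p) (tw p) <: C (dg p - 2)" by (rule HOM_in[OF d2_HOM]) (use uv in auto)
    have "tmap C ?P C ?P (-2) 0 d2 (gid ?P) d (wt ?P p ?wq) =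
     sg (0 * dg p) *[?Q k] telt C ?P (dg p + -2, d2 (dg p) (tw p)) (dg q + j + 0, gid ?P (dg q + j) (wt M q (j,x)))"
     by (rule tmap_elt[OF C P C P d2_HOM gid_HOM[OF P]]) (use uv wt dk in auto)
    also have "... = telt C ?P (dg p - 2, d2 (dg p) (tw p)) ?wq" using m wq c2 P k' by (simp del: gcomp_apply)
    also have "d2 (dg p) (tw p) = sum2 (C (dg p - 2)) (%u v. kact C (dg u - 2, xi u) (wd v)) p -[C (dg p - 2)] sum2 (C (dg p - 2)) (%u v. kact C (dg v - 2, xi v) (wd u)) p"
     using uv d2_word[OF uv(1) refl refl] by simp
    also have "telt C ?P (dg p - 2, ...) ?wq = telt C ?P (dg p - 2, sum2 (C (dg p - 2)) (%u v. kact C (dg u - 2, xi u) (wd v)) p) ?wq -[?Q k]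
      telt C ?P (dg p - 2, sum2 (C (dg p - 2)) (%u v. kact C (dg v - 2, xi v) (wd u)) p) ?wq"
     by (rule lin_minus[OF mC m tens_elt_lin1[OF C P wq k'] s])
    also have "telt C ?P (dg p - 2, sum2 (C (dg p - 2)) (%u v. kact C (dg u - 2, xi u) (wd v)) p) ?wq = sum2 (?Q k) (%u v. telt C ?P (dg p - 2, kact C (dg u - 2, xi u) (wd v)) ?wq) p"
     by (rule tens_sum2_l[OF C P uv(1) wq k']) (use kc in auto)
    also have "... = sum2 (?Q k) (%u v. ?G u v q) p"
    proof (rule vsum2_cong[OF m uv(1)])
     fix u v assume uv': "vw V u" "vw V v" "p = u @ v"
     show "telt C ?P (dg p - 2, kact C (dg u - 2, xi u) (wd v)) ?wq = ?G u v q" by (rule tens_kact_l[OF C P _ _ wq]) (use uv' in auto)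
     show "?G u v q <: ?Q k" using G uv uv' by auto
    qed
    also have "telt C ?P (dg p - 2, sum2 (C (dg p - 2)) (%u v. kact C (dg v - 2, xi v) (wd u)) p) ?wq = sum2 (?Q k) (%u v. telt C ?P (dg p - 2, kact C (dg v - 2, xi v) (wd u)) ?wq) p"
     by (rule tens_sum2_l[OF C P uv(1) wq k']) (use kc in auto)
    also have "... = sum2 (?Q k) (%u v. ?G v u q) p"
    proof (rule vsum2_cong[OF m uv(1)])
     fix u v assume uv': "vw V u" "vw V v" "p = u @ v"
     show "telt C ?P (dg p - 2, kact C (dg v - 2, xi v) (wd u)) ?wq = ?G v u q" by (rule tens_kact_l[OF C P _ _ wq]) (use uv' in auto)
     show "?G v u q <: ?Q k" using G uv uv' by auto
    qed
    finally show "tmap C ?P C ?P (-2) 0 d2 (gid ?P) d (wt ?P p ?wq) = sum2 (?Q k) (%u v. ?G u v q) p +[?Q k] -[?Q k] sum2 (?Q k) (%u v. ?G v u q) p"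
     by (simp add: a_minus_def)
    show "sum2 (?Q k) (%u v. ?G u v q) p +[?Q k] -[?Q k] sum2 (?Q k) (%u v. ?G v u q) p <: ?Q k"
     by (intro m_add[OF m] m_neg[OF m] vsum2_closed[OF m uv(1)]) (use uv G in auto)
   qed
   also have "... = ?A +[?Q k] sum2 (?Q k) (%w1 w2. -[?Q k] sum2 (?Q k) (%u v. ?G v u w2) w1) w"
    by (rule sum2_add[OF m]) (use w G in \<open>auto intro!: m_neg[OF m] sum2_closed[OF m]\<close>)
   also have "sum2 (?Q k) (%w1 w2. -[?Q k] sum2 (?Q k) (%u v. ?G v u w2) w1) w = -[?Q k] ?B"
    by (rule sum2_neg[OF m, symmetric]) (use w G in \<open>auto intro!: sum2_closed[OF m]\<close>)
   finally show ?thesis by (simp add: a_minus_def)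
  qed
  have R2: "tmap C ?P C ?P 0 (-2) (gid C) (Xc M) d (rho M d (wt M w (j,x))) = ?B"
  proof -
   have "tmap C ?P C ?P 0 (-2) (gid C) (Xc M) d (rho M d (wt M w (j,x))) =
    sum2 (?Q k) (%u v. tmap C ?P C ?P 0 (-2) (gid C) (Xc M) d (wt ?P u (dg v + j, wt M v (j,x)))) w"
    unfolding rho_wt[OF M w x d_def[symmetric]] by (rule HOM_sum2[OF t2 _ Q w]) (use P wt dk in auto)
   also have "... = sum2 (?Q k) (%u v. sum2 (?Q k) (%a b. ?G a u b) v) w"
   proof (rule vsum2_cong[OF m w])
    fix u v assume uv: "vw V u" "vw V v" "w = u @ v"
    let ?l = "dg v + j - 2"
    have cx: "Xc M (dg v + j) (wt M v (j,x)) <: ?P ?l" by (rule HOM_in[OF xc wt[OF uv(2) refl]]) simp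
    have k': "dg u + ?l = k" using uv dk by simp
    have kc: "kact ?P (dg a - 2, xi a) (dg b + j, wt M b (j,x)) <: ?P ?l" if "vw V a" "vw V b" "v = a @ b" for a b
     using that P wt by (auto intro!: kact_closed)
    have "tmap C ?P C ?P 0 (-2) (gid C) (Xc M) d (wt ?P u (dg v + j, wt M v (j,x))) =
     sg (-2 * dg u) *[?Q k] telt C ?P (dg u + 0, gid C (dg u) (tw u)) (dg v + j + -2, Xc M (dg v + j) (wt M v (j,x)))"
     by (rule tmap_elt[OF C P C P gid_HOM[OF C] xc]) (use uv wt dk in auto)
    also have "... = wt ?P u (?l, Xc M (dg v + j) (wt M v (j,x)))" using m uv cx P k' by (simp add: sgn_even)
    also have "... = sum2 (?Q k) (%a b. wt ?P u (?l, kact ?P (dg a - 2, xi a) (dg b + j, wt M b (j,x)))) v"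
     unfolding Xc_wt[OF M uv(2) x refl refl] by (rule tens_sum2_r[OF C P uv(2) _ k']) (use uv kc in auto)
    also have "... = sum2 (?Q k) (%a b. ?G a u b) v"
    proof (rule vsum2_cong[OF m uv(2)])
     fix a b assume ab: "vw V a" "vw V b" "v = a @ b"
     show "wt ?P u (?l, kact ?P (dg a - 2, xi a) (dg b + j, wt M b (j,x))) = ?G a u b"
      by (rule tens_kact_r[OF C P _ _ wt]) (use ab uv in auto)
     show "?G a u b <: ?Q k" using G uv ab by auto
    qed
    finally show "tmap C ?P C ?P 0 (-2) (gid C) (Xc M) d (wt ?P u (dg v + j, wt M v (j,x))) = sum2 (?Q k) (%a b. ?G a u b) v" .
    show "sum2 (?Q k) (%a b. ?G a u b) v <: ?Q k" by (rule vsum2_closed[OF m uv(2)]) (use uv G in auto)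
   qed
   also have "... = ?B" by (rule sum2_assoc[OF m, symmetric]) (use w G in auto)
   finally show ?thesis .
  qed
  have "?A = (?A -[?Q k] ?B) +[?Q k] ?B" using m_assoc'[OF m Ac m_neg[OF m Bc] Bc] Ac Bc m by (simp add: a_minus_def)
  then show "gcomp ?P (-2) (rho M) (Xc M) (dg w + j) (wt M w (j,x)) =
   (gcomp ?P 0 (tmap C ?P C ?P (-2) 0 d2 (gid ?P)) (rho M) +[Hom ?P ?Q (-2)]
   gcomp ?P 0 (tmap C ?P C ?P 0 (-2) (gid C) (Xc M)) (rho M)) (dg w + j) (wt M w (j,x))"
   using wt[OF w refl] L[unfolded dk] R1[unfolded dk] R2[unfolded dk] by (simp add: dk)
 qed auto
 from fun_cong[OF fun_cong[OF this, of i], of z] show ?thesis using z k by auto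
qed

text \<open>The mixed terms \<open>(d (x) 1) (1 (x) D)\<close> and
  \<open>(1 (x) D) (d (x) 1)\<close> cancel: both maps are odd, so the second one carries the Koszul
  sign -1.\<close>

lemma rho_DD:
 assumes M: "gm M" and D: "is_coderivation R K (cofree_comod R K M) D" and z: "z <: CT M i"
 shows "rho M (i - 2) (gcomp (CT M) (-1) D D i z) = tmap C (CT M) C (CT M) (-2) 0 d2 (gid (CT M)) i (rho M i z) +[CT (CT M) (i - 2)]
   tmap C (CT M) C (CT M) 0 (-2) (gid C) (gcomp (CT M) (-1) D D) i (rho M i z)"
proof -
 let ?P = "CT M" and ?Q = "CT (CT M)"
 have P: "gm ?P" and Q: "gm ?Q" using M by auto
 note cD = coderD[OF M D]
 note h1 = tmap_HOM[OF C P C P K_diff gid_HOM[OF P], of "-1", simplified]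
 note h2 = tmap_HOM[OF C P C P gid_HOM[OF C] cD(1), of "-1", simplified]
 let ?t1 = "tmap C ?P C ?P (-1) 0 dC (gid ?P)" and ?t2 = "cotens ?P ?P (-1) D"
 let ?r = "rho M i z"
 have m: "md (?Q (i - 2))" using Q by simp
 have rz: "?r <: ?Q i" by (rule HOM_in[OF rho_HOM[OF M] z]) simp
 have Dz: "D i z <: ?P (i - 1)" by (rule HOM_in[OF cD(1) z]) simp
 have c: "?t1 i ?r <: ?Q (i - 1)" "?t2 i ?r <: ?Q (i - 1)" using HOM_in[OF h1 rz] HOM_in[OF h2 rz] by auto
 have DD: "gcomp ?P (-1) D D <: Hom ?P ?P (-2)" by (rule gcomp_HOM[OF P cD(1) cD(1)]) simp
 have e11: "?t1 (i - 1) (?t1 i ?r) = sg (0 * -1) *[?Q (i - 2)] tmap C ?P C ?P (-2) 0 d2 (gcomp ?P 0 (gid ?P) (gid ?P)) i ?r"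
  by (rule tmap_comp[OF C P C P C P K_diff gid_HOM[OF P] K_diff gid_HOM[OF P] rz]) auto
 have e12: "?t1 (i - 1) (?t2 i ?r) = sg (0 * 0) *[?Q (i - 2)] tmap C ?P C ?P (-1) (-1) (gcomp C 0 dC (gid C)) (gcomp ?P (-1) (gid ?P) D) i ?r"
  by (rule tmap_comp[OF C P C P C P gid_HOM[OF C] cD(1) K_diff gid_HOM[OF P] rz]) auto
 have e21: "?t2 (i - 1) (?t1 i ?r) = sg (-1 * -1) *[?Q (i - 2)] tmap C ?P C ?P (-1) (-1) (gcomp C (-1) (gid C) dC) (gcomp ?P 0 D (gid ?P)) i ?r"
  by (rule tmap_comp[OF C P C P C P K_diff gid_HOM[OF P] gid_HOM[OF C] cD(1) rz]) auto
 have e22: "?t2 (i - 1) (?t2 i ?r) = sg (-1 * 0) *[?Q (i - 2)] tmap C ?P C ?P 0 (-2) (gcomp C 0 (gid C) (gid C)) (gcomp ?P (-1) D D) i ?r"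
  by (rule tmap_comp[OF C P C P C P gid_HOM[OF C] cD(1) gid_HOM[OF C] cD(1) rz]) auto
 note idl = gcomp_gid_left[OF P cD(1)] gcomp_gid_left[OF P gid_HOM[OF P]] gcomp_gid_left[OF C K_diff] gcomp_gid_left[OF C gid_HOM[OF C]]
  gcomp_gid_right[OF P cD(1)] gcomp_gid_right[OF C K_diff]
 have cc: "tmap C ?P C ?P (-2) 0 d2 (gid ?P) i ?r <: ?Q (i - 2)"
   "tmap C ?P C ?P (-1) (-1) dC D i ?r <: ?Q (i - 2)"
   "tmap C ?P C ?P 0 (-2) (gid C) (gcomp ?P (-1) D D) i ?r <: ?Q (i - 2)" using HOM_in[OF tmap_HOM[OF C P C P d2_HOM gid_HOM[OF P] refl] rz]
   HOM_in[OF tmap_HOM[OF C P C P K_diff cD(1) refl] rz]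
   HOM_in[OF tmap_HOM[OF C P C P gid_HOM[OF C] DD refl] rz] by auto
 have "rho M (i - 2) (gcomp ?P (-1) D D i z) = rho M (i - 2) (D (i - 1) (D i z))" using z by simp
 also have "... = ?t1 (i - 1) (rho M (i - 1) (D i z)) +[?Q (i - 2)] ?t2 (i - 1) (rho M (i - 1) (D i z))" by (rule cD(2)[OF Dz]) simp
 also have "... = ?t1 (i - 1) (?t1 i ?r +[?Q (i - 1)] ?t2 i ?r) +[?Q (i - 2)] ?t2 (i - 1) (?t1 i ?r +[?Q (i - 1)] ?t2 i ?r)"
  by (simp add: cD(2)[OF z])
 also have "?t1 (i - 1) (?t1 i ?r +[?Q (i - 1)] ?t2 i ?r) = ?t1 (i - 1) (?t1 i ?r) +[?Q (i - 2)] ?t1 (i - 1) (?t2 i ?r)"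
  by (rule HOM_add_map[OF h1 _ c]) simp
 also have "?t2 (i - 1) (?t1 i ?r +[?Q (i - 1)] ?t2 i ?r) = ?t2 (i - 1) (?t1 i ?r) +[?Q (i - 2)] ?t2 (i - 1) (?t2 i ?r)"
  by (rule HOM_add_map[OF h2 _ c]) simp
 also have "?t1 (i - 1) (?t1 i ?r) +[?Q (i - 2)] ?t1 (i - 1) (?t2 i ?r) +[?Q (i - 2)] (?t2 (i - 1) (?t1 i ?r) +[?Q (i - 2)] ?t2 (i - 1) (?t2 i ?r)) =
   tmap C ?P C ?P (-2) 0 d2 (gid ?P) i ?r +[?Q (i - 2)] tmap C ?P C ?P 0 (-2) (gid C) (gcomp ?P (-1) D D) i ?r"
  unfolding e11 e12 e21 e22 idl using m cc by (simp add: sgn_odd m_assoc')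
 finally show ?thesis .
qed

text \<open>\<open>rho_DD\<close> and \<open>rho_Xc\<close> have the same shape, so by
  \<open>ppi_unique\<close> the equation can be tested after \<open>ppi\<close>. There
  \<open>ppi D D\<close> is \<open>m D\<close>, because \<open>D\<close> itself has projection
  \<open>m\<close>.\<close>

lemma curv_iff:
 assumes M: "gm M" and m: "m <: Hom (CT M) M (-1)" and D: "D = phi_inv R K M m"
 shows "gcomp (CT M) (-1) D D = Xc M \<longleftrightarrow>
  (\<forall>w j x. vw V w --> x <: M j -->
   m (dg w + j - 1) (D (dg w + j) (wt M w (j,x))) = kact M (dg w - 2, xi w) (j,x))"
  (is "?L \<longleftrightarrow> ?Rhs")
proof -
 let ?P = "CT M" and ?Q = "CT (CT M)"
 have P: "gm ?P" and Q: "gm ?Q" using M by auto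
 have D': "is_coderivation R K (cofree_comod R K M) D" unfolding D by (rule coder_phi_inv[OF M m])
 note cD = coderD[OF M D']
 have DD: "gcomp ?P (-1) D D <: Hom ?P ?P (-2)" by (rule gcomp_HOM[OF P cD(1) cD(1)]) simp
 have pDD: "ppi M (i - 2) (D (i - 1) (D i z)) = m (i - 1) (D i z)" if "z <: ?P i" for i z
  unfolding D by (rule ppi_phi_inv[OF M m]) (use HOM_in[OF cD(1) that] D in auto)
 have wt: "wt M v (j,x) <: ?P l" if "vw V v" "dg v + j = l" "x <: M j" for v l j x using that M by auto
 \<comment> \<open>\<open>ppi\<close> keeps only the cut with empty remainder, so \<open>xi\<close>
   acts with the whole word.\<close>
 have pX: "ppi M (dg w + j - 2) (Xc M (dg w + j) (wt M w (j,x))) = kact M (dg w - 2, xi w) (j,x)"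
  if w: "vw V w" and x: "x <: M j" for w j x
 proof -
  let ?k = "dg w + j - 2"
  let ?F = "%u v. kact M (dg u - 2, xi u) (dg v + j, if v = [] then x else \<zero>[M (dg v + j)])"
  have F: "?F u v <: M ?k" if "vw V u" "vw V v" "w = u @ v" for u v using that M x by (auto intro!: kact_closed)
  have "ppi M ?k (Xc M (dg w + j) (wt M w (j,x))) = sum2 (M ?k) (%u v. ppi M ?k (kact ?P (dg u - 2, xi u) (dg v + j, wt M v (j,x)))) w"
   unfolding Xc_wt[OF M w x refl refl] by (rule HOM_sum2[OF ppi_HOM[OF M] P M w]) (use P wt x M in \<open>auto intro!: kact_closed\<close>)
  also have "... = sum2 (M ?k) ?F w"
  proof (rule vsum2_cong[OF _ w])
   fix u v assume uv: "vw V u" "vw V v" "w = u @ v"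
   have "ppi M ?k (kact ?P (dg u - 2, xi u) (dg v + j, wt M v (j,x))) = kact M (dg u - 2, xi u) (dg v + j, ppi M (dg v + j) (wt M v (j,x)))"
    by (rule HOM_kact[OF P M ppi_HOM[OF M]]) (use uv wt x in auto)
   then show "ppi M ?k (kact ?P (dg u - 2, xi u) (dg v + j, wt M v (j,x))) = ?F u v" unfolding ppi_wt[OF M uv(2) x refl] .
  qed (use M F in auto)
  also have "... = ?F w []"
  proof (subst sum2_last)
   fix u v assume uv: "w = u @ v" "v ~= []"
   then have "vw V u" using w by auto
   have e: "?k = dg u - 2 + (dg v + j)" using uv by simp
   show "?F u v = \<zero>[M ?k]" unfolding e using uv(2) M \<open>vw V u\<close> by (auto simp: kact_def)
  qed (use M x F[OF w _ , of "[]"] w in \<open>auto intro!: kact_closed\<close>)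
  finally show ?thesis by simp
 qed
 have "?L \<longleftrightarrow> gcomp ?P (-2) (ppi M) (gcomp ?P (-1) D D) = gcomp ?P (-2) (ppi M) (Xc M)"
 proof
  assume e: "gcomp ?P (-2) (ppi M) (gcomp ?P (-1) D D) = gcomp ?P (-2) (ppi M) (Xc M)"
  show ?L
  proof (rule ppi_unique[OF M M DD Xc_HOM[OF M], where Z="%i z. tmap C ?P C ?P (-2) 0 d2 (gid ?P) i (rho M i z)"])
   fix i z assume z: "z <: ?P i"
   have rz: "rho M i z <: ?Q i" by (rule HOM_in[OF rho_HOM[OF M] z]) simp
   show "tmap C ?P C ?P (-2) 0 d2 (gid ?P) i (rho M i z) <: ?Q (i + -2)"
    using HOM_in[OF tmap_HOM[OF C P C P d2_HOM gid_HOM[OF P] refl] rz] by (simp del: gcomp_apply)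
  qed (use rho_DD[OF M D'] rho_Xc[OF M _ refl] e in auto)
 qed simp
 also have "... \<longleftrightarrow> ?Rhs"
 proof
  assume "gcomp ?P (-2) (ppi M) (gcomp ?P (-1) D D) = gcomp ?P (-2) (ppi M) (Xc M)"
  then have e: "ppi M (i - 2) (D (i - 1) (D i z)) = ppi M (i - 2) (Xc M i z)" if "z <: ?P i" for i z
   using that unfolding gcomp_eq_iff by auto
  show ?Rhs using e pDD pX wt by metis
 next
  assume r: ?Rhs
  show "gcomp ?P (-2) (ppi M) (gcomp ?P (-1) D D) = gcomp ?P (-2) (ppi M) (Xc M)"
  proof (rule CM_HOM_eqI[OF M M gcomp_HOM[OF P DD ppi_HOM[OF M]] gcomp_HOM[OF P Xc_HOM[OF M] ppi_HOM[OF M]]])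
   fix w j x assume w: "vw V w" and x: "x <: M j"
   show "gcomp ?P (-2) (ppi M) (gcomp ?P (-1) D D) (dg w + j) (wt M w (j,x)) =
    gcomp ?P (-2) (ppi M) (Xc M) (dg w + j) (wt M w (j,x))" using wt[OF w refl x] pDD[OF wt[OF w refl x]] pX[OF w x] r w x by simp
  qed auto
 qed
 finally show ?thesis .
qed

text \<open>Each composite \<open>Y\<close> has coaction
  \<open>(d (x) F) rho + (1 (x) Y) rho\<close>, so the two are equal as soon as their projections
  are. The projection of \<open>phi_inv\<close> is \<open>n\<close> on one side, that of
  \<open>Phi\<close> is \<open>f\<close> on the other.\<close>

lemma commute_iff:
 assumes M: "gm M" and N: "gm N" and m: "m <: Hom (CT M) M (-1)" and n: "n <: Hom (CT N) N (-1)"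
  and f: "f <: Hom (CT M) N 0"
 shows "gcomp (CT M) 0 (phi_inv R K N n) (Phi M N 0 f) = gcomp (CT M) (-1) (Phi M N 0 f) (phi_inv R K M m) \<longleftrightarrow>
  (\<forall>w j x. vw V w --> x <: M j -->
   n (dg w + j) (Phi M N 0 f (dg w + j) (wt M w (j,x))) =
   f (dg w + j - 1) (phi_inv R K M m (dg w + j) (wt M w (j,x))))"
  (is "?L \<longleftrightarrow> ?Rhs")
proof -
 let ?P = "CT M" and ?Q = "CT N"
 let ?DM = "phi_inv R K M m" and ?DN = "phi_inv R K N n" and ?F = "Phi M N 0 f"
 have P: "gm ?P" and Q: "gm ?Q" and CP: "gm (CT ?P)" and CQ: "gm (CT ?Q)" using M N by auto
 note dm = coderD[OF M coder_phi_inv[OF M m]] and dn = coderD[OF N coder_phi_inv[OF N n]]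
 note ph = Phi_HOM[OF M N f]
 have Y1: "gcomp ?P 0 ?DN ?F <: Hom ?P ?Q (-1)" by (rule gcomp_HOM[OF P ph dn(1)]) simp
 have Y2: "gcomp ?P (-1) ?F ?DM <: Hom ?P ?Q (-1)" by (rule gcomp_HOM[OF P dm(1) ph]) simp
 have wt: "wt M v (j,x) <: ?P l" if "vw V v" "dg v + j = l" "x <: M j" for v l j x using that M by auto
 have p1: "ppi N (i - 1) (?DN i (?F i z)) = n i (?F i z)" if "z <: ?P i" for i z
  by (rule ppi_phi_inv[OF N n]) (use HOM_in[OF ph that] in auto)
 have p2: "ppi N (i - 1) (?F (i - 1) (?DM i z)) = f (i - 1) (?DM i z)" if z: "z <: ?P i" for i z
 proof -
  have "?DM i z <: ?P (i - 1)" by (rule HOM_in[OF dm(1) z]) simp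
  then show ?thesis using fun_cong[OF fun_cong[OF ppi_Phi[OF M N f], of "i - 1"], of "?DM i z"] by simp
 qed
 \<comment> \<open>\<open>d (x) F\<close> arises as \<open>(d (x) 1) (1 (x) F)\<close> in one
   composite and as \<open>(1 (x) F) (d (x) 1)\<close> in the other; there is no sign because
   \<open>F\<close> has degree 0.\<close>
 let ?Z = "tmap C ?P C ?Q (-1) 0 dC ?F"
 have "?L \<longleftrightarrow> gcomp ?P (-1) (ppi N) (gcomp ?P 0 ?DN ?F) = gcomp ?P (-1) (ppi N) (gcomp ?P (-1) ?F ?DM)"
 proof
  assume e: "gcomp ?P (-1) (ppi N) (gcomp ?P 0 ?DN ?F) = gcomp ?P (-1) (ppi N) (gcomp ?P (-1) ?F ?DM)"
  show ?L
  proof (rule ppi_unique[OF M N Y1 Y2, where Z="%i z. ?Z i (rho M i z)"])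
   fix i z assume z: "z <: ?P i"
   let ?r = "rho M i z"
   have rz: "?r <: CT ?P i" by (rule HOM_in[OF rho_HOM[OF M] z]) simp
   show zc: "?Z i ?r <: CT ?Q (i + -1)" using HOM_in[OF tmap_HOM[OF C P C Q K_diff ph refl] rz] by simp
   have Fz: "?F i z <: ?Q i" by (rule HOM_in[OF ph z]) simp
   have Dz: "?DM i z <: ?P (i - 1)" by (rule HOM_in[OF dm(1) z]) simp
   have m1: "md (CT ?Q (i - 1))" using CQ by simp
   have c1: "cotens ?P ?Q (-1) (gcomp ?P 0 ?DN ?F) i ?r <: CT ?Q (i - 1)"
    "cotens ?P ?Q (-1) (gcomp ?P (-1) ?F ?DM) i ?r <: CT ?Q (i - 1)"
    using HOM_in[OF tmap_HOM[OF C P C Q gid_HOM[OF C] Y1 refl] rz] HOM_in[OF tmap_HOM[OF C P C Q gid_HOM[OF C] Y2 refl] rz] by auto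
   have a1: "tmap C ?Q C ?Q (-1) 0 dC (gid ?Q) i (cotens ?P ?Q 0 ?F i ?r) =
    sg (0 * 0) *[CT ?Q (i - 1)] tmap C ?P C ?Q (-1) 0 (gcomp C 0 dC (gid C)) (gcomp ?P 0 (gid ?Q) ?F) i ?r"
    by (rule tmap_comp[OF C P C Q C Q gid_HOM[OF C] ph K_diff gid_HOM[OF Q] rz]) auto
   have a2: "cotens ?Q ?Q (-1) ?DN i (cotens ?P ?Q 0 ?F i ?r) =
    sg (-1 * 0) *[CT ?Q (i - 1)] tmap C ?P C ?Q 0 (-1) (gcomp C 0 (gid C) (gid C)) (gcomp ?P 0 ?DN ?F) i ?r"
    by (rule tmap_comp[OF C P C Q C Q gid_HOM[OF C] ph gid_HOM[OF C] dn(1) rz]) auto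
   have "rho N (i - 1) (?DN i (?F i z)) = tmap C ?Q C ?Q (-1) 0 dC (gid ?Q) i (rho N i (?F i z)) +[CT ?Q (i - 1)]
     cotens ?Q ?Q (-1) ?DN i (rho N i (?F i z))" by (rule dn(2)[OF Fz refl])
   also have "rho N i (?F i z) = cotens ?P ?Q 0 ?F i ?r" by (rule rho_Phi[OF M N f z]) simp
   finally show "rho N (i + -1) (gcomp ?P 0 ?DN ?F i z) = ?Z i ?r +[CT ?Q (i + -1)] cotens ?P ?Q (-1) (gcomp ?P 0 ?DN ?F) i ?r"
    unfolding a1 a2 gcomp_gid_right[OF C K_diff] gcomp_gid_left[OF P ph] gcomp_gid_left[OF C gid_HOM[OF C]] using z zc c1 m1 by simp
   have b1: "cotens ?P ?Q 0 ?F (i - 1) (tmap C ?P C ?P (-1) 0 dC (gid ?P) i ?r) =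
    sg (0 * -1) *[CT ?Q (i - 1)] tmap C ?P C ?Q (-1) 0 (gcomp C (-1) (gid C) dC) (gcomp ?P 0 ?F (gid ?P)) i ?r"
    by (rule tmap_comp[OF C P C P C Q K_diff gid_HOM[OF P] gid_HOM[OF C] ph rz]) auto
   have b2: "cotens ?P ?Q 0 ?F (i - 1) (cotens ?P ?P (-1) ?DM i ?r) =
    sg (0 * 0) *[CT ?Q (i - 1)] tmap C ?P C ?Q 0 (-1) (gcomp C 0 (gid C) (gid C)) (gcomp ?P (-1) ?F ?DM) i ?r"
    by (rule tmap_comp[OF C P C P C Q gid_HOM[OF C] dm(1) gid_HOM[OF C] ph rz]) auto
   have cc: "tmap C ?P C ?P (-1) 0 dC (gid ?P) i ?r <: CT ?P (i - 1)" "cotens ?P ?P (-1) ?DM i ?r <: CT ?P (i - 1)"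
    using HOM_in[OF tmap_HOM[OF C P C P K_diff gid_HOM[OF P] refl] rz] HOM_in[OF tmap_HOM[OF C P C P gid_HOM[OF C] dm(1) refl] rz] by auto
   have "rho N (i - 1) (?F (i - 1) (?DM i z)) = cotens ?P ?Q 0 ?F (i - 1) (rho M (i - 1) (?DM i z))" by (rule rho_Phi[OF M N f Dz]) simp
   also have "rho M (i - 1) (?DM i z) = tmap C ?P C ?P (-1) 0 dC (gid ?P) i ?r +[CT ?P (i - 1)] cotens ?P ?P (-1) ?DM i ?r"
    by (rule dm(2)[OF z refl])
   also have "cotens ?P ?Q 0 ?F (i - 1) ... =
     cotens ?P ?Q 0 ?F (i - 1) (tmap C ?P C ?P (-1) 0 dC (gid ?P) i ?r) +[CT ?Q (i - 1)]
     cotens ?P ?Q 0 ?F (i - 1) (cotens ?P ?P (-1) ?DM i ?r)" by (rule HOM_add_map[OF tmap_HOM[OF C P C Q gid_HOM[OF C] ph refl] _ cc]) simp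
   finally show "rho N (i + -1) (gcomp ?P (-1) ?F ?DM i z) = ?Z i ?r +[CT ?Q (i + -1)] cotens ?P ?Q (-1) (gcomp ?P (-1) ?F ?DM) i ?r"
    unfolding b1 b2 gcomp_gid_left[OF C K_diff] gcomp_gid_right[OF P ph] gcomp_gid_left[OF C gid_HOM[OF C]] using z zc c1 m1 by simp
  qed (rule e)
 qed simp
 also have "... \<longleftrightarrow> ?Rhs"
 proof
  assume "gcomp ?P (-1) (ppi N) (gcomp ?P 0 ?DN ?F) = gcomp ?P (-1) (ppi N) (gcomp ?P (-1) ?F ?DM)"
  then have e: "ppi N (i - 1) (?DN i (?F i z)) = ppi N (i - 1) (?F (i - 1) (?DM i z))" if "z <: ?P i" for i z
   using that unfolding gcomp_eq_iff by auto
  show ?Rhs using e p1 p2 wt by metis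
 next
  assume r: ?Rhs
  show "gcomp ?P (-1) (ppi N) (gcomp ?P 0 ?DN ?F) = gcomp ?P (-1) (ppi N) (gcomp ?P (-1) ?F ?DM)"
  proof (rule CM_HOM_eqI[OF M N gcomp_HOM[OF P Y1 ppi_HOM[OF N]] gcomp_HOM[OF P Y2 ppi_HOM[OF N]]])
   fix w j x assume w: "vw V w" and x: "x <: M j"
   show "gcomp ?P (-1) (ppi N) (gcomp ?P 0 ?DN ?F) (dg w + j) (wt M w (j,x)) =
    gcomp ?P (-1) (ppi N) (gcomp ?P (-1) ?F ?DM) (dg w + j) (wt M w (j,x))"
    using wt[OF w refl x] p1[OF wt[OF w refl x]] p2[OF wt[OF w refl x]] r w x by simp
  qed auto
 qed
 finally show ?thesis .
qed

end

section \<open>Hochschild cochains as multilinear functions on words\<close>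

lemma susp_at: "susp M n = M (n - 1)" by (simp add: susp_def)

context ground begin

text \<open>Here \<open>i\<close> counts the inputs of the outer cochain, so the inner block has
  length \<open>length w - i + 1\<close>. These lengths run through all positive ones; the empty
  blocks of \<open>sum3\<close> are covered by the vanishing hypothesis.\<close>

lemma finsum_circ:
 assumes N: "md N"
  and c: "!!u m v. w = u @ m @ v ==> F u m v <: N" and z: "!!u v. w = u @ v ==> F u [] v = \<zero>[N]"
 shows "finsum N (%i. finsum N (%j. F (take j w) (take (length w - i + 1) (drop j w)) (drop (j + (length w - i + 1)) w)) {..<i}) {1..length w} = sum3 N F w"
proof -
 let ?A = "{s \<in> S3 w. fst (snd s) ~= []}"
 have aux: "w = take b w @ take (Suc (length w - a)) (drop b w) @ drop (Suc (b + length w - a)) w" if "a \<le> length w" "b < a" for a b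
 proof -
  have "Suc (b + length w - a) = Suc (length w - a) + b" using that by simp
  then show ?thesis by (metis append_take_drop_id drop_drop)
 qed
 have "finsum N (%i. finsum N (%j. F (take j w) (take (length w - i + 1) (drop j w)) (drop (j + (length w - i + 1)) w)) {..<i}) {1..length w}
   = finsum N (%s. F (fst s) (fst (snd s)) (snd (snd s))) ?A"
  by (rule fs_nest[OF N, where h="%s. (take (snd s) w, take (length w - fst s + 1) (drop (snd s) w), drop (snd s + (length w - fst s + 1)) w)"], simp, simp,
    rule bij_betwI[where g="%s. (length w - length (fst (snd s)) + 1, length (fst s))"])
   (use c in \<open>auto simp: Suc_le_eq intro!: c aux\<close>)
 also have "... = sum3 N F w" by (rule sum3_restrict[OF N, symmetric]) (use c z in auto)
 finally show ?thesis .
qed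

text \<open>The scalar multiplication is indexed by \<open>dg u + dg m + dg v\<close> instead of the
  degree of the whole word because \<open>mlin_sum3\<close> works with summands that depend on the
  pieces only.\<close>

lemma mlin_circ:
 assumes V: "gm V" and W: "gm W" and gm: "mlin R V W b g" and fm: "mlin R V V a f"
 shows "mlin R V W (b + a) (%w. sum3 (W (dg w + (b + a))) (%u m v. sg (a * dg u) *[W (dg u + dg m + dg v + (b + a))] g (u @ (dg m + a, f m) # v)) w)"
  (is "mlin R V W (b + a) (%w. sum3 (W (dg w + (b + a))) ?G w)")
proof -
 have fc: "f m <: V (dg m + a)" if "vw V m" for m by (rule mlin_closed[OF fm that refl])
 have gl: "lin R (V i) (W k) (%x. g (u @ (i,x) # v))" if "vw V u" "vw V v" "k = dg u + i + dg v + b" for u v i k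
  by (rule mlin_lin[OF gm]) (use that in auto)
 have gc: "g (u @ (dg m + a, f m) # v) <: W k" if "vw V u" "vw V v" "vw V m" "k = dg u + dg m + dg v + (b + a)" for u m v k
  by (rule mlin_closed[OF gm]) (use that fc in auto)
 show ?thesis
 proof (rule mlin_sum3[OF V W])
  fix u m v k assume uv: "vw V u" "vw V m" "vw V v" "k = dg u + dg m + dg v + (b + a)"
  then show "?G u m v <: W k" using gc W by (simp del: wdeg_simps)
 next
  fix p i q m v k assume uv: "vw V p" "vw V q" "vw V m" "vw V v" "k = dg p + i + dg q + dg m + dg v + (b + a)"
  have "lin R (V i) (W k) (%x. g (p @ (i,x) # (q @ (dg m + a, f m) # v)))" by (rule gl) (use uv fc in auto)
  then have "lin R (V i) (W k) (%x. sg (a * (dg p + i + dg q)) *[W k] g (p @ (i,x) # (q @ (dg m + a, f m) # v)))"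
   by (rule lin_scale[OF gmod_module[OF W] sgn_in])
  then show "lin R (V i) (W k) (%x. ?G (p @ (i,x) # q) m v)" using uv by (simp add: add.assoc)
 next
  fix p i q u v k assume uv: "vw V p" "vw V q" "vw V u" "vw V v" "k = dg u + dg p + i + dg q + dg v + (b + a)"
  let ?l = "dg p + i + dg q + a"
  have "lin R (V i) (W k) (%x. g (u @ (?l, f (p @ (i,x) # q)) # v))"
   by (rule lin_compose[OF mlin_lin[OF fm uv(1,2) refl]], rule gl) (use uv in auto)
  then have "lin R (V i) (W k) (%x. sg (a * dg u) *[W k] g (u @ (?l, f (p @ (i,x) # q)) # v))"
   by (rule lin_scale[OF gmod_module[OF W] sgn_in])
  then show "lin R (V i) (W k) (%x. ?G u (p @ (i,x) # q) v)" using uv by (simp add: add.assoc)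
 next
  fix p i q u m k assume uv: "vw V p" "vw V q" "vw V u" "vw V m" "k = dg u + dg m + dg p + i + dg q + (b + a)"
  have "lin R (V i) (W k) (%x. g ((u @ (dg m + a, f m) # p) @ (i,x) # q))" by (rule gl) (use uv fc in auto)
  then have "lin R (V i) (W k) (%x. sg (a * dg u) *[W k] g ((u @ (dg m + a, f m) # p) @ (i,x) # q))"
   by (rule lin_scale[OF gmod_module[OF W] sgn_in])
  then show "lin R (V i) (W k) (%x. ?G u m (p @ (i,x) # q))" using uv by (simp add: add.assoc)
 qed
qed

lemma CCu_HOM: "f \<in> CCu R A E n ==> f k <: Hom (tpow R (susp A) k) (susp E) n" by (simp add: CCu_def)

text \<open>One half of a dictionary whose other half is \<open>cc_of_CCu\<close> and
  \<open>cc_at_of\<close>: cochains are multilinear functions on words. Equations between cochains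
  are then checked on words with \<open>CCu_eqI\<close>.\<close>

lemma cc_at_mlin:
 assumes A: "gm A" and f: "f \<in> CCu R A E n"
 shows "mlin R (susp A) (susp E) n (cc_at R A f)"
proof (rule mlinI)
 have "f 0 0 (tword R (susp A) []) <: susp E (0 + n)" by (rule HOM_in[OF CCu_HOM[OF f] tword_closed]) (use A in auto)
 then show "cc_at R A f [] <: susp E n" by (simp add: cc_at_def)
 fix u i v k assume u: "vw (susp A) u" "vw (susp A) v" "k = dg u + i + dg v + n"
 have e: "dg u + (i + dg v) = dg u + i + dg v" by simp
 have "lin R (susp A i) (susp E k) (%x. f (Suc (length u + length v)) (dg u + i + dg v) (tword R (susp A) (u @ (i,x) # v)))"
  by (rule lin_compose[OF tword_lin[OF _ u(1,2) refl refl] HOM_lin[OF CCu_HOM[OF f]]]) (use A u in auto)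
 then show "lin R (susp A i) (susp E k) (%x. cc_at R A f (u @ (i,x) # v))" by (simp add: cc_at_def e)
qed

lemma cc_at_closed:
 "gm A ==> f \<in> CCu R A E n ==> vw (susp A) w ==> dg w + n = k ==> cc_at R A f w <: susp E k" by (rule mlin_closed[OF cc_at_mlin])

lemma CCu_eqI:
 assumes A: "gm A" and E: "gm E" and f: "f \<in> CCu R A E n" and g: "g \<in> CCu R A E n"
  and eq: "!!w. vw (susp A) w ==> cc_at R A f w = cc_at R A g w"
 shows "f = g"
proof
 fix k
 show "f k = g k"
 proof (rule HOM_eqI[OF CCu_HOM[OF f] CCu_HOM[OF g]])
  fix d X assume X: "X <: tpow R (susp A) k d"
  show "f k d X = g k d X" by (rule tpow_lin_eq[OF _ _ HOM_lin[OF CCu_HOM[OF f] refl] HOM_lin[OF CCu_HOM[OF g] refl] _ X])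
    (use A E eq in \<open>auto simp: cc_at_def\<close>)
 qed
qed

lemma
 assumes A: "gm A" and E: "gm E" and m: "mlin R (susp A) (susp E) n \<phi>"
 shows cc_of_CCu: "cc_of R A E n \<phi> \<in> CCu R A E n"
  and cc_at_of: "!!w. vw (susp A) w ==> cc_at R A (cc_of R A E n \<phi>) w = \<phi> w"
 using tpow_ext_HOM[OF _ _ m] tpow_ext_word[OF _ _ m] A E by (auto simp: CCu_def cc_of_def cc_at_def)

lemma cc_of_cong:
 assumes A: "gm A" and E: "gm E" and m: "mlin R (susp A) (susp E) n \<psi>"
  and eq: "!!w. vw (susp A) w ==> \<phi> w = \<psi> w"
 shows "cc_of R A E n \<phi> = cc_of R A E n \<psi>" unfolding cc_of_def
 by (intro ext, subst tpow_ext_cong[of "susp A" "susp E" \<phi> \<psi>]) (use A E eq mlin_closed[OF m] in auto)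

lemma
 assumes A: "gm A" and E: "gm E" and f: "f \<in> CCu R A E n" and g: "g \<in> CCu R A E n"
 shows cc_add_CCu: "cc_add R A E n f g \<in> CCu R A E n"
  and cc_minus_CCu: "cc_minus R A E n f g \<in> CCu R A E n"
  and cc_at_add: "!!w k. vw (susp A) w ==> dg w + n = k ==> cc_at R A (cc_add R A E n f g) w = cc_at R A f w +[susp E k] cc_at R A g w"
  and cc_at_minus: "!!w k. vw (susp A) w ==> dg w + n = k ==> cc_at R A (cc_minus R A E n f g) w = cc_at R A f w -[susp E k] cc_at R A g w"
proof -
 have T: "gm (tpow R (susp A) k)" "gm (susp E)" for k using A E by auto
 note HM = HOM_module[OF T]
 show "cc_add R A E n f g \<in> CCu R A E n" "cc_minus R A E n f g \<in> CCu R A E n"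
  using HM f g by (auto simp: CCu_def cc_add_def cc_minus_def)
 fix w k assume w: "vw (susp A) w" "dg w + n = k"
 have t: "tword R (susp A) w <: tpow R (susp A) (length w) (dg w)" using A w by simp
 show "cc_at R A (cc_add R A E n f g) w = cc_at R A f w +[susp E k] cc_at R A g w" unfolding cc_at_def cc_add_def using t w by simp
 show "cc_at R A (cc_minus R A E n f g) w = cc_at R A f w -[susp E k] cc_at R A g w" unfolding cc_at_def cc_minus_def
  by (rule HOM_minus_apply[OF T t w(2) CCu_HOM[OF f] CCu_HOM[OF g]])
qed

lemma
 assumes A: "gm A" and E: "gm E"
 shows cc_zero_CCu: "cc_zero R A E n \<in> CCu R A E n"
  and cc_at_zero: "!!w k. vw (susp A) w ==> dg w + n = k ==> cc_at R A (cc_zero R A E n) w = \<zero>[susp E k]"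
 using HOM_module A E by (auto simp: CCu_def cc_zero_def cc_at_def)

lemma
 assumes A: "gm A" and E: "gm E" and f: "f \<in> CCu R A E n"
 shows cc_ge1_CC: "cc_ge1 R A E n f \<in> CC R A E n"
  and cc_at_ge1: "!!w k. vw (susp A) w ==> dg w + n = k ==> cc_at R A (cc_ge1 R A E n f) w = (if w = [] then \<zero>[susp E k] else cc_at R A f w)"
proof -
 show "cc_ge1 R A E n f \<in> CC R A E n" using f cc_zero_CCu[OF A E, of n] by (auto simp: CC_def CCu_def cc_ge1_def)
 show "!!w k. vw (susp A) w ==> dg w + n = k ==> cc_at R A (cc_ge1 R A E n f) w = (if w = [] then \<zero>[susp E k] else cc_at R A f w)"
  using cc_at_zero[OF A E, of "[]" n] by (auto simp: cc_at_def cc_ge1_def)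
qed

lemma CC_iff:
 assumes A: "gm A" and E: "gm E"
 shows "f \<in> CC R A E n \<longleftrightarrow> f \<in> CCu R A E n \<and> cc_at R A f [] = \<zero>[susp E n]"
proof
 assume "f \<in> CC R A E n"
 then show "f \<in> CCu R A E n \<and> cc_at R A f [] = \<zero>[susp E n]"
  using cc_at_zero[OF A E, of "[]" n n] by (auto simp: CC_def cc_at_def)
next
 assume f: "f \<in> CCu R A E n \<and> cc_at R A f [] = \<zero>[susp E n]"
 have "f = cc_ge1 R A E n f"
  by (rule CCu_eqI[OF A E]) (use f cc_ge1_CC[OF A E, of f n] cc_at_ge1[OF A E, of f n] in \<open>auto simp: CC_def\<close>)
 then show "f \<in> CC R A E n" using cc_ge1_CC[OF A E, of f n] f by auto
qed

text \<open>Taking \<open>f\<close> from \<open>CC\<close> makes its value on the empty word zero,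
  so the empty blocks that \<open>sum3\<close> counts contribute nothing and the positional sum of
  \<open>cc_circ\<close> is recovered.\<close>

lemma
 assumes A: "gm A" and E: "gm E" and g: "g \<in> CCu R A E b" and f: "f \<in> CC R A A a"
 shows cc_circ_CCu: "cc_circ R A E b a g f \<in> CCu R A E (b + a)"
  and cc_at_circ: "!!w k. vw (susp A) w ==> dg w + (b + a) = k ==> cc_at R A (cc_circ R A E b a g f) w =
   sum3 (susp E k) (%u m v. sg (a * dg u) *[susp E k] cc_at R A g (u @ (dg m + a, cc_at R A f m) # v)) w"
proof -
 have sA: "gm (susp A)" and sE: "gm (susp E)" using A E by auto
 have f': "f \<in> CCu R A A a" and f0: "cc_at R A f [] = \<zero>[susp A a]" using f CC_iff[OF A A] by auto
 note gm = cc_at_mlin[OF A g] and fm = cc_at_mlin[OF A f']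
 have fc: "cc_at R A f m <: susp A (dg m + a)" if "vw (susp A) m" for m by (rule mlin_closed[OF fm that refl])
 let ?F = "%k u m v. sg (a * dg u) *[susp E k] cc_at R A g (u @ (dg m + a, cc_at R A f m) # v)"
 let ?G = "%u m v. ?F (dg u + dg m + dg v + (b + a)) u m v"
 have gl: "lin R (susp A i) (susp E k) (%x. cc_at R A g (u @ (i,x) # v))" if "vw (susp A) u" "vw (susp A) v" "k = dg u + i + dg v + b" for u v i k
  by (rule mlin_lin[OF gm]) (use that in auto)
 have gc: "cc_at R A g (u @ (dg m + a, cc_at R A f m) # v) <: susp E k" if "vw (susp A) u" "vw (susp A) v" "vw (susp A) m" "k = dg u + dg m + dg v + (b + a)" for u m v k
  by (rule mlin_closed[OF gm]) (use that fc in auto)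
 have m0: "mlin R (susp A) (susp E) (b + a) (%w. sum3 (susp E (dg w + (b + a))) ?G w)" by (rule mlin_circ[OF sA sE gm fm])
 have z: "?F k u [] v = \<zero>[susp E k]" if "vw (susp A) u" "vw (susp A) v" "k = dg u + dg v + (b + a)" for u v k
 proof -
  have "lin R (susp A a) (susp E k) (%x. cc_at R A g (u @ (a,x) # v))" by (rule gl) (use that in auto)
  from lin_zero[OF _ _ this] show ?thesis using sA sE f0 by simp
 qed
 let ?\<phi> = "%w. let n = length w; W = susp E (dg w + (b + a)) in
   \<Oplus>\<^bsub>W\<^esub>i\<in>{1..n}. \<Oplus>\<^bsub>W\<^esub>j\<in>{..<i}.
    let u = take j w; m = take (n - i + 1) (drop j w); v = drop (j + (n - i + 1)) w in
    sg (a * dg u) *[W] cc_at R A g (u @ (dg m + a, cc_at R A f m) # v)"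
 have eq: "?\<phi> w = sum3 (susp E (dg w + (b + a))) ?G w" if w: "vw (susp A) w" for w
 proof -
  have "?\<phi> w = sum3 (susp E (dg w + (b + a))) (?F (dg w + (b + a))) w" unfolding Let_def
   by (rule finsum_circ) (use w gc z sE in \<open>auto simp: add.assoc\<close>)
  also have "... = sum3 (susp E (dg w + (b + a))) ?G w" by (rule sum3_cong) (use w gc sE in \<open>auto simp: add.assoc\<close>)
  finally show ?thesis .
 qed
 have m1: "mlin R (susp A) (susp E) (b + a) ?\<phi>" by (rule mlin_cong[OF sA m0 eq])
 show "cc_circ R A E b a g f \<in> CCu R A E (b + a)" unfolding cc_circ_def by (rule cc_of_CCu[OF A E m1])
 fix w k assume w: "vw (susp A) w" and k: "dg w + (b + a) = k"
 have "cc_at R A (cc_circ R A E b a g f) w = sum3 (susp E (dg w + (b + a))) ?G w"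
  unfolding cc_circ_def cc_at_of[OF A E m1 w] by (rule eq[OF w])
 also have "... = sum3 (susp E k) (?F k) w"
  unfolding k by (rule sum3_cong) (use w k[symmetric] gc sE in \<open>auto simp: add.assoc\<close>)
 finally show "cc_at R A (cc_circ R A E b a g f) w = sum3 (susp E k) (?F k) w" .
qed

end

section \<open>A-infinity algebras with split unit\<close>

locale ainf = ground R for R :: "'k ring" +
 fixes A :: "('k, 'a) gmod" and e :: 'a and \<epsilon> :: "('a, 'k) gmap" and \<mu> :: "('k, 'a, 'a) cochain" and h :: "('k, 'a, 'k) cochain"
 assumes ainf: "Ainf_algebra_split_unit R A e \<epsilon> \<mu> h"
begin

abbreviation "B \<equiv> bar_mod R A \<epsilon>"
abbreviation "V \<equiv> susp B"
abbreviation "CT \<equiv> tens R (tco R V)"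
abbreviation "CH M N \<equiv> CCu R (bar_mod R A \<epsilon>) (HOM R M N)"
abbreviation "vA \<equiv> vw (susp A)"
abbreviation "ac \<equiv> cc_at R A"
abbreviation "cinc \<equiv> cc_incl R A e \<epsilon>"
abbreviation "fullp \<equiv> full_p R A e \<epsilon>"
abbreviation "SU \<equiv> SURep R A e \<epsilon> \<mu> h"
abbreviation "surep \<equiv> su_rep R A e \<epsilon> \<mu> h"
abbreviation "rmor \<equiv> rep_mor R A e \<epsilon> \<mu> h"
abbreviation "bobj \<equiv> bar_obj R A \<epsilon> \<mu> h"

lemma A [simp]: "gm A" and e [simp]: "e <: A 0"
 and eps: "\<epsilon> <: Hom A (kmod R) 0" and eps_e [simp]: "\<epsilon> 0 e = \<one>\<^bsub>R\<^esub>"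
 and mu: "\<mu> \<in> CC R B B (-1)" and h: "h \<in> CC R B (kmod R) (-1)"
 and struct: "Ainf_structure R A (total_mu R A e \<epsilon> \<mu> h)"
 using ainf by (auto simp: Ainf_algebra_split_unit_def split_element_def)

lemma eps_lin: "lin R (A i) (kmod R i) (\<epsilon> i)" by (rule HOM_lin[OF eps]) simp

lemma eps_kmod: "x <: A i ==> \<epsilon> i x <: kmod R i" by (rule lin_closed[OF eps_lin])

lemma eps_closed [simp]: "x <: A i ==> \<epsilon> i x <: R" by (rule kmodD[OF eps_kmod])

lemma eps_nz: "x <: A i ==> i ~= 0 ==> \<epsilon> i x = \<zero>[R]" using eps_kmod[of x i] by (auto simp: kmod_carrier)

lemma B_simps [simp]: "x +[B i] y = x +[A i] y" "\<zero>[B i] = \<zero>[A i]" "r *[B i] x = r *[A i] x" by (simp_all add: bar_mod_def)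

lemma B_carrier: "x <: B i \<longleftrightarrow> x <: A i \<and> \<epsilon> i x = \<zero>[R]" by (simp add: bar_mod_def)

lemma B [simp]: "gm B" unfolding gmodule_def
proof
 fix i
 interpret M: module R "A i" by simp
 have "submodule {x \<in> carrier (A i). \<epsilon> i x = \<zero>[R]} R (A i)"
 proof (rule M.submoduleI)
  show "\<zero>[A i] \<in> {x \<in> carrier (A i). \<epsilon> i x = \<zero>[R]}" using lin_zero[OF _ _ eps_lin] by simp
  fix a assume a: "a \<in> {x \<in> carrier (A i). \<epsilon> i x = \<zero>[R]}"
  then show "-[A i] a \<in> {x \<in> carrier (A i). \<epsilon> i x = \<zero>[R]}"
   using lin_neg[OF _ _ eps_lin, where x=a] m_negzero[OF gmod_module[OF kmod_module], of i] by simp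
  fix r assume "r <: R"
  then show "r *[A i] a \<in> {x \<in> carrier (A i). \<epsilon> i x = \<zero>[R]}" using a lin_smult[OF eps_lin, where r=r and x=a] by simp
 next
  fix a b assume "a \<in> {x \<in> carrier (A i). \<epsilon> i x = \<zero>[R]}" "b \<in> {x \<in> carrier (A i). \<epsilon> i x = \<zero>[R]}"
  then show "a +[A i] b \<in> {x \<in> carrier (A i). \<epsilon> i x = \<zero>[R]}" using lin_add[OF eps_lin, where x=a and y=b] by simp
 qed auto
 from submodule.submodule_is_module[OF this M.module_axioms]
 show "md (B i)" by (simp add: bar_mod_def)
qed

lemma B_incl: "lin R (B i) (A i) (%x. x)" by (rule linI) (auto simp: B_carrier)

text \<open>\<open>bar_mod\<close> shares addition and scalars with \<open>A\<close>, but negation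
  is derived from the carrier, hence the detour through the linear inclusion.\<close>

lemma B_neg: "x <: B i ==> -[B i] x = -[A i] x" using lin_neg[OF _ _ B_incl, of i x] by simp

lemma B_kact: "kact B p q = kact A p q" by (cases p; cases q) (simp add: kact_def)

lemma V_A: "x <: V i ==> x <: susp A i" by (simp add: susp_at B_carrier)

lemma vw_V_A: "vw V w ==> vA w" using V_A by (auto simp: vw_def)

abbreviation "bp i \<equiv> bar_proj A e \<epsilon> i"

lemma unit_lin: "lin R (kmod R i) (A i) (unit_map A e i)" unfolding unit_map_def by (rule kact_lin1) auto

lemma eps_unit: "r <: kmod R i ==> \<epsilon> i (unit_map A e i r) = r"
proof (cases "i = 0")
 case True
 assume "r <: kmod R i"
 then have r: "r <: R" by (rule kmodD)
 show ?thesis using lin_smult[OF eps_lin[of 0] r e] True r by (simp add: unit_map_def kact_def)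
next
 case False
 assume "r <: kmod R i"
 then show ?thesis using lin_zero[OF _ _ eps_lin, of i] False by (simp add: unit_map_def kact_def kmod_carrier)
qed

lemma eps_bp: assumes x: "x <: A i" shows "\<epsilon> i (bp i x) = \<zero>[R]"
proof -
 have u: "unit_map A e i (\<epsilon> i x) <: A i" by (rule lin_closed[OF unit_lin eps_kmod[OF x]])
 have "\<epsilon> i (bp i x) = \<epsilon> i x -[kmod R i] \<epsilon> i x"
  unfolding bar_proj_def by (subst lin_minus[OF _ _ eps_lin x u]) (use x eps_unit[OF eps_kmod[OF x]] in auto)
 also have "... = \<zero>[kmod R i]" using eps_kmod[OF x] m_rneg[OF gmod_module[OF kmod_module] eps_kmod[OF x]] by (simp add: a_minus_def)
 finally show ?thesis by simp
qed

lemma bp_A: "lin R (A i) (A i) (bp i)" unfolding bar_proj_def by (rule lin_diff[OF _ lin_id lin_compose[OF eps_lin unit_lin]]) simp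

lemma bp_lin: "lin R (A i) (B i) (bp i)" using bp_A[of i] eps_bp by (auto simp: lin_def B_carrier)

lemma bp_closed [simp]: "x <: A i ==> bp i x <: B i" by (rule lin_closed[OF bp_lin])

lemma bp_B [simp]: assumes "x <: B i" shows "bp i x = x"
proof -
 have "unit_map A e i \<zero>[R] = \<zero>[A i]" using lin_zero[OF _ _ unit_lin, of i] by simp
 then show ?thesis using assms by (simp add: bar_proj_def B_carrier a_minus_def)
qed

lemma bp_unit: assumes "r <: kmod R i" shows "bp i (unit_map A e i r) = \<zero>[A i]"
 using eps_unit[OF assms] lin_closed[OF unit_lin assms] by (simp add: bar_proj_def a_minus_def)

text \<open>The projection to \<open>ker \<epsilon>\<close>, letter by letter; a letter of degree
  \<open>i\<close> in \<open>susp A\<close> lies in \<open>A (i - 1)\<close>. Including a cochain on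
  \<open>B\<close> into those on \<open>A\<close> is precomposition with \<open>bw\<close>, see
  \<open>cc_at_incl\<close>.\<close>

definition bw :: "(int \<times> 'a) list \<Rightarrow> (int \<times> 'a) list" where
 "bw w = map (%(i,x). (i, bp (i - 1) x)) w"

lemma bw_simps [simp]: "bw [] = []" "bw (p # w) = (fst p, bp (fst p - 1) (snd p)) # bw w" "bw (u @ v) = bw u @ bw v"
 "length (bw w) = length w" "bw w = [] \<longleftrightarrow> w = []" by (simp_all add: bw_def split: prod.splits)

lemma wdeg_bw [simp]: "dg (bw w) = dg w" by (induction w) auto

lemma vw_bw [simp]: "vA w ==> vw V (bw w)" by (induction w) (auto simp: susp_at)

lemma bw_V [simp]: "vw V w ==> bw w = w" by (induction w) (auto simp: susp_at)

lemma bw_mlin: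
 assumes m: "mlin R V W n \<phi>"
 shows "mlin R (susp A) W n (%w. \<phi> (bw w))"
proof (rule mlinI)
 show "\<phi> (bw []) <: W n" using mlin_closed[OF m, of "[]"] by simp
 fix u i v k assume uv: "vA u" "vA v" "k = dg u + i + dg v + n"
 have "lin R (susp A i) (V i) (bp (i - 1))" using bp_lin[of "i - 1"] by (simp add: susp_at)
 moreover have "lin R (V i) (W k) (%x. \<phi> (bw u @ (i,x) # bw v))" by (rule mlin_lin[OF m]) (use uv in auto)
 ultimately have "lin R (susp A i) (W k) (%x. \<phi> (bw u @ (i, bp (i - 1) x) # bw v))" by (rule lin_compose)
 then show "lin R (susp A i) (W k) (%x. \<phi> (bw (u @ (i,x) # v)))" using uv by simp
qed

lemma
 assumes E: "gm E" and f: "f \<in> CCu R B E n"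
 shows cc_incl_CCu: "cinc E n f \<in> CCu R A E n"
  and cc_at_incl: "!!w. vA w ==> ac (cinc E n f) w = cc_at R B f (bw w)"
 using cc_of_CCu[OF A E bw_mlin[OF cc_at_mlin[OF B f]]] cc_at_of[OF A E bw_mlin[OF cc_at_mlin[OF B f]]]
 by (simp_all add: cc_incl_def bw_def)

abbreviation "bm \<equiv> cc_at R B \<mu>"
abbreviation "hm \<equiv> cc_at R B h"

lemma bm_mlin: "mlin R V V (-1) bm" and bm_Nil: "bm [] = \<zero>[V (-1)]"
 and hm_mlin: "mlin R V (susp (kmod R)) (-1) hm" and hm_Nil: "hm [] = \<zero>[R]"
 using mu h CC_iff[OF B B] CC_iff[OF B kmod_module] cc_at_mlin[OF B] by (auto simp: susp_at)

lemma hm_kmod: "vw V w ==> hm w <: kmod R (dg w - 2)" using mlin_closed[OF hm_mlin, of w] by (simp add: susp_at)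

lemma bm_closed: "vw V w ==> bm w <: B (dg w - 2)" using mlin_closed[OF bm_mlin, of w] by (simp add: susp_at)

text \<open>\<open>total_mu\<close> includes \<open>\<mu>\<close> as a cochain with values in
  \<open>A\<close>, whereas \<open>\<mu>\<close> is given with values in \<open>B\<close>. Since
  \<open>B\<close> is carved out of \<open>A\<close> by restricting carriers, the same functions
  serve for both.\<close>

lemma mu_CCu_A: "\<mu> \<in> CCu R B A (-1)" unfolding CCu_def
proof (intro CollectI allI)
 fix n
 have m: "\<mu> n <: Hom (tpow R V n) V (-1)" using mu by (simp add: CC_def CCu_def)
 have "lin R (V i) (susp A i) (%x. x)" for i using B_incl by (simp add: susp_at)
 from lin_compose[OF HOM_lin[OF m refl] this]
 show "\<mu> n <: Hom (tpow R V n) (susp A) (-1)" using m by (auto simp: HOM_iff)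
qed

text \<open>The word function inside \<open>mu_su\<close>, made recursive to obtain a case rule. Its
  values lie in \<open>A (dg w - 2)\<close>: one is lost to the degree of the operation, one to
  removing the suspension.\<close>

fun ms :: "(int \<times> 'a) list \<Rightarrow> 'a" where
 "ms [(i,x), (j,y)] =
   kact A (i - 1, \<epsilon> (i - 1) x) (j - 1, y) +[A (i - 1 + (j - 1))] sg (i - 1) *[A (i - 1 + (j - 1))] kact A (j - 1, \<epsilon> (j - 1) y) (i - 1, x)
    -[A (i - 1 + (j - 1))] kact A (i - 1, \<epsilon> (i - 1) x) (j - 1, kact A (j - 1, \<epsilon> (j - 1) y) (0,e))"
| "ms w = \<zero>[A (dg w - 2)]"

lemma ms_other: "length w ~= 2 ==> ms w = \<zero>[A (dg w - 2)]" by (cases w rule: ms.cases) auto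

lemma mu_su_eq: "mu_su R A e \<epsilon> = cc_of R A A (-1) ms" unfolding mu_su_def
proof (rule arg_cong[where f="cc_of R A A (-1)"], rule ext)
 fix w :: "(int \<times> 'a) list"
 show "(case w of
    [(i,x), (j,y)] \<Rightarrow>
     let a = i - 1; b = j - 1; r = (a, \<epsilon> a x); t = (b, \<epsilon> b y) in
     kact A r (b,y) +[A (a + b)] (sg a *[A (a + b)] kact A t (a,x))
      -[A (a + b)] kact A r (b, kact A t (0,e))
   | _ \<Rightarrow> \<zero>[susp A (dg w - 1)]) = ms w" by (cases w rule: ms.cases) (auto simp: Let_def susp_at)
qed

lemma ms_lin:
 assumes y: "y <: A (j - 1)" and k: "k = i + j - 2"
 shows "lin R (A (i - 1)) (A k) (%x. ms [(i,x), (j,y)])" "lin R (A (i - 1)) (A k) (%x. ms [(j,y), (i,x)])"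
proof -
 have c: "kact A (j - 1, \<epsilon> (j - 1) y) (0,e) <: A (j - 1)" using y by (intro kact_closed) auto
 have e1: "i - 1 + (j - 1) = k" "j - 1 + (i - 1) = k" using k by auto
 have k1: "lin R (A (i - 1)) (A k) (%x. kact A (i - 1, \<epsilon> (i - 1) x) (j - 1, z))" if "z <: A (j - 1)" for z
  by (rule lin_compose[OF eps_lin kact_lin1[OF A that]]) (use k in auto)
 have k2: "lin R (A (i - 1)) (A k) (%x. kact A (j - 1, \<epsilon> (j - 1) y) (i - 1, x))" by (rule kact_lin2) (use y k in auto)
 have k3: "lin R (A (i - 1)) (A k) (%x. kact A (j - 1, \<epsilon> (j - 1) y) (i - 1, kact A (i - 1, \<epsilon> (i - 1) x) (0,e)))"
  by (rule lin_compose[OF lin_compose[OF eps_lin kact_lin1[OF A e]] k2]) auto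
 have m: "md (A k)" by simp
 show "lin R (A (i - 1)) (A k) (%x. ms [(i,x), (j,y)])"
  unfolding ms.simps e1 by (intro lin_diff[OF m] lin_plus[OF m] lin_scale[OF m] k1 k2 y c sgn_in)
 show "lin R (A (i - 1)) (A k) (%x. ms [(j,y), (i,x)])"
  unfolding ms.simps e1 by (intro lin_diff[OF m] lin_plus[OF m] lin_scale[OF m] k1 k2 k3 y sgn_in)
qed

lemma ms_mlin: "mlin R (susp A) (susp A) (-1) ms"
proof (rule mlinI)
 show "ms [] <: susp A (-1)" by (simp add: susp_at)
 fix u i v k assume uv: "vA u" "vA v" "k = dg u + i + dg v + -1"
 consider j y where "u = []" "v = [(j,y)]" | j y where "u = [(j,y)]" "v = []" | "length u + length v ~= 1"
  by (cases u; cases v; cases "tl u"; cases "tl v") auto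
 then show "lin R (susp A i) (susp A k) (%x. ms (u @ (i,x) # v))"
 proof cases
  case 1 then show ?thesis using uv ms_lin(1)[of y j "k - 1" i] by (simp add: susp_at del: ms.simps)
 next
  case 2 then show ?thesis using uv ms_lin(2)[of y j "k - 1" i] by (simp add: susp_at del: ms.simps)
 next
  case 3
  have e: "dg (u @ (i,x) # v) - 2 = k - 1" for x using uv(3) by simp
  have "ms (u @ (i,x) # v) = \<zero>[susp A k]" for x unfolding susp_at e[of x, symmetric] by (rule ms_other) (use 3 in auto)
  then show ?thesis using lin_const0[of "susp A k" "susp A i"] by (simp del: ms.simps)
 qed
qed

abbreviation "nu \<equiv> total_mu R A e \<epsilon> \<mu> h"

lemma nu_CC: "nu \<in> CC R A A (-1)" and nu_nu: "cc_circ R A A (-1) (-1) nu nu = cc_zero R A A (-2)"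
 using struct by (auto simp: Ainf_structure_def)

lemma nu_word: assumes w: "vA w" and k: "dg w - 2 = k"
 shows "ac nu w = bm (bw w) +[A k] unit_map A e k (hm (bw w)) +[A k] ms w"
proof -
 have k': "dg w + -1 = k + 1" using k by simp
 have h': "h \<in> CCu R B (kmod R) (-1)" using h by (simp add: CC_def)
 let ?h = "cinc (kmod R) (-1) h"
 note hc = cc_incl_CCu[OF kmod_module h']
 have u: "cc_unit R A e ?h \<in> CCu R A A (-1)" unfolding CCu_def
 proof (intro CollectI allI)
  fix n
  have l1: "lin R (tpow R (susp A) n d) (kmod R (d - 2)) (?h n d)" for d
   using HOM_lin[OF CCu_HOM[OF hc, of n] refl, of d] by (simp add: susp_at)
  have l: "lin R (tpow R (susp A) n d) (susp A (d + -1)) (%X. unit_map A e (d - 2) (?h n d X))" for d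
   using lin_compose[OF l1 unit_lin, of d] by (simp add: susp_at)
  have "(%d. \<lambda>X\<in>carrier (tpow R (susp A) n d). unit_map A e (d - 2) (?h n d X)) <: Hom (tpow R (susp A) n) (susp A) (-1)"
   by (rule HOM_restrict, simp, rule l)
  then show "cc_unit R A e ?h n <: Hom (tpow R (susp A) n) (susp A) (-1)" by (simp add: cc_unit_def)
 qed
 have uw: "ac (cc_unit R A e ?h) w = unit_map A e k (hm (bw w))"
 proof -
  have "tword R (susp A) w <: tpow R (susp A) (length w) (dg w)" using w by simp
  then have "ac (cc_unit R A e ?h) w = unit_map A e (dg w - 2) (ac ?h w)" by (simp add: cc_at_def cc_unit_def)
  then show ?thesis using cc_at_incl[OF kmod_module h' w] k by simp
 qed
 note mc = cc_incl_CCu[OF A mu_CCu_A]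
 note sc = cc_of_CCu[OF A A ms_mlin]
 have "ac nu w = ac (cc_add R A A (-1) (cinc A (-1) \<mu>) (cc_unit R A e ?h)) w +[A k] ac (mu_su R A e \<epsilon>) w"
  using cc_at_add[OF A A cc_add_CCu[OF A A mc u] sc w k'] unfolding total_mu_def mu_su_eq by (simp add: susp_at)
 also have "ac (mu_su R A e \<epsilon>) w = ms w" unfolding mu_su_eq by (rule cc_at_of[OF A A ms_mlin w])
 also have "ac (cc_add R A A (-1) (cinc A (-1) \<mu>) (cc_unit R A e ?h)) w = bm (bw w) +[A k] unit_map A e k (hm (bw w))"
  using cc_at_add[OF A A mc u w k'] uw cc_at_incl[OF A mu_CCu_A w] by (simp add: susp_at)
 finally show ?thesis .
qed

lemma eps_kact: assumes "r <: R" "x <: A j" "i + j = k"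
 shows "\<epsilon> k (kact A (i,r) (j,x)) = (if i = 0 then r \<otimes>\<^bsub>R\<^esub> \<epsilon> k x else \<zero>[R])"
 using assms lin_smult[OF eps_lin[of j] assms(1,2)] lin_zero[OF _ _ eps_lin[of "i + j"]] by (auto simp: kact_def)

lemma bp_kact: assumes "r <: R" "x <: A j" "i + j = k"
 shows "bp k (kact A (i,r) (j,x)) = kact A (i,r) (j, bp j x)"
 using assms lin_smult[OF bp_A[of j] assms(1,2)] lin_zero[OF _ _ bp_A[of "i + j"]] by (auto simp: kact_def)

lemma bp_e: "bp 0 e = \<zero>[A 0]" using bp_unit[of "\<one>\<^bsub>R\<^esub>" 0] by (simp add: kmod_carrier unit_map_def kact_def)

text \<open>The splitting separates two effects. After projection to \<open>ker \<epsilon>\<close>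
  the correction \<open>\<epsilon>(x) \<epsilon>(y) 1\<close> disappears, and each argument acts on
  the other through its \<open>\<epsilon>\<close>-value. After \<open>\<epsilon>\<close>, if both
  degrees are 0, the three terms are \<open>\<epsilon>(x) \<epsilon>(y)\<close> twice with a plus
  and once with a minus; otherwise all of them vanish.\<close>

lemma ms_parts:
 assumes x: "x <: A i" and y: "y <: A j" and k: "i + j = k"
 shows "bp k (ms [(i + 1, x), (j + 1, y)]) = kact A (i, \<epsilon> i x) (j, bp j y) +[A k] sg i *[A k] kact A (j, \<epsilon> j y) (i, bp i x)"
  and "\<epsilon> k (ms [(i + 1, x), (j + 1, y)]) = (if i = 0 \<and> j = 0 then \<epsilon> i x \<otimes>\<^bsub>R\<^esub> \<epsilon> j y else \<zero>[R])"
proof -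
 let ?a = "kact A (i, \<epsilon> i x) (j,y)" and ?b = "kact A (j, \<epsilon> j y) (i,x)" and ?c = "kact A (i, \<epsilon> i x) (j, kact A (j, \<epsilon> j y) (0,e))"
 have ce: "kact A (j, \<epsilon> j y) (0,e) <: A j" using y by (intro kact_closed) auto
 have c: "?a <: A k" "?b <: A k" "?c <: A k" using x y k ce by (auto intro!: kact_closed)
 have m: "md (A k)" by simp
 have me: "ms [(i + 1, x), (j + 1, y)] = ?a +[A k] sg i *[A k] ?b -[A k] ?c" using k by simp
 have sb: "sg i *[A k] ?b <: A k" "?a +[A k] sg i *[A k] ?b <: A k" using c m by auto
 have "bp k ?c = kact A (i, \<epsilon> i x) (j, kact A (j, \<epsilon> j y) (0, \<zero>[A 0]))"
  using bp_kact[OF _ ce k] bp_kact[OF _ e, of "\<epsilon> j y" j j] x y bp_e by simp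
 also have "... = \<zero>[A k]" using x y k by (auto simp: kact_def)
 finally have pc: "bp k ?c = \<zero>[A k]" .
 have "bp k (ms [(i + 1, x), (j + 1, y)]) = bp k ?a +[A k] sg i *[A k] bp k ?b -[A k] bp k ?c"
  unfolding me lin_minus[OF m m bp_A sb(2) c(3)] lin_add[OF bp_A c(1) sb(1)] lin_smult[OF bp_A sgn_in c(2)] ..
 then show "bp k (ms [(i + 1, x), (j + 1, y)]) = kact A (i, \<epsilon> i x) (j, bp j y) +[A k] sg i *[A k] kact A (j, \<epsilon> j y) (i, bp i x)"
  using pc bp_kact[OF _ y k, of "\<epsilon> i x"] bp_kact[OF _ x, of "\<epsilon> j y" j k] x y k m lin_closed[OF bp_A c(1)] lin_closed[OF bp_A c(2)]
  by (simp add: a_minus_def)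
 have mk: "md (kmod R k)" by simp
 have ek: "\<epsilon> k (ms [(i + 1, x), (j + 1, y)]) = \<epsilon> k ?a +[kmod R k] sg i *[kmod R k] \<epsilon> k ?b -[kmod R k] \<epsilon> k ?c"
  unfolding me lin_minus[OF m mk eps_lin sb(2) c(3)] lin_add[OF eps_lin c(1) sb(1)] lin_smult[OF eps_lin sgn_in c(2)] ..
 have ea: "\<epsilon> k ?a = (if i = 0 then \<epsilon> i x \<otimes>\<^bsub>R\<^esub> \<epsilon> j y else \<zero>[R])" "\<epsilon> k ?b = (if j = 0 then \<epsilon> j y \<otimes>\<^bsub>R\<^esub> \<epsilon> i x else \<zero>[R])"
  using eps_kact[OF _ y k, of "\<epsilon> i x"] eps_kact[OF _ x, of "\<epsilon> j y" j k] x y k by auto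
 have ec: "\<epsilon> k ?c = (if i = 0 \<and> j = 0 then \<epsilon> i x \<otimes>\<^bsub>R\<^esub> \<epsilon> j y else \<zero>[R])"
  using eps_kact[OF _ ce k, of "\<epsilon> i x"] eps_kact[OF _ e, of "\<epsilon> j y" j j] x y k by auto
 show "\<epsilon> k (ms [(i + 1, x), (j + 1, y)]) = (if i = 0 \<and> j = 0 then \<epsilon> i x \<otimes>\<^bsub>R\<^esub> \<epsilon> j y else \<zero>[R])"
 proof (cases "i = 0 \<and> j = 0")
  case True
  then have "k = 0" using k by simp
  have r: "\<epsilon> 0 x \<otimes>\<^bsub>R\<^esub> \<epsilon> 0 y <: kmod R 0" using x y True by (simp add: kmod_carrier)
  show ?thesis using ek ea ec True x y \<open>k = 0\<close> r m_rneg[OF gmod_module[OF kmod_module] r] m_add[OF gmod_module[OF kmod_module] r r]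
    m_assoc'[OF gmod_module[OF kmod_module] r r m_neg[OF gmod_module[OF kmod_module] r]]
   by (simp add: m_comm[of "\<epsilon> 0 y"] a_minus_def)
 next
  case False
  have "\<epsilon> k ?a = \<zero>[R]" "\<epsilon> k ?b = \<zero>[R]" "\<epsilon> k ?c = \<zero>[R]"
   using ea ec False x y eps_nz[of x i] eps_nz[of y j] by auto
  then show ?thesis using ek False m_negzero[OF mk] by (auto simp: a_minus_def)
 qed
qed

end

context ground begin

lemma kact_neg: assumes M: "gm M" and r: "r <: kmod R i" and x: "x <: M j" and k: "i + j = k"
 shows "kact M (i, -[kmod R i] r) (j,x) = -[M k] kact M (i,r) (j,x)" by (rule lin_neg[OF _ _ kact_lin1[OF M x k] r]) (use M in auto)

lemma kact_zero: "gm M ==> x <: M j ==> i + j = k ==> kact M (i, \<zero>[R]) (j,x) = \<zero>[M k]" by (auto simp: kact_def)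

end

section \<open>The curved bar relation from the A-infinity relation\<close>

context ainf begin

lemma nu_CCu: "nu \<in> CCu R A A (-1)" using nu_CC by (simp add: CC_def)

lemma nu_closed: "vA w ==> dg w - 2 = k ==> ac nu w <: A k" using cc_at_closed[OF A nu_CCu, of w "k + 1"] by (simp add: susp_at)

lemma ms_closed: "vA w ==> dg w - 2 = k ==> ms w <: A k" using mlin_closed[OF ms_mlin, of w "k + 1"] by (simp add: susp_at del: ms.simps)

lemma V_carrier: "x <: V i \<longleftrightarrow> x <: A (i - 1) \<and> \<epsilon> (i - 1) x = \<zero>[R]" by (simp add: susp_at B_carrier)

lemma ms_V: assumes w: "vw V w" shows "ms w = \<zero>[A (dg w - 2)]"
proof (cases "length w = 2")
 case True
 then obtain i x j y where w': "w = [(i,x), (j,y)]" by (cases w rule: ms.cases) auto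
 have c: "x <: A (i - 1)" "\<epsilon> (i - 1) x = \<zero>[R]" "y <: A (j - 1)" "\<epsilon> (j - 1) y = \<zero>[R]"
  using w w' by (auto simp: V_carrier)
 have z: "kact A (j - 1, \<zero>[R]) (0,e) = \<zero>[A (j - 1)]" by (rule kact_zero) auto
 have z1: "kact A (i - 1, \<zero>[R]) (j - 1, y) = \<zero>[A (i - 1 + (j - 1))]" "kact A (i - 1, \<zero>[R]) (j - 1, \<zero>[A (j - 1)]) = \<zero>[A (i - 1 + (j - 1))]"
  "kact A (j - 1, \<zero>[R]) (i - 1, x) = \<zero>[A (i - 1 + (j - 1))]" using c by (auto intro!: kact_zero)
 have e2: "dg w - 2 = i - 1 + (j - 1)" using w' by simp
 show ?thesis unfolding e2 unfolding w' ms.simps c z z1 by (simp add: a_minus_def)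
qed (rule ms_other)

text \<open>On words in \<open>ker \<epsilon>\<close> the cochain \<open>mu_su\<close> is silent, so
  the splitting reads off \<open>bm\<close> and \<open>hm\<close> as the two components of
  \<open>nu\<close>.\<close>

lemma nu_V: assumes m: "vw V m" and k: "dg m - 2 = k"
 shows "bp k (ac nu m) = bm m" "\<epsilon> k (ac nu m) = hm m"
proof -
 have M: "md (A k)" by simp
 have b: "bm m <: B k" using bm_closed[OF m] k by simp
 then have b': "bm m <: A k" "\<epsilon> k (bm m) = \<zero>[R]" by (auto simp: B_carrier)
 have hk: "hm m <: kmod R k" using hm_kmod[OF m] k by simp
 have u: "unit_map A e k (hm m) <: A k" by (rule lin_closed[OF unit_lin hk])
 have nu: "ac nu m = bm m +[A k] unit_map A e k (hm m)" using nu_word[OF vw_V_A[OF m] k] ms_V[OF m] b' u m k by simp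
 show "bp k (ac nu m) = bm m" unfolding nu lin_add[OF bp_A b'(1) u] using b b' bp_unit[OF hk] by simp
 show "\<epsilon> k (ac nu m) = hm m" unfolding nu lin_add[OF eps_lin b'(1) u] using b' eps_unit[OF hk] kmodD[OF hk] by simp
qed

lemma bp_nu: assumes w: "vA w" and k: "dg w - 2 = k"
 shows "bp k (ac nu w) = bm (bw w) +[A k] bp k (ms w)"
proof -
 have b: "bm (bw w) <: B k" using bm_closed[of "bw w"] w k by simp
 then have b': "bm (bw w) <: A k" by (auto simp: B_carrier)
 have hk: "hm (bw w) <: kmod R k" using hm_kmod[of "bw w"] w k by simp
 have u: "unit_map A e k (hm (bw w)) <: A k" by (rule lin_closed[OF unit_lin hk])
 have bu: "bm (bw w) +[A k] unit_map A e k (hm (bw w)) <: A k" using b' u by simp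
 show ?thesis unfolding nu_word[OF w k] lin_add[OF bp_A bu ms_closed[OF w k]] lin_add[OF bp_A b' u] using b b' bp_unit[OF hk] by simp
qed

lemma eps_nu: assumes w: "vA w" and k: "dg w - 2 = k"
 shows "\<epsilon> k (ac nu w) = hm (bw w) +[R] \<epsilon> k (ms w)"
proof -
 have b: "bm (bw w) <: B k" using bm_closed[of "bw w"] w k by simp
 then have b': "bm (bw w) <: A k" "\<epsilon> k (bm (bw w)) = \<zero>[R]" by (auto simp: B_carrier)
 have hk: "hm (bw w) <: kmod R k" using hm_kmod[of "bw w"] w k by simp
 have u: "unit_map A e k (hm (bw w)) <: A k" by (rule lin_closed[OF unit_lin hk])
 have bu: "bm (bw w) +[A k] unit_map A e k (hm (bw w)) <: A k" using b' u by simp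
 show ?thesis unfolding nu_word[OF w k] lin_add[OF eps_lin bu ms_closed[OF w k]] lin_add[OF eps_lin b'(1) u]
  using b' eps_unit[OF hk] kmodD[OF hk] by simp
qed

lemma kact_V: "kact V (i,r) (l,y) = kact A (i,r) (l - 1, y)" by (simp add: kact_def susp_at add_diff_eq)

abbreviation "xi w \<equiv> -[kmod R (wdeg w - 2)] hm w"

text \<open>The A-infinity relation of \<open>nu\<close> on a word in \<open>ker \<epsilon>\<close>
  is projected to \<open>ker \<epsilon>\<close>. The only letter the outer \<open>nu\<close> may see
  outside \<open>ker \<epsilon>\<close> is the inner output. Hence its \<open>mu_su\<close> part
  survives only when exactly one letter stands next to the block, the last or the first one, and
  there it multiplies this letter by the component \<open>hm\<close> of the inner output. Moving
  these two terms to the other side produces the sign in \<open>xi = - h\<close>.\<close>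

lemma bb:
 assumes w: "vw V w" and ne: "w ~= []"
 shows "sum3 (V (dg w - 2)) (%u m v. sw u *[V (dg w - 2)] bm (u @ (dg m - 1, bm m) # v)) w =
    kact V (dg (butlast w) - 2, xi (butlast w)) (last w) -[V (dg w - 2)] kact V (dg (tl w) - 2, xi (tl w)) (hd w)"
proof -
 \<comment> \<open>Two operations lower the suspended degree \<open>dg w\<close> by 2, and removing
   the suspension lowers it by 1 more.\<close>
 define k where "k = dg w - 3"
 have Vk: "V (dg w - 2) = B k" by (simp add: susp_at k_def)
 have M: "md (B k)" and MA: "md (A k)" by simp_all
 let ?w' = "%u m v. u @ (dg m - 1, ac nu m) # v"
 have w': "vA (?w' u m v)" "dg (?w' u m v) - 2 = k" "vw V u" "vw V m" "vw V v" if "w = u @ m @ v" for u m v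
  using that w nu_closed[of m "dg m - 2"] by (auto simp: susp_at k_def vw_V_A)
 have bww': "bw (?w' u m v) = u @ (dg m - 1, bm m) # v" if "w = u @ m @ v" for u m v
  using w'(3-5)[OF that] nu_V(1)[OF w'(4)[OF that], of "dg m - 2"] by simp
 have bmc: "bm (u @ (dg m - 1, bm m) # v) <: B k" if "w = u @ m @ v" for u m v
  using bm_closed[OF vw_bw[OF w'(1)[OF that]]] w'(2)[OF that] bww'[OF that] by simp
 let ?S = "%u m v. sw u *[B k] bm (u @ (dg m - 1, bm m) # v)"
 let ?G = "%u m v. sw u *[B k] bp k (ms (?w' u m v))"
 have msc: "bp k (ms (?w' u m v)) <: B k" if "w = u @ m @ v" for u m v by (rule bp_closed[OF ms_closed[OF w'(1,2)[OF that]]])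
 have Sc: "?S u m v <: B k" and Gc: "?G u m v <: B k" if "w = u @ m @ v" for u m v
  using m_smult[OF M sgn_in bmc[OF that]] m_smult[OF M sgn_in msc[OF that]] by auto
 have "\<zero>[A k] = ac (cc_circ R A A (-1) (-1) nu nu) w"
  unfolding nu_nu using cc_at_zero[OF A A vw_V_A[OF w], of "-2" "k + 1"] by (simp add: susp_at k_def)
 also have "... = sum3 (A k) (%u m v. sw u *[A k] ac nu (?w' u m v)) w"
  using cc_at_circ[OF A A nu_CCu nu_CC vw_V_A[OF w], of "k + 1"] by (simp add: susp_at k_def)
 finally have "bp k \<zero>[A k] = bp k (sum3 (A k) (%u m v. sw u *[A k] ac nu (?w' u m v)) w)" by simp
 also have "... = sum3 (B k) (%u m v. bp k (sw u *[A k] ac nu (?w' u m v))) w"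
  by (rule lin_sum3[OF MA M bp_lin]) (use nu_closed w' MA in auto)
 also have "... = sum3 (B k) (%u m v. ?S u m v +[B k] ?G u m v) w"
 proof (rule sum3_cong[OF M])
  fix u m v assume uv: "w = u @ m @ v"
  have "bp k (sw u *[A k] ac nu (?w' u m v)) = sw u *[B k] bp k (ac nu (?w' u m v))"
   by (rule lin_smult[OF bp_lin sgn_in nu_closed[OF w'(1,2)[OF uv]]])
  also have "bp k (ac nu (?w' u m v)) = bm (u @ (dg m - 1, bm m) # v) +[B k] bp k (ms (?w' u m v))"
   unfolding bp_nu[OF w'(1,2)[OF uv]] bww'[OF uv] by simp
  also have "sw u *[B k] ... = ?S u m v +[B k] ?G u m v" by (rule m_sr[OF M sgn_in bmc[OF uv] msc[OF uv]])
  finally show "bp k (sw u *[A k] ac nu (?w' u m v)) = ?S u m v +[B k] ?G u m v" .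
  show "?S u m v +[B k] ?G u m v <: B k" by (rule m_add[OF M Sc[OF uv] Gc[OF uv]])
 qed
 also have "... = sum3 (B k) ?S w +[B k] sum3 (B k) ?G w" by (rule sum3_add[OF M Sc Gc])
 finally have main: "sum3 (B k) ?S w +[B k] sum3 (B k) ?G w = \<zero>[B k]" using lin_zero[OF MA M bp_lin] by simp
 have wl: "w = [] @ butlast w @ [last w]" "w = [hd w] @ tl w @ []" using ne by simp_all
 define i x where "i = fst (last w) - 1" and "x = snd (last w)"
 define j y where "j = fst (hd w) - 1" and "y = snd (hd w)"
 have lw: "last w = (i + 1, x)" and hw: "hd w = (j + 1, y)" by (simp_all add: i_def x_def j_def y_def)
 have cx: "x <: A i" "\<epsilon> i x = \<zero>[R]" "x <: B i" using w'(5)[OF wl(1)] lw by (auto simp: V_carrier B_carrier)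
 have cy: "y <: A j" "\<epsilon> j y = \<zero>[R]" "y <: B j" using w'(3)[OF wl(2)] hw by (auto simp: V_carrier B_carrier)
 define p where "p = dg (butlast w) - 2"
 define q where "q = dg (tl w) - 2"
 have "dg w = dg (butlast w) + fst (last w)" "dg w = fst (hd w) + dg (tl w)"
  using arg_cong[OF wl(1), of dg] arg_cong[OF wl(2), of dg] by simp_all
 then have deg: "p + i = k" "j + q = k" by (simp_all add: p_def q_def i_def j_def k_def)
 let ?n1 = "ac nu (butlast w)" and ?n2 = "ac nu (tl w)"
 have n1: "?n1 <: A p" and n2: "?n2 <: A q"
  using nu_closed vw_V_A[OF w'(4)[OF wl(1)]] vw_V_A[OF w'(4)[OF wl(2)]] by (auto simp: p_def q_def)
 have h1: "hm (butlast w) <: kmod R p" and h2: "hm (tl w) <: kmod R q"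
  using hm_kmod[OF w'(4)[OF wl(1)]] hm_kmod[OF w'(4)[OF wl(2)]] by (auto simp: p_def q_def)
 let ?k1 = "kact A (p, hm (butlast w)) (i,x)" and ?k2 = "kact A (q, hm (tl w)) (j,y)"
 have kB: "?k1 <: B k" "?k2 <: B k"
  using kact_closed[OF B kmodD[OF h1] cx(3) deg(1)] kact_closed[OF B kmodD[OF h2] cy(3), of q k] deg by (auto simp: B_kact)
 have G1: "?G [] (butlast w) [last w] = ?k1"
 proof -
  have "ms (?w' [] (butlast w) [last w]) = ms [(p + 1, ?n1), (i + 1, x)]" by (simp add: p_def lw del: ms.simps)
  then have "bp k (ms (?w' [] (butlast w) [last w])) = kact A (p, hm (butlast w)) (i,x) +[A k] sg p *[A k] kact A (i, \<zero>[R]) (p, bp p ?n1)"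
   using ms_parts(1)[OF n1 cx(1) deg(1)] nu_V(2)[OF w'(4)[OF wl(1)], of p] cx by (simp add: p_def del: ms.simps)
  moreover have "kact A (i, \<zero>[R]) (p, bp p ?n1) = \<zero>[A k]" by (rule kact_zero[OF A lin_closed[OF bp_A n1]]) (use deg in auto)
  ultimately show ?thesis using kB by (simp add: B_carrier del: ms.simps)
 qed
 have G2: "?G [hd w] (tl w) [] = -[B k] ?k2"
 proof -
  have "ms (?w' [hd w] (tl w) []) = ms [(j + 1, y), (q + 1, ?n2)]" by (simp add: q_def hw del: ms.simps)
  then have "bp k (ms (?w' [hd w] (tl w) [])) = kact A (j, \<zero>[R]) (q, bp q ?n2) +[A k] sg j *[A k] kact A (q, hm (tl w)) (j,y)"
   using ms_parts(1)[OF cy(1) n2 deg(2)] nu_V(2)[OF w'(4)[OF wl(2)], of q] cy by (simp add: q_def del: ms.simps)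
  moreover have "kact A (j, \<zero>[R]) (q, bp q ?n2) = \<zero>[A k]" by (rule kact_zero[OF A lin_closed[OF bp_A n2]]) (use deg in auto)
  moreover have "?k2 <: A k" using kB by (simp add: B_carrier)
  \<comment> \<open>One sign comes from moving the inner operation past \<open>hd w\<close>, of
    suspended degree \<open>j + 1\<close>, the other from \<open>mu_su\<close> with first argument
    of degree \<open>j\<close>. Together they are odd.\<close>
  ultimately have "?G [hd w] (tl w) [] = sg (j + 1 + j) *[A k] ?k2" using MA by (simp add: hw del: ms.simps)
  also have "... = -[A k] ?k2" by (rule sgn_odd[OF MA \<open>?k2 \<in> carrier (A k)\<close>]) simp
  finally show ?thesis using B_neg[OF kB(2)] by simp
 qed
 have sG: "sum3 (B k) ?G w = ?k1 +[B k] -[B k] ?k2"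
 proof -
  let ?T = "{([], butlast w, [last w]), ([hd w], tl w, [])}"
  have "sum3 (B k) ?G w = finsum (B k) (%s. ?G (fst s) (fst (snd s)) (snd (snd s))) ?T"
  proof (rule sum3_restrict[OF M])
   show "?T \<subseteq> S3 w" using wl by simp
   fix u m v assume uv: "w = u @ m @ v" "(u, m, v) \<notin> ?T"
   have "length u + length v ~= 1"
   proof
    assume "length u + length v = 1"
    then consider z where "u = []" "v = [z]" | z where "u = [z]" "v = []" by (cases u; cases v) auto
    then show False using uv by cases auto
   qed
   then have "ms (?w' u m v) = \<zero>[A k]" using ms_other[of "?w' u m v"] w'(2)[OF uv(1)] by (simp del: ms.simps)
   then show "?G u m v = \<zero>[B k]" using lin_zero[OF MA M bp_lin] MA by simp
  qed (rule Gc)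
  also have "... = ?G [] (butlast w) [last w] +[B k] ?G [hd w] (tl w) []"
   by (subst fs_insert[OF M]) (use Gc[OF wl(1)] Gc[OF wl(2)] M in \<open>auto simp del: ms.simps B_simps\<close>)
  finally show ?thesis unfolding G1 G2 .
 qed
 have Sw: "sum3 (B k) ?S w <: B k" by (rule sum3_closed[OF M Sc])
 have "sum3 (B k) ?S w = -[B k] (?k1 +[B k] -[B k] ?k2)"
  by (rule m_eq_neg[OF M Sw _ main[unfolded sG]]) (use M kB in \<open>simp del: B_simps\<close>)
 also have "... = -[B k] ?k1 -[B k] -[B k] ?k2" using M kB by (simp add: m_negadd a_minus_def del: B_simps)
 also have "-[B k] ?k1 = kact V (dg (butlast w) - 2, xi (butlast w)) (last w)"
  unfolding lw kact_V p_def[symmetric] using kact_neg[OF B h1 cx(3) deg(1)] by (simp add: B_kact)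
 also have "-[B k] ?k2 = kact V (dg (tl w) - 2, xi (tl w)) (hd w)"
  unfolding hw kact_V q_def[symmetric] using kact_neg[OF B h2 cy(3), of k] deg by (simp add: B_kact add.commute)
 finally show ?thesis unfolding Vk .
qed

lemma xi_mlin: "mlin R V (kmod R) (-2) (%w. xi w)"
proof (rule mlinI)
 show "xi [] <: kmod R (-2)" using m_neg[OF gmod_module[OF kmod_module] hm_kmod[of "[]"]] by simp
 fix u i v k assume uv: "vw V u" "vw V v" "k = dg u + i + dg v + -2"
 have "lin R (V i) (kmod R k) (%x. hm (u @ (i,x) # v))"
  using mlin_lin[OF hm_mlin uv(1,2), of i "k + 1"] uv(3) by (simp add: susp_at add.assoc)
 from lin_uminus[OF gmod_module[OF kmod_module] this]
 have "lin R (V i) (kmod R k) (%x. -[kmod R k] hm (u @ (i,x) # v))" .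
 moreover have "dg (u @ (i,x) # v) - 2 = k" for x using uv(3) by simp
 ultimately show "lin R (V i) (kmod R k) (%x. xi (u @ (i,x) # v))" by simp
qed

section \<open>The bar construction on words\<close>

lemma
 shows bar_diff_HOM: "bar_diff R B \<mu> <: Hom (tco R V) (tco R V) (-1)"
  and bar_diff_word: "!!w. vw V w ==> bar_diff R B \<mu> (dg w) (tco_word R V w) =
    sum3 (tco R V (dg w - 1)) (%u m v. sw u *[tco R V (dg w - 1)] tco_word R V (u @ (dg m - 1, bm m) # v)) w"
proof -
 let ?T = "tco R V"
 have sV: "gm V" and T: "gm ?T" by simp_all
 let ?F = "%k u m v. sw u *[?T k] tco_word R V (u @ (dg m - 1, bm m) # v)"
 let ?\<phi> = "%w. \<Oplus>\<^bsub>?T (dg w - 1)\<^esub>i\<in>{1..length w}. \<Oplus>\<^bsub>?T (dg w - 1)\<^esub>j\<in>{..length w - i}.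
   ?F (dg w - 1) (take j w) (take i (drop j w)) (drop (j + i) w)"
 have tc: "tco_word R V (u @ (dg m - 1, bm m) # v) <: ?T k" if "vw V u" "vw V m" "vw V v" "k = dg u + dg m + dg v - 1" for u m v k
  by (rule tco_word_closed) (use that bm_closed[of m] in \<open>auto simp: susp_at\<close>)
 have eq: "?\<phi> w = sum3 (?T (dg w - 1)) (?F (dg w - 1)) w" if w: "vw V w" for w
 proof (rule finsum_sum3)
  fix u v assume uv: "w = u @ v"
  have "lin R (V (-1)) (?T (dg w - 1)) (%x. tco_word R V (u @ (-1, x) # v))" by (rule tco_word_lin) (use w uv in auto)
  from lin_zero[OF _ _ this] show "?F (dg w - 1) u [] v = \<zero>[?T (dg w - 1)]" by (simp add: bm_Nil)
 qed (use w tc T in \<open>auto simp: add.assoc\<close>)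
 have m0: "mlin R V ?T (-1) (%w. sum3 (?T (dg w - 1)) (?F (dg w - 1)) w)"
 proof (rule mlin_cong[OF sV mlin_circ[OF sV T tco_word_mlin[OF sV] bm_mlin, simplified]])
  fix w assume w: "vw V w"
  show "sum3 (?T (dg w - 1)) (?F (dg w - 1)) w = sum3 (?T (dg w - 1)) (%u m v. sw u *[?T (dg u + dg m + dg v - 1)] tco_word R V (u @ (dg m - 1, bm m) # v)) w"
   by (rule sum3_cong) (use w tc T in \<open>auto simp: add.assoc\<close>)
 qed
 have m1: "mlin R V ?T (-1) ?\<phi>" by (rule mlin_cong[OF sV m0 eq])
 \<comment> \<open>The sums in \<open>bar_diff\<close> are bounded by the tensor degree
   \<open>n\<close>, those in \<open>?\<phi>\<close> by \<open>length w\<close>; they agree on the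
   words that generate the degree \<open>n\<close> part.\<close>
 have be: "bar_diff R B \<mu> = tco_ext R V ?T (-1) (%n. tpow_ext R V n ?T (-1) ?\<phi>)"
 proof -
  have "tpow_ext R V n ?T (-1) ?\<phi> = tpow_ext R V n ?T (-1) (%w.
   \<Oplus>\<^bsub>?T (dg w - 1)\<^esub>i\<in>{1..n}. \<Oplus>\<^bsub>?T (dg w - 1)\<^esub>j\<in>{..n - i}.
   ?F (dg w - 1) (take j w) (take i (drop j w)) (drop (j + i) w))" for n unfolding tpow_ext_def
  proof (rule ext, rule restrict_ext)
   fix d X assume X: "X <: tpow R V n d"
   show "lin_ext R (?T (d + -1)) ?\<phi> X = lin_ext R (?T (d + -1)) (%w. \<Oplus>\<^bsub>?T (dg w - 1)\<^esub>i\<in>{1..n}. \<Oplus>\<^bsub>?T (dg w - 1)\<^esub>j\<in>{..n - i}.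
     ?F (dg w - 1) (take j w) (take i (drop j w)) (drop (j + i) w)) X"
    by (rule lin_ext_cong[OF word_rels_carrier[OF sV] gmod_module[OF T] X[unfolded tpow_def]])
     (use mlin_closed[OF m1] in \<open>auto simp: words_iff\<close>)
  qed
  then show ?thesis unfolding bar_diff_def Let_def sgn_uminus by simp
 qed
 show "bar_diff R B \<mu> <: Hom ?T ?T (-1)" unfolding be by (rule tco_mext_HOM[OF sV T m1])
 fix w assume w: "vw V w"
 show "bar_diff R B \<mu> (dg w) (tco_word R V w) = sum3 (?T (dg w - 1)) (?F (dg w - 1)) w"
  unfolding be tco_mext_word[OF sV T m1 w refl] by (rule eq[OF w])
qed

lemma
 shows bar_curv_HOM: "bar_curv R B h <: Hom (tco R V) (kmod R) (-2)"
  and bar_curv_word: "!!w. vw V w ==> bar_curv R B h (dg w) (tco_word R V w) = xi w"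
proof -
 let ?\<Phi> = "%n d. \<lambda>X\<in>carrier (tpow R V n d). -[kmod R (d - 2)] h n d X"
 have sV: "gm V" by simp
 have h': "h n <: Hom (tpow R V n) (susp (kmod R)) (-1)" for n using h by (simp add: CC_def CCu_def)
 have hl: "lin R (tpow R V n d) (kmod R (d - 2)) (h n d)" for n d using HOM_lin[OF h'[of n] refl, of d] by (simp add: susp_at)
 have \<Phi>: "?\<Phi> n <: Hom (tpow R V n) (kmod R) (-2)" for n
 proof (rule HOM_restrict)
  fix d show "lin R (tpow R V n d) (kmod R (d + -2)) (%X. -[kmod R (d - 2)] h n d X)"
   using lin_uminus[OF gmod_module[OF kmod_module] hl] by simp
 qed simp
 \<comment> \<open>The family in \<open>bar_curv\<close> is not extensional. Restricting it to the
   carriers leaves \<open>tco_ext\<close> unchanged, which evaluates it only there.\<close>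
 have be: "bar_curv R B h = tco_ext R V (kmod R) (-2) ?\<Phi>" unfolding bar_curv_def tco_ext_def
 proof (rule ext, rule restrict_ext)
  fix d t assume t: "t <: tco R V d"
  show "(\<Oplus>\<^bsub>kmod R (d + -2)\<^esub>n\<in>{n. t n ~= \<zero>[tpow R V n d]}. -[kmod R (d - 2)] h n d (t n)) =
   (\<Oplus>\<^bsub>kmod R (d + -2)\<^esub>n\<in>{n. t n ~= \<zero>[tpow R V n d]}. ?\<Phi> n d (t n))"
   by (rule fs_cong) (use t lin_closed[OF hl] in \<open>auto simp: tco_carrier\<close>)
 qed
 show "bar_curv R B h <: Hom (tco R V) (kmod R) (-2)" unfolding be by (rule tco_ext_HOM[OF sV kmod_module \<Phi>])
 fix w assume w: "vw V w"
 have t: "tword R V w <: tpow R V (length w) (dg w)" using w by simp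
 show "bar_curv R B h (dg w) (tco_word R V w) = xi w"
  unfolding be tco_word_inj[OF refl refl] tco_ext_inj[OF sV kmod_module \<Phi> t] using t by (simp add: cc_at_def)
qed

end

text \<open>From here on the comodule theory is available for \<open>Bar_u\<close> under the prefix
  \<open>tc\<close>; of its assumptions only \<open>bb\<close> draws on the A-infinity
  relation.\<close>

sublocale ainf \<subseteq> tc: tcoalg R V "Bar_u R A \<epsilon> \<mu> h" bm "%w. xi w"
proof
 show "coalg_mod (Bar_u R A \<epsilon> \<mu> h) = tco R V" "coalg_delta (Bar_u R A \<epsilon> \<mu> h) = tco_delta R V"
  "coalg_counit (Bar_u R A \<epsilon> \<mu> h) = tco_counit R V" by (simp_all add: Bar_u_def Let_def)
 have d: "coalg_diff (Bar_u R A \<epsilon> \<mu> h) = bar_diff R B \<mu>" "coalg_curv (Bar_u R A \<epsilon> \<mu> h) = bar_curv R B h"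
  by (simp_all add: Bar_u_def Let_def)
 show "coalg_diff (Bar_u R A \<epsilon> \<mu> h) <: HOM R (tco R V) (tco R V) (- 1)"
  "coalg_curv (Bar_u R A \<epsilon> \<mu> h) <: HOM R (tco R V) (kmod R) (- 2)" unfolding d by (rule bar_diff_HOM bar_curv_HOM)+
 show "!!w. vw V w ==> coalg_diff (Bar_u R A \<epsilon> \<mu> h) (wdeg w) (tco_word R V w) =
   sum3 (tco R V (wdeg w - 1)) (%u m v. sgn_pow R (wdeg u) *[tco R V (wdeg w - 1)] tco_word R V (u @ (wdeg m - 1, bm m) # v)) w"
  unfolding d by (rule bar_diff_word)
 show "!!w. vw V w ==> coalg_curv (Bar_u R A \<epsilon> \<mu> h) (wdeg w) (tco_word R V w) = xi w" unfolding d by (rule bar_curv_word)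
qed (use bm_mlin bm_Nil xi_mlin bb in auto)

context ground begin

text \<open>For \<open>i = 0\<close> this is homogeneity in the slot; for other \<open>i\<close> the
  action \<open>kact\<close> is zero by definition, and a multilinear function vanishes on a word
  with a zero letter.\<close>

lemma mlin_kact:
 assumes V: "gm V" and W: "gm W" and m: "mlin R V W n \<phi>"
  and u: "vw V u" and v: "vw V v" and y: "y <: V l" and r: "r <: R" and d: "i + l = d" "dg u + l + dg v + n = k"
 shows "\<phi> (u @ (d, kact V (i,r) (l,y)) # v) = kact W (i,r) (k, \<phi> (u @ (l,y) # v))"
proof (cases "i = 0")
 case True
 have "lin R (V l) (W k) (%x. \<phi> (u @ (l,x) # v))" by (rule mlin_lin[OF m u v d(2)])
 from lin_smult[OF this r y] show ?thesis using True d by (simp add: kact_def)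
next
 case False
 have "lin R (V d) (W (i + k)) (%x. \<phi> (u @ (d,x) # v))" by (rule mlin_lin[OF m u v]) (use d in auto)
 from lin_zero[OF _ _ this] show ?thesis using False d V W by (simp add: kact_def)
qed

lemma lin_into_HOM:
 assumes M: "gm M" and N: "gm N" and Y: "md Y"
  and c: "!!y. y <: Y ==> f y <: Hom M N n"
  and l: "!!j x. x <: M j ==> lin R Y (N (j + n)) (%y. f y j x)"
 shows "lin R Y (Hom M N n) f"
proof (rule linI)
 note H = HOM_module[OF M N, of n]
 show "f y <: Hom M N n" if "y <: Y" for y using c that .
 show "f (y +[Y] z) = f y +[Hom M N n] f z" if "y <: Y" "z <: Y" for y z
  by (rule HOM_eqI[of _ M N n _ n]) (use that c Y H lin_add[OF l that] in auto)
 show "f (r *[Y] y) = r *[Hom M N n] f y" if "r <: R" "y <: Y" for r y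
  by (rule HOM_eqI[of _ M N n _ n]) (use that c Y H lin_smult[OF l that] in auto)
qed

lemma gcomp_lin_l:
 assumes M: "gm M" and N: "gm N" and P: "gm P" and g: "g <: Hom M N b" and k: "a + b = k"
 shows "lin R (Hom N P a) (Hom M P k) (%f. gcomp M b f g)"
proof (rule lin_into_HOM[OF M P HOM_module[OF N P]])
 show "gcomp M b f g <: Hom M P k" if "f <: Hom N P a" for f by (rule gcomp_HOM[OF M g that]) (use k in simp)
 fix j x assume x: "x <: M j"
 have "lin R (Hom N P a) (P (j + k)) (%f. f (j + b) (g j x))" by (rule HOM_ev[OF P]) (use HOM_in[OF g x refl] k in auto)
 then show "lin R (Hom N P a) (P (j + k)) (%f. gcomp M b f g j x)" using x by simp
qed

lemma gcomp_lin_r: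
 assumes M: "gm M" and N: "gm N" and P: "gm P" and f: "f <: Hom N P a" and k: "a + b = k"
 shows "lin R (Hom M N b) (Hom M P k) (%g. gcomp M b f g)"
proof (rule lin_into_HOM[OF M P HOM_module[OF M N]])
 show "gcomp M b f g <: Hom M P k" if "g <: Hom M N b" for g by (rule gcomp_HOM[OF M that f]) (use k in simp)
 fix j x assume x: "x <: M j"
 have "lin R (Hom M N b) (P (j + k)) (%g. f (j + b) (g j x))"
  by (rule lin_compose[where g="f (j + b)", OF HOM_ev[where M=M and N=N and i=j and n=b, OF N x refl] HOM_lin[OF f]]) (use k in auto)
 then show "lin R (Hom M N b) (P (j + k)) (%g. gcomp M b f g j x)" using x by simp
qed

text \<open>The exponent adds the Koszul sign \<open>b * dg u\<close>, for moving \<beta> past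
  \<open>u\<close>, to the sign \<open>dg u + a\<close> with which \<open>gam\<close> moves the
  desuspension past the value of \<alpha>.\<close>

lemma
 assumes A: "gm A" and M: "gm M" and N: "gm N" and P: "gm P"
  and \<alpha>: "\<alpha> \<in> CCu R A (Hom N P) a" and \<beta>: "\<beta> \<in> CCu R A (Hom M N) b"
 shows cc_star_CCu: "cc_star R A M P a b \<alpha> \<beta> \<in> CCu R A (Hom M P) (a + b - 1)"
  and cc_at_star: "!!w k. vw (susp A) w ==> dg w + (a + b) - 2 = k ==> cc_at R A (cc_star R A M P a b \<alpha> \<beta>) w =
   sum2 (Hom M P k) (%u v. sg (b * dg u + dg u + a) *[Hom M P k]
     gcomp M (dg v + b - 1) (cc_at R A \<alpha> u) (cc_at R A \<beta> v)) w"
proof -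
 let ?H = "Hom M P"
 have sA: "gm (susp A)" and H: "gm ?H" and sH: "gm (susp ?H)" using A M P by auto
 note am = cc_at_mlin[OF A \<alpha>] and bm = cc_at_mlin[OF A \<beta>]
 have ac: "cc_at R A \<alpha> u <: Hom N P (dg u + a - 1)" if "vw (susp A) u" for u
  using mlin_closed[OF am that refl] by (simp add: susp_at)
 have bc: "cc_at R A \<beta> u <: Hom M N (dg u + b - 1)" if "vw (susp A) u" for u using mlin_closed[OF bm that refl] by (simp add: susp_at)
 let ?F = "%k u v. sg (b * dg u + dg u + a) *[?H k] gcomp M (dg v + b - 1) (cc_at R A \<alpha> u) (cc_at R A \<beta> v)"
 let ?G = "%u v. ?F (dg u + dg v + (a + b) - 2) u v"
 have Fc: "?F k u v <: ?H k" if "vw (susp A) u" "vw (susp A) v" "k = dg u + dg v + (a + b) - 2" for k u v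
  using H gcomp_HOM[OF M bc[OF that(2)] ac[OF that(1)], of k] that(3) by simp
 have m0: "mlin R (susp A) (susp ?H) (a + b - 1) (%w. sum2 (susp ?H (dg w + (a + b - 1))) ?G w)"
 proof (rule mlin_sum2[OF sA sH])
  fix u v k assume "vw (susp A) u" "vw (susp A) v" "k = dg u + dg v + (a + b - 1)"
  moreover from this have "dg u + dg v + (a + b) - 2 = k - 1" by simp
  ultimately show "?G u v <: susp ?H k" using Fc[of u v "k - 1"] by (simp only: susp_at)
 next
  fix p i q v k assume uv: "vw (susp A) p" "vw (susp A) q" "vw (susp A) v" "k = dg p + i + dg q + dg v + (a + b - 1)"
  let ?l = "dg p + i + dg q + a"
  have l1: "lin R (susp A i) (Hom N P (?l - 1)) (%x. cc_at R A \<alpha> (p @ (i,x) # q))"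
   using mlin_lin[OF am uv(1,2) refl] by (simp add: susp_at)
  have "lin R (susp A i) (?H (k - 1)) (%x. gcomp M (dg v + b - 1) (cc_at R A \<alpha> (p @ (i,x) # q)) (cc_at R A \<beta> v))"
   by (rule lin_compose[OF l1 gcomp_lin_l[OF M N P bc[OF uv(3)]]]) (use uv in auto)
  from lin_scale[OF gmod_module[OF H] sgn_in this]
  have l2: "lin R (susp A i) (?H (k - 1)) (%x. sg (b * (dg p + i + dg q) + (dg p + i + dg q) + a) *[?H (k - 1)] gcomp M (dg v + b - 1) (cc_at R A \<alpha> (p @ (i,x) # q)) (cc_at R A \<beta> v))" .
  have e: "dg p + i + dg q + dg v + (a + b) - 2 = k - 1" "dg (p @ (i,x) # q) = dg p + i + dg q" for x using uv by auto
  show "lin R (susp A i) (susp ?H k) (%x. ?G (p @ (i,x) # q) v)" unfolding e susp_at[of ?H] using l2 by simp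
 next
  fix p i q v k assume uv: "vw (susp A) p" "vw (susp A) q" "vw (susp A) v" "k = dg v + dg p + i + dg q + (a + b - 1)"
  let ?l = "dg p + i + dg q + b"
  have l1: "lin R (susp A i) (Hom M N (?l - 1)) (%x. cc_at R A \<beta> (p @ (i,x) # q))"
   using mlin_lin[OF bm uv(1,2) refl] by (simp add: susp_at)
  have "lin R (susp A i) (?H (k - 1)) (%x. gcomp M (?l - 1) (cc_at R A \<alpha> v) (cc_at R A \<beta> (p @ (i,x) # q)))"
   by (rule lin_compose[OF l1 gcomp_lin_r[OF M N P ac[OF uv(3)]]]) (use uv in auto)
  from lin_scale[OF gmod_module[OF H] sgn_in this]
  have l2: "lin R (susp A i) (?H (k - 1)) (%x. sg (b * dg v + dg v + a) *[?H (k - 1)] gcomp M (?l - 1) (cc_at R A \<alpha> v) (cc_at R A \<beta> (p @ (i,x) # q)))" .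
  have e: "dg v + (dg p + i + dg q) + (a + b) - 2 = k - 1" "dg (p @ (i,x) # q) = dg p + i + dg q" for x using uv by auto
  show "lin R (susp A i) (susp ?H k) (%x. ?G v (p @ (i,x) # q))" unfolding e susp_at[of ?H] using l2 by simp
 qed
 let ?\<phi> = "%w. let W = susp ?H (dg w + (a + b - 1)) in
   \<Oplus>\<^bsub>W\<^esub>j\<in>{..length w}. let u = take j w; v = drop j w in
    sg (b * dg u) *[W] gam R M P (dg u + a, cc_at R A \<alpha> u) (dg v + b, cc_at R A \<beta> v)"
 have eq: "?\<phi> w = sum2 (?H k) (?F k) w" if w: "vw (susp A) w" and k: "dg w + (a + b) - 2 = k" for w k
 proof -
  have W: "susp ?H (dg w + (a + b - 1)) = ?H k" using k by (simp add: susp_at algebra_simps)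
  have t: "sg (b * dg u) *[?H k] gam R M P (dg u + a, cc_at R A \<alpha> u) (dg v + b, cc_at R A \<beta> v) = ?F k u v"
   if "vw (susp A) u" "vw (susp A) v" "w = u @ v" for u v
  proof -
   have d: "dg u + (a + (dg v + b)) - 2 = k" using that k by simp
   have c: "gcomp M (dg v + b - 1) (cc_at R A \<alpha> u) (cc_at R A \<beta> v) <: ?H k"
    by (rule gcomp_HOM[OF M bc[OF that(2)] ac[OF that(1)]]) (use d in simp)
   show ?thesis using H c unfolding gam_def by (simp add: d add.assoc)
  qed
  have "?\<phi> w = sum2 (?H k) (%u v. sg (b * dg u) *[?H k] gam R M P (dg u + a, cc_at R A \<alpha> u) (dg v + b, cc_at R A \<beta> v)) w"
   unfolding Let_def W by (rule sum2_image) (use H w Fc t k in auto)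
  also have "... = sum2 (?H k) (?F k) w" by (rule vsum2_cong[OF _ w]) (use H w Fc t k in auto)
  finally show ?thesis .
 qed
 have m1: "mlin R (susp A) (susp ?H) (a + b - 1) ?\<phi>"
 proof (rule mlin_cong[OF sA m0])
  fix w assume w: "vw (susp A) w"
  have "sum2 (susp ?H (dg w + (a + b - 1))) ?G w = sum2 (?H (dg w + (a + b) - 2)) (?F (dg w + (a + b) - 2)) w" unfolding susp_at
   by (rule trans[OF _ vsum2_cong[OF gmod_module[OF H] w]], rule arg_cong[where f="%k. sum2 (?H k) ?G w"])
    (use Fc in \<open>auto simp: add.assoc\<close>)
  then show "?\<phi> w = sum2 (susp ?H (dg w + (a + b - 1))) ?G w" using eq[OF w refl] by simp
 qed
 have ce: "cc_star R A M P a b \<alpha> \<beta> = cc_of R A ?H (a + b - 1) ?\<phi>" unfolding cc_star_def Let_def ..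
 show "cc_star R A M P a b \<alpha> \<beta> \<in> CCu R A ?H (a + b - 1)" unfolding ce by (rule cc_of_CCu[OF A H m1])
 fix w k assume w: "vw (susp A) w" "dg w + (a + b) - 2 = k"
 show "cc_at R A (cc_star R A M P a b \<alpha> \<beta>) w = sum2 (?H k) (?F k) w" unfolding ce cc_at_of[OF A H m1 w(1)] by (rule eq[OF w])
qed

lemma sum3_map:
 assumes N: "md N" and c: "!!u m v. map f w = u @ m @ v ==> F u m v <: N"
 shows "sum3 N (%u m v. F (map f u) (map f m) (map f v)) w = sum3 N F (map f w)" unfolding sum3_def
proof (rule fs_bij[OF N, where h="%s. (map f (fst s), map f (fst (snd s)), map f (snd (snd s)))"])
 show "bij_betw (%s. (map f (fst s), map f (fst (snd s)), map f (snd (snd s)))) (S3 w) (S3 (map f w))"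
 proof (rule bij_betwI[where g="%s. (take (length (fst s)) w, take (length (fst (snd s))) (drop (length (fst s)) w), drop (length (fst (snd s))) (drop (length (fst s)) w))"])
  fix t assume "t \<in> S3 (map f w)"
  then obtain a m b where "t = (a, m, b)" "map f w = a @ m @ b" by (cases t) auto
  then show "(%s. (map f (fst s), map f (fst (snd s)), map f (snd (snd s)))) ((%s. (take (length (fst s)) w, take (length (fst (snd s))) (drop (length (fst s)) w), drop (length (fst (snd s))) (drop (length (fst s)) w))) t) = t"
   by (simp add: take_map[symmetric] drop_map[symmetric] del: drop_drop)
 qed (auto simp del: drop_drop)
qed (use c in auto)

lemma sum2_map:
 assumes N: "md N" and c: "!!u v. map f w = u @ v ==> F u v <: N"
 shows "sum2 N (%u v. F (map f u) (map f v)) w = sum2 N F (map f w)" unfolding sum2_def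
 by (rule fs_bij[OF N, where h="%s. (map f (fst s), map f (snd s))"],
   rule bij_betwI[where g="%s. (take (length (fst s)) w, drop (length (fst s)) w)"])
  (use c in \<open>auto simp: take_map[symmetric] drop_map[symmetric] append_eq_conv_conj\<close>)

end

section \<open>Adjoints of cochains, and the unit terms in circle products\<close>

context ainf begin

abbreviation "CB \<equiv> tco R V"
abbreviation "wB w \<equiv> (wdeg w, tco_word R V w)"
abbreviation "blB m \<equiv> (wdeg m - 1, bm m)"
abbreviation "KB \<equiv> Bar_u R A \<epsilon> \<mu> h"

lemma
 assumes M: "gm M" and N: "gm N" and q: "q \<in> CH M N n"
 shows adj_HOM: "cc_adjoint_family R B M N n q <: Hom (CT M) N (n - 1)"
  and adj_wt: "!!w j x d. vw V w ==> x <: M j ==> dg w + j = d ==>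
   cc_adjoint_family R B M N n q d (telt CB M (wB w) (j,x)) = cc_at R B q w j x"
proof -
 let ?H = "Hom M N"
 have sV: "gm V" and T: "gm (tpow R V k)" for k by auto
 have qc: "q k i X <: ?H (i + n - 1)" if "X <: tpow R V k i" for k i X using HOM_in[OF CCu_HOM[OF q] that refl] by (simp add: susp_at)
 have ql: "lin R (tpow R V k i) (?H (i + n - 1)) (q k i)" for k i using HOM_lin[OF CCu_HOM[OF q, of k] refl, of i] by (simp add: susp_at)
 have bil: "bilin (tpow R V k) M N (n - 1) (%(i,X) (j,x). q k i X j x)" for k
 proof (rule bilinI)
  fix i j x assume x: "x <: M j"
  have "lin R (tpow R V k i) (N (i + j + (n - 1))) (%X. q k i X j x)"
   by (rule lin_compose[OF ql HOM_ev[where M=M and N=N and i=j and n="i + n - 1", OF N x]]) simp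
  then show "lin R (tpow R V k i) (N (i + j + (n - 1))) (%X. (%(i,X) (j,x). q k i X j x) (i,X) (j,x))" by simp
 next
  fix i j X assume X: "X <: tpow R V k i"
  show "lin R (M j) (N (i + j + (n - 1))) (%x. (%(i,X) (j,x). q k i X j x) (i,X) (j,x))"
   using HOM_lin[OF qc[OF X], of j "i + j + (n - 1)"] by simp
 qed
 have aH: "cc_adjoint R B M N n q k <: Hom (tns (tpow R V k) M) N (n - 1)" for k
  unfolding cc_adjoint_def by (rule tens_ext_HOM[OF T M N bil])
 have ae: "cc_adjoint R B M N n q k d (telt (tpow R V k) M (i,X) (j,x)) = q k i X j x"
  if "X <: tpow R V k i" "x <: M j" "i + j = d" for k i X j x d unfolding cc_adjoint_def by (subst tens_ext_elt[OF T M N bil that]) simp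
 define \<phi> where "\<phi> = (%(i,t) (j,x). \<Oplus>\<^bsub>N (i + j + (n - 1))\<^esub>k\<in>{k. t k ~= \<zero>[tpow R V k i]}.
     cc_adjoint R B M N n q k (i + j) (telt (tpow R V k) M (i, t k) (j,x)))"
 \<comment> \<open>For fixed \<open>x\<close> the family is a \<open>tco_ext\<close> into
   \<open>N\<close> shifted by the degree of \<open>x\<close>; this supplies linearity in
   \<open>t\<close>.\<close>
 have \<phi>e: "\<phi> (i,t) (j,x) = tco_ext R V (%d. N (d + j)) (n - 1) (%k i. \<lambda>X\<in>carrier (tpow R V k i). q k i X j x) i t"
  if t: "t <: CB i" and x: "x <: M j" for i t j x
 proof -
  have tk: "t k <: tpow R V k i" for k using t by (simp add: tco_carrier)
  have d: "i + (n - 1) + j = i + j + (n - 1)" by simp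
  have "q k i (t k) j x <: N (i + j + (n - 1))" for k by (rule HOM_in[OF qc[OF tk] x]) simp
  then show ?thesis unfolding \<phi>_def tco_ext_def using t N tk x by (simp add: d) (intro fs_cong, auto simp: ae)
 qed
 have \<Phi>: "(%i. \<lambda>X\<in>carrier (tpow R V k i). q k i X j x) <: Hom (tpow R V k) (%d. N (d + j)) (n - 1)"
  if x: "x <: M j" for k j x
 proof (rule HOM_restrict[OF T])
  fix i show "lin R (tpow R V k i) (N (i + (n - 1) + j)) (%X. q k i X j x)"
   by (rule lin_compose[OF ql HOM_ev[where M=M and N=N and i=j and n="i + n - 1", OF N x]]) simp
 qed
 have Nj: "gm (%d. N (d + j))" for j using N by (simp add: gmodule_def)
 have bil2: "bilin CB M N (n - 1) \<phi>"
 proof (rule bilinI)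
  fix i j x assume x: "x <: M j"
  have d: "i + (n - 1) + j = i + j + (n - 1)" by simp
  show "lin R (CB i) (N (i + j + (n - 1))) (%t. \<phi> (i,t) (j,x))"
   by (rule lin_cong[OF _ HOM_lin[OF tco_ext_HOM[OF sV Nj \<Phi>[OF x]] refl, of i, unfolded d]]) (use \<phi>e x in auto)
 next
  fix i j t assume t: "t <: CB i"
  have tk: "t k <: tpow R V k i" for k using t by (simp add: tco_carrier)
  show "lin R (M j) (N (i + j + (n - 1))) (%x. \<phi> (i,t) (j,x))" unfolding \<phi>_def prod.case
  proof (rule lin_sum)
   fix k
   show "lin R (M j) (N (i + j + (n - 1))) (%x. cc_adjoint R B M N n q k (i + j) (telt (tpow R V k) M (i, t k) (j,x)))"
    by (rule lin_compose[OF tens_elt_lin2[OF T M tk refl] HOM_lin[OF aH refl]])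
  qed (use M N t in \<open>auto simp: tco_carrier\<close>)
 qed
 have fe: "cc_adjoint_family R B M N n q = tens_ext R CB M N (n - 1) \<phi>" by (simp add: cc_adjoint_family_def \<phi>_def Let_def)
 show "cc_adjoint_family R B M N n q <: Hom (CT M) N (n - 1)" unfolding fe by (rule tens_ext_HOM[OF _ M N bil2]) simp
 fix w j x d assume w: "vw V w" and x: "x <: M j" and d: "dg w + j = d"
 have t: "tword R V w <: tpow R V (length w) (dg w)" using w by simp
 have "cc_adjoint_family R B M N n q d (telt CB M (wB w) (j,x)) = \<phi> (wB w) (j,x)"
  unfolding fe by (rule tens_ext_elt[OF _ M N bil2]) (use w x d in auto)
 also have "... = cc_at R B q w j x" unfolding \<phi>e[OF tco_word_closed[OF sV w refl] x]
  unfolding tco_word_inj[OF refl refl] tco_ext_inj[OF sV Nj \<Phi>[OF x] t] using t by (simp add: cc_at_def)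
 finally show "cc_adjoint_family R B M N n q d (telt CB M (wB w) (j,x)) = cc_at R B q w j x" .
qed

lemma adj_inj:
 assumes M: "gm M" and N: "gm N" and q: "q \<in> CH M N n" and q': "q' \<in> CH M N n"
  and eq: "cc_adjoint_family R B M N n q = cc_adjoint_family R B M N n q'"
 shows "q = q'"
proof (rule CCu_eqI[OF B _ q q'])
 fix w assume w: "vw V w"
 show "cc_at R B q w = cc_at R B q' w"
 proof (rule HOM_eqI)
  show "cc_at R B q w <: Hom M N (dg w + n - 1)" "cc_at R B q' w <: Hom M N (dg w + n - 1)"
   using cc_at_closed[OF B q w refl] cc_at_closed[OF B q' w refl] by (auto simp: susp_at)
  fix j x assume x: "x <: M j"
  show "cc_at R B q w j x = cc_at R B q' w j x" using adj_wt[OF M N q w x refl] adj_wt[OF M N q' w x refl] eq by simp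
 qed
qed (use M N in auto)

text \<open>The inverse is currying: on a word \<open>w\<close> the cochain is the map taking
  \<open>x\<close> to \<open>m (w (x) x)\<close>, restricted to the carriers so that it belongs to
  \<open>Hom\<close>. The degree shift \<open>n = b + 1\<close> is the suspension of the
  target.\<close>

lemma adj_surj:
 assumes M: "gm M" and N: "gm N" and m: "m <: Hom (CT M) N b" and n: "n = b + 1"
 shows "\<exists>q\<in>CH M N n. cc_adjoint_family R B M N n q = m"
proof -
 let ?\<phi> = "%w j. \<lambda>x\<in>carrier (M j). m (dg w + j) (telt CB M (wB w) (j,x))"
 have H: "gm (Hom M N)" using M N by simp
 have \<phi>c: "?\<phi> w <: Hom M N k" if "vw V w" "dg w + b = k" for w k
  by (rule HOM_restrict[OF M], rule lin_compose[OF tens_elt_lin2[OF _ M] HOM_lin[OF m]]) (use that in auto)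
 have ml: "mlin R V (susp (Hom M N)) n ?\<phi>"
 proof (rule mlinI)
  show "?\<phi> [] <: susp (Hom M N) n" using \<phi>c[of "[]" b] n by (simp add: susp_at)
  fix u i v k assume uv: "vw V u" "vw V v" "k = dg u + i + dg v + n"
  have Vi: "md (V i)" by simp
  have "lin R (V i) (Hom M N (k - 1)) (%y. ?\<phi> (u @ (i,y) # v))"
  proof (rule lin_into_HOM[OF M N Vi])
   show "?\<phi> (u @ (i,y) # v) <: Hom M N (k - 1)" if "y <: V i" for y by (rule \<phi>c) (use that uv n in auto)
   fix j x assume x: "x <: M j"
   let ?l = "dg u + i + dg v"
   have "lin R (V i) (CB ?l) (%y. tco_word R V (u @ (i,y) # v))" by (rule tco_word_lin) (use uv in auto)
   then have "lin R (V i) (N (j + (k - 1))) (%y. m (?l + j) (telt CB M (?l, tco_word R V (u @ (i,y) # v)) (j,x)))"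
    by (rule lin_compose[OF _ lin_compose[where f="%c. telt CB M (?l,c) (j,x)", OF tens_elt_lin1[OF _ M x refl] HOM_lin[OF m]]]) (use uv n in auto)
   moreover have "dg (u @ (i,y) # v) = ?l" for y by simp
   ultimately show "lin R (V i) (N (j + (k - 1))) (%y. ?\<phi> (u @ (i,y) # v) j x)" using x by (simp add: add.assoc)
  qed
  then show "lin R (V i) (susp (Hom M N) k) (%y. ?\<phi> (u @ (i,y) # v))" by (simp only: susp_at)
 qed
 let ?q = "cc_of R B (Hom M N) n ?\<phi>"
 have q: "?q \<in> CH M N n" by (rule cc_of_CCu[OF B H ml])
 have "cc_adjoint_family R B M N n ?q = m"
 proof (rule tc.CM_HOM_eqI[OF M N _ m])
  show "cc_adjoint_family R B M N n ?q <: Hom (CT M) N b" using adj_HOM[OF M N q] n by simp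
  fix w j x assume w: "vw V w" and x: "x <: M j"
  show "cc_adjoint_family R B M N n ?q (dg w + j) (telt CB M (wB w) (j,x)) = m (dg w + j) (telt CB M (wB w) (j,x))"
   using adj_wt[OF M N q w x refl] cc_at_of[OF B H ml w] x by simp
 qed
 then show ?thesis using q by blast
qed

lemma bw_map: "bw w = map (%p. (fst p, bp (fst p - 1) (snd p))) w" by (induction w) auto

text \<open>The contributions of \<open>mu_su\<close> telescope, leaving those of the first and of the last letter.\<close>

lemma circ_incl:
 assumes W: "gm W" and q: "mlin R V W n q" and w: "vA w" and ne: "w ~= []" and k: "k = dg w - 1 + n"
 shows "sum3 (W k) (%u m v. sw u *[W k] q (bw (u @ (dg m - 1, ac nu m) # v))) w =
  sum3 (W k) (%u m v. sw u *[W k] q (u @ blB m # v)) (bw w) +[W k]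
  (kact W (fst (hd w) - 1, \<epsilon> (fst (hd w) - 1) (snd (hd w))) (dg (tl w) + n, q (bw (tl w))) -[W k]
   sg (dg (butlast w)) *[W k] kact W (fst (last w) - 1, \<epsilon> (fst (last w) - 1) (snd (last w))) (dg (butlast w) + n, q (bw (butlast w))))"
proof -
 have Wk: "md (W k)" and sV: "gm V" using W by auto
 let ?s = "%u z. sw u *[W k] z"
 \<comment> \<open>\<open>?G (u, p, v)\<close> drops the letter \<open>p\<close> from the word and
   multiplies by its \<open>\<epsilon>\<close>-value, with the sign of the prefix
   \<open>u\<close>.\<close>
 let ?G = "%(u, p, v). ?s u (kact W (fst p - 1, \<epsilon> (fst p - 1) (snd p)) (dg (u @ v) + n, q (bw (u @ v))))"
 have pA: "snd p <: A (fst p - 1)" if "vA [p]" for p using that by (simp add: susp_at)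
 have qc: "q (bw v) <: W (dg v + n)" if "vA v" for v using mlin_closed[OF q vw_bw[OF that]] by simp
 have kc: "kact W (fst p - 1, \<epsilon> (fst p - 1) (snd p)) (dg v + n, q (bw v)) <: W k"
  if "vA [p]" "vA v" "fst p + dg v = dg w" for p v
  by (rule kact_closed[OF W eps_closed[OF pA[OF that(1)]] qc[OF that(2)]]) (use that k in auto)
 let ?S = "{(u, p, v). w = u @ p # v}"
 have Sfin: "finite ?S"
 proof -
  have "?S \<subseteq> (%s. (fst s, hd (fst (snd s)), snd (snd s))) ` S3 w" by (auto simp: image_iff intro!: bexI[of _ "(_, [_], _)"])
  then show ?thesis by (rule finite_subset) auto
 qed
 have Gc: "?G s <: W k" if s: "s \<in> ?S" for s
 proof -
  obtain u p v where s': "s = (u, p, v)" by (cases s)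
  then have "vA u" "vA [p]" "vA v" "dg w = dg u + fst p + dg v" using s w by auto
  then show ?thesis using s' kc[of p "u @ v"] Wk by simp
 qed
 have c1: "q (u @ blB m # v) <: W k" if "vw V u" "vw V m" "vw V v" "dg w = dg u + dg m + dg v" for u m v
  by (rule mlin_closed[OF q]) (use that k bm_closed[of m] in \<open>auto simp: susp_at\<close>)
 have msc: "bp (dg m - 2) (ms m) <: V (dg m - 1)" if "vA m" for m using bp_closed[OF ms_closed[OF that refl]] by (simp add: susp_at)
 have c2: "q (bw u @ (dg m - 1, bp (dg m - 2) (ms m)) # bw v) <: W k" if "vA u" "vA m" "vA v" "dg w = dg u + dg m + dg v" for u m v
  by (rule mlin_closed[OF q]) (use that k msc[of m] in auto)
 \<comment> \<open>Linearity in the output letter separates the \<open>bm\<close> part of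
   \<open>nu\<close> from its \<open>mu_su\<close> part; the unit component of \<open>nu\<close> is
   projected away by \<open>bw\<close>.\<close>
 have split: "q (bw (u @ (dg m - 1, ac nu m) # v)) = q (bw u @ blB (bw m) # bw v) +[W k] q (bw u @ (dg m - 1, bp (dg m - 2) (ms m)) # bw v)"
  if uv: "vA u" "vA m" "vA v" "w = u @ m @ v" for u m v
 proof -
  have l: "lin R (V (dg m - 1)) (W k) (%x. q (bw u @ (dg m - 1, x) # bw v))" by (rule mlin_lin[OF q]) (use uv k in auto)
  have b: "bm (bw m) <: V (dg m - 1)" using bm_closed[OF vw_bw[OF uv(2)]] by (simp add: susp_at)
  have "bp (dg m - 2) (ac nu m) = bm (bw m) +[V (dg m - 1)] bp (dg m - 2) (ms m)" using bp_nu[OF uv(2) refl] by (simp add: susp_at)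
  then show ?thesis using lin_add[OF l b msc[OF uv(2)]] by simp
 qed
 have "sum3 (W k) (%u m v. ?s u (q (bw (u @ (dg m - 1, ac nu m) # v)))) w =
  sum3 (W k) (%u m v. ?s u (q (bw u @ blB (bw m) # bw v)) +[W k] ?s u (q (bw u @ (dg m - 1, bp (dg m - 2) (ms m)) # bw v))) w"
 proof (rule vsum3_cong[OF Wk w])
  fix u m v assume uv: "vA u" "vA m" "vA v" "w = u @ m @ v"
  have a: "q (bw u @ blB (bw m) # bw v) <: W k" by (rule c1) (use uv in auto)
  have b: "q (bw u @ (dg m - 1, bp (dg m - 2) (ms m)) # bw v) <: W k" by (rule c2) (use uv in auto)
  show "?s u (q (bw (u @ (dg m - 1, ac nu m) # v))) = ?s u (q (bw u @ blB (bw m) # bw v)) +[W k] ?s u (q (bw u @ (dg m - 1, bp (dg m - 2) (ms m)) # bw v))"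
   unfolding split[OF uv] by (rule m_sr[OF Wk sgn_in a b])
  show "?s u (q (bw u @ blB (bw m) # bw v)) +[W k] ?s u (q (bw u @ (dg m - 1, bp (dg m - 2) (ms m)) # bw v)) <: W k" using a b Wk by simp
 qed
 also have "... = sum3 (W k) (%u m v. ?s u (q (bw u @ blB (bw m) # bw v))) w +[W k] sum3 (W k) (%u m v. ?s u (q (bw u @ (dg m - 1, bp (dg m - 2) (ms m)) # bw v))) w"
 proof (rule sum3_add[OF Wk])
  fix u m v assume uv: "w = u @ m @ v"
  show "?s u (q (bw u @ blB (bw m) # bw v)) <: W k" by (rule m_smult[OF Wk sgn_in c1]) (use w uv in auto)
  show "?s u (q (bw u @ (dg m - 1, bp (dg m - 2) (ms m)) # bw v)) <: W k" by (rule m_smult[OF Wk sgn_in c2]) (use w uv in auto)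
 qed
 also have "sum3 (W k) (%u m v. ?s u (q (bw u @ blB (bw m) # bw v))) w = sum3 (W k) (%u m v. ?s u (q (u @ blB m # v))) (bw w)"
 proof -
  have "sum3 (W k) (%u m v. ?s u (q (u @ blB m # v))) (bw w) = sum3 (W k) (%u m v. ?s (bw u) (q (bw u @ blB (bw m) # bw v))) w"
   unfolding bw_map
  proof (rule sum3_map[OF Wk, symmetric], unfold bw_map[symmetric])
   fix u m v assume uv: "bw w = u @ m @ v"
   have "vw V (u @ m @ v)" "dg (u @ m @ v) = dg w" using w unfolding uv[symmetric] by simp_all
   then show "?s u (q (u @ blB m # v)) <: W k" using c1[of u m v] Wk by simp
  qed
  then show ?thesis by simp
 qed
 also have "sum3 (W k) (%u m v. ?s u (q (bw u @ (dg m - 1, bp (dg m - 2) (ms m)) # bw v))) w =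
  ?G ([], hd w, tl w) -[W k] ?G (butlast w, last w, [])"
 proof -
  let ?N = "{s \<in> S3 w. length (fst (snd s)) = 2}"
  let ?A0 = "{s \<in> ?S. snd (snd s) = []}" and ?B0 = "{s \<in> ?S. fst s = []}"
  \<comment> \<open>On a two-letter block \<open>[a, b]\<close> the projected \<open>mu_su\<close>
    either drops \<open>a\<close>, which is recorded by \<open>?h1\<close>, or drops
    \<open>b\<close>, recorded by \<open>?h2\<close>. Each droppable letter is reached in both ways
    unless it is the first or the last one.\<close>
  let ?h1 = "%s. (fst s, hd (fst (snd s)), last (fst (snd s)) # snd (snd s))"
  let ?h2 = "%s. (fst s @ [hd (fst (snd s))], last (fst (snd s)), snd (snd s))"
  have two: "\<exists>a b. m = [a, b]" if "length m = 2" for m :: "(int \<times> 'a) list" using that by (cases m; cases "tl m") auto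
  have NE: "\<exists>u a b v. s = (u, [a, b], v) \<and> w = u @ a # b # v" if s: "s \<in> ?N" for s
  proof -
   obtain u m v where "s = (u, m, v)" by (cases s)
   with s two[of m] show ?thesis by auto
  qed
  have AE: "\<exists>u a b v. s = (u, a, b # v) \<and> w = u @ a # b # v" if s: "s \<in> ?S - ?A0" for s
  proof -
   obtain u a v where "s = (u, a, v)" by (cases s)
   with s show ?thesis by (cases v) auto
  qed
  have BE: "\<exists>u a b v. s = (u @ [a], b, v) \<and> w = u @ a # b # v" if s: "s \<in> ?S - ?B0" for s
  proof -
   obtain u a v where "s = (u, a, v)" by (cases s)
   with s show ?thesis by (cases u rule: rev_cases) auto
  qed
  have b1: "bij_betw ?h1 ?N (?S - ?A0)"
  proof (rule bij_betwI[where g="%s. (fst s, [fst (snd s), hd (snd (snd s))], tl (snd (snd s)))"]; (rule Pi_I)?)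
   show "?h1 s \<in> ?S - ?A0" if "s \<in> ?N" for s using NE[OF that] by auto
   show "(fst s, [fst (snd s), hd (snd (snd s))], tl (snd (snd s))) \<in> ?N" if "s \<in> ?S - ?A0" for s using AE[OF that] by auto
   show "(%s. (fst s, [fst (snd s), hd (snd (snd s))], tl (snd (snd s)))) (?h1 s) = s" if "s \<in> ?N" for s using NE[OF that] by auto
   show "?h1 ((%s. (fst s, [fst (snd s), hd (snd (snd s))], tl (snd (snd s)))) s) = s" if "s \<in> ?S - ?A0" for s using AE[OF that] by auto
  qed
  have b2: "bij_betw ?h2 ?N (?S - ?B0)"
  proof (rule bij_betwI[where g="%s. (butlast (fst s), [last (fst s), fst (snd s)], snd (snd s))"]; (rule Pi_I)?)
   show "?h2 s \<in> ?S - ?B0" if "s \<in> ?N" for s using NE[OF that] by auto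
   show "(butlast (fst s), [last (fst s), fst (snd s)], snd (snd s)) \<in> ?N" if "s \<in> ?S - ?B0" for s using BE[OF that] by auto
   show "(%s. (butlast (fst s), [last (fst s), fst (snd s)], snd (snd s))) (?h2 s) = s" if "s \<in> ?N" for s using NE[OF that] by auto
   show "?h2 ((%s. (butlast (fst s), [last (fst s), fst (snd s)], snd (snd s))) s) = s" if "s \<in> ?S - ?B0" for s using BE[OF that] by auto
  qed
  have h1S: "?h1 s \<in> ?S" and h2S: "?h2 s \<in> ?S" if "s \<in> ?N" for s using NE[OF that] by auto
  have key: "?s (fst s) (q (bw (fst s) @ (dg (fst (snd s)) - 1, bp (dg (fst (snd s)) - 2) (ms (fst (snd s)))) # bw (snd (snd s)))) =
    ?G (?h1 s) +[W k] -[W k] ?G (?h2 s)" if s: "s \<in> ?N" for s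
  proof -
   obtain u m v where s0: "s = (u, m, v)" by (cases s)
   then obtain p1 p2 where m: "m = [p1, p2]" using two s by fastforce
   define i x j y where "i = fst p1 - 1" and "x = snd p1" and "j = fst p2 - 1" and "y = snd p2"
   have p: "p1 = (i + 1, x)" "p2 = (j + 1, y)" by (simp_all add: i_def x_def j_def y_def)
   have uv: "vA u" "vA v" "w = u @ p1 # p2 # v" using s s0 m w by auto
   have x: "x <: A i" and y: "y <: A j" using w uv(3) p by (auto simp: susp_at)
   let ?d = "dg m - 1"
   have d: "?d = i + j + 1" using m p by simp
   have Vk: "kact V (i, \<epsilon> i x) (j + 1, bp j y) = kact A (i, \<epsilon> i x) (j, bp j y)" "kact V (j, \<epsilon> j y) (i + 1, bp i x) = kact A (j, \<epsilon> j y) (i, bp i x)"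
    by (simp_all add: kact_V)
   have kV: "kact V (i, \<epsilon> i x) (j + 1, bp j y) <: V ?d" "kact V (j, \<epsilon> j y) (i + 1, bp i x) <: V ?d"
    unfolding Vk B_kact[symmetric] d susp_at by (auto intro!: kact_closed simp: x y)
   have VV: "md (V ?d)" by simp
   have "bp (dg m - 2) (ms m) = kact V (i, \<epsilon> i x) (j + 1, bp j y) +[V ?d] sg i *[V ?d] kact V (j, \<epsilon> j y) (i + 1, bp i x)"
    unfolding Vk using ms_parts(1)[OF x y refl] m p by (simp add: susp_at del: ms.simps)
   moreover have l: "lin R (V ?d) (W k) (%z. q (bw u @ (?d,z) # bw v))" by (rule mlin_lin[OF q]) (use uv m k in auto)
   ultimately have "q (bw u @ (?d, bp (dg m - 2) (ms m)) # bw v) = q (bw u @ (?d, kact V (i, \<epsilon> i x) (j + 1, bp j y)) # bw v) +[W k]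
     sg i *[W k] q (bw u @ (?d, kact V (j, \<epsilon> j y) (i + 1, bp i x)) # bw v)"
    using lin_add[OF l kV(1) m_smult[OF VV sgn_in kV(2)]] lin_smult[OF l sgn_in kV(2)] by simp
   also have "q (bw u @ (?d, kact V (i, \<epsilon> i x) (j + 1, bp j y)) # bw v) = kact W (i, \<epsilon> i x) (dg (u @ p2 # v) + n, q (bw (u @ p2 # v)))"
    using mlin_kact[OF sV W q vw_bw[OF uv(1)] vw_bw[OF uv(2)], where y="bp j y" and l="j + 1" and d="?d" and k="dg (u @ p2 # v) + n" and i=i and r="\<epsilon> i x"] x y d p
    by (simp add: susp_at add.assoc add.commute add.left_commute)
   also have "q (bw u @ (?d, kact V (j, \<epsilon> j y) (i + 1, bp i x)) # bw v) = kact W (j, \<epsilon> j y) (dg (u @ p1 # v) + n, q (bw (u @ p1 # v)))"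
    using mlin_kact[OF sV W q vw_bw[OF uv(1)] vw_bw[OF uv(2)], where y="bp i x" and l="i + 1" and d="?d" and k="dg (u @ p1 # v) + n" and i=j and r="\<epsilon> j y"] x y d p
    by (simp add: susp_at add.assoc add.commute add.left_commute)
   finally have qe: "q (bw u @ (?d, bp (dg m - 2) (ms m)) # bw v) = kact W (i, \<epsilon> i x) (dg (u @ p2 # v) + n, q (bw (u @ p2 # v))) +[W k]
     sg i *[W k] kact W (j, \<epsilon> j y) (dg (u @ p1 # v) + n, q (bw (u @ p1 # v)))" .
   have cc: "kact W (i, \<epsilon> i x) (dg (u @ p2 # v) + n, q (bw (u @ p2 # v))) <: W k" "kact W (j, \<epsilon> j y) (dg (u @ p1 # v) + n, q (bw (u @ p1 # v))) <: W k"
    using kc[of p1 "u @ p2 # v"] kc[of p2 "u @ p1 # v"] uv w p by auto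
   have "?s u (q (bw u @ (?d, bp (dg m - 2) (ms m)) # bw v)) = ?s u (kact W (i, \<epsilon> i x) (dg (u @ p2 # v) + n, q (bw (u @ p2 # v)))) +[W k]
    sg (dg u + i) *[W k] kact W (j, \<epsilon> j y) (dg (u @ p1 # v) + n, q (bw (u @ p1 # v)))" unfolding qe using Wk cc by (simp add: m_sr)
   \<comment> \<open>\<open>mu_su\<close> contributes the exponent \<open>i\<close>, the degree of
     the first letter in \<open>A\<close>, whereas the prefix \<open>u @ [p1]\<close> counts its
     suspended degree \<open>i + 1\<close>. So dropping the second letter enters with the opposite
     sign, and the sum telescopes.\<close>
   also have "sg (dg u + i) *[W k] kact W (j, \<epsilon> j y) (dg (u @ p1 # v) + n, q (bw (u @ p1 # v))) =
     -[W k] (sg (dg (u @ [p1])) *[W k] kact W (j, \<epsilon> j y) (dg (u @ p1 # v) + n, q (bw (u @ p1 # v))))"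
    by (rule sgn_neg[OF Wk cc(2)]) (simp add: p)
   finally show ?thesis using s0 m p by (simp add: add.assoc)
  qed
  have "sum3 (W k) (%u m v. ?s u (q (bw u @ (dg m - 1, bp (dg m - 2) (ms m)) # bw v))) w =
    finsum (W k) (%s. ?s (fst s) (q (bw (fst s) @ (dg (fst (snd s)) - 1, bp (dg (fst (snd s)) - 2) (ms (fst (snd s)))) # bw (snd (snd s))))) ?N"
  proof (rule sum3_restrict[OF Wk])
   fix u m v assume uv: "w = u @ m @ v" "(u, m, v) \<notin> ?N"
   then have "length m ~= 2" by simp
   then have "ms m = \<zero>[A (dg m - 2)]" by (rule ms_other)
   then have z: "bp (dg m - 2) (ms m) = \<zero>[V (dg m - 1)]" using lin_zero[OF _ _ bp_A, of "dg m - 2"] by (simp add: susp_at)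
   have "lin R (V (dg m - 1)) (W k) (%z. q (bw u @ (dg m - 1, z) # bw v))" by (rule mlin_lin[OF q]) (use uv w k in auto)
   from lin_zero[OF _ Wk this] show "?s u (q (bw u @ (dg m - 1, bp (dg m - 2) (ms m)) # bw v)) = \<zero>[W k]" unfolding z using Wk by simp
  qed (use w c2 Wk in auto)
  also have "... = finsum (W k) (%s. ?G (?h1 s) +[W k] -[W k] ?G (?h2 s)) ?N"
   by (rule fs_cong[OF Wk refl key]) (assumption, intro m_add[OF Wk] m_neg[OF Wk] Gc h1S h2S)
  also have "... = finsum (W k) (%s. ?G (?h1 s)) ?N +[W k] finsum (W k) (%s. -[W k] ?G (?h2 s)) ?N"
   by (rule fs_add[OF Wk]) (intro m_neg[OF Wk] Gc h1S h2S, assumption)+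
  also have "finsum (W k) (%s. -[W k] ?G (?h2 s)) ?N = -[W k] finsum (W k) (%s. ?G (?h2 s)) ?N"
   by (rule fs_neg[OF Wk, symmetric], rule finite_subset[OF _ finite_S3[of w]], blast, rule Gc, erule h2S)
  also have "finsum (W k) (%s. ?G (?h1 s)) ?N = finsum (W k) ?G (?S - ?A0)" by (rule fs_bij[OF Wk b1 refl]) (use Gc in blast)
  also have "finsum (W k) (%s. ?G (?h2 s)) ?N = finsum (W k) ?G (?S - ?B0)" by (rule fs_bij[OF Wk b2 refl]) (use Gc in blast)
  also have "finsum (W k) ?G (?S - ?A0) +[W k] -[W k] finsum (W k) ?G (?S - ?B0) = finsum (W k) ?G ?B0 -[W k] finsum (W k) ?G ?A0"
  proof -
   have t: "finsum (W k) ?G (?S - ?A0) +[W k] finsum (W k) ?G ?A0 = finsum (W k) ?G (?S - ?B0) +[W k] finsum (W k) ?G ?B0"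
    by (rule fs_tele[OF Wk Sfin _ _ Gc]) auto
   have c: "finsum (W k) ?G X <: W k" if "X \<subseteq> ?S" for X by (rule fs_closed[OF Wk]) (use that Gc in blast)
   show ?thesis by (rule m_swap[OF Wk t]; rule c; blast)
  qed
  also have "?B0 = {([], hd w, tl w)}" using ne by (cases w) auto
  also have "?A0 = {(butlast w, last w, [])}" using ne by (cases w rule: rev_cases) auto
  finally show ?thesis using Wk Gc[of "([], hd w, tl w)"] Gc[of "(butlast w, last w, [])"] ne by simp
 qed
 also have "?G ([], hd w, tl w) = kact W (fst (hd w) - 1, \<epsilon> (fst (hd w) - 1) (snd (hd w))) (dg (tl w) + n, q (bw (tl w)))"
  using Gc[of "([], hd w, tl w)"] kc[of "hd w" "tl w"] w ne Wk by (cases w) auto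
 finally show ?thesis by simp
qed

end

context ground begin

lemma kact_susp: "kact (susp M) (i,r) (l,y) = kact M (i,r) (l - 1, y)" by (simp add: kact_def susp_at add_diff_eq)

lemma gcomp_kact_l:
 assumes M: "gm M" and N: "gm N" and g: "g <: Hom M N b" and r: "r <: R"
 shows "gcomp M b (kact (Hom N N) (i,r) (0, gid N)) g = kact (Hom M N) (i,r) (b,g)"
proof (cases "i = 0")
 case True
 then show ?thesis using lin_smult[OF gcomp_lin_l[OF M N N g, of 0 b] r gid_HOM[OF N]] gcomp_gid_left[OF M g] by (simp add: kact_def)
next
 case False
 then show ?thesis using lin_zero[OF _ _ gcomp_lin_l[OF M N N g refl, of i]] M N by (simp add: kact_def)
qed

lemma gcomp_kact_r:
 assumes M: "gm M" and N: "gm N" and f: "f <: Hom M N b" and r: "r <: R"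
 shows "gcomp M i f (kact (Hom M M) (i,r) (0, gid M)) = kact (Hom M N) (i,r) (b,f)"
proof (cases "i = 0")
 case True
 then show ?thesis using lin_smult[OF gcomp_lin_r[OF M M N f, of 0 b] r gid_HOM[OF M]] gcomp_gid_right[OF M f] by (simp add: kact_def)
next
 case False
 then show ?thesis using lin_zero[OF _ _ gcomp_lin_r[OF M M N f refl, of i]] M N by (simp add: kact_def add.commute)
qed

lemma HOM_sum2_apply:
 assumes M: "gm M" and N: "gm N" and x: "x <: M j" and l: "j + k = l" and w: "vw V w"
  and c: "!!u v. vw V u ==> vw V v ==> w = u @ v ==> F u v <: Hom M N k"
 shows "sum2 (Hom M N k) F w j x = sum2 (N l) (%u v. F u v j x) w"
 by (rule lin_sum2[OF HOM_module[OF M N] gmod_module[OF N] HOM_ev[where M=M and i=j and x=x, OF N x l]]) (use w c in auto)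

lemma HOM_sum3_apply:
 assumes M: "gm M" and N: "gm N" and x: "x <: M j" and l: "j + k = l" and w: "vw V w"
  and c: "!!u m v. vw V u ==> vw V m ==> vw V v ==> w = u @ m @ v ==> F u m v <: Hom M N k"
 shows "sum3 (Hom M N k) F w j x = sum3 (N l) (%u m v. F u m v j x) w"
 by (rule lin_sum3[OF HOM_module[OF M N] gmod_module[OF N] HOM_ev[where M=M and i=j and x=x, OF N x l]]) (use w c in auto)

lemma HOM_kact_apply:
 assumes x: "x <: M j" and l: "j + b = l"
 shows "kact (Hom M N) (i,r) (b,f) j x = kact N (i,r) (l, f j x)" using x l by (auto simp: kact_def algebra_simps)

end

section \<open>Structure cochains of representations with their unit part\<close>

context ainf begin

abbreviation "ep p \<equiv> (fst p - 1, \<epsilon> (fst p - 1) (snd p))"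

definition gs :: "('k,'m) gmod \<Rightarrow> (int \<times> 'a) list \<Rightarrow> ('m,'m) gmap" where
 "gs M w = (case w of [(i,x)] \<Rightarrow> kact (Hom M M) (i - 1, \<epsilon> (i - 1) x) (0, gid M)
   | _ \<Rightarrow> \<zero>[susp (Hom M M) (dg w)])"

lemma gs_1: "gs M [p] = kact (Hom M M) (ep p) (0, gid M)" by (cases p) (simp add: gs_def)

lemma gs_other: "length w ~= 1 ==> gs M w = \<zero>[Hom M M (dg w - 1)]" by (auto simp: gs_def susp_at split: list.splits)

lemma gs_mlin: assumes M: "gm M" shows "mlin R (susp A) (susp (Hom M M)) 0 (gs M)"
proof (rule mlinI)
 have H: "gm (Hom M M)" using M by simp
 show "gs M [] <: susp (Hom M M) 0" using H by (simp add: gs_other susp_at)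
 fix u i v k assume uv: "vA u" "vA v" "k = dg u + i + dg v + 0"
 show "lin R (susp A i) (susp (Hom M M) k) (%x. gs M (u @ (i,x) # v))"
 proof (cases "u = [] \<and> v = []")
  case True
  have "lin R (A (i - 1)) (Hom M M (k - 1)) (%x. kact (Hom M M) (i - 1, \<epsilon> (i - 1) x) (0, gid M))"
   by (rule lin_compose[OF eps_lin kact_lin1[OF H gid_HOM[OF M]]]) (use True uv in auto)
  then show ?thesis using True by (simp add: gs_1 susp_at)
 next
  case False
  then have e: "length (u @ (i,x) # v) ~= 1" for x by auto
  have d: "dg (u @ (i,x) # v) = k" for x using uv by simp
  show ?thesis unfolding gs_other[OF e] d susp_at by (rule lin_const0) (use H in simp)
 qed
qed

lemma gs_HOM: "gm M ==> vA w ==> dg w - 1 = k ==> gs M w <: Hom M M k" using mlin_closed[OF gs_mlin, of M w "dg w"] by (simp add: susp_at)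

lemma g_su_eq: "g_su R A \<epsilon> M = cc_of R A (Hom M M) 0 (gs M)"
 unfolding g_su_def Let_def by (rule arg_cong[where f="cc_of R A (Hom M M) 0"]) (simp add: gs_def fun_eq_iff)

lemma cb_HOM:
 assumes M: "gm M" and N: "gm N" and q: "q \<in> CH M N n" and w: "vw V w" and k: "dg w + n - 1 = k"
 shows "cc_at R B q w <: Hom M N k" using cc_at_closed[OF B q w refl] k by (simp add: susp_at)

abbreviation "rP M p \<equiv> cc_add R A (HOM R M M) 0 (cc_ge1 R A (HOM R M M) 0 (cc_incl R A e \<epsilon> (HOM R M M) 0 p)) (g_su R A \<epsilon> M)"

text \<open>\<open>rP\<close> is the cochain required to be an A-infinity morphism,
  \<open>fullp\<close> also keeps the component \<open>p^0\<close>. They agree on nonempty words;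
  \<open>p^0\<close> enters the morphism equation through the differential of \<open>End M\<close>
  instead.\<close>

lemma
 assumes M: "gm M" and p: "p \<in> CH M M 0"
 shows full_CCu: "fullp (M,p) \<in> CCu R A (Hom M M) 0"
  and full_at: "!!w k. vA w ==> dg w - 1 = k ==>
    ac (fullp (M,p)) w = cc_at R B p (bw w) +[Hom M M k] gs M w"
  and rep_CC: "rP M p \<in> CC R A (Hom M M) 0"
  and rep_at: "!!w. vA w ==> w ~= [] ==> ac (rP M p) w = ac (fullp (M,p)) w"
proof -
 let ?H = "Hom M M"
 have H: "gm ?H" using M by simp
 note i = cc_incl_CCu[OF H p] and g = cc_of_CCu[OF A H gs_mlin[OF M], folded g_su_eq]
 have ga: "ac (g_su R A \<epsilon> M) w = gs M w" if "vA w" for w unfolding g_su_eq by (rule cc_at_of[OF A H gs_mlin[OF M] that])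
 have i1: "cc_ge1 R A ?H 0 (cinc ?H 0 p) \<in> CCu R A ?H 0" using cc_ge1_CC[OF A H i] CC_iff[OF A H] by auto
 show "fullp (M,p) \<in> CCu R A ?H 0" unfolding full_p_def prod.case by (rule cc_add_CCu[OF A H i g])
 show *: "ac (fullp (M,p)) w = cc_at R B p (bw w) +[?H k] gs M w" if w: "vA w" "dg w - 1 = k" for w k
  unfolding full_p_def prod.case cc_at_add[OF A H i g w(1) refl] ga[OF w(1)] cc_at_incl[OF H p w(1)] using w by (simp add: susp_at)
 have P0: "ac (rP M p) [] = \<zero>[susp ?H 0]"
  using cc_at_add[OF A H i1 g, of "[]" 0] cc_at_ge1[OF A H i, of "[]" 0] ga[of "[]"] H by (simp add: gs_other susp_at)
 show "rP M p \<in> CC R A ?H 0" unfolding CC_iff[OF A H] using cc_add_CCu[OF A H i1 g] P0 by simp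
 show "ac (rP M p) w = ac (fullp (M,p)) w" if w: "vA w" "w ~= []" for w
  unfolding *[OF w(1) refl] cc_at_add[OF A H i1 g w(1) refl] ga[OF w(1)]
  using w cc_at_ge1[OF A H i w(1) refl] cc_at_incl[OF H p w(1)] by (simp add: susp_at)
qed

text \<open>\<open>gs\<close> can be nonzero only on one-letter words, so the unit part of the left
  factor contributes just the cut after the first letter. The signs \<open>s\<close> are left
  arbitrary to serve both the morphism and the representation equation; \<open>full_right\<close> is
  the mirror image.\<close>

lemma full_left:
 assumes M: "gm M" and N: "gm N" and q: "q \<in> CH N N 0"
  and F: "!!v. vA v ==> F v <: Hom M N (dg v + b - 1)"
  and s: "!!u. s u <: R" and w: "vA w" and ne: "w ~= []" and k: "k = dg w + b - 2"
 shows "sum2 (Hom M N k) (%u v. s u *[Hom M N k] gcomp M (dg v + b - 1) (ac (fullp (N,q)) u) (F v)) w =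
  sum2 (Hom M N k) (%u v. s u *[Hom M N k] gcomp M (dg v + b - 1) (cc_at R B q (bw u)) (F v)) w
  +[Hom M N k] s [hd w] *[Hom M N k] kact (Hom M N) (ep (hd w)) (dg (tl w) + b - 1, F (tl w))"
proof -
 have H: "gm (Hom M N)" and Hk: "md (Hom M N k)" using M N by auto
 let ?g = "%X u v. s u *[Hom M N k] gcomp M (dg v + b - 1) X (F v)"
 have l: "lin R (Hom N N (dg u - 1)) (Hom M N k) (%X. ?g X u v)" if "vA u" "vA v" "w = u @ v" for u v
  by (rule lin_scale[OF Hk s gcomp_lin_l[OF M N N F]]) (use that k in auto)
 have c: "cc_at R B q (bw u) <: Hom N N (dg u - 1)" "gs N u <: Hom N N (dg u - 1)" if "vA u" for u
  using cb_HOM[OF N N q vw_bw[OF that]] gs_HOM[OF N that] by auto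
 have "sum2 (Hom M N k) (%u v. ?g (ac (fullp (N,q)) u) u v) w =
  sum2 (Hom M N k) (%u v. ?g (cc_at R B q (bw u)) u v +[Hom M N k] ?g (gs N u) u v) w" by (rule vsum2_cong[OF Hk w])
   (use full_at[OF N q _ refl] lin_add[OF l c] lin_closed[OF l] c Hk in \<open>auto intro!: m_add\<close>)
 also have "... = sum2 (Hom M N k) (%u v. ?g (cc_at R B q (bw u)) u v) w +[Hom M N k] sum2 (Hom M N k) (%u v. ?g (gs N u) u v) w"
  by (rule sum2_add[OF Hk]) (use w c lin_closed[OF l] in auto)
 also have "sum2 (Hom M N k) (%u v. ?g (gs N u) u v) w = finsum (Hom M N k) (%t. ?g (gs N (fst t)) (fst t) (snd t)) {([hd w], tl w)}"
 proof (rule sum2_restrict[OF Hk])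
  fix u v assume uv: "w = u @ v"
  have vv: "vA u" "vA v" using w uv by auto
  show "?g (gs N u) u v <: Hom M N k" by (rule lin_closed[OF l[OF vv uv] c(2)[OF vv(1)]])
  assume "(u,v) \<notin> {([hd w], tl w)}"
  then have "length u ~= 1" using uv by (auto simp: length_Suc_conv)
  then show "?g (gs N u) u v = \<zero>[Hom M N k]" using lin_zero[OF _ Hk l[OF vv uv]] N by (simp add: gs_other)
 qed (use ne in auto)
 also have "... = ?g (gs N [hd w]) [hd w] (tl w)" using lin_closed[OF l[of "[hd w]" "tl w"] c(2)[of "[hd w]"]] w ne Hk by (cases w) auto
 also have "gcomp M (dg (tl w) + b - 1) (gs N [hd w]) (F (tl w)) = kact (Hom M N) (ep (hd w)) (dg (tl w) + b - 1, F (tl w))"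
  unfolding gs_1 by (rule gcomp_kact_l[OF M N F]) (use w ne in \<open>cases w; auto simp: susp_at\<close>)+
 finally show ?thesis .
qed

lemma full_right:
 assumes M: "gm M" and N: "gm N" and q: "q \<in> CH M M 0"
  and F: "!!v. vA v ==> F v <: Hom M N (dg v + b - 1)"
  and s: "!!u. s u <: R" and w: "vA w" and ne: "w ~= []" and k: "k = dg w + b - 2"
 shows "sum2 (Hom M N k) (%u v. s u *[Hom M N k] gcomp M (dg v - 1) (F u) (ac (fullp (M,q)) v)) w =
  sum2 (Hom M N k) (%u v. s u *[Hom M N k] gcomp M (dg v - 1) (F u) (cc_at R B q (bw v))) w
  +[Hom M N k] s (butlast w) *[Hom M N k] kact (Hom M N) (ep (last w)) (dg (butlast w) + b - 1, F (butlast w))"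
proof -
 have H: "gm (Hom M N)" and Hk: "md (Hom M N k)" using M N by auto
 let ?g = "%X u v. s u *[Hom M N k] gcomp M (dg v - 1) (F u) X"
 have l: "lin R (Hom M M (dg v - 1)) (Hom M N k) (%X. ?g X u v)" if "vA u" "vA v" "w = u @ v" for u v
  by (rule lin_scale[OF Hk s gcomp_lin_r[OF M M N F]]) (use that k in auto)
 have c: "cc_at R B q (bw u) <: Hom M M (dg u - 1)" "gs M u <: Hom M M (dg u - 1)" if "vA u" for u
  using cb_HOM[OF M M q vw_bw[OF that]] gs_HOM[OF M that] by auto
 have "sum2 (Hom M N k) (%u v. ?g (ac (fullp (M,q)) v) u v) w =
  sum2 (Hom M N k) (%u v. ?g (cc_at R B q (bw v)) u v +[Hom M N k] ?g (gs M v) u v) w" by (rule vsum2_cong[OF Hk w])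
   (use full_at[OF M q _ refl] lin_add[OF l c] lin_closed[OF l] c Hk in \<open>auto intro!: m_add\<close>)
 also have "... = sum2 (Hom M N k) (%u v. ?g (cc_at R B q (bw v)) u v) w +[Hom M N k] sum2 (Hom M N k) (%u v. ?g (gs M v) u v) w"
  by (rule sum2_add[OF Hk]) (use w c lin_closed[OF l] in auto)
 also have "sum2 (Hom M N k) (%u v. ?g (gs M v) u v) w = finsum (Hom M N k) (%t. ?g (gs M (snd t)) (fst t) (snd t)) {(butlast w, [last w])}"
 proof (rule sum2_restrict[OF Hk])
  fix u v assume uv: "w = u @ v"
  have vv: "vA u" "vA v" using w uv by auto
  show "?g (gs M v) u v <: Hom M N k" by (rule lin_closed[OF l[OF vv uv] c(2)[OF vv(2)]])
  assume "(u,v) \<notin> {(butlast w, [last w])}"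
  then have "length v ~= 1" using uv by (auto simp: length_Suc_conv)
  then show "?g (gs M v) u v = \<zero>[Hom M N k]" using lin_zero[OF _ Hk l[OF vv uv]] M by (simp add: gs_other)
 qed (use ne in auto)
 also have "... = ?g (gs M [last w]) (butlast w) [last w]"
  using lin_closed[OF l[of "butlast w" "[last w]"] c(2)[of "[last w]"]] w ne Hk by (cases w rule: rev_cases) auto
 also have "gcomp M (dg [last w] - 1) (F (butlast w)) (gs M [last w]) = kact (Hom M N) (ep (last w)) (dg (butlast w) + b - 1, F (butlast w))"
  unfolding gs_1 by (simp, rule gcomp_kact_r[OF M N F]) (use w ne in \<open>cases w rule: rev_cases; auto simp: susp_at\<close>)+
 finally show ?thesis .
qed

end

context ground begin

text \<open>The bookkeeping of \<open>mor_word\<close>: \<open>a\<close> is the term dropping the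
  first letter, \<open>l\<close> the one dropping the last letter with its sign. Each occurs once
  from \<open>nu\<close> and once from a unit part.\<close>

lemma m_mor_alg:
 assumes M: "md M" and c: "X <: M" "Y <: M" "Z <: M" "a <: M" "l <: M"
 shows "(X +[M] a) -[M] (Y +[M] (a -[M] l)) +[M] (-[M] Z +[M] -[M] l) = X -[M] Y -[M] Z"
proof -
 have *: "(X +[M] a) +[M] (Y' +[M] (b +[M] l)) +[M] (Z' +[M] m) = X +[M] Y' +[M] Z'"
  if h: "a +[M] b = \<zero>[M]" "l +[M] m = \<zero>[M]" "b <: M" "m <: M" "Y' <: M" "Z' <: M" for b m Y' Z'
 proof -
  have "a +[M] (b +[M] z) = z" "l +[M] (m +[M] z) = z" if "z <: M" for z
   using h that c M m_assoc'[OF M, of a b z] m_assoc'[OF M, of l m z] by auto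
  then show ?thesis using h c M by (simp add: m_ac)
 qed
 show ?thesis using *[of "-[M] a" "-[M] l" "-[M] Y" "-[M] Z"] c M by (simp add: a_minus_def m_negadd)
qed

text \<open>The bookkeeping of \<open>rep_word\<close>: \<open>f\<close> and \<open>L\<close> are
  the terms dropping the first and the last letter, \<open>g\<close> is the product of two unit
  parts, \<open>x\<close> the contribution of \<open>h\<close>. Only \<open>x\<close> is left to
  balance \<open>S\<close> and \<open>T\<close>.\<close>

lemma m_rep_alg:
 assumes M: "md M" and c: "S <: M" "T <: M" "L <: M" "f <: M" "g <: M" "x <: M"
 shows "-[M] (S +[M] L +[M] -[M] (f +[M] g)) = T +[M] (f -[M] L) +[M] (x +[M] g) \<longleftrightarrow> T +[M] S = -[M] x"
proof -
 let ?c = "-[M] L +[M] (f +[M] g)"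
 have "-[M] (S +[M] L +[M] -[M] (f +[M] g)) = ?c +[M] -[M] S" using c M by (simp add: m_negadd m_ac)
 moreover have "T +[M] (f -[M] L) +[M] (x +[M] g) = ?c +[M] (T +[M] x)" using c M by (simp add: a_minus_def m_ac)
 moreover have "-[M] S = T +[M] x \<longleftrightarrow> T +[M] S = -[M] x"
 proof
  assume h: "-[M] S = T +[M] x"
  have "T +[M] S +[M] x = S +[M] (T +[M] x)" using c M by (simp add: m_ac)
  then show "T +[M] S = -[M] x" using c M h[symmetric] m_eq_neg[OF M, of "T +[M] S" x] by simp
 next
  assume h: "T +[M] S = -[M] x"
  have "T +[M] x +[M] S = (T +[M] S) +[M] x" using c M by (simp add: m_ac)
  then show "-[M] S = T +[M] x" using c M h m_eq_neg[OF M, of "T +[M] x" S] by simp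
 qed
 ultimately show ?thesis using c M by simp
qed

lemma mlin_zero_slot:
 assumes V: "gm V" and W: "gm W" and m: "mlin R V W n \<phi>" and u: "vw V u" and v: "vw V v" and k: "dg u + i + dg v + n = k"
 shows "\<phi> (u @ (i, \<zero>[V i]) # v) = \<zero>[W k]" using lin_zero[OF _ _ mlin_lin[OF m u v k]] V W by simp

end

section \<open>The morphism equation reduced to words in \<open>ker \<epsilon>\<close>\<close>

context ainf begin

abbreviation "bc \<equiv> cc_at R B"

lemma sum2_bw:
 assumes N: "md N" and w: "vA w" and c: "!!u v. vw V u ==> vw V v ==> bw w = u @ v ==> F u v <: N"
 shows "sum2 N (%u v. F (bw u) (bw v)) w = sum2 N F (bw w)" unfolding bw_map
proof (rule sum2_map[OF N], unfold bw_map[symmetric])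
 fix u v assume "bw w = u @ v"
 then show "F u v <: N" using c[of u v] vw_bw[OF w] by simp
qed

lemma nu_Nil: "ac nu [] = \<zero>[susp A (- 1)]" using nu_CC CC_iff[OF A A] by auto

text \<open>The only block of the empty word is empty, and both \<open>bm []\<close> and
  \<open>nu []\<close> vanish.\<close>

lemma circ_Nil:
 assumes W: "gm W" and q: "mlin R V W n q" and q': "mlin R (susp A) W n q'" and k: "k = n - 1"
 shows "sum3 (W k) (%u m v. sw u *[W k] q (u @ blB m # v)) [] = \<zero>[W k]"
  "sum3 (W k) (%u m v. sg (- 1 * dg u) *[W k] q' (u @ (dg m + - 1, ac nu m) # v)) [] = \<zero>[W k]"
 using mlin_zero_slot[OF _ W q, of "[]" "[]" "-1" k] mlin_zero_slot[OF _ W q', of "[]" "[]" "-1" k] k W bm_Nil nu_Nil by auto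

abbreviation "morC M N p q f \<equiv> cc_add R A (HOM R M N) 0
     (cc_minus R A (HOM R M N) 0
       (cc_star R A M N 0 1 (fullp (N,q)) (cinc (HOM R M N) 1 f))
       (cc_circ R A (HOM R M N) 1 (-1) (cc_ge1 R A (HOM R M N) 1 (cinc (HOM R M N) 1 f)) nu))
     (cc_star R A M N 1 0 (cinc (HOM R M N) 1 f) (fullp (M,p)))"

text \<open>The point is that the value depends on \<open>w\<close> only through
  \<open>bw w\<close>. The terms dropping an end letter are extracted by \<open>full_left\<close>,
  \<open>full_right\<close> and \<open>circ_incl\<close>, and \<open>m_mor_alg\<close> cancels them.
  The empty word has no end letters and is treated on its own.\<close>

lemma mor_word:
 assumes M: "gm M" and N: "gm N" and p: "p \<in> CH M M 0" and q: "q \<in> CH N N 0"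
  and f: "f \<in> CH M N 1" and w: "vA w" and k: "k = dg w - 1"
 shows "ac (morC M N p q f) w =
   sum2 (Hom M N k) (%u v. gcomp M (dg v) (bc q u) (bc f v)) (bw w)
   -[Hom M N k] sum3 (Hom M N k) (%u m v. sw u *[Hom M N k] bc f (u @ blB m # v)) (bw w)
   -[Hom M N k] sum2 (Hom M N k) (%u v. sw u *[Hom M N k] gcomp M (dg v - 1) (bc f u) (bc p v)) (bw w)"
proof -
 let ?H = "Hom M N"
 have H: "gm ?H" and Hk: "md (?H k)" and sH: "gm (susp ?H)" using M N by auto
 let ?F = "cinc ?H 1 f"
 note F = cc_incl_CCu[OF H f] and Fw = cc_at_incl[OF H f]
 note fp = full_CCu[OF M p] and fq = full_CCu[OF N q]
 have F1: "cc_ge1 R A ?H 1 ?F \<in> CCu R A ?H 1" using cc_ge1_CC[OF A H F] CC_iff[OF A H] by auto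
 have S: "cc_star R A M N 0 1 (fullp (N,q)) ?F \<in> CCu R A ?H 0"
   "cc_circ R A ?H 1 (-1) (cc_ge1 R A ?H 1 ?F) nu \<in> CCu R A ?H 0"
   "cc_star R A M N 1 0 ?F (fullp (M,p)) \<in> CCu R A ?H 0"
  using cc_star_CCu[OF A M N N fq F] cc_circ_CCu[OF A H F1 nu_CC] cc_star_CCu[OF A M M N F fp] by auto
 have Fc: "ac ?F v <: ?H (dg v + 1 - 1)" if "vA v" for v using cb_HOM[OF M N f vw_bw[OF that]] Fw[OF that] by simp
 have fc: "bc f v <: ?H l" if "vw V v" "dg v = l" for v l using cb_HOM[OF M N f that(1)] that by simp
 have pc: "bc p v <: Hom M M (dg v - 1)" if "vw V v" for v using cb_HOM[OF M M p that] by simp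
 have qc: "bc q v <: Hom N N (dg v - 1)" if "vw V v" for v using cb_HOM[OF N N q that] by simp
 let ?X = "%w. sum2 (?H k) (%u v. gcomp M (dg v) (bc q u) (bc f v)) w"
 let ?Y = "%w. sum3 (?H k) (%u m v. sw u *[?H k] bc f (u @ blB m # v)) w"
 let ?Z = "%w. sum2 (?H k) (%u v. sw u *[?H k] gcomp M (dg v - 1) (bc f u) (bc p v)) w"
 have gX: "gcomp M (dg v) (bc q u) (bc f v) <: ?H k" if "vw V u" "vw V v" "bw w = u @ v" for u v
  by (rule gcomp_HOM[OF M fc[OF that(2) refl] qc[OF that(1)]]) (use arg_cong[OF that(3), of dg] k in simp)
 have gZ: "gcomp M (dg v - 1) (bc f u) (bc p v) <: ?H k" if "vw V u" "vw V v" "bw w = u @ v" for u v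
  by (rule gcomp_HOM[OF M pc[OF that(2)] fc[OF that(1) refl]]) (use arg_cong[OF that(3), of dg] k in simp)
 have gY: "bc f (u @ blB m # v) <: ?H k" if "vw V u" "vw V m" "vw V v" "bw w = u @ m @ v" for u m v
 proof -
  have "dg w = dg (u @ m @ v)" unfolding that(4)[symmetric] by simp
  then show ?thesis by (intro fc) (use that(1-3) bm_closed[of m] k in \<open>auto simp: susp_at\<close>)
 qed
 have XYZ: "?X (bw w) <: ?H k" "?Y (bw w) <: ?H k" "?Z (bw w) <: ?H k"
  by (rule vsum2_closed[OF Hk vw_bw[OF w]] vsum3_closed[OF Hk vw_bw[OF w]]; (rule m_smult[OF Hk sgn_in])?; rule gX gY gZ; assumption)+
 \<comment> \<open>The exponents of \<open>cc_at_star\<close> for degrees (0, 1) and (1, 0): the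
   former is always even, the latter has parity opposite to \<open>dg u\<close>. This is why the
   third sum ends up with a minus sign.\<close>
 let ?s1 = "%u. sg (1 * dg u + dg u + 0)" and ?s3 = "%u. sg (0 * dg u + dg u + 1)"
 have t1: "sum2 (?H k) (%u v. ?s1 u *[?H k] gcomp M (dg v + 1 - 1) (bc q (bw u)) (ac ?F v)) w = ?X (bw w)"
 proof -
  have "sum2 (?H k) (%u v. ?s1 u *[?H k] gcomp M (dg v + 1 - 1) (bc q (bw u)) (ac ?F v)) w =
   sum2 (?H k) (%u v. gcomp M (dg (bw v)) (bc q (bw u)) (bc f (bw v))) w"
   by (rule vsum2_cong[OF Hk w]) (use Fw gX[OF vw_bw vw_bw] Hk in \<open>auto simp: sgn_even\<close>)
  also have "... = ?X (bw w)" by (rule sum2_bw[where F="%u v. gcomp M (dg v) (bc q u) (bc f v)", OF Hk w]) (rule gX)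
  finally show ?thesis .
 qed
 have t3: "sum2 (?H k) (%u v. ?s3 u *[?H k] gcomp M (dg v - 1) (ac ?F u) (bc p (bw v))) w = -[?H k] ?Z (bw w)"
 proof -
  have "-[?H k] ?Z (bw w) = sum2 (?H k) (%u v. -[?H k] (sw u *[?H k] gcomp M (dg v - 1) (bc f u) (bc p v))) (bw w)"
   by (rule sum2_neg[OF Hk]) (use gZ Hk vw_bw[OF w] in auto)
  also have "... = sum2 (?H k) (%u v. -[?H k] (sg (dg (bw u)) *[?H k] gcomp M (dg (bw v) - 1) (bc f (bw u)) (bc p (bw v)))) w"
   by (rule sum2_bw[where F="%u v. -[?H k] (sw u *[?H k] gcomp M (dg v - 1) (bc f u) (bc p v))", OF Hk w, symmetric]) (use gZ Hk in auto)
  also have "... = sum2 (?H k) (%u v. ?s3 u *[?H k] gcomp M (dg v - 1) (ac ?F u) (bc p (bw v))) w"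
  proof (rule vsum2_cong[OF Hk w])
   fix u v assume uv: "vA u" "vA v" "w = u @ v"
   have c: "gcomp M (dg v - 1) (bc f (bw u)) (bc p (bw v)) <: ?H k" using gZ[of "bw u" "bw v"] uv by simp
   show "-[?H k] (sg (dg (bw u)) *[?H k] gcomp M (dg (bw v) - 1) (bc f (bw u)) (bc p (bw v))) =
    ?s3 u *[?H k] gcomp M (dg v - 1) (ac ?F u) (bc p (bw v))" using sgn_neg[OF Hk c, of "dg u + 1" "dg u"] Fw[OF uv(1)] by simp
   show "?s3 u *[?H k] gcomp M (dg v - 1) (ac ?F u) (bc p (bw v)) <: ?H k" using c Hk Fw[OF uv(1)] by simp
  qed
  finally show ?thesis by simp
 qed
 have W: "susp ?H (dg w) = ?H k" using k by (simp add: susp_at)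
 have a1: "ac (cc_star R A M N 0 1 (fullp (N,q)) ?F) w =
   sum2 (?H k) (%u v. ?s1 u *[?H k] gcomp M (dg v + 1 - 1) (ac (fullp (N,q)) u) (ac ?F v)) w"
  by (rule cc_at_star[OF A M N N fq F w]) (use k in simp)
 have a3: "ac (cc_star R A M N 1 0 ?F (fullp (M,p))) w =
   sum2 (?H k) (%u v. ?s3 u *[?H k] gcomp M (dg v + 0 - 1) (ac ?F u) (ac (fullp (M,p)) v)) w"
  by (rule cc_at_star[OF A M M N F fp w]) (use k in simp)
 have a2: "ac (cc_circ R A ?H 1 (-1) (cc_ge1 R A ?H 1 ?F) nu) w =
   sum3 (?H k) (%u m v. sg (- 1 * dg u) *[?H k] ac (cc_ge1 R A ?H 1 ?F) (u @ (dg m + - 1, ac nu m) # v)) w"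
  unfolding W[symmetric] by (rule cc_at_circ[OF A H F1 nu_CC w]) simp
 have sum: "ac (morC M N p q f) w =
   ac (cc_star R A M N 0 1 (fullp (N,q)) ?F) w -[?H k] ac (cc_circ R A ?H 1 (-1) (cc_ge1 R A ?H 1 ?F) nu) w
   +[?H k] ac (cc_star R A M N 1 0 ?F (fullp (M,p))) w"
  using cc_at_add[OF A H cc_minus_CCu[OF A H S(1,2)] S(3) w, of "dg w"] cc_at_minus[OF A H S(1,2) w, of "dg w"] W by simp
 show ?thesis
 \<comment> \<open>On the empty word the unit parts and the circle product vanish, so the identity
   holds without any cancellation.\<close>
 proof (cases "w = []")
  case True
  have g0: "gs N [] = \<zero>[Hom N N (- 1)]" "gs M [] = \<zero>[Hom M M (- 1)]" by (simp_all add: gs_other)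
  have f0: "ac (fullp (N,q)) [] = bc q (bw [])" "ac (fullp (M,p)) [] = bc p (bw [])"
   using full_at[OF N q, of "[]" "-1"] full_at[OF M p, of "[]" "-1"] qc[of "[]"] pc[of "[]"] M N by (auto simp: g0)
  have e1: "sum2 (?H k) (%u v. ?s1 u *[?H k] gcomp M (dg v + 1 - 1) (ac (fullp (N,q)) u) (ac ?F v)) w = ?X (bw w)"
   unfolding t1[symmetric] by (rule vsum2_cong[OF Hk w]) (use True f0 Fw gX[of "[]" "[]"] Hk in auto)
  have e3: "sum2 (?H k) (%u v. ?s3 u *[?H k] gcomp M (dg v + 0 - 1) (ac ?F u) (ac (fullp (M,p)) v)) w = -[?H k] ?Z (bw w)"
   unfolding t3[symmetric] by (rule vsum2_cong[OF Hk w]) (use True f0 Fw gZ[of "[]" "[]"] Hk in auto)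
  have e2: "?Y (bw w) = \<zero>[?H k]" "sum3 (?H k) (%u m v. sg (- 1 * dg u) *[?H k] ac (cc_ge1 R A ?H 1 ?F) (u @ (dg m + - 1, ac nu m) # v)) w = \<zero>[?H k]"
   using circ_Nil[OF sH cc_at_mlin[OF B f] cc_at_mlin[OF A F1] refl] True k by (simp_all add: susp_at)
  show ?thesis unfolding sum a1 a2 a3 e1 e2 e3 using XYZ(1,3) Hk by (simp only: a_minus_def)
 next
  case False
  define K1 where "K1 = kact ?H (ep (hd w)) (dg (tl w), bc f (bw (tl w)))"
  define K2 where "K2 = kact ?H (ep (last w)) (dg (butlast w), bc f (bw (butlast w)))"
  have hl: "vA (tl w)" "vA (butlast w)" "snd (hd w) <: A (fst (hd w) - 1)" "snd (last w) <: A (fst (last w) - 1)"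
   "dg w = fst (hd w) + dg (tl w)" "dg w = dg (butlast w) + fst (last w)"
  proof -
   obtain a v where "w = a # v" using False by (cases w) auto
   then show "vA (tl w)" "snd (hd w) <: A (fst (hd w) - 1)" "dg w = fst (hd w) + dg (tl w)" using w by (auto simp: susp_at)
   obtain b u where "w = u @ [b]" using False by (cases w rule: rev_cases) auto
   then show "vA (butlast w)" "snd (last w) <: A (fst (last w) - 1)" "dg w = dg (butlast w) + fst (last w)" using w by (auto simp: susp_at)
  qed
  have K: "K1 <: ?H k" "K2 <: ?H k"
   unfolding K1_def K2_def by (rule kact_closed[OF H]; use hl k fc[OF vw_bw[OF hl(1)]] fc[OF vw_bw[OF hl(2)]] in simp)+
  have k': "k = dg w + 1 - 2" using k by simp
  have L: "sum2 (?H k) (%u v. ?s1 u *[?H k] gcomp M (dg v + 1 - 1) (ac (fullp (N,q)) u) (ac ?F v)) w =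
   sum2 (?H k) (%u v. ?s1 u *[?H k] gcomp M (dg v + 1 - 1) (bc q (bw u)) (ac ?F v)) w
   +[?H k] ?s1 [hd w] *[?H k] kact ?H (ep (hd w)) (dg (tl w) + 1 - 1, ac ?F (tl w))" by (rule full_left[OF M N q Fc sgn_in w False k'])
  have L': "sum2 (?H k) (%u v. ?s3 u *[?H k] gcomp M (dg v - 1) (ac ?F u) (ac (fullp (M,p)) v)) w =
   sum2 (?H k) (%u v. ?s3 u *[?H k] gcomp M (dg v - 1) (ac ?F u) (bc p (bw v))) w
   +[?H k] ?s3 (butlast w) *[?H k] kact ?H (ep (last w)) (dg (butlast w) + 1 - 1, ac ?F (butlast w))"
   by (rule full_right[OF M N p Fc sgn_in w False k'])
  have "ac (cc_star R A M N 0 1 (fullp (N,q)) ?F) w = ?X (bw w) +[?H k] K1" unfolding a1 L t1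
   using K Hk Fw[OF hl(1)] by (simp add: sgn_even K1_def)
  moreover have "ac (cc_star R A M N 1 0 ?F (fullp (M,p))) w = -[?H k] ?Z (bw w) +[?H k] -[?H k] (sg (dg (butlast w)) *[?H k] K2)"
   unfolding a3 add_0_right L' t3
   using K Hk Fw[OF hl(2)] sgn_neg[OF Hk K(2), of "dg (butlast w) + 1" "dg (butlast w)"] by (simp add: K2_def)
  moreover have "ac (cc_circ R A ?H 1 (-1) (cc_ge1 R A ?H 1 ?F) nu) w = ?Y (bw w) +[?H k] (K1 -[?H k] sg (dg (butlast w)) *[?H k] K2)"
  proof -
   have "ac (cc_circ R A ?H 1 (-1) (cc_ge1 R A ?H 1 ?F) nu) w =
    sum3 (susp ?H (dg w)) (%u m v. sw u *[susp ?H (dg w)] bc f (bw (u @ (dg m - 1, ac nu m) # v))) w" unfolding a2 W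
   proof (rule vsum3_cong[OF Hk w])
    fix u m v assume uv: "vA u" "vA m" "vA v" "w = u @ m @ v"
    let ?w = "u @ (dg m - 1, ac nu m) # v"
    have vw: "vA ?w" using uv nu_closed[OF uv(2)] by (simp add: susp_at)
    have "ac (cc_ge1 R A ?H 1 ?F) ?w = bc f (bw ?w)" using cc_at_ge1[OF A H F vw refl] Fw[OF vw] by simp
    then show "sg (- 1 * dg u) *[?H k] ac (cc_ge1 R A ?H 1 ?F) (u @ (dg m + - 1, ac nu m) # v) =
     sw u *[?H k] bc f (bw ?w)" by simp
    have "bc f (bw ?w) <: ?H k" by (rule fc[OF vw_bw[OF vw]]) (use uv k in simp)
    then show "sw u *[?H k] bc f (bw ?w) <: ?H k" using Hk by simp
   qed
   also have "... = ?Y (bw w) +[?H k] (K1 -[?H k] sg (dg (butlast w)) *[?H k] K2)"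
    using circ_incl[OF sH cc_at_mlin[OF B f] w False, of "dg w"] by (simp add: W kact_susp K1_def K2_def)
   finally show ?thesis .
  qed
  ultimately show ?thesis unfolding sum using m_mor_alg[OF Hk XYZ K(1) m_smult[OF Hk sgn_in K(2)]] by simp
 qed
qed

end

context ground begin

lemma m_minus_minus_zero:
 assumes M: "md M" and c: "X <: M" "Y <: M" "Z <: M"
 shows "X -[M] Y -[M] Z = \<zero>[M] \<longleftrightarrow> X = Y +[M] Z"
proof -
 have "X -[M] Y -[M] Z = X -[M] (Y +[M] Z)" using c M by (simp add: a_minus_def m_negadd m_ac)
 then show ?thesis using m_minus_zero[OF M c(1), of "Y +[M] Z"] c M by simp
qed

lemma m_neg_eq: "md M ==> x <: M ==> y <: M ==> -[M] x = -[M] y \<longleftrightarrow> x = y" by (metis m_negneg)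

end

section \<open>Morphisms of representations as morphisms of comodules\<close>

context ainf begin

abbreviation "adj \<equiv> cc_adjoint_family R B"
abbreviation "DB M p \<equiv> phi_inv R KB M (adj M M 0 p)"
abbreviation "wt M w j x \<equiv> tens_elt R CB M (wB w) (j, x)"

text \<open>The two sums come from the two summands of \<open>phi_inv\<close>: \<open>dP\<close>
  inserts \<open>bm\<close> into the word, \<open>Phi\<close> feeds a suffix to \<open>p\<close> and
  hands the result to \<open>f\<close> together with the prefix. In the latter the sign is that of
  an odd map passing \<open>u\<close>.\<close>

lemma adj_D:
 assumes M: "gm M" and N: "gm N" and p: "p \<in> CH M M 0" and f: "f \<in> CH M N n"
  and w: "vw V w" and x: "x <: M j" and l: "l = dg w + j - 1 + (n - 1)"
 shows "adj M N n f (dg w + j - 1) (DB M p (dg w + j) (wt M w j x)) =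
  sum3 (N l) (%u m v. sw u *[N l] bc f (u @ blB m # v) j x) w
  +[N l] sum2 (N l) (%u v. sw u *[N l] bc f u (dg v + j - 1) (bc p v j x)) w"
proof -
 let ?d = "dg w + j" and ?P = "CT M"
 have P: "gm ?P" and Pk: "md (?P (?d - 1))" using M by auto
 have Nl: "md (N l)" using N by simp
 have ap: "adj M M 0 p <: Hom ?P M (- 1)" using adj_HOM[OF M M p] by simp
 note af = adj_HOM[OF M N f]
 have z: "wt M w j x <: ?P ?d" using w x M by (auto intro!: telt_in)
 have wc: "wt M u i y <: ?P l'" if "vw V u" "y <: M i" "dg u + i = l'" for u i y l' using that M by (auto intro!: telt_in)
 have blV: "vw V (u @ blB m # v)" if "vw V u" "vw V m" "vw V v" for u m v using that bm_closed by (simp add: susp_at)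
 have pc: "bc p v j x <: M (dg v + j - 1)" if "vw V v" for v by (rule HOM_in[OF cb_HOM[OF M M p that refl] x]) simp
 have fw: "adj M N n f l' (wt M u i y) = bc f u i y" if "vw V u" "y <: M i" "dg u + i = l'" for u i y l' by (rule adj_wt[OF M N f that])
 have fc: "bc f u i y <: N l" if "vw V u" "y <: M i" "dg u + i = ?d - 1" for u i y
  by (rule HOM_in[OF cb_HOM[OF M N f that(1) refl] that(2)]) (use that(3) l in simp)
 have "adj M N n f (?d - 1) (DB M p ?d (wt M w j x)) =
  adj M N n f (?d - 1) (tc.dP M ?d (wt M w j x)) +[N l] adj M N n f (?d - 1) (tc.Phi M M (-1) (adj M M 0 p) ?d (wt M w j x))"
  unfolding tc.phi_inv_apply[OF z refl]
  by (rule HOM_add_map[OF af]) (use l HOM_in[OF tc.dP_HOM[OF M] z] HOM_in[OF tc.Phi_HOM[OF M M ap] z] in auto)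
 also have "adj M N n f (?d - 1) (tc.dP M ?d (wt M w j x)) = sum3 (N l) (%u m v. sw u *[N l] bc f (u @ blB m # v) j x) w"
 proof -
  have "adj M N n f (?d - 1) (tc.dP M ?d (wt M w j x)) = sum3 (N l) (%u m v. adj M N n f (?d - 1) (sw u *[?P (?d - 1)] wt M (u @ blB m # v) j x)) w"
   unfolding tc.dP_wt[OF M w x refl refl] by (rule HOM_sum3[OF af P N w]) (use l in simp, rule m_smult[OF Pk sgn_in wc[OF blV x]], simp_all)
  also have "... = sum3 (N l) (%u m v. sw u *[N l] bc f (u @ blB m # v) j x) w"
  proof (rule vsum3_cong[OF Nl w])
   fix u m v assume uv: "vw V u" "vw V m" "vw V v" "w = u @ m @ v"
   have d: "dg (u @ blB m # v) + j = ?d - 1" using uv(4) by simp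
   note b = blV[OF uv(1-3)]
   show "adj M N n f (?d - 1) (sw u *[?P (?d - 1)] wt M (u @ blB m # v) j x) = sw u *[N l] bc f (u @ blB m # v) j x"
    unfolding fw[OF b x d, symmetric] by (rule HOM_smult_map[OF af _ sgn_in wc[OF b x d]]) (use l in simp)
   show "sw u *[N l] bc f (u @ blB m # v) j x <: N l" by (rule m_smult[OF Nl sgn_in fc[OF b x d]])
  qed
  finally show ?thesis .
 qed
 also have "adj M N n f (?d - 1) (tc.Phi M M (-1) (adj M M 0 p) ?d (wt M w j x)) = sum2 (N l) (%u v. sw u *[N l] bc f u (dg v + j - 1) (bc p v j x)) w"
 proof -
  let ?T = "%u v. sg (-1 * dg u) *[?P (?d - 1)] wt M u (dg v + j + -1) (adj M M 0 p (dg v + j) (wt M v j x))"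
  have e: "?T u v = sw u *[?P (?d - 1)] wt M u (dg v + j - 1) (bc p v j x)" if "vw V v" for u v using adj_wt[OF M M p that x refl] by simp
  have d: "dg u + (dg v + j - 1) = ?d - 1" if "w = u @ v" for u v using that by simp
  have "adj M N n f (?d - 1) (tc.Phi M M (-1) (adj M M 0 p) ?d (wt M w j x)) = sum2 (N l) (%u v. adj M N n f (?d - 1) (?T u v)) w"
  proof -
   have ph: "tc.Phi M M (-1) (adj M M 0 p) ?d (wt M w j x) = sum2 (?P (?d - 1)) ?T w" by (rule tc.Phi_wt[OF M M ap w x refl]) simp
   have Tc: "?T u v <: ?P (?d - 1)" if "vw V u" "vw V v" "w = u @ v" for u v
    unfolding e[OF that(2)] by (rule m_smult[OF Pk sgn_in wc[OF that(1) pc[OF that(2)] d[OF that(3)]]])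
   show ?thesis unfolding ph by (rule HOM_sum2[OF af P N w]) (use l in simp, rule Tc)
  qed
  also have "... = sum2 (N l) (%u v. sw u *[N l] bc f u (dg v + j - 1) (bc p v j x)) w"
  proof (rule vsum2_cong[OF Nl w])
   fix u v assume uv: "vw V u" "vw V v" "w = u @ v"
   note c = wc[OF uv(1) pc[OF uv(2)] d[OF uv(3)]]
   show "adj M N n f (?d - 1) (?T u v) = sw u *[N l] bc f u (dg v + j - 1) (bc p v j x)"
    unfolding e[OF uv(2)] fw[OF uv(1) pc[OF uv(2)] d[OF uv(3)], symmetric] by (rule HOM_smult_map[OF af _ sgn_in c]) (use l in simp)
   show "sw u *[N l] bc f u (dg v + j - 1) (bc p v j x) <: N l" by (rule m_smult[OF Nl sgn_in fc[OF uv(1) pc[OF uv(2)] d[OF uv(3)]]])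
  qed
  finally show ?thesis .
 qed
 finally show ?thesis .
qed

lemma adj_Phi:
 assumes M: "gm M" and N: "gm N" and P: "gm P" and q: "q \<in> CH N P n"
  and g: "g <: Hom (CT M) N 0"
  and w: "vw V w" and x: "x <: M j" and l: "l = dg w + j + (n - 1)"
 shows "adj N P n q (dg w + j) (tc.Phi M N 0 g (dg w + j) (wt M w j x)) =
  sum2 (P l) (%u v. bc q u (dg v + j) (g (dg v + j) (wt M v j x))) w"
proof -
 let ?d = "dg w + j"
 let ?T = "%u v. sg (0 * dg u) *[CT N ?d] wt N u (dg v + j + 0) (g (dg v + j) (wt M v j x))"
 have N': "gm (CT N)" and Nd: "md (CT N ?d)" using N by auto
 have gc: "g (dg v + j) (wt M v j x) <: N (dg v + j)" if "vw V v" for v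
  by (rule HOM_in[OF g]) (use that x M in \<open>auto intro!: telt_in\<close>)
 have c: "wt N u (dg v + j) (g (dg v + j) (wt M v j x)) <: CT N ?d" if "vw V u" "vw V v" "w = u @ v" for u v
  using that gc[OF that(2)] N by (auto intro!: telt_in)
 have e: "?T u v = wt N u (dg v + j) (g (dg v + j) (wt M v j x))" if "vw V u" "vw V v" "w = u @ v" for u v using c[OF that] Nd by simp
 have "tc.Phi M N 0 g ?d (wt M w j x) = sum2 (CT N ?d) ?T w" by (rule tc.Phi_wt[OF M N g w x refl]) simp
 note ph = this
 have Tc: "?T u v <: CT N ?d" if "vw V u" "vw V v" "w = u @ v" for u v unfolding e[OF that] by (rule c[OF that])
 have "adj N P n q ?d (tc.Phi M N 0 g ?d (wt M w j x)) = sum2 (P l) (%u v. adj N P n q ?d (?T u v)) w"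
  unfolding ph by (rule HOM_sum2[OF adj_HOM[OF N P q] N' P w]) (use l in simp, rule Tc)
 also have "... = sum2 (P l) (%u v. bc q u (dg v + j) (g (dg v + j) (wt M v j x))) w"
 proof (rule vsum2_cong[OF gmod_module[OF P] w])
  fix u v assume uv: "vw V u" "vw V v" "w = u @ v"
  show "adj N P n q ?d (?T u v) = bc q u (dg v + j) (g (dg v + j) (wt M v j x))"
   unfolding e[OF uv] by (rule adj_wt[OF N P q uv(1) gc[OF uv(2)]]) (use uv in simp)
  show "bc q u (dg v + j) (g (dg v + j) (wt M v j x)) <: P l"
   by (rule HOM_in[OF cb_HOM[OF N P q uv(1) refl] gc[OF uv(2)]]) (use uv l in simp)
 qed
 finally show ?thesis .
qed

text \<open>The identity of a representation is \<open>- 1\<close> and \<open>\<star>\<close> composes values with the sign \<open>-1\<close>, so the functor uses the negated adjoint.\<close>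

definition nadj :: "('k,'m) gmod \<Rightarrow> ('k,'n) gmod \<Rightarrow> ('k, 'a, ('m,'n) gmap) cochain \<Rightarrow> (('k, nat \<Rightarrow> ('k,'a) tpow, 'm) tens, 'n) gmap" where
 "nadj M N f = -[Hom (CT M) N 0] adj M N 1 f"

abbreviation "Fb M N f \<equiv> tc.Phi M N 0 (nadj M N f)"

lemma
 assumes M: "gm M" and N: "gm N" and f: "f \<in> CH M N 1"
 shows nadj_HOM: "nadj M N f <: Hom (CT M) N 0"
  and nadj_apply: "!!z d. z <: CT M d ==> nadj M N f d z = -[N d] adj M N 1 f d z"
  and nadj_wt: "!!w j x. vw V w ==> x <: M j ==> nadj M N f (dg w + j) (wt M w j x) = -[N (dg w + j)] bc f w j x"
proof -
 have T: "gm (CT M)" using M by simp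
 have af: "adj M N 1 f <: Hom (CT M) N 0" using adj_HOM[OF M N f] by simp
 show "nadj M N f <: Hom (CT M) N 0" unfolding nadj_def using af HOM_module[OF T N] by simp
 show *: "nadj M N f d z = -[N d] adj M N 1 f d z" if "z <: CT M d" for z d
  unfolding nadj_def by (rule HOM_neg_apply[OF T N that _ af]) simp
 show "nadj M N f (dg w + j) (wt M w j x) = -[N (dg w + j)] bc f w j x" if "vw V w" "x <: M j" for w j x
  using *[of "wt M w j x" "dg w + j"] adj_wt[OF M N f that refl] that M by (auto intro!: telt_in)
qed

text \<open>Each side of the commutation equation carries exactly one \<open>nadj\<close>, so its
  sign drops out and \<open>?X = ?Y + ?Z\<close>, evaluated at \<open>x\<close>, remains. By
  \<open>mor_word\<close> the cochain equation on a word in \<open>A\<close> is this relation at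
  \<open>bw w\<close>, and \<open>bw\<close> is the identity on words in
  \<open>ker \<epsilon>\<close>, so no word is lost.\<close>

lemma mor_iff:
 assumes M: "gm M" and N: "gm N" and p: "p \<in> CH M M 0" and q: "q \<in> CH N N 0"
 shows "f \<in> rmor (M,p) (N,q) \<longleftrightarrow> f \<in> CH M N 1 \<and>
  gcomp (CT M) 0 (DB N q) (Fb M N f) =
  gcomp (CT M) (-1) (Fb M N f) (DB M p)"
proof (cases "f \<in> CH M N 1")
 case f: True
 let ?H = "Hom M N"
 have H: "gm ?H" using M N by simp
 let ?X = "%w. sum2 (?H (dg w - 1)) (%u v. gcomp M (dg v) (bc q u) (bc f v)) w"
 let ?Y = "%w. sum3 (?H (dg w - 1)) (%u m v. sw u *[?H (dg w - 1)] bc f (u @ blB m # v)) w"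
 let ?Z = "%w. sum2 (?H (dg w - 1)) (%u v. sw u *[?H (dg w - 1)] gcomp M (dg v - 1) (bc f u) (bc p v)) w"
 let ?C = "morC M N p q f"
 have fc: "bc f v <: ?H l" if "vw V v" "dg v = l" for v l using cb_HOM[OF M N f that(1)] that by simp
 have pc: "bc p v <: Hom M M (dg v - 1)" if "vw V v" for v using cb_HOM[OF M M p that] by simp
 have qc: "bc q v <: Hom N N (dg v - 1)" if "vw V v" for v using cb_HOM[OF N N q that] by simp
 have gX: "gcomp M (dg v) (bc q u) (bc f v) <: ?H (dg w - 1)" if "vw V u" "vw V v" "w = u @ v" for u v w
  by (rule gcomp_HOM[OF M fc[OF that(2) refl] qc[OF that(1)]]) (use that in simp)
 have gZ: "gcomp M (dg v - 1) (bc f u) (bc p v) <: ?H (dg w - 1)" if "vw V u" "vw V v" "w = u @ v" for u v w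
  by (rule gcomp_HOM[OF M pc[OF that(2)] fc[OF that(1) refl]]) (use that in simp)
 have gY: "bc f (u @ blB m # v) <: ?H (dg w - 1)" if "vw V u" "vw V m" "vw V v" "w = u @ m @ v" for u m v w
  by (rule fc) (use that bm_closed[of m] in \<open>auto simp: susp_at\<close>)
 note m = m_smult[OF gmod_module[OF H] sgn_in]
 have XYZ: "?X w <: ?H (dg w - 1)" "?Y w <: ?H (dg w - 1)" "?Z w <: ?H (dg w - 1)" if "vw V w" for w
  by (rule vsum2_closed[OF gmod_module[OF H] that] vsum3_closed[OF gmod_module[OF H] that]; (rule m)?; rule gX gY gZ; assumption)+
 have zc: "cc_zero R A ?H 0 \<in> CCu R A ?H 0" by (rule cc_zero_CCu[OF A H])
 have cc: "?C \<in> CCu R A ?H 0"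
 proof -
  note F = cc_incl_CCu[OF H f]
  have F1: "cc_ge1 R A ?H 1 (cinc ?H 1 f) \<in> CCu R A ?H 1" using cc_ge1_CC[OF A H F] CC_iff[OF A H] by auto
  show ?thesis using cc_star_CCu[OF A M N N full_CCu[OF N q] F] cc_circ_CCu[OF A H F1 nu_CC] cc_star_CCu[OF A M M N F full_CCu[OF M p]]
   by (auto intro!: cc_add_CCu[OF A H] cc_minus_CCu[OF A H])
 qed
 have cat: "ac ?C w = ?X (bw w) -[?H (dg w - 1)] ?Y (bw w) -[?H (dg w - 1)] ?Z (bw w)" if "vA w" for w
  using mor_word[OF M N p q f that refl] by simp
 have "f \<in> rmor (M,p) (N,q) \<longleftrightarrow> ?C = cc_zero R A ?H 0" using f by (simp add: rep_mor_def Let_def)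
 also have "... \<longleftrightarrow> (\<forall>w. vA w --> ac ?C w = \<zero>[?H (dg w - 1)])"
 proof
  assume "?C = cc_zero R A ?H 0"
  then show "\<forall>w. vA w --> ac ?C w = \<zero>[?H (dg w - 1)]" using cc_at_zero[OF A H, of _ 0] by (simp add: susp_at)
 next
  assume "\<forall>w. vA w --> ac ?C w = \<zero>[?H (dg w - 1)]"
  then show "?C = cc_zero R A ?H 0" by (intro CCu_eqI[OF A H cc zc]) (simp add: cc_at_zero[OF A H] susp_at)
 qed
 also have "... \<longleftrightarrow> (\<forall>w. vw V w --> ?X w = ?Y w +[?H (dg w - 1)] ?Z w)"
 proof -
  have *: "ac ?C w = \<zero>[?H (dg w - 1)] \<longleftrightarrow> ?X (bw w) = ?Y (bw w) +[?H (dg (bw w) - 1)] ?Z (bw w)" if "vA w" for w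
   unfolding cat[OF that] using m_minus_minus_zero[OF gmod_module[OF H] XYZ[OF vw_bw[OF that]]] by simp
  show ?thesis
  proof (intro iffI allI impI)
   fix w assume "\<forall>w. vA w --> ac ?C w = \<zero>[?H (dg w - 1)]" and w: "vw V w"
   then show "?X w = ?Y w +[?H (dg w - 1)] ?Z w" using *[OF vw_V_A[OF w]] vw_V_A[OF w] bw_V[OF w] by simp
  next
   fix w assume h: "\<forall>w. vw V w --> ?X w = ?Y w +[?H (dg w - 1)] ?Z w" and w: "vA w"
   show "ac ?C w = \<zero>[?H (dg w - 1)]" unfolding *[OF w] using h vw_bw[OF w] by blast
  qed
 qed
 also have "... \<longleftrightarrow> (\<forall>w j x. vw V w --> x <: M j --> ?X w j x = ?Y w j x +[N (j + (dg w - 1))] ?Z w j x)"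
 proof -
  have "?X w = ?Y w +[?H (dg w - 1)] ?Z w \<longleftrightarrow> (\<forall>j x. x <: M j --> ?X w j x = ?Y w j x +[N (j + (dg w - 1))] ?Z w j x)" if w: "vw V w" for w
  proof
   assume e: "?X w = ?Y w +[?H (dg w - 1)] ?Z w"
   show "\<forall>j x. x <: M j --> ?X w j x = ?Y w j x +[N (j + (dg w - 1))] ?Z w j x" unfolding e by simp
  next
   assume "\<forall>j x. x <: M j --> ?X w j x = ?Y w j x +[N (j + (dg w - 1))] ?Z w j x"
   then show "?X w = ?Y w +[?H (dg w - 1)] ?Z w" by (intro HOM_eqI[OF XYZ(1)[OF w] m_add[OF gmod_module[OF H] XYZ(2,3)[OF w]]]) simp
  qed
  then show ?thesis by blast
 qed
 also have "... \<longleftrightarrow> (\<forall>w j x. vw V w --> x <: M j -->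
   adj N N 0 q (dg w + j) (Fb M N f (dg w + j) (wt M w j x)) =
   nadj M N f (dg w + j - 1) (DB M p (dg w + j) (wt M w j x)))"
 proof -
  have "?X w j x = ?Y w j x +[N (j + (dg w - 1))] ?Z w j x \<longleftrightarrow>
   adj N N 0 q (dg w + j) (Fb M N f (dg w + j) (wt M w j x)) =
   nadj M N f (dg w + j - 1) (DB M p (dg w + j) (wt M w j x))"
   if w: "vw V w" and x: "x <: M j" for w j x
  proof -
   let ?l = "dg w + j - 1"
   have l: "j + (dg w - 1) = ?l" by simp
   have Nl: "md (N ?l)" using N by simp
   have qf: "bc q u (dg v + j) (bc f v j x) <: N ?l" if "vw V u" "vw V v" "w = u @ v" for u v
    by (rule HOM_in[OF qc[OF that(1)] HOM_in[OF fc[OF that(2) refl] x]]) (use that in auto)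
   have X: "?X w j x = sum2 (N ?l) (%u v. bc q u (dg v + j) (bc f v j x)) w"
   proof -
    have "?X w j x = sum2 (N ?l) (%u v. gcomp M (dg v) (bc q u) (bc f v) j x) w" by (rule HOM_sum2_apply[OF M N x l w gX])
    then show ?thesis using x by (simp add: add.commute)
   qed
   have Y: "?Y w j x = sum3 (N ?l) (%u m v. sw u *[N ?l] bc f (u @ blB m # v) j x) w"
   proof -
    have "?Y w j x = sum3 (N ?l) (%u m v. (sw u *[?H (dg w - 1)] bc f (u @ blB m # v)) j x) w"
     by (rule HOM_sum3_apply[OF M N x l w]) (rule m, rule gY)
    then show ?thesis using x l by simp
   qed
   have Z: "?Z w j x = sum2 (N ?l) (%u v. sw u *[N ?l] bc f u (dg v + j - 1) (bc p v j x)) w"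
   proof -
    have e: "j + (dg v - 1) = dg v + j - 1" for v :: "(int \<times> 'a) list" by simp
    have "?Z w j x = sum2 (N ?l) (%u v. (sw u *[?H (dg w - 1)] gcomp M (dg v - 1) (bc f u) (bc p v)) j x) w"
     by (rule HOM_sum2_apply[OF M N x l w]) (rule m, rule gZ)
    then show ?thesis unfolding HOM_smult_apply[where M=M, OF x] gcomp_apply[where M=M, OF x] l e .
   qed
   have XYZc: "?X w j x <: N ?l" "?Y w j x <: N ?l" "?Z w j x <: N ?l"
    using HOM_in[OF XYZ(1)[OF w] x l] HOM_in[OF XYZ(2)[OF w] x l] HOM_in[OF XYZ(3)[OF w] x l] by auto
   have z: "wt M w j x <: CT M (dg w + j)" using w x M by (auto intro!: telt_in)
   have ap: "adj M M 0 p <: Hom (CT M) M (- 1)" using adj_HOM[OF M M p] by simp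
   have r: "nadj M N f ?l (DB M p (dg w + j) (wt M w j x)) = -[N ?l] (?Y w j x +[N ?l] ?Z w j x)"
    unfolding Y Z nadj_apply[OF M N f HOM_in[OF tc.phi_inv_HOM[OF M ap] z, of ?l, simplified]]
    by (rule arg_cong[where f="a_inv (N ?l)"], rule adj_D[OF M N p f w x]) simp
   have "adj N N 0 q (dg w + j) (Fb M N f (dg w + j) (wt M w j x)) =
    sum2 (N ?l) (%u v. bc q u (dg v + j) (nadj M N f (dg v + j) (wt M v j x))) w" by (rule adj_Phi[OF M N N q nadj_HOM[OF M N f] w x]) simp
   also have "... = sum2 (N ?l) (%u v. -[N ?l] bc q u (dg v + j) (bc f v j x)) w"
   proof (rule vsum2_cong[OF Nl w])
    fix u v assume uv: "vw V u" "vw V v" "w = u @ v"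
    have fv: "bc f v j x <: N (dg v + j)" by (rule HOM_in[OF fc[OF uv(2) refl] x]) simp
    show "bc q u (dg v + j) (nadj M N f (dg v + j) (wt M v j x)) = -[N ?l] bc q u (dg v + j) (bc f v j x)"
     unfolding nadj_wt[OF M N f uv(2) x] by (rule HOM_neg_map[OF N N qc[OF uv(1)] _ fv]) (use uv in simp)
    show "-[N ?l] bc q u (dg v + j) (bc f v j x) <: N ?l" using qf[OF uv] Nl by simp
   qed
   also have "... = -[N ?l] ?X w j x" unfolding X by (rule sum2_neg[OF Nl, symmetric]) (use w qf in auto)
   finally have "adj N N 0 q (dg w + j) (Fb M N f (dg w + j) (wt M w j x)) = -[N ?l] ?X w j x" .
   then show ?thesis unfolding r l using m_neg_eq[OF Nl XYZc(1) m_add[OF Nl XYZc(2,3)]] by simp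
  qed
  then show ?thesis by blast
 qed
 also have "... \<longleftrightarrow> gcomp (CT M) 0 (DB N q) (Fb M N f) =
  gcomp (CT M) (-1) (Fb M N f) (DB M p)"
  by (rule tc.commute_iff[symmetric, OF M N _ _ nadj_HOM[OF M N f]]) (use adj_HOM[OF M M p] adj_HOM[OF N N q] in simp_all)
 finally show ?thesis using f by simp
qed (simp add: rep_mor_def Let_def)

end

section \<open>The representation equation\<close>

lemma wdeg_blocks: "sum_list is = length w ==> wdeg (map (%u. (wdeg u, F u)) (blocks is w)) = wdeg w"
proof (induction "is" arbitrary: w)
 case (Cons i js)
 have "wdeg w = wdeg (take i w) + wdeg (drop i w)" by (metis append_take_drop_id wdeg_simps(3))
 then show ?case using Cons by simp
qed simp

lemma length_blocks [simp]: "length (blocks is w) = length is" by (induction "is" arbitrary: w) auto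

lemma vw_blocks: "vw V w ==> u \<in> set (blocks is w) ==> vw V u"
proof (induction "is" arbitrary: w)
 case (Cons i js)
 have "vw V (take i w) \<and> vw V (drop i w)" using Cons.prems(1) by (metis append_take_drop_id vw_simps(3))
 then show ?case using Cons by auto
qed simp

text \<open>Since the parts are positive, both their number and their size are bounded by
  \<open>n\<close>.\<close>

lemma finite_compositions: "finite {is. sum_list is = (n::nat) \<and> (\<forall>i\<in>set is. 1 \<le> i)}"
proof (rule finite_subset)
 have "length is \<le> sum_list is" if "\<forall>i\<in>set is. 1 \<le> i" for "is" :: "nat list" using that by (induction "is") auto
 moreover have "set is \<subseteq> {..sum_list is}" for "is" :: "nat list" using member_le_sum_list by auto
 ultimately show "{is. sum_list is = n \<and> (\<forall>i\<in>set is. 1 \<le> i)} \<subseteq> {is. set is \<subseteq> {..n} \<and> length is \<le> n}" by auto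
 show "finite {is. set is \<subseteq> {..n} \<and> length is \<le> n}" by (rule finite_lists_length_le) simp
qed

context ground begin

definition me :: "('k,'m) gmod \<Rightarrow> ('m,'m) gmap \<Rightarrow> (int \<times> ('m,'m) gmap) list \<Rightarrow> ('m,'m) gmap" where
 "me M \<delta> w = (let E = Hom M M in case w of
    [(i, \<phi>)] \<Rightarrow> let a = i - 1 in
     gcomp M a \<delta> \<phi> -[E (a - 1)] (sg a *[E (a - 1)] gcomp M (-1) \<phi> \<delta>)
   | [(i, \<phi>), (j, \<psi>)] \<Rightarrow> let a = i - 1; b = j - 1 in
     sg a *[E (a + b)] gcomp M b \<phi> \<psi>
   | _ \<Rightarrow> \<zero>[susp E (dg w - 1)])"

lemma me_simps:
 "me M \<delta> [(i, \<phi>)] = gcomp M (i - 1) \<delta> \<phi> -[Hom M M (i - 2)] (sg (i - 1) *[Hom M M (i - 2)] gcomp M (-1) \<phi> \<delta>)"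
 "me M \<delta> [(i, \<phi>), (j, \<psi>)] = sg (i - 1) *[Hom M M (i + j - 2)] gcomp M (j - 1) \<phi> \<psi>"
 by (simp_all add: me_def Let_def)

lemma me_other: "length w ~= 1 ==> length w ~= 2 ==> me M \<delta> w = \<zero>[Hom M M (dg w - 2)]"
 by (auto simp: me_def susp_at Let_def split: list.splits)

lemma mu_End_eq: "mu_End R M \<delta> = cc_of R (Hom M M) (Hom M M) (-1) (me M \<delta>)"
 unfolding mu_End_def Let_def by (rule arg_cong[where f="cc_of R (Hom M M) (Hom M M) (-1)"]) (rule ext, unfold me_def Let_def, rule refl)

lemma me_mlin: assumes M: "gm M" and d: "\<delta> <: Hom M M (-1)"
 shows "mlin R (susp (Hom M M)) (susp (Hom M M)) (-1) (me M \<delta>)"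
proof (rule mlinI)
 let ?E = "Hom M M"
 have E: "gm ?E" using M by simp
 show "me M \<delta> [] <: susp ?E (-1)" using E by (simp add: me_other susp_at)
 fix u i v k assume uv: "vw (susp ?E) u" "vw (susp ?E) v" "k = dg u + i + dg v + - 1"
 have Ek: "md (?E (k - 1))" using E by simp
 consider "u = []" "v = []" | "length (u @ v) = 1" | "length (u @ v) ~= 0" "length (u @ v) ~= 1" by fastforce
 then have "lin R (?E (i - 1)) (?E (k - 1)) (%x. me M \<delta> (u @ (i,x) # v))"
 proof cases
  case 1
  have k: "k - 1 = i - 2" using uv 1 by simp
  show ?thesis unfolding 1 append_Nil me_simps k
   by (rule lin_diff[OF _ gcomp_lin_r[OF M M M d] lin_scale[OF _ sgn_in gcomp_lin_l[OF M M M d]]]) (use E in auto)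
 next
  case 2
  then consider j y where "u = [(j,y)]" "v = []" | j y where "u = []" "v = [(j,y)]" by (cases u; cases v) auto
  then show ?thesis
  proof cases
   case 1
   have k: "j + i - 2 = k - 1" and y: "y <: ?E (j - 1)" using uv 1 by (auto simp: susp_at)
   show ?thesis unfolding 1 append_Cons append_Nil me_simps k by (rule lin_scale[OF Ek sgn_in gcomp_lin_r[OF M M M y]]) (use k in simp)
  next
   case 2
   have k: "i + j - 2 = k - 1" and y: "y <: ?E (j - 1)" using uv 2 by (auto simp: susp_at)
   show ?thesis unfolding 2 append_Nil me_simps k by (rule lin_scale[OF Ek sgn_in gcomp_lin_l[OF M M M y]]) (use k in simp)
  qed
 next
  case 3
  have l: "length (u @ (i,x) # v) ~= 1" "length (u @ (i,x) # v) ~= 2" for x using 3 by auto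
  have d: "dg (u @ (i,x) # v) - 2 = k - 1" for x using uv by simp
  show ?thesis unfolding me_other[OF l] d by (rule lin_const0[OF Ek])
 qed
 then show "lin R (susp ?E i) (susp ?E k) (%x. me M \<delta> (u @ (i,x) # v))" by (simp only: susp_at)
qed

text \<open>\<open>mu_End\<close> has arities 1 and 2 only. The binary part gives the cuts into two
  nonempty pieces. The unary part is the graded commutator with \<open>\<delta> = - P' []\<close>,
  which supplies exactly the two cuts with an empty piece. So the composite is, up to sign, the full
  sum over cuts for \<open>P'\<close>, with the component on the empty word included.\<close>

lemma star0_word:
 assumes A: "gm A" and M: "gm M" and P: "P \<in> CCu R A (Hom M M) 0"
  and P': "!!u. vw (susp A) u ==> P' u <: Hom M M (dg u - 1)"
  and PP': "!!u. vw (susp A) u ==> u ~= [] ==> cc_at R A P u = P' u" and d: "\<delta> = -[Hom M M (-1)] P' []"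
  and w: "vw (susp A) w" and ne: "w ~= []" and k: "k = dg w - 2"
 shows "finsum (Hom M M k) (%is. cc_at R (Hom M M) (mu_End R M \<delta>) (map (%u. (dg u, cc_at R A P u)) (blocks is w))) {is. sum_list is = length w \<and> (\<forall>i\<in>set is. 1 \<le> i)} =
  -[Hom M M k] sum2 (Hom M M k) (%u v. sw u *[Hom M M k] gcomp M (dg v - 1) (P' u) (P' v)) w"
proof -
 let ?E = "Hom M M"
 have E: "gm ?E" and Ek: "md (?E k)" using M by auto
 have P0: "P' [] <: ?E (-1)" using P'[of "[]"] by simp
 have dc: "\<delta> <: ?E (-1)" unfolding d using P0 E by simp
 have Pc: "cc_at R A P u <: ?E (dg u - 1)" if "vw (susp A) u" for u using cc_at_closed[OF A P that refl] by (simp add: susp_at)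
 let ?I = "{is. sum_list is = length w \<and> (\<forall>i\<in>set is. 1 \<le> i)}"
 let ?m = "%is. map (%u. (dg u, cc_at R A P u)) (blocks is w)"
 let ?g = "%is. cc_at R ?E (mu_End R M \<delta>) (?m is)"
 have vm: "vw (susp ?E) (?m is)" for "is" unfolding vw_def using vw_blocks[OF w] Pc by (auto simp: susp_at)
 have gm: "?g is = me M \<delta> (?m is)" for "is" unfolding mu_End_eq by (rule cc_at_of[OF E E me_mlin[OF M dc] vm])
 have gc: "?g is <: ?E k" if "is \<in> ?I" for "is"
 proof -
  have "me M \<delta> (?m is) <: susp ?E (dg w - 1)"
   by (rule mlin_closed[OF me_mlin[OF M dc] vm]) (use that in \<open>simp add: wdeg_blocks\<close>)
  then show ?thesis using k by (simp add: gm susp_at)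
 qed
 let ?J = "{is \<in> ?I. length is = 2}" and ?T = "{s \<in> S2 w. fst s ~= [] \<and> snd s ~= []}"
 let ?F = "%u v. sg (dg u - 1) *[?E k] gcomp M (dg v - 1) (P' u) (P' v)"
 have gF: "gcomp M (dg v - 1) (P' u) (P' v) <: ?E k" if "w = u @ v" for u v by (rule gcomp_HOM[OF M P' P']) (use that w k in auto)
 then have Fc: "?F u v <: ?E k" if "w = u @ v" for u v using that Ek by simp
 have nI: "[length w] \<in> ?I" using ne by (cases w) auto
 have fJ: "finite ?J" by (rule finite_subset[OF _ finite_compositions[of "length w"]]) blast
 \<comment> \<open>Compositions with three or more parts are killed by \<open>mu_End\<close>;
   \<open>[length w]\<close> is the composition with one part, \<open>?J\<close> holds those with
   two.\<close>
 have "finsum (?E k) ?g ?I = finsum (?E k) ?g (insert [length w] ?J)"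
 proof (rule fs_neutral[OF Ek finite_compositions])
  show "insert [length w] ?J \<subseteq> ?I" using nI by blast
  show "?g is = \<zero>[?E k]" if "is \<in> ?I - insert [length w] ?J" for "is"
  proof -
   have "length is ~= 1" using that by (auto simp: length_Suc_conv)
   moreover have "length is ~= 2" using that by auto
   ultimately show ?thesis using me_other[of "?m is" M \<delta>] that k by (simp add: gm wdeg_blocks)
  qed
 qed (use gc nI in blast)
 also have "... = ?g [length w] +[?E k] finsum (?E k) ?g ?J"
  proof (rule fs_insert[OF Ek fJ])
  show "[length w] \<notin> ?J" by simp
  show "?g is <: ?E k" if "is \<in> ?J" for "is" using gc that by blast
 qed (rule gc[OF nI])
 also have "finsum (?E k) ?g ?J = finsum (?E k) (%s. ?F (fst s) (snd s)) ?T"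
 proof (rule fs_bij[OF Ek, symmetric])
  show "bij_betw (%s. [length (fst s), length (snd s)]) ?T ?J"
  proof (rule bij_betwI[where g="%is. (take (hd is) w, drop (hd is) w)"])
   show "(%s. [length (fst s), length (snd s)]) \<in> ?T \<rightarrow> ?J" by (auto simp: Suc_le_eq)
   have J: "\<exists>i j. is = [i, j] \<and> length w = i + j \<and> 1 \<le> i \<and> 1 \<le> j" if "is \<in> ?J" for "is"
    using that by (auto simp: length_Suc_conv numeral_2_eq_2)
   show "(%is. (take (hd is) w, drop (hd is) w)) \<in> ?J \<rightarrow> ?T"
   proof
    fix "is" assume "is \<in> ?J"
    from J[OF this] show "(take (hd is) w, drop (hd is) w) \<in> ?T" by auto
   qed
   show "(%is. (take (hd is) w, drop (hd is) w)) ((%s. [length (fst s), length (snd s)]) s) = s" if "s \<in> ?T" for s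
    using that by (cases s) auto
   show "(%s. [length (fst s), length (snd s)]) ((%is. (take (hd is) w, drop (hd is) w)) is) = is" if "is \<in> ?J" for "is"
    using J[OF that] by auto
  qed
  show "?g is <: ?E k" if "is \<in> ?J" for "is" using gc that by blast
  fix s assume s: "s \<in> ?T"
  obtain u v where uv: "s = (u,v)" by (cases s)
  then have "w = u @ v" "u ~= []" "v ~= []" "vw (susp A) u" "vw (susp A) v" using s w by auto
  note w' = this
  have "?m [length u, length v] = [(dg u, P' u), (dg v, P' v)]" using w' by (simp add: PP')
  then have "?g [length u, length v] = me M \<delta> [(dg u, P' u), (dg v, P' v)]" using gm[of "[length u, length v]"] by (simp only:)
  then show "?F (fst s) (snd s) = ?g [length (fst s), length (snd s)]" using uv k w'(1) by (simp add: me_simps)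
 qed
 also have "?g [length w] = ?F [] w +[?E k] ?F w []"
 proof -
  let ?a = "gcomp M (dg w - 1) (P' []) (P' w)" and ?b = "gcomp M (-1) (P' w) (P' [])"
  have ab: "?a <: ?E k" "?b <: ?E k" using gF[of "[]" w] gF[of w "[]"] by auto
  have "gcomp M (dg w - 1) \<delta> (P' w) = -[?E k] ?a"
   unfolding d by (rule lin_neg[OF gmod_module[OF E] Ek gcomp_lin_l[OF M M M P'[OF w]] P0]) (use k in simp)
  moreover have "gcomp M (-1) (P' w) \<delta> = -[?E k] ?b"
   unfolding d by (rule lin_neg[OF gmod_module[OF E] Ek gcomp_lin_r[OF M M M P'[OF w]] P0]) (use k in simp)
  moreover have "?m [length w] = [(dg w, P' w)]" using PP'[OF w ne] by simp
  then have "?g [length w] = me M \<delta> [(dg w, P' w)]" using gm[of "[length w]"] by (simp only:)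
  ultimately show ?thesis using ab Ek k by (simp add: me_simps sgn_odd a_minus_def m_negs)
 qed
 also have "?F [] w +[?E k] ?F w [] +[?E k] finsum (?E k) (%s. ?F (fst s) (snd s)) ?T = sum2 (?E k) ?F w"
 proof -
  have fT: "finite ?T" by (rule finite_subset[OF _ finite_S2[of w]]) blast
  have c: "finsum (?E k) (%s. ?F (fst s) (snd s)) ?T <: ?E k" by (rule fs_closed[OF Ek]) (use Fc in auto)
  \<comment> \<open>The two boundary cuts are distinct because \<open>w\<close> is nonempty.\<close>
  have S: "S2 w = insert ([], w) (insert (w, []) ?T)" by auto
  have "sum2 (?E k) ?F w = finsum (?E k) (%s. ?F (fst s) (snd s)) (insert ([], w) (insert (w, []) ?T))"
   unfolding sum2_def S[symmetric] by (rule fs_cong[OF Ek refl]) (use Fc in auto)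
  also have "... = ?F [] w +[?E k] finsum (?E k) (%s. ?F (fst s) (snd s)) (insert (w, []) ?T)"
   by (subst fs_insert[OF Ek]) (use fT ne Fc[of "[]" w] Fc[of w "[]"] Fc in auto)
  also have "finsum (?E k) (%s. ?F (fst s) (snd s)) (insert (w, []) ?T) = ?F w [] +[?E k] finsum (?E k) (%s. ?F (fst s) (snd s)) ?T"
   by (subst fs_insert[OF Ek]) (use fT ne Fc[of w "[]"] Fc in auto)
  finally show ?thesis using m_assoc'[OF Ek Fc[of "[]" w] Fc[of w "[]"] c] by simp
 qed
 also have "sum2 (?E k) ?F w = -[?E k] sum2 (?E k) (%u v. sw u *[?E k] gcomp M (dg v - 1) (P' u) (P' v)) w"
 proof -
  have "-[?E k] sum2 (?E k) (%u v. sw u *[?E k] gcomp M (dg v - 1) (P' u) (P' v)) w =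
   sum2 (?E k) (%u v. -[?E k] (sw u *[?E k] gcomp M (dg v - 1) (P' u) (P' v))) w" by (rule sum2_neg[OF Ek]) (use gF Ek in auto)
  also have "... = sum2 (?E k) ?F w" by (rule sum2_cong[OF Ek], rule sgn_neg[OF Ek gF, symmetric]) (use Fc in auto)
  finally show ?thesis ..
 qed
 finally show ?thesis .
qed

end

context ainf begin

text \<open>Both sides can be nonzero only on two-letter words with both letters of degree 0 in
  \<open>A\<close>, where they are \<open>\<epsilon>(x) \<epsilon>(y)\<close> times the identity.
  This is the compatibility of \<open>g_su\<close> with \<open>mu_su\<close> and
  composition.\<close>

lemma kact_gs:
 assumes M: "gm M" and w: "vA w" and ne: "w ~= []"
 shows "kact (Hom M M) (ep (hd w)) (dg (tl w) - 1, gs M (tl w)) = kact (Hom M M) (dg w - 2, \<epsilon> (dg w - 2) (ms w)) (0, gid M)"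
proof (cases "length w = 2")
 case True
 then obtain p q where "w = [p, q]" by (auto simp: length_Suc_conv numeral_2_eq_2)
 moreover define i x j y where "i = fst p - 1" and "x = snd p" and "j = fst q - 1" and "y = snd q"
 ultimately have w': "w = [(i + 1, x), (j + 1, y)]" by simp
 have x: "x <: A i" and y: "y <: A j" using w w' by (auto simp: susp_at)
 have H: "gm (Hom M M)" using M by simp
 have d: "dg w - 2 = i + j" using w' by simp
 have e: "\<epsilon> (i + j) (ms w) = (if i = 0 \<and> j = 0 then \<epsilon> i x \<otimes>\<^bsub>R\<^esub> \<epsilon> j y else \<zero>[R])"
  unfolding w' by (rule ms_parts(2)[OF x y refl])
 show ?thesis unfolding d e using w' x y H gid_HOM[OF M] by (auto simp: gs_1 kact_def m_ss)
next
 case False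
 then have "length (tl w) ~= 1" using ne by (cases w) auto
 then have "gs M (tl w) = \<zero>[Hom M M (dg (tl w) - 1)]" by (rule gs_other)
 moreover have "\<epsilon> (dg w - 2) (ms w) = \<zero>[R]"
  using ms_other[OF False] lin_zero[OF gmod_module[OF A] gmod_module[OF kmod_module] eps_lin[of "dg w - 2"]] by (simp add: kmod_def)
 moreover have "dg w = fst (hd w) + dg (tl w)" "\<epsilon> (fst (hd w) - 1) (snd (hd w)) <: R" using w ne by (cases w; simp add: susp_at)+
 ultimately show ?thesis using M by (cases "fst (hd w) = 1") (auto simp: kact_def)
qed

text \<open>Besides the end letters a new term appears: on the one-letter word formed by the output
  of \<open>nu\<close> on all of \<open>w\<close>, the unit part \<open>gs\<close> sees the
  \<open>\<epsilon>\<close>-component of that output. This is \<open>hm (bw w)\<close> plus the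
  \<open>\<epsilon>\<close>-value of \<open>mu_su\<close>. The second summand cancels by
  \<open>kact_gs\<close>; the first one is the curvature.\<close>

lemma rep_word:
 assumes M: "gm M" and p: "p \<in> CH M M 0" and w: "vA w" and ne: "w ~= []" and k: "k = dg w - 2"
 shows "-[Hom M M k] sum2 (Hom M M k) (%u v. sw u *[Hom M M k]
    gcomp M (dg v - 1) (ac (fullp (M,p)) u) (ac (fullp (M,p)) v)) w =
   ac (cc_circ R A (Hom M M) 0 (-1) (rP M p) nu) w \<longleftrightarrow>
   sum3 (Hom M M k) (%u m v. sw u *[Hom M M k] bc p (u @ blB m # v)) (bw w) +[Hom M M k]
   sum2 (Hom M M k) (%u v. sw u *[Hom M M k] gcomp M (dg v - 1) (bc p u) (bc p v)) (bw w) =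
   kact (Hom M M) (dg (bw w) - 2, xi (bw w)) (0, gid M)"
proof -
 let ?E = "Hom M M" and ?f = "ac (fullp (M,p))"
 have E: "gm ?E" and Ek: "md (?E k)" and sE: "gm (susp ?E)" using M by auto
 have P: "rP M p \<in> CCu R A ?E 0" using rep_CC[OF M p] CC_iff[OF A E] by auto
 have fc: "?f v <: ?E (dg v - 1)" if "vA v" for v using cc_at_closed[OF A full_CCu[OF M p] that refl] by (simp add: susp_at)
 have pc: "bc p v <: ?E l" if "vw V v" "dg v - 1 = l" for v l using cb_HOM[OF M M p that(1)] that by simp
 have W: "susp ?E (dg w - 1) = ?E k" using k by (simp add: susp_at)
 let ?T = "sum3 (?E k) (%u m v. sw u *[?E k] bc p (u @ blB m # v)) (bw w)"
 let ?S = "sum2 (?E k) (%u v. sw u *[?E k] gcomp M (dg v - 1) (bc p u) (bc p v)) (bw w)"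
 have gS: "gcomp M (dg v - 1) (bc p u) (bc p v) <: ?E k" if "vw V u" "vw V v" "bw w = u @ v" for u v
  by (rule gcomp_HOM[OF M pc[OF that(2) refl] pc[OF that(1) refl]]) (use arg_cong[OF that(3), of dg] k in simp)
 have gT: "bc p (u @ blB m # v) <: ?E k" if "vw V u" "vw V m" "vw V v" "bw w = u @ m @ v" for u m v
 proof -
  have "dg w = dg (u @ m @ v)" unfolding that(4)[symmetric] by simp
  then show ?thesis by (intro pc) (use that(1-3) bm_closed[of m] k in \<open>auto simp: susp_at\<close>)
 qed
 have ST: "?S <: ?E k" "?T <: ?E k"
  by (rule vsum2_closed[OF Ek vw_bw[OF w]] vsum3_closed[OF Ek vw_bw[OF w]]; (rule m_smult[OF Ek sgn_in])?; rule gS gT; assumption)+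
 have hl: "vA (tl w)" "vA (butlast w)" "snd (hd w) <: A (fst (hd w) - 1)" "snd (last w) <: A (fst (last w) - 1)"
  "dg w = fst (hd w) + dg (tl w)" "dg w = dg (butlast w) + fst (last w)"
 proof -
  obtain a v where "w = a # v" using ne by (cases w) auto
  then show "vA (tl w)" "snd (hd w) <: A (fst (hd w) - 1)" "dg w = fst (hd w) + dg (tl w)" using w by (auto simp: susp_at)
  obtain b u where "w = u @ [b]" using ne by (cases w rule: rev_cases) auto
  then show "vA (butlast w)" "snd (last w) <: A (fst (last w) - 1)" "dg w = dg (butlast w) + fst (last w)" using w by (auto simp: susp_at)
 qed
 define K1 where "K1 = kact ?E (ep (hd w)) (dg (tl w) - 1, bc p (bw (tl w)))"
 define K2 where "K2 = kact ?E (ep (last w)) (dg (butlast w) - 1, bc p (bw (butlast w)))"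
 define gg where "gg = kact ?E (dg w - 2, \<epsilon> (dg w - 2) (ms w)) (0, gid M)"
 define xx where "xx = kact ?E (dg w - 2, hm (bw w)) (0, gid M)"
 have msc: "ms w <: A (dg w - 2)" by (rule ms_closed[OF w refl])
 have hc: "hm (bw w) <: kmod R (dg w - 2)" using hm_kmod[OF vw_bw[OF w]] by simp
 have hR: "hm (bw w) <: R" using hc by (auto simp: kmod_def split: if_splits)
 have K: "K1 <: ?E k" "K2 <: ?E k" "gg <: ?E k" "xx <: ?E k" unfolding K1_def K2_def gg_def xx_def
  by (rule kact_closed[OF E]; use hl k pc[OF vw_bw[OF hl(1)] refl] pc[OF vw_bw[OF hl(2)] refl] gid_HOM[OF M] msc hR in simp)+
 \<comment> \<open>\<open>fullp\<close> on the remaining letters has a \<open>p\<close> part and a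
   unit part. The latter is rewritten by \<open>kact_gs\<close> so that it can meet the same term
   coming from \<open>nu\<close>.\<close>
 have ge: "kact ?E (ep (hd w)) (dg (tl w) - 1, ?f (tl w)) = K1 +[?E k] gg"
 proof -
  have l: "lin R (?E (dg (tl w) - 1)) (?E k) (%y. kact ?E (ep (hd w)) (dg (tl w) - 1, y))" by (rule kact_lin2[OF E]) (use hl k in auto)
  show ?thesis
   unfolding full_at[OF M p hl(1) refl] lin_add[OF l pc[OF vw_bw[OF hl(1)], simplified, OF refl] gs_HOM[OF M hl(1) refl]] K1_def gg_def kact_gs[OF M w ne] ..
 qed
 have k': "k = dg w + 0 - 2" using k by simp
 have fc': "?f v <: ?E (dg v + 0 - 1)" if "vA v" for v using fc[OF that] by simp
 have pc': "bc p (bw v) <: ?E (dg v + 0 - 1)" if "vA v" for v by (rule pc[OF vw_bw[OF that]]) simp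
 let ?B = "sg (dg (butlast w)) *[?E k] K2"
 have Bc: "?B <: ?E k" using Ek K by simp
 \<comment> \<open>The unit part of the left factor is taken out while the right factor is still
   complete, and that of the right factor only afterwards. Hence the product \<open>gg\<close> of
   the two unit parts is counted once.\<close>
 have S: "sum2 (?E k) (%u v. sw u *[?E k] gcomp M (dg v - 1) (?f u) (?f v)) w = ?S +[?E k] ?B +[?E k] -[?E k] (K1 +[?E k] gg)"
 proof -
  have "sum2 (?E k) (%u v. sw u *[?E k] gcomp M (dg v + 0 - 1) (?f u) (?f v)) w =
   sum2 (?E k) (%u v. sw u *[?E k] gcomp M (dg v + 0 - 1) (bc p (bw u)) (?f v)) w +[?E k]
   sg (dg [hd w]) *[?E k] kact ?E (ep (hd w)) (dg (tl w) + 0 - 1, ?f (tl w))" by (rule full_left[OF M M p fc' sgn_in w ne k'])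
  moreover have "sum2 (?E k) (%u v. sw u *[?E k] gcomp M (dg v - 1) (bc p (bw u)) (?f v)) w =
   sum2 (?E k) (%u v. sw u *[?E k] gcomp M (dg v - 1) (bc p (bw u)) (bc p (bw v))) w +[?E k]
   sg (dg (butlast w)) *[?E k] kact ?E (ep (last w)) (dg (butlast w) + 0 - 1, bc p (bw (butlast w)))"
   by (rule full_right[OF M M p pc' sgn_in w ne k'])
  moreover have "sum2 (?E k) (%u v. sg (dg (bw u)) *[?E k] gcomp M (dg (bw v) - 1) (bc p (bw u)) (bc p (bw v))) w = ?S"
   by (rule sum2_bw[where F="%u v. sw u *[?E k] gcomp M (dg v - 1) (bc p u) (bc p v)", OF Ek w]) (rule m_smult[OF Ek sgn_in gS])
  moreover have "sg (dg [hd w]) *[?E k] kact ?E (ep (hd w)) (dg (tl w) - 1, ?f (tl w)) = -[?E k] (K1 +[?E k] gg)"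
  \<comment> \<open>\<open>\<epsilon>\<close> is concentrated in degree 0 of \<open>A\<close>, that
    is in suspended degree 1, where the sign is -1. For any other degree of the first letter the
    term is zero and the sign is immaterial.\<close>
  proof (cases "fst (hd w) = 1")
   case True
   have "K1 +[?E k] gg <: ?E k" using K Ek by simp
   then show ?thesis unfolding ge using True Ek by (simp add: sgn_odd)
  next
   case False
   then have "K1 +[?E k] gg = \<zero>[?E k]" unfolding ge[symmetric] using hl(5) k by (simp add: kact_def)
   then show ?thesis unfolding ge using Ek by simp
  qed
  ultimately show ?thesis by (simp add: K2_def)
 qed
 have C: "ac (cc_circ R A ?E 0 (-1) (rP M p) nu) w = ?T +[?E k] (K1 -[?E k] ?B) +[?E k] (xx +[?E k] gg)"
 proof -
  let ?n = "%u m v. u @ (dg m - 1, ac nu m) # v"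
  have vn: "vA (?n u m v)" "dg (?n u m v) - 1 = k" if "vA u" "vA m" "vA v" "w = u @ m @ v" for u m v
   using that nu_closed[OF that(2) refl] k by (auto simp: susp_at)
  note gn = gs_HOM[OF M vn(1) vn(2)]
  have "ac (cc_circ R A ?E 0 (-1) (rP M p) nu) w =
   sum3 (?E k) (%u m v. sg (-1 * dg u) *[?E k] ac (rP M p) (u @ (dg m + -1, ac nu m) # v)) w"
   unfolding W[symmetric] by (rule cc_at_circ[OF A E P nu_CC w]) simp
  also have "... = sum3 (?E k) (%u m v. sw u *[?E k] bc p (bw (?n u m v)) +[?E k] sw u *[?E k] gs M (?n u m v)) w"
  proof (rule vsum3_cong[OF Ek w])
   fix u m v assume uv: "vA u" "vA m" "vA v" "w = u @ m @ v"
   have c: "bc p (bw (?n u m v)) <: ?E k" "gs M (?n u m v) <: ?E k"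
    by (rule pc[OF vw_bw[OF vn(1)[OF uv]]], use vn(2)[OF uv] in simp, rule gn[OF uv uv])
   have "ac (rP M p) (?n u m v) = bc p (bw (?n u m v)) +[?E k] gs M (?n u m v)"
    using rep_at[OF M p vn(1)[OF uv]] full_at[OF M p vn[OF uv]] by simp
   then show "sg (-1 * dg u) *[?E k] ac (rP M p) (u @ (dg m + -1, ac nu m) # v) =
    sw u *[?E k] bc p (bw (?n u m v)) +[?E k] sw u *[?E k] gs M (?n u m v)" using m_sr[OF Ek sgn_in c] by simp
   show "sw u *[?E k] bc p (bw (?n u m v)) +[?E k] sw u *[?E k] gs M (?n u m v) <: ?E k" by (intro m_add[OF Ek] m_smult[OF Ek sgn_in] c)
  qed
  also have "... = sum3 (?E k) (%u m v. sw u *[?E k] bc p (bw (?n u m v))) w +[?E k] sum3 (?E k) (%u m v. sw u *[?E k] gs M (?n u m v)) w"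
  proof (rule sum3_add[OF Ek])
   fix u m v assume w': "w = u @ m @ v"
   then have uv: "vA u" "vA m" "vA v" "w = u @ m @ v" using w by auto
   show "sw u *[?E k] bc p (bw (?n u m v)) <: ?E k"
    by (rule m_smult[OF Ek sgn_in], rule pc[OF vw_bw[OF vn(1)[OF uv]]], use vn(2)[OF uv] in simp)
   show "sw u *[?E k] gs M (?n u m v) <: ?E k" by (rule m_smult[OF Ek sgn_in gn[OF uv uv]])
  qed
  also have "sum3 (?E k) (%u m v. sw u *[?E k] bc p (bw (?n u m v))) w = ?T +[?E k] (K1 -[?E k] ?B)"
   using circ_incl[OF sE cc_at_mlin[OF B p] w ne, of "dg w - 1"] by (simp add: W kact_susp K1_def K2_def)
  \<comment> \<open>\<open>gs\<close> can be nonzero only on one-letter words, so the block must be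
    all of \<open>w\<close>.\<close>
  also have "sum3 (?E k) (%u m v. sw u *[?E k] gs M (?n u m v)) w = gs M (?n [] w [])"
  proof -
   have c: "gs M (?n [] w []) <: ?E k" by (rule gn[of "[]" w "[]"]) (use w in auto)
   have "sum3 (?E k) (%u m v. sw u *[?E k] gs M (?n u m v)) w =
    finsum (?E k) (%s. sg (dg (fst s)) *[?E k] gs M (?n (fst s) (fst (snd s)) (snd (snd s)))) {([], w, [])}"
   proof (rule sum3_restrict[OF Ek])
    fix u m v assume uv: "w = u @ m @ v" "(u, m, v) \<notin> {([], w, [])}"
    then have l: "length (?n u m v) ~= 1" by auto
    have "dg (?n u m v) - 1 = k" using uv k by simp
    then show "sw u *[?E k] gs M (?n u m v) = \<zero>[?E k]" unfolding gs_other[OF l] using Ek by simp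
   qed (use c Ek in auto)
   then show ?thesis using c Ek by simp
  qed
  also have "gs M (?n [] w []) = xx +[?E k] gg"
  proof -
   have l: "lin R (kmod R (dg w - 2)) (?E k) (%r. kact ?E (dg w - 2, r) (0, gid M))" by (rule kact_lin1[OF E gid_HOM[OF M]]) (use k in simp)
   have "\<epsilon> (dg w - 2) (ac nu w) = hm (bw w) +[kmod R (dg w - 2)] \<epsilon> (dg w - 2) (ms w)"
    unfolding eps_nu[OF w refl] by (simp add: kmod_def)
   then show ?thesis using lin_add[OF l hc eps_kmod[OF msc]] by (simp add: gs_1 xx_def gg_def diff_diff_eq)
  qed
  finally show ?thesis .
 qed
 have xe: "kact ?E (dg (bw w) - 2, xi (bw w)) (0, gid M) = -[?E k] xx"
  unfolding xx_def wdeg_bw by (rule kact_neg[OF E hc gid_HOM[OF M]]) (use k in simp)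
 show ?thesis unfolding S C xe by (rule m_rep_alg[OF Ek ST Bc K(1,3,4)])
qed

text \<open>\<open>rep_word\<close> handles nonempty words. On the empty word the A-infinity
  morphism equation is vacuous, and the relation wanted there is precisely
  \<open>\<delta>^2 = 0\<close>, the separate clause of \<open>su_rep\<close>. All words together
  give the projected curvature equation of \<open>tc.curv_iff\<close>.\<close>

lemma rep_iff:
 assumes M: "gm M" and p: "p \<in> CH M M 0"
 shows "surep (M,p) \<longleftrightarrow>
  gcomp (CT M) (-1) (DB M p) (DB M p) = tc.Xc M"
proof -
 let ?E = "Hom M M" and ?f = "ac (fullp (M,p))"
 define \<delta> where "\<delta> = rep_diff R A \<epsilon> (M,p)"
 have E: "gm ?E" using M by simp
 have Ek: "md (?E k)" for k using E by simp
 have pc: "bc p v <: ?E l" if "vw V v" "dg v - 1 = l" for v l using cb_HOM[OF M M p that(1)] that by simp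
 have p0: "bc p [] <: ?E (-1)" by (rule pc) auto
 have d: "\<delta> = -[?E (-1)] bc p []" by (simp add: \<delta>_def rep_diff_def)
 have dc: "\<delta> <: ?E (-1)" unfolding d using p0 Ek by simp
 have f0: "?f [] = bc p []" using full_at[OF M p, of "[]" "-1"] p0 Ek by (simp add: gs_other)
 have fc: "?f v <: ?E (dg v - 1)" if "vA v" for v using cc_at_closed[OF A full_CCu[OF M p] that refl] by (simp add: susp_at)
 let ?T = "%w. sum3 (?E (dg w - 2)) (%u m v. sw u *[?E (dg w - 2)] bc p (u @ blB m # v)) w"
 let ?S = "%w. sum2 (?E (dg w - 2)) (%u v. sw u *[?E (dg w - 2)] gcomp M (dg v - 1) (bc p u) (bc p v)) w"
 let ?k = "%w. kact ?E (dg w - 2, xi w) (0, gid M)"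
 let ?RB = "%w. ?T w +[?E (dg w - 2)] ?S w = ?k w"
 let ?Q = "%w. -[?E (dg w - 2)] sum2 (?E (dg w - 2)) (%u v. sw u *[?E (dg w - 2)] gcomp M (dg v - 1) (?f u) (?f v)) w"
 have P: "rP M p \<in> CCu R A ?E 0" using rep_CC[OF M p] CC_iff[OF A E] by auto
 have circ: "cc_circ R A ?E 0 (-1) (rP M p) nu \<in> CCu R A ?E (-1)" using cc_circ_CCu[OF A E P nu_CC] by simp
 have gS: "gcomp M (dg v - 1) (bc p u) (bc p v) <: ?E (dg w - 2)" if "vw V u" "vw V v" "w = u @ v" for u v w
  by (rule gcomp_HOM[OF M pc[OF that(2) refl] pc[OF that(1) refl]]) (use that in simp)
 have gT: "bc p (u @ blB m # v) <: ?E (dg w - 2)" if "vw V u" "vw V m" "vw V v" "w = u @ m @ v" for u m v w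
  by (rule pc) (use that bm_closed[of m] in \<open>auto simp: susp_at\<close>)
 note sm = m_smult[OF Ek sgn_in]
 have ST: "?S w <: ?E (dg w - 2)" "?T w <: ?E (dg w - 2)" if "vw V w" for w
  by (rule vsum2_closed[OF Ek that] vsum3_closed[OF Ek that]; rule sm; rule gS gT; assumption)+
 \<comment> \<open>\<open>Q\<close> is what the composite with \<open>mu_End\<close> turns out to
   be: minus the star square of \<open>fullp\<close>, with its value on the empty word removed.
   Since \<open>Q\<close> is already a cochain, it supplies the multilinearity that is awkward to
   read off a sum over compositions.\<close>
 define Q where "Q = cc_minus R A ?E (-1) (cc_zero R A ?E (-1)) (cc_ge1 R A ?E (-1) (cc_star R A M M 0 0 (fullp (M,p)) (fullp (M,p))))"
 have st: "cc_star R A M M 0 0 (fullp (M,p)) (fullp (M,p)) \<in> CCu R A ?E (-1)"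
  using cc_star_CCu[OF A M M M full_CCu[OF M p] full_CCu[OF M p]] by simp
 have ge: "cc_ge1 R A ?E (-1) (cc_star R A M M 0 0 (fullp (M,p)) (fullp (M,p))) \<in> CCu R A ?E (-1)"
  using cc_ge1_CC[OF A E st] CC_iff[OF A E] by auto
 have Qc: "Q \<in> CCu R A ?E (-1)" unfolding Q_def by (rule cc_minus_CCu[OF A E cc_zero_CCu[OF A E] ge])
 have Qw: "ac Q w = (if w = [] then \<zero>[?E (dg w - 2)] else ?Q w)" if w: "vA w" for w
 proof -
  have s: "susp ?E (dg w - 1) = ?E (dg w - 2)" by (simp add: susp_at)
  have "ac Q w = \<zero>[?E (dg w - 2)] -[?E (dg w - 2)] (if w = [] then \<zero>[?E (dg w - 2)]
    else ac (cc_star R A M M 0 0 (fullp (M,p)) (fullp (M,p))) w)"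
   unfolding Q_def using cc_at_minus[OF A E cc_zero_CCu[OF A E] ge w, of "dg w - 1"] cc_at_zero[OF A E w, of "-1" "dg w - 1"] cc_at_ge1[OF A E st w, of "dg w - 1"]
   by (simp add: s) (simp add: susp_at)
  moreover have "ac (cc_star R A M M 0 0 (fullp (M,p)) (fullp (M,p))) w =
   sum2 (?E (dg w - 2)) (%u v. sw u *[?E (dg w - 2)] gcomp M (dg v - 1) (?f u) (?f v)) w"
   using cc_at_star[OF A M M M full_CCu[OF M p] full_CCu[OF M p] w, of "dg w - 2"] by simp
  moreover have "sum2 (?E (dg w - 2)) (%u v. sw u *[?E (dg w - 2)] gcomp M (dg v - 1) (?f u) (?f v)) w <: ?E (dg w - 2)"
   by (rule vsum2_closed[OF Ek w], rule sm, rule gcomp_HOM[OF M fc fc]) auto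
  ultimately show ?thesis using Ek by (simp add: a_minus_def)
 qed
 let ?\<phi> = "%w. \<Oplus>\<^bsub>susp ?E (dg w + - 1)\<^esub>is\<in>{is. sum_list is = length w \<and> (\<forall>i\<in>set is. 1 \<le> i)}.
    cc_at R ?E (mu_End R M \<delta>) (map (%u. (dg u, ac (rP M p) u)) (blocks is w))"
 have \<phi>: "?\<phi> w = ac Q w" if w: "vA w" for w
 proof (cases "w = []")
  case True
  have "cc_at R ?E (mu_End R M \<delta>) [] = \<zero>[?E (-2)]"
   unfolding mu_End_eq using cc_at_of[OF E E me_mlin[OF M dc], of "[]"] by (simp add: me_other)
  moreover have "sum_list is = 0 \<and> (\<forall>i\<in>set is. (1::nat) \<le> i) \<longleftrightarrow> is = []" for "is" by (cases "is") auto
  then have "{is. sum_list is = length w \<and> (\<forall>i\<in>set is. (1::nat) \<le> i)} = {[]}" using True by simp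
  ultimately show ?thesis using Qw[OF w] True fs_single[OF Ek, of "%is. cc_at R ?E (mu_End R M \<delta>) (map (%u. (dg u, ac (rP M p) u)) (blocks is w))" "[]" "-2"] Ek
   by (simp add: susp_at)
 next
  case False
  have s: "susp ?E (dg w + - 1) = ?E (dg w - 2)" by (simp add: susp_at)
  show ?thesis unfolding s Qw[OF w] if_not_P[OF False] by (rule star0_word[OF A M P fc rep_at[OF M p] _ w False refl]) (simp_all add: d f0)
 qed
 have s0: "cc_star0 R A ?E ?E (-1) (mu_End R M \<delta>) (rP M p) = cc_of R A ?E (-1) (ac Q)"
  unfolding cc_star0_def by (rule cc_of_cong[OF A E cc_at_mlin[OF A Qc] \<phi>])
 note m = cc_at_mlin[OF A Qc]
 have circ0: "ac (cc_circ R A ?E 0 (-1) (rP M p) nu) [] = \<zero>[?E (-2)]"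
  using cc_at_circ[OF A E P nu_CC, of "[]" "-1"] circ_Nil(2)[where k="-1" and n=0, OF _ cc_at_mlin[OF B p] cc_at_mlin[OF A P]] E by (simp add: susp_at)
 have "Ainf_morphism R A nu ?E (mu_End R M \<delta>) (rP M p) \<longleftrightarrow> cc_of R A ?E (-1) (ac Q) = cc_circ R A ?E 0 (-1) (rP M p) nu"
  unfolding Ainf_morphism_def s0 using rep_CC[OF M p] by simp
 also have "... \<longleftrightarrow> (\<forall>w. vA w --> w ~= [] --> ?Q w = ac (cc_circ R A ?E 0 (-1) (rP M p) nu) w)"
 proof (intro iffI allI impI)
  fix w assume e: "cc_of R A ?E (-1) (ac Q) = cc_circ R A ?E 0 (-1) (rP M p) nu" and w: "vA w" "w ~= []"
  show "?Q w = ac (cc_circ R A ?E 0 (-1) (rP M p) nu) w" unfolding e[symmetric] cc_at_of[OF A E m w(1)] Qw[OF w(1)] using w(2) by simp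
 next
  assume h: "\<forall>w. vA w --> w ~= [] --> ?Q w = ac (cc_circ R A ?E 0 (-1) (rP M p) nu) w"
  show "cc_of R A ?E (-1) (ac Q) = cc_circ R A ?E 0 (-1) (rP M p) nu"
  proof (rule CCu_eqI[OF A E cc_of_CCu[OF A E m] circ])
   fix w assume w: "vA w"
   show "ac (cc_of R A ?E (-1) (ac Q)) w = ac (cc_circ R A ?E 0 (-1) (rP M p) nu) w"
    unfolding cc_at_of[OF A E m w] Qw[OF w] using h w circ0 by simp
  qed
 qed
 also have "... \<longleftrightarrow> (\<forall>w. vw V w --> w ~= [] --> ?RB w)"
 proof -
  have bn: "bw w = [] \<longleftrightarrow> w = []" for w by (simp add: bw_map)
  have *: "?Q w = ac (cc_circ R A ?E 0 (-1) (rP M p) nu) w \<longleftrightarrow> ?RB (bw w)" if "vA w" "w ~= []" for w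
   using rep_word[OF M p that refl] unfolding wdeg_bw .
  show ?thesis
  proof (intro iffI allI impI)
   fix w assume h: "\<forall>w. vA w --> w ~= [] --> ?Q w = ac (cc_circ R A ?E 0 (-1) (rP M p) nu) w" and w: "vw V w" "w ~= []"
   have "?RB (bw w)" using *[OF vw_V_A[OF w(1)] w(2)] h vw_V_A[OF w(1)] w(2) by blast
   then show "?RB w" unfolding bw_V[OF w(1)] .
  next
   fix w assume h: "\<forall>w. vw V w --> w ~= [] --> ?RB w" and w: "vA w" "w ~= []"
   have "?RB (bw w)" using h vw_bw[OF w(1)] bn w(2) by blast
   then show "?Q w = ac (cc_circ R A ?E 0 (-1) (rP M p) nu) w" using *[OF w] by blast
  qed
 qed
 finally have am: "Ainf_morphism R A nu ?E (mu_End R M \<delta>) (rP M p) \<longleftrightarrow> (\<forall>w. vw V w --> w ~= [] --> ?RB w)" .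
 \<comment> \<open>The two minus signs of \<open>\<delta> = - p^0\<close> cancel. The insertions
   vanish on the empty word, and its curvature term sits in degree -2, where \<open>kact\<close> is
   zero.\<close>
 have dd: "gcomp M (-1) \<delta> \<delta> = \<zero>[?E (-2)] \<longleftrightarrow> ?RB []"
 proof -
  let ?pp = "gcomp M (-1) (bc p []) (bc p [])"
  have pp: "?pp <: ?E (-2)" using gS[of "[]" "[]" "[]"] by simp
  have "gcomp M (-1) \<delta> \<delta> = -[?E (-2)] gcomp M (-1) (bc p []) \<delta>"
   by (subst (1) d) (rule lin_neg[OF Ek Ek gcomp_lin_l[OF M M M dc] p0], simp)
  also have "gcomp M (-1) (bc p []) \<delta> = -[?E (-2)] ?pp" by (subst d) (rule lin_neg[OF Ek Ek gcomp_lin_r[OF M M M p0] p0], simp)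
  finally have 1: "gcomp M (-1) \<delta> \<delta> = ?pp" using pp Ek by simp
  have T0: "?T [] = \<zero>[?E (-2)]" using circ_Nil(1)[where k="-1" and n=0, OF _ cc_at_mlin[OF B p] cc_at_mlin[OF A P]] E by (simp add: susp_at)
  have "?S [] = ?pp" using pp Ek by simp
  moreover have "?k [] = \<zero>[?E (-2)]" by (simp add: kact_def)
  ultimately show ?thesis unfolding 1 using T0 pp Ek by simp
 qed
 have "surep (M,p) \<longleftrightarrow> gcomp M (-1) \<delta> \<delta> = \<zero>[?E (-2)] \<and> Ainf_morphism R A nu ?E (mu_End R M \<delta>) (rP M p)"
  unfolding su_rep_def Let_def prod.case \<delta>_def using M p by simp
 also have "... \<longleftrightarrow> (\<forall>w. vw V w --> ?RB w)" unfolding am dd using vw_simps(1)[of V] by blast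
 also have "... \<longleftrightarrow> (\<forall>w j x. vw V w --> x <: M j -->
   adj M M 0 p (dg w + j - 1) (DB M p (dg w + j) (wt M w j x)) = kact M (dg w - 2, xi w) (j,x))"
 proof -
  have "?RB w \<longleftrightarrow> (\<forall>j x. x <: M j -->
   adj M M 0 p (dg w + j - 1) (DB M p (dg w + j) (wt M w j x)) = kact M (dg w - 2, xi w) (j,x))" if w: "vw V w" for w
  proof -
   have xc: "xi w <: R" using mlin_closed[OF xi_mlin w refl] by (auto simp: kmod_def split: if_splits)
   have kc: "?k w <: ?E (dg w - 2)" by (rule kact_closed[OF E xc gid_HOM[OF M]]) simp
   have l: "(?T w +[?E (dg w - 2)] ?S w) j x =
    adj M M 0 p (dg w + j - 1) (DB M p (dg w + j) (wt M w j x))" if x: "x <: M j" for j x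
   proof -
    let ?l = "j + (dg w - 2)"
    have e: "j + (dg v - 1) = dg v + j - 1" for v :: "(int \<times> 'a) list" by simp
    have "?T w j x = sum3 (M ?l) (%u m v. (sw u *[?E (dg w - 2)] bc p (u @ blB m # v)) j x) w"
     by (rule HOM_sum3_apply[OF M M x refl w]) (rule sm, rule gT)
    moreover have "?S w j x = sum2 (M ?l) (%u v. (sw u *[?E (dg w - 2)] gcomp M (dg v - 1) (bc p u) (bc p v)) j x) w"
     by (rule HOM_sum2_apply[OF M M x refl w]) (rule sm, rule gS)
    ultimately show ?thesis unfolding HOM_add_apply[where M=M, OF x] HOM_smult_apply[where M=M, OF x] gcomp_apply[where M=M, OF x] e
     using adj_D[OF M M p p w x, of ?l] by simp
   qed
   have r: "?k w j x = kact M (dg w - 2, xi w) (j,x)" if x: "x <: M j" for j x by (simp add: HOM_kact_apply[where M=M, OF x, of 0 j] x)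
   show ?thesis
   proof
    assume h: "?RB w"
    show "\<forall>j x. x <: M j -->
     adj M M 0 p (dg w + j - 1) (DB M p (dg w + j) (wt M w j x)) = kact M (dg w - 2, xi w) (j,x)"
    proof (intro allI impI)
     fix j x assume x: "x <: M j"
     show "adj M M 0 p (dg w + j - 1) (DB M p (dg w + j) (wt M w j x)) = kact M (dg w - 2, xi w) (j,x)"
      unfolding l[OF x, symmetric] r[OF x, symmetric] h ..
    qed
   next
    assume h: "\<forall>j x. x <: M j -->
     adj M M 0 p (dg w + j - 1) (DB M p (dg w + j) (wt M w j x)) = kact M (dg w - 2, xi w) (j,x)"
    show "?RB w"
    proof (rule HOM_eqI[OF m_add[OF Ek ST(2,1)[OF w]] kc])
     fix j x assume x: "x <: M j"
     show "(?T w +[?E (dg w - 2)] ?S w) j x = ?k w j x" unfolding l[OF x] r[OF x] using h x by blast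
    qed
   qed
  qed
  then show ?thesis by blast
 qed
 also have "... \<longleftrightarrow> gcomp (CT M) (-1) (DB M p) (DB M p) = tc.Xc M"
  by (rule tc.curv_iff[symmetric, OF M _ refl]) (use adj_HOM[OF M M p] in simp)
 finally show ?thesis .
qed

end

text \<open>The category axioms of \<open>C\<close> are pulled back from \<open>D\<close>. For this
  the assignment \<open>Fa\<close> has to be injective and multiplicative on sets
  \<open>S X Y\<close> that may exceed the arrows, and an element of \<open>S X Y\<close> has to be
  an arrow exactly when its image is. Closure under composition, units and associativity then follow
  from those in \<open>D\<close>.\<close>

lemma transported_category:
 assumes D: "is_category D" and Fo: "!!X. X \<in> Ob C ==> Fo X \<in> Ob D"
  and S: "!!X Y f. [|X \<in> Ob C; Y \<in> Ob C|] ==> f \<in> Arr C X Y \<longleftrightarrow> f \<in> S X Y \<and> Fa X Y f \<in> Arr D (Fo X) (Fo Y)"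
  and inj: "!!X Y. [|X \<in> Ob C; Y \<in> Ob C|] ==> inj_on (Fa X Y) (S X Y)"
  and I: "!!X. X \<in> Ob C ==> Idt C X \<in> S X X \<and> Fa X X (Idt C X) = Idt D (Fo X)"
  and c: "!!X Y Z f g. [|X \<in> Ob C; Y \<in> Ob C; Z \<in> Ob C; f \<in> S X Y; g \<in> S Y Z|] ==>
    Cmp C X Y Z g f \<in> S X Z \<and> Fa X Z (Cmp C X Y Z g f) = Cmp D (Fo X) (Fo Y) (Fo Z) (Fa Y Z g) (Fa X Y f)"
 shows "is_functor C D Fo Fa"
proof -
 have Di: "!!X. X \<in> Ob D ==> Idt D X \<in> Arr D X X"
  and Dc: "!!X Y Z f g. [|X \<in> Ob D; Y \<in> Ob D; Z \<in> Ob D; f \<in> Arr D X Y; g \<in> Arr D Y Z|] ==> Cmp D X Y Z g f \<in> Arr D X Z"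
  and Du: "!!X Y f. [|X \<in> Ob D; Y \<in> Ob D; f \<in> Arr D X Y|] ==> Cmp D X X Y f (Idt D X) = f \<and> Cmp D X Y Y (Idt D Y) f = f"
  and Da: "!!W X Y Z f g h. [|W \<in> Ob D; X \<in> Ob D; Y \<in> Ob D; Z \<in> Ob D; f \<in> Arr D W X; g \<in> Arr D X Y; h \<in> Arr D Y Z|] ==>
    Cmp D W Y Z h (Cmp D W X Y g f) = Cmp D W X Z (Cmp D X Y Z h g) f" using D unfolding is_category_def by blast+
 have Cc: "Cmp C X Y Z g f \<in> Arr C X Z"
  if "X \<in> Ob C" "Y \<in> Ob C" "Z \<in> Ob C" "f \<in> Arr C X Y" "g \<in> Arr C Y Z" for X Y Z f g
  using that S c[of X Y Z f g] Dc[of "Fo X" "Fo Y" "Fo Z" "Fa X Y f" "Fa Y Z g"] Fo by simp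
 have Ci: "Idt C X \<in> Arr C X X" if "X \<in> Ob C" for X using that S I Di Fo by simp
 have eq: "f = g" if "X \<in> Ob C" "Y \<in> Ob C" "f \<in> Arr C X Y" "g \<in> Arr C X Y" "Fa X Y f = Fa X Y g" for X Y f g
  using inj_onD[OF inj[OF that(1,2)] that(5)] that S by blast
 have Fc: "Fa X Z (Cmp C X Y Z g f) = Cmp D (Fo X) (Fo Y) (Fo Z) (Fa Y Z g) (Fa X Y f)"
  if "X \<in> Ob C" "Y \<in> Ob C" "Z \<in> Ob C" "f \<in> Arr C X Y" "g \<in> Arr C Y Z" for X Y Z f g using that S c by blast
 have FA: "Fa X Y f \<in> Arr D (Fo X) (Fo Y)" if "X \<in> Ob C" "Y \<in> Ob C" "f \<in> Arr C X Y" for X Y f using that S by blast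
 have FI: "Fa X X (Idt C X) = Idt D (Fo X)" if "X \<in> Ob C" for X using I that by blast
 have Cu1: "Cmp C X X Y f (Idt C X) = f" if "X \<in> Ob C" "Y \<in> Ob C" "f \<in> Arr C X Y" for X Y f
  by (rule eq[of X Y]; use that Cc Ci Fc FI Du FA Fo in simp)
 have Cu2: "Cmp C X Y Y (Idt C Y) f = f" if "X \<in> Ob C" "Y \<in> Ob C" "f \<in> Arr C X Y" for X Y f
  by (rule eq[of X Y]; use that Cc Ci Fc FI Du FA Fo in simp)
 have Ca: "Cmp C W Y Z h (Cmp C W X Y g f) = Cmp C W X Z (Cmp C X Y Z h g) f"
  if "W \<in> Ob C" "X \<in> Ob C" "Y \<in> Ob C" "Z \<in> Ob C" "f \<in> Arr C W X" "g \<in> Arr C X Y" "h \<in> Arr C Y Z" for W X Y Z f g h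
  by (rule eq[of W Z]; use that Cc Fc Da FA Fo in simp)
 show ?thesis unfolding is_functor_def is_category_def[of C] using D Fo FA FI Fc Cc Ci Cu1 Cu2 Ca by (intro conjI ballI) simp_all
qed

section \<open>The category of curved dg-comodules and transport along isomorphisms\<close>

context ground begin

lemma gcomp_assoc:
 assumes "f <: Hom M N a"
 shows "gcomp M a (gcomp N b h g) f = gcomp M (a + b) h (gcomp M a g f)"
 unfolding gcomp_def by (intro ext) (use HOM_in[OF assms _ refl] in \<open>auto simp: restrict_def add.assoc\<close>)

lemma tens_map_gid:
 assumes M: "gm M" and N: "gm N"
 shows "tmap M N M N 0 0 (gid M) (gid N) = gid (tns M N)"
proof (rule tens_HOM_eqI[OF M N _ tmap_HOM[OF M N M N gid_HOM[OF M] gid_HOM[OF N]] gid_HOM])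
 fix i x j y assume xy: "x <: M i" "y <: N j"
 show "tmap M N M N 0 0 (gid M) (gid N) (i + j) (telt M N (i,x) (j,y)) = gid (tns M N) (i + j) (telt M N (i,x) (j,y))"
  using tmap_elt[OF M N M N gid_HOM[OF M] gid_HOM[OF N] xy refl refl] xy M N by simp
qed (use M N in auto)

lemma lunit_natural:
 assumes M: "gm M" and N: "gm N" and f: "f <: Hom M N 0" and z: "z <: tns (kmod R) M i"
 shows "f i (tens_lunit R M i z) = tens_lunit R N i (tmap (kmod R) M (kmod R) N 0 0 (gid (kmod R)) f i z)"
proof -
 note K = kmod_module
 have T: "gm (tns (kmod R) M)" using M by simp
 note t = tmap_HOM[OF K M K N gid_HOM[OF K] f, of 0, simplified]
 have "gcomp (tns (kmod R) M) 0 f (tens_lunit R M) = gcomp (tns (kmod R) M) 0 (tens_lunit R N) (tmap (kmod R) M (kmod R) N 0 0 (gid (kmod R)) f)"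
 proof (rule tens_HOM_eqI[OF K M N gcomp_HOM[OF T tens_lunit_HOM[OF M] f] gcomp_HOM[OF T t tens_lunit_HOM[OF N]]])
  fix i x j y assume xy: "x <: kmod R i" "y <: M j"
  have e: "tmap (kmod R) M (kmod R) N 0 0 (gid (kmod R)) f (i + j) (telt (kmod R) M (i,x) (j,y)) = telt (kmod R) N (i,x) (j, f j y)"
   using tmap_elt[OF K M K N gid_HOM[OF K] f xy refl refl] xy HOM_in[OF f xy(2)] N by simp
  have "f (i + j) (kact M (i,x) (j,y)) = kact N (i,x) (j, f j y)" by (rule HOM_kact[OF M N f kmodD[OF xy(1)] xy(2)]) auto
  then show "gcomp (tns (kmod R) M) 0 f (tens_lunit R M) (i + j) (telt (kmod R) M (i,x) (j,y)) =
   gcomp (tns (kmod R) M) 0 (tens_lunit R N) (tmap (kmod R) M (kmod R) N 0 0 (gid (kmod R)) f) (i + j) (telt (kmod R) M (i,x) (j,y))"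
   using xy M e tens_lunit_elt[OF M xy refl] tens_lunit_elt[OF N xy(1) HOM_in[OF f xy(2)], of j "i + j"] by simp
 qed auto
 then show ?thesis unfolding gcomp_eq_iff using z by auto
qed

end

context tcoalg begin

lemma comodule_mor_iff:
 "f \<in> comodule_mor R K (P, \<rho>) (Q, \<sigma>) \<longleftrightarrow> f <: Hom P Q 0 \<and>
  (\<forall>i. \<forall>z\<in>carrier (P i). cotens P Q 0 f i (\<rho> i z) = \<sigma> i (f i z))"
 unfolding comodule_mor_def Let_def prod.case K_mod mem_Collect_eq gcomp_eq_iff by auto

lemma graded_comoduleD:
 "graded_comodule R K (P, \<rho>) ==> gm P" "graded_comodule R K (P, \<rho>) ==> \<rho> <: Hom P (CT P) 0"
 unfolding graded_comodule_def Let_def prod.case K_mod by blast+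

lemma gid_mor:
 assumes "graded_comodule R K (P, \<rho>)" shows "gid P \<in> comodule_mor R K (P, \<rho>) (P, \<rho>)"
 using graded_comoduleD[OF assms] HOM_in[where M=P, OF graded_comoduleD(2)[OF assms]] by (auto simp: comodule_mor_iff tens_map_gid)

lemma comp_mor:
 assumes X: "graded_comodule R K (P, \<rho>)" and Y: "graded_comodule R K (Q, \<sigma>)" and Z: "graded_comodule R K (T, \<tau>)"
  and f: "f \<in> comodule_mor R K (P, \<rho>) (Q, \<sigma>)" and g: "g \<in> comodule_mor R K (Q, \<sigma>) (T, \<tau>)"
 shows "gcomp P 0 g f \<in> comodule_mor R K (P, \<rho>) (T, \<tau>)"
proof -
 note P = graded_comoduleD[OF X] and Q = graded_comoduleD[OF Y] and T = graded_comoduleD[OF Z]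
 have f': "f <: Hom P Q 0" and g': "g <: Hom Q T 0"
  and fe: "!!i z. z <: P i ==> cotens P Q 0 f i (\<rho> i z) = \<sigma> i (f i z)"
  and ge: "!!i z. z <: Q i ==> cotens Q T 0 g i (\<sigma> i z) = \<tau> i (g i z)" using f g by (auto simp: comodule_mor_iff)
 have h: "gcomp P 0 g f <: Hom P T 0" by (rule gcomp_HOM[OF P(1) f' g']) simp
 show ?thesis unfolding comodule_mor_iff
 proof (intro conjI h allI ballI)
  fix i z assume z: "z <: P i"
  have r: "\<rho> i z <: CT P i" by (rule HOM_in[OF P(2) z]) simp
  have "cotens Q T 0 g i (cotens P Q 0 f i (\<rho> i z)) = cotens P T 0 (gcomp P 0 g f) i (\<rho> i z)"
   using tmap_comp[OF C P(1) C Q(1) C T(1) gid_HOM[OF C] f' gid_HOM[OF C] g' r, of i i 0 0] gcomp_gid_left[OF C gid_HOM[OF C]]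
    HOM_in[OF tmap_HOM[OF C P(1) C T(1) gid_HOM[OF C] h, of 0] r] T(1) by simp
  then show "cotens P T 0 (gcomp P 0 g f) i (\<rho> i z) = \<tau> i (gcomp P 0 g f i z)" using fe[OF z] ge[OF HOM_in[OF f' z]] z by simp
 qed
qed

text \<open>The curvature equation constrains objects only; arrows are comodule morphisms with a
  commuting square, and such squares paste together.\<close>

lemma CDG_category: "is_category (CDGComod R K :: (('k, nat \<Rightarrow> ('k,'v) tpow, 'p) cdg_comod, _) precat)"
proof -
 have comm: "gcomp P 0 D' (gcomp P 0 g f) = gcomp P (-1) (gcomp P 0 g f) D"
  if f: "f <: Hom P Q 0" and g: "g <: Hom Q T 0" and D: "D <: Hom P P (-1)"
   and 1: "gcomp P 0 E f = gcomp P (-1) f D" and 2: "gcomp Q 0 D' g = gcomp Q (-1) g E" for P Q T :: "('k,'p) gmod" and f g D E D'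
 proof -
  have "gcomp P 0 D' (gcomp P 0 g f) = gcomp P 0 (gcomp Q 0 D' g) f" using gcomp_assoc[OF f, of 0 D' g] by simp
  also have "... = gcomp P (-1) g (gcomp P 0 E f)" unfolding 2 using gcomp_assoc[OF f, of "-1" g E] by simp
  also have "... = gcomp P (-1) (gcomp P 0 g f) D" unfolding 1
   unfolding gcomp_def by (intro ext) (use HOM_in[OF D _ refl] in \<open>auto simp: restrict_def\<close>)
  finally show ?thesis .
 qed
 have D: "graded_comodule R K (P, \<rho>)" "D <: Hom P P (-1)" if "cdg_comodule R K ((P, \<rho>), D)" for P :: "('k,'p) gmod" and \<rho> D
  using that unfolding cdg_comodule_def is_coderivation_def Let_def by auto
 have HOMf: "f <: Hom P Q 0" if "f \<in> comodule_mor R K (P, \<rho>) (Q, \<sigma>)" for P Q :: "('k,'p) gmod" and \<rho> \<sigma> f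
  using that by (simp add: comodule_mor_iff)
 show ?thesis unfolding is_category_def CDGComod_def precat.simps
 proof (intro conjI ballI; (elim CollectE)?)
  fix X :: "('k, nat \<Rightarrow> ('k,'v) tpow, 'p) cdg_comod" assume "cdg_comodule R K X"
  moreover obtain P \<rho> E where X: "X = ((P, \<rho>), E)" by (metis prod.exhaust)
  ultimately have d: "graded_comodule R K (P, \<rho>)" "E <: Hom P P (-1)" using D by auto
  have P: "gm P" by (rule graded_comoduleD[OF d(1)])
  have "gcomp P 0 E (gid P) = gcomp P (-1) (gid P) E" using gcomp_gid_left[OF P d(2)] gcomp_gid_right[OF P d(2)] by simp
  then show "gid (fst (fst X)) \<in> {f \<in> comodule_mor R K (fst X) (fst X). gcomp (fst (fst X)) 0 (snd X) f = gcomp (fst (fst X)) (-1) f (snd X)}"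
   unfolding X using gid_mor[OF d(1)] by simp
 next
  fix X Y Z :: "('k, nat \<Rightarrow> ('k,'v) tpow, 'p) cdg_comod" and f g
  assume o: "cdg_comodule R K X" "cdg_comodule R K Y" "cdg_comodule R K Z"
   and fg: "f \<in> comodule_mor R K (fst X) (fst Y) \<and> gcomp (fst (fst X)) 0 (snd Y) f = gcomp (fst (fst X)) (-1) f (snd X)"
    "g \<in> comodule_mor R K (fst Y) (fst Z) \<and> gcomp (fst (fst Y)) 0 (snd Z) g = gcomp (fst (fst Y)) (-1) g (snd Y)"
  obtain P \<rho> D1 Q \<sigma> D2 T \<tau> D3 where X: "X = ((P, \<rho>), D1)" "Y = ((Q, \<sigma>), D2)" "Z = ((T, \<tau>), D3)" by (metis prod.exhaust)
  show "gcomp (fst (fst X)) 0 g f \<in> {f \<in> comodule_mor R K (fst X) (fst Z). gcomp (fst (fst X)) 0 (snd Z) f = gcomp (fst (fst X)) (-1) f (snd X)}"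
   using o fg comp_mor[of P \<rho> Q \<sigma> T \<tau> f g] comm[of f P Q g T D1 D2 D3] D HOMf unfolding X by auto
 next
  fix X Y :: "('k, nat \<Rightarrow> ('k,'v) tpow, 'p) cdg_comod" and f
  assume o: "cdg_comodule R K X" "cdg_comodule R K Y"
   and f: "f \<in> comodule_mor R K (fst X) (fst Y) \<and> gcomp (fst (fst X)) 0 (snd Y) f = gcomp (fst (fst X)) (-1) f (snd X)"
  obtain P \<rho> D1 Q \<sigma> D2 where X: "X = ((P, \<rho>), D1)" "Y = ((Q, \<sigma>), D2)" by (metis prod.exhaust)
  have P: "gm P" using o D graded_comoduleD(1) unfolding X by blast
  have f': "f <: Hom P Q 0" using f HOMf unfolding X by auto
  show "gcomp (fst (fst X)) 0 f (gid (fst (fst X))) = f" "gcomp (fst (fst X)) 0 (gid (fst (fst Y))) f = f"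
   unfolding X using gcomp_gid_left[OF P f'] gcomp_gid_right[OF P f'] by auto
 next
  fix W X Y Z :: "('k, nat \<Rightarrow> ('k,'v) tpow, 'p) cdg_comod" and f g h
  assume f: "f \<in> comodule_mor R K (fst W) (fst X) \<and> gcomp (fst (fst W)) 0 (snd X) f = gcomp (fst (fst W)) (-1) f (snd W)"
  obtain P \<rho> D1 Q \<sigma> D2 where X: "W = ((P, \<rho>), D1)" "X = ((Q, \<sigma>), D2)" by (metis prod.exhaust)
  have f': "f <: Hom P Q 0" using f HOMf unfolding X by auto
  show "gcomp (fst (fst W)) 0 h (gcomp (fst (fst W)) 0 g f) = gcomp (fst (fst W)) 0 (gcomp (fst (fst X)) 0 h g) f"
   using gcomp_assoc[OF f', of 0 h g] unfolding X by simp
 qed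
qed

text \<open>\<open>D'\<close> is the conjugate of \<open>D\<close>. In the coderivation rule and in
  the curvature equation the terms for \<open>P\<close> are precomposed with \<open>g\<close> and
  followed by \<open>f\<close>; by \<open>tmap_comp\<close> these combine to \<open>f g = 1\<close>
  or to \<open>D'\<close>. The curvature equation uses in addition that the unit isomorphism is
  natural, see \<open>lunit_natural\<close>.\<close>

lemma transport_cdg:
 assumes X: "cdg_comodule R K ((P, \<rho>), D)" and Y: "graded_comodule R K (Q, \<sigma>)"
  and f: "f \<in> comodule_mor R K (P, \<rho>) (Q, \<sigma>)" and g: "g \<in> comodule_mor R K (Q, \<sigma>) (P, \<rho>)"
  and gf: "gcomp P 0 g f = gid P" and fg: "gcomp Q 0 f g = gid Q"
 defines "D' \<equiv> gcomp Q (-1) f (gcomp Q 0 D g)"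
 shows "cdg_comodule R K ((Q, \<sigma>), D')" "gcomp P 0 D' f = gcomp P (-1) f D" "gcomp Q 0 D g = gcomp Q (-1) g D'"
proof -
 have X': "graded_comodule R K (P, \<rho>)" and D: "D <: Hom P P (-1)"
  using X unfolding cdg_comodule_def is_coderivation_def Let_def by auto
 note P = graded_comoduleD[OF X'] and Q = graded_comoduleD[OF Y]
 have CP: "gm (CT P)" and CQ: "gm (CT Q)" using P Q by auto
 have f': "f <: Hom P Q 0" and g': "g <: Hom Q P 0"
  and fe: "!!i z. z <: P i ==> cotens P Q 0 f i (\<rho> i z) = \<sigma> i (f i z)"
  and ge: "!!i z. z <: Q i ==> cotens Q P 0 g i (\<sigma> i z) = \<rho> i (g i z)" using f g by (auto simp: comodule_mor_iff)
 have fgz: "f i (g i z) = z" if "z <: Q i" for i z using fun_cong[OF fun_cong[OF fg, of i], of z] that by simp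
 have gfz: "g i (f i z) = z" if "z <: P i" for i z using fun_cong[OF fun_cong[OF gf, of i], of z] that by simp
 have fc: "f i z <: Q i" if "z <: P i" for i z by (rule HOM_in[OF f' that]) simp
 have gc: "g i z <: P i" if "z <: Q i" for i z by (rule HOM_in[OF g' that]) simp
 have Dc: "D i z <: P (i - 1)" if "z <: P i" for i z by (rule HOM_in[OF D that]) simp
 have sc: "\<sigma> i z <: CT Q i" if "z <: Q i" for i z by (rule HOM_in[OF Q(2) that]) simp
 have D': "D' <: Hom Q Q (-1)" unfolding D'_def by (rule gcomp_HOM[OF Q(1) gcomp_HOM[OF Q(1) g' D] f']) auto
 have D'z: "D' i z = f (i - 1) (D i (g i z))" if "z <: Q i" for i z using that by (simp add: D'_def)
 show "gcomp P 0 D' f = gcomp P (-1) f D" unfolding gcomp_eq_iff using D'z fc gfz by simp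
 show "gcomp Q 0 D g = gcomp Q (-1) g D'" unfolding gcomp_eq_iff using D'z gc gfz Dc by simp
 note hd = K_diff and hx = K_curv
 note tf = tmap_HOM[OF C P(1) C Q(1) gid_HOM[OF C] f', of 0, simplified]
  and tg = tmap_HOM[OF C Q(1) C P(1) gid_HOM[OF C] g', of 0, simplified]
  and dP = tmap_HOM[OF C P(1) C P(1) hd gid_HOM[OF P(1)], of "-1", simplified]
  and DP = tmap_HOM[OF C P(1) C P(1) gid_HOM[OF C] D, of "-1", simplified]
  and dQ = tmap_HOM[OF C Q(1) C Q(1) hd gid_HOM[OF Q(1)], of "-1", simplified]
  and DQ = tmap_HOM[OF C Q(1) C Q(1) gid_HOM[OF C] D', of "-1", simplified]
  and dg = tmap_HOM[OF C Q(1) C P(1) hd g', of "-1", simplified]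
 have Pco: "\<rho> (i - 1) (D i z) = tmap C P C P (-1) 0 dC (gid P) i (\<rho> i z) +[CT P (i - 1)] cotens P P (-1) D i (\<rho> i z)"
  and Pcu: "D (i - 1) (D i z) = tens_lunit R P (i - 2) (tmap C P (kmod R) P (-2) 0 (coalg_curv K) (gid P) i (\<rho> i z))"
  if z: "z <: P i" for i z
 proof -
  have r: "\<rho> i z <: CT P i" by (rule HOM_in[OF P(2) z]) simp
  have "(tmap C P C P (-1) 0 dC (gid P) +[Hom (CT P) (CT P) (-1)] cotens P P (-1) D) i (\<rho> i z) = \<rho> (i - 1) (D i z)"
   "D (i - 1) (D i z) = tens_lunit R P (i - 2) (tmap C P (kmod R) P (-2) 0 (coalg_curv K) (gid P) i (\<rho> i z))"
   using X z unfolding cdg_comodule_def is_coderivation_def Let_def prod.case K_mod gcomp_eq_iff by auto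
  then show "\<rho> (i - 1) (D i z) = tmap C P C P (-1) 0 dC (gid P) i (\<rho> i z) +[CT P (i - 1)] cotens P P (-1) D i (\<rho> i z)"
   "D (i - 1) (D i z) = tens_lunit R P (i - 2) (tmap C P (kmod R) P (-2) 0 (coalg_curv K) (gid P) i (\<rho> i z))"
   by (simp_all add: HOM_add_apply[where M="CT P", OF r])
 qed
 have gg: "gcomp C 0 (gid C) (gid C) = gid C" "gcomp C (-1) (gid C) dC = dC" "gcomp C 0 dC (gid C) = dC"
  using gcomp_gid_left[OF C gid_HOM[OF C]] gcomp_gid_left[OF C hd] gcomp_gid_right[OF C hd] by auto
 have Qco: "\<sigma> (i - 1) (D' i z) = tmap C Q C Q (-1) 0 dC (gid Q) i (\<sigma> i z) +[CT Q (i - 1)] cotens Q Q (-1) D' i (\<sigma> i z)"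
  if z: "z <: Q i" for i z
 proof -
  let ?s = "\<sigma> i z" and ?r = "\<rho> i (g i z)"
  have r: "?r = cotens Q P 0 g i ?s" using ge[OF z] by simp
  have rc: "?r <: CT P i" by (rule HOM_in[OF P(2) gc[OF z]]) simp
  have "\<sigma> (i - 1) (D' i z) = cotens P Q 0 f (i - 1) (\<rho> (i - 1) (D i (g i z)))" unfolding D'z[OF z] fe[OF Dc[OF gc[OF z]]] ..
  also have "... = cotens P Q 0 f (i - 1) (tmap C P C P (-1) 0 dC (gid P) i ?r) +[CT Q (i - 1)]
   cotens P Q 0 f (i - 1) (cotens P P (-1) D i ?r)"
   unfolding Pco[OF gc[OF z]] by (rule HOM_add_map[OF tf _ HOM_in[OF dP rc] HOM_in[OF DP rc]]) auto
  also have "tmap C P C P (-1) 0 dC (gid P) i ?r = tmap C Q C P (-1) 0 dC g i ?s"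
   unfolding r using tmap_comp[OF C Q(1) C P(1) C P(1) gid_HOM[OF C] g' hd gid_HOM[OF P(1)] sc[OF z], of i "i - 1" "-1" 0] gg
    gcomp_gid_left[OF Q(1) g'] HOM_in[OF dg sc[OF z], of "i - 1"] CP by simp
  also have "cotens P Q 0 f (i - 1) (tmap C Q C P (-1) 0 dC g i ?s) = tmap C Q C Q (-1) 0 dC (gid Q) i ?s"
   using tmap_comp[OF C Q(1) C P(1) C Q(1) hd g' gid_HOM[OF C] f' sc[OF z], of "i - 1" "i - 1" "-1" 0] gg fg
    HOM_in[OF dQ sc[OF z], of "i - 1"] CQ by simp
  also have "cotens P P (-1) D i ?r = cotens Q P (-1) (gcomp Q 0 D g) i ?s"
   unfolding r using tmap_comp[OF C Q(1) C P(1) C P(1) gid_HOM[OF C] g' gid_HOM[OF C] D sc[OF z], of i "i - 1" 0 "-1"] gg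
    HOM_in[OF tmap_HOM[OF C Q(1) C P(1) gid_HOM[OF C] gcomp_HOM[OF Q(1) g' D, of "-1"], of "-1"] sc[OF z], of "i - 1"] CP by simp
  also have "cotens P Q 0 f (i - 1) (cotens Q P (-1) (gcomp Q 0 D g) i ?s) = cotens Q Q (-1) D' i ?s"
   using tmap_comp[OF C Q(1) C P(1) C Q(1) gid_HOM[OF C] gcomp_HOM[OF Q(1) g' D, of "-1"] gid_HOM[OF C] f' sc[OF z], of "i - 1" "i - 1" 0 "-1"] gg
    HOM_in[OF DQ sc[OF z], of "i - 1"] CQ by (simp add: D'_def)
  finally show ?thesis .
 qed
 have Qcu: "D' (i - 1) (D' i z) = tens_lunit R Q (i - 2) (tmap C Q (kmod R) Q (-2) 0 (coalg_curv K) (gid Q) i (\<sigma> i z))"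
  if z: "z <: Q i" for i z
 proof -
  let ?s = "\<sigma> i z"
  note tx = tmap_HOM[OF C P(1) kmod_module P(1) hx gid_HOM[OF P(1)], of "-2", simplified]
   and txg = tmap_HOM[OF C Q(1) kmod_module P(1) hx g', of "-2", simplified]
   and txQ = tmap_HOM[OF C Q(1) kmod_module Q(1) hx gid_HOM[OF Q(1)], of "-2", simplified]
  have Kz: "gm (tns (kmod R) P)" "gm (tns (kmod R) Q)" using P Q by auto
  have "D' (i - 1) (D' i z) = f (i - 2) (D (i - 1) (D i (g i z)))"
   using D'z[OF z] D'z[OF fc[OF Dc[OF gc[OF z]]]] gfz[OF Dc[OF gc[OF z]]] by (simp add: diff_diff_eq)
  also have "D (i - 1) (D i (g i z)) = tens_lunit R P (i - 2) (tmap C P (kmod R) P (-2) 0 (coalg_curv K) (gid P) i (cotens Q P 0 g i ?s))"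
   unfolding Pcu[OF gc[OF z]] ge[OF z] ..
  also have "tmap C P (kmod R) P (-2) 0 (coalg_curv K) (gid P) i (cotens Q P 0 g i ?s) = tmap C Q (kmod R) P (-2) 0 (coalg_curv K) g i ?s"
   using tmap_comp[OF C Q(1) C P(1) kmod_module P(1) gid_HOM[OF C] g' hx gid_HOM[OF P(1)] sc[OF z], of i "i - 2" "-2" 0]
    gcomp_gid_right[OF C hx] gcomp_gid_left[OF Q(1) g'] HOM_in[OF txg sc[OF z], of "i - 2"] Kz by simp
  also have "f (i - 2) (tens_lunit R P (i - 2) (tmap C Q (kmod R) P (-2) 0 (coalg_curv K) g i ?s)) =
   tens_lunit R Q (i - 2) (tmap (kmod R) P (kmod R) Q 0 0 (gid (kmod R)) f (i - 2) (tmap C Q (kmod R) P (-2) 0 (coalg_curv K) g i ?s))"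
   by (rule lunit_natural[OF P(1) Q(1) f' HOM_in[OF txg sc[OF z]]]) simp
  also have "tmap (kmod R) P (kmod R) Q 0 0 (gid (kmod R)) f (i - 2) (tmap C Q (kmod R) P (-2) 0 (coalg_curv K) g i ?s) =
   tmap C Q (kmod R) Q (-2) 0 (coalg_curv K) (gid Q) i ?s"
   using tmap_comp[OF C Q(1) kmod_module P(1) kmod_module Q(1) hx g' gid_HOM[OF kmod_module] f' sc[OF z], of "i - 2" "i - 2" "-2" 0]
    gcomp_gid_left[OF C hx] fg HOM_in[OF txQ sc[OF z], of "i - 2"] Kz by simp
  finally show ?thesis .
 qed
 show "cdg_comodule R K ((Q, \<sigma>), D')" unfolding cdg_comodule_def is_coderivation_def Let_def prod.case K_mod gcomp_eq_iff
  using Y D' Qco Qcu sc by auto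
qed

end

section \<open>The functor and its image\<close>

context ainf begin

abbreviation "Fa X Y f \<equiv> tc.Phi (fst X) (fst Y) 0 (nadj (fst X) (fst Y) f)"

lemma bar_obj_eq: "bobj (M,p) = (cofree_comod R KB M, DB M p)" by (simp add: bar_obj_def Let_def)

lemma su_repD:
 assumes "surep (M,p)" shows "gm M" "p \<in> CH M M 0" using assms unfolding su_rep_def Let_def by auto

text \<open>The comodule axioms hold for any cofree comodule and \<open>phi_inv\<close> always
  yields a coderivation, so the curvature equation is the only condition left, and
  \<open>rep_iff\<close> identifies it.\<close>

lemma bar_obj_cdg:
 assumes M: "gm M" and p: "p \<in> CH M M 0"
 shows "cdg_comodule R KB (bobj (M,p)) \<longleftrightarrow> surep (M,p)"
proof -
 have a: "adj M M 0 p <: Hom (CT M) M (-1)" using adj_HOM[OF M M p] by simp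
 note g = tc.cofree_graded_comodule[OF M] and c = tc.coder_phi_inv[OF M a]
 show ?thesis unfolding rep_iff[OF M p] bar_obj_eq tc.cofree_eq cdg_comodule_def prod.case Let_def tc.K_mod tc.Xc_def
  using g c unfolding tc.cofree_eq by blast
qed

lemma nadj_inj:
 assumes M: "gm M" and N: "gm N" and f: "f \<in> CH M N 1" and f': "f' \<in> CH M N 1"
  and eq: "Fb M N f = tc.Phi M N 0 (nadj M N f')"
 shows "f = f'"
proof -
 have T: "gm (CT M)" using M by simp
 have "nadj M N f = nadj M N f'"
  by (rule trans[OF tc.ppi_Phi[OF M N nadj_HOM[OF M N f], unfolded eq, symmetric] tc.ppi_Phi[OF M N nadj_HOM[OF M N f']]])
 moreover have "adj M N 1 f <: Hom (CT M) N 0" "adj M N 1 f' <: Hom (CT M) N 0" using adj_HOM[OF M N f] adj_HOM[OF M N f'] by auto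
 ultimately have "adj M N 1 f = adj M N 1 f'" unfolding nadj_def using m_neg_eq[OF HOM_module[OF T N]] by blast
 then show ?thesis by (rule adj_inj[OF M N f f'])
qed

lemma nadj_surj:
 assumes M: "gm M" and N: "gm N" and m: "m <: Hom (CT M) N 0"
 shows "\<exists>f\<in>CH M N 1. nadj M N f = m"
proof -
 have T: "md (Hom (CT M) N 0)" using M N by (intro HOM_module) simp_all
 have "\<exists>q\<in>CH M N 1. adj M N 1 q = -[Hom (CT M) N 0] m" by (rule adj_surj[OF M N m_neg[OF T m]]) simp
 then obtain q where q: "q \<in> CH M N 1" "adj M N 1 q = -[Hom (CT M) N 0] m" ..
 have "nadj M N q = m" unfolding nadj_def q(2) using T m by simp
 then show ?thesis using q(1) ..
qed

text \<open>On values, \<star> of two cochains of degree 1 is composition with the sign -1. So the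
  negated adjoint of the star product is \<open>-(- g f)\<close>, while the two negated adjoints
  compose to \<open>(- g) (- f)\<close>. Both sides being comodule morphisms,
  \<open>tc.mor_eq\<close> lifts this equality of projections.\<close>

lemma Fa_comp:
 assumes M: "gm M" and N: "gm N" and P: "gm P" and f: "f \<in> CH M N 1" and g: "g \<in> CH N P 1"
 shows "cc_star R B M P 1 1 g f \<in> CH M P 1"
  and "tc.Phi M P 0 (nadj M P (cc_star R B M P 1 1 g f)) = gcomp (CT M) 0 (Fb N P g) (Fb M N f)"
proof -
 show s: "cc_star R B M P 1 1 g f \<in> CH M P 1" using cc_star_CCu[OF B M N P g f] by simp
 note nf = nadj_HOM[OF M N f] and ng = nadj_HOM[OF N P g] and ns = nadj_HOM[OF M P s]
 have T: "gm (CT M)" using M by simp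
 note pf = tc.Phi_HOM[OF M N nf] and pg = tc.Phi_HOM[OF N P ng]
 have c: "gcomp (CT M) 0 (nadj N P g) (Fb M N f) <: Hom (CT M) P 0" by (rule gcomp_HOM[OF T pf ng]) simp
 have e: "nadj M P (cc_star R B M P 1 1 g f) = gcomp (CT M) 0 (nadj N P g) (Fb M N f)"
 proof (rule tc.CM_HOM_eqI[OF M P ns c])
  fix w j x assume w: "vw V w" and x: "x <: M j"
  let ?d = "dg w + j"
  have Pd: "md (P ?d)" using P by simp
  have z: "wt M w j x <: CT M ?d" using w x M by (auto intro!: telt_in)
  have fc: "bc f v j x <: N (dg v + j)" if "vw V v" for v by (rule HOM_in[OF cb_HOM[OF M N f that refl] x]) simp
  have gfc: "bc g u (dg v + j) (bc f v j x) <: P ?d" if "vw V u" "vw V v" "w = u @ v" for u v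
   by (rule HOM_in[OF cb_HOM[OF N P g that(1) refl] fc[OF that(2)]]) (use that in simp)
  have gh: "gcomp M (dg v + 1 - 1) (bc g u) (bc f v) <: Hom M P (dg w)" if "vw V u" "vw V v" "w = u @ v" for u v
   by (rule gcomp_HOM[OF M cb_HOM[OF M N f that(2) refl] cb_HOM[OF N P g that(1) refl]]) (use that in simp)
  have "bc (cc_star R B M P 1 1 g f) w j x =
   sum2 (Hom M P (dg w)) (%u v. sg (1 * dg u + dg u + 1) *[Hom M P (dg w)] gcomp M (dg v + 1 - 1) (bc g u) (bc f v)) w j x"
   by (subst cc_at_star[OF B M N P g f w, of "dg w"]) simp_all
  also have "... = sum2 (P ?d) (%u v. (sg (1 * dg u + dg u + 1) *[Hom M P (dg w)] gcomp M (dg v + 1 - 1) (bc g u) (bc f v)) j x) w"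
   by (rule HOM_sum2_apply[OF M P x _ w]) (simp, rule m_smult[OF HOM_module[OF M P] sgn_in gh])
  also have "... = sum2 (P ?d) (%u v. -[P ?d] bc g u (dg v + j) (bc f v j x)) w"
  proof (rule vsum2_cong[OF Pd w])
   fix u v assume uv: "vw V u" "vw V v" "w = u @ v"
   have d: "j + dg w = ?d" "j + (dg v + 1 - 1) = dg v + j" by auto
   show "(sg (1 * dg u + dg u + 1) *[Hom M P (dg w)] gcomp M (dg v + 1 - 1) (bc g u) (bc f v)) j x = -[P ?d] bc g u (dg v + j) (bc f v j x)"
    unfolding HOM_smult_apply[where M=M, OF x] gcomp_apply[where M=M, OF x] d by (rule sgn_odd[OF Pd gfc[OF uv]]) simp
   show "-[P ?d] bc g u (dg v + j) (bc f v j x) <: P ?d" using gfc[OF uv] Pd by simp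
  qed
  finally have 1: "bc (cc_star R B M P 1 1 g f) w j x = sum2 (P ?d) (%u v. -[P ?d] bc g u (dg v + j) (bc f v j x)) w" .
  have "adj N P 1 g ?d (Fb M N f ?d (wt M w j x)) = sum2 (P ?d) (%u v. bc g u (dg v + j) (nadj M N f (dg v + j) (wt M v j x))) w"
   by (rule adj_Phi[OF M N P g nf w x]) simp
  also have "... = sum2 (P ?d) (%u v. -[P ?d] bc g u (dg v + j) (bc f v j x)) w"
  proof (rule vsum2_cong[OF Pd w])
   fix u v assume uv: "vw V u" "vw V v" "w = u @ v"
   show "bc g u (dg v + j) (nadj M N f (dg v + j) (wt M v j x)) = -[P ?d] bc g u (dg v + j) (bc f v j x)"
    unfolding nadj_wt[OF M N f uv(2) x] by (rule HOM_neg_map[OF N P cb_HOM[OF N P g uv(1) refl] _ fc[OF uv(2)]]) (use uv in simp)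
   show "-[P ?d] bc g u (dg v + j) (bc f v j x) <: P ?d" using gfc[OF uv] Pd by simp
  qed
  finally have 2: "adj N P 1 g ?d (Fb M N f ?d (wt M w j x)) = bc (cc_star R B M P 1 1 g f) w j x" unfolding 1 .
  show "nadj M P (cc_star R B M P 1 1 g f) ?d (wt M w j x) = gcomp (CT M) 0 (nadj N P g) (Fb M N f) ?d (wt M w j x)"
   unfolding nadj_wt[OF M P s w x] gcomp_apply[where M="CT M", OF z] add_0_right
    nadj_apply[OF N P g HOM_in[OF pf z add_0_right]] 2 ..
 qed
 note X = tc.cofree_graded_comodule[OF M, unfolded tc.cofree_eq] and Y = tc.cofree_graded_comodule[OF N, unfolded tc.cofree_eq]
  and Z = tc.cofree_graded_comodule[OF P, unfolded tc.cofree_eq]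
 have cm: "gcomp (CT M) 0 (Fb N P g) (Fb M N f) \<in> comodule_mor R KB (cofree_comod R KB M) (cofree_comod R KB P)"
  using tc.comp_mor[OF X Y Z] tc.Phi_mor[OF M N nf] tc.Phi_mor[OF N P ng] unfolding tc.cofree_eq by blast
 show "tc.Phi M P 0 (nadj M P (cc_star R B M P 1 1 g f)) = gcomp (CT M) 0 (Fb N P g) (Fb M N f)"
  unfolding e using tc.mor_eq[OF M P cm] gcomp_assoc[OF pf, of 0 "tc.ppi P" "Fb N P g"] tc.ppi_Phi[OF N P ng] by simp
qed

text \<open>The identity cochain is \<open>-1\<close> on the empty word and zero elsewhere, so its
  negated adjoint is the projection \<open>tc.ppi\<close>, whose cofree extension is the
  identity.\<close>

lemma Fa_id:
 assumes M: "gm M"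
 shows "rep_id R A \<epsilon> (M,p) \<in> CH M M 1"
  and "tc.Phi M M 0 (nadj M M (rep_id R A \<epsilon> (M,p))) = gid (CT M)"
proof -
 let ?E = "Hom M M"
 let ?\<phi> = "%w. if w = [] then -[?E 0] gid M else \<zero>[susp ?E (dg w + 1)]"
 have E: "gm ?E" and sV: "gm V" using M by auto
 have g: "gid M <: ?E 0" using gid_HOM[OF M] .
 have ml: "mlin R V (susp ?E) 1 ?\<phi>"
 proof (rule mlinI)
  show "?\<phi> [] <: susp ?E 1" using g E by (simp add: susp_at)
  fix u i v k assume uv: "vw V u" "vw V v" "k = dg u + i + dg v + 1"
  have "dg (u @ (i,x) # v) + 1 = k" for x using uv by simp
  then show "lin R (V i) (susp ?E k) (%x. ?\<phi> (u @ (i,x) # v))" using lin_const0[of "susp ?E k"] E by simp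
 qed
 have r: "rep_id R A \<epsilon> (M,p) = cc_of R B ?E 1 ?\<phi>" by (simp add: rep_id_def Let_def)
 show f: "rep_id R A \<epsilon> (M,p) \<in> CCu R B ?E 1" unfolding r by (rule cc_of_CCu[OF B E ml])
 have "nadj M M (rep_id R A \<epsilon> (M,p)) = tc.ppi M"
 proof (rule tc.CM_HOM_eqI[OF M M nadj_HOM[OF M M f] tc.ppi_HOM[OF M]])
  fix w j x assume w: "vw V w" and x: "x <: M j"
  have z: "bc (rep_id R A \<epsilon> (M,p)) w = ?\<phi> w" unfolding r by (rule cc_at_of[OF B E ml w])
  have "bc (rep_id R A \<epsilon> (M,p)) w j x = (if w = [] then -[M (dg w + j)] x else \<zero>[M (dg w + j)])"
   unfolding z using x HOM_neg_apply[OF M M x, of 0 j "gid M"] g by (auto simp: susp_at add.commute)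
  then show "nadj M M (rep_id R A \<epsilon> (M,p)) (dg w + j) (wt M w j x) = tc.ppi M (dg w + j) (wt M w j x)"
   unfolding nadj_wt[OF M M f w x] tc.ppi_wt[OF M w x refl] using M x by auto
 qed
 then show "tc.Phi M M 0 (nadj M M (rep_id R A \<epsilon> (M,p))) = gid (CT M)" using tc.Phi_ppi[OF M] by simp
qed

text \<open>A cofree extension \<open>Phi\<close> in degree 0 is always a comodule morphism, so
  being an arrow is just the commutation found in \<open>mor_iff\<close>.\<close>

lemma mor_iff_Arr:
 assumes X: "surep X" and Y: "surep Y"
 shows "f \<in> rmor X Y \<longleftrightarrow> f \<in> CCu R B (Hom (fst X) (fst Y)) 1 \<and>
  Fa X Y f \<in> Arr (CDGComod R KB) (bobj X) (bobj Y)"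
proof -
 obtain M p N q where XY: "X = (M,p)" "Y = (N,q)" by (cases X; cases Y)
 have M: "gm M" and p: "p \<in> CH M M 0" and N: "gm N" and q: "q \<in> CH N N 0" using su_repD X Y unfolding XY by auto
 have f: "f \<in> CH M N 1 ==> Fb M N f \<in> comodule_mor R KB (cofree_comod R KB M) (cofree_comod R KB N)"
  by (rule tc.Phi_mor[OF M N nadj_HOM[OF M N]])
 have t: "fst (cofree_comod R KB M) = CT M" by (simp add: tc.cofree_eq)
 show ?thesis unfolding XY mor_iff[OF M N p q] bar_obj_eq CDGComod_def using f by (auto simp: t)
qed

lemma Arr_surj:
 assumes X: "surep X" and Y: "surep Y" and g: "g \<in> Arr (CDGComod R KB) (bobj X) (bobj Y)"
 shows "\<exists>f\<in>rmor X Y. Fa X Y f = g"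
proof -
 obtain M p N q where XY: "X = (M,p)" "Y = (N,q)" by (cases X; cases Y)
 have M: "gm M" and N: "gm N" using su_repD X Y unfolding XY by auto
 have gm: "g \<in> comodule_mor R KB (cofree_comod R KB M) (cofree_comod R KB N)" using g unfolding XY bar_obj_eq CDGComod_def by simp
 have T: "gm (CT M)" using M by simp
 have "gcomp (CT M) 0 (tc.ppi N) g <: Hom (CT M) N 0" by (rule gcomp_HOM[OF T _ tc.ppi_HOM[OF N]]) (use gm tc.comod_mor_iff[OF M N] in auto)
 from nadj_surj[OF M N this] obtain f where f: "f \<in> CH M N 1" "nadj M N f = gcomp (CT M) 0 (tc.ppi N) g" by blast
 have e: "Fa X Y f = g" unfolding XY fst_conv f(2) by (rule tc.mor_eq[OF M N gm, symmetric])
 then have "f \<in> rmor X Y" unfolding mor_iff_Arr[OF X Y] using f(1) g unfolding XY by simp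
 then show ?thesis using e by blast
qed

text \<open>For \<open>S X Y\<close> all cochains of degree 1 are taken: \<open>Fa\<close> is
  injective and multiplicative on them already, and \<open>mor_iff_Arr\<close> says which of them
  are arrows.\<close>

lemma bar_functor: "is_functor (SU :: (('k, 'a, 'm) rep, _) precat) (CDGComod R KB) (bobj) Fa"
proof (rule transported_category[where S="%X Y. CCu R B (Hom (fst X) (fst Y)) 1", OF tc.CDG_category])
 note d = SURep_def CDGComod_def precat.simps mem_Collect_eq
 fix X :: "('k, 'a, 'm) rep" assume X: "X \<in> Ob (SU)"
 obtain M p where Xe: "X = (M,p)" by (cases X)
 have X': "surep (M,p)" using X unfolding d Xe .
 note M = su_repD[OF X']
 show "bobj X \<in> Ob (CDGComod R KB)" unfolding d Xe bar_obj_cdg[OF M] by (rule X')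
 show "Idt (SU) X \<in> CCu R B (Hom (fst X) (fst X)) 1 \<and> Fa X X (Idt (SU) X) = Idt (CDGComod R KB) (bobj X)"
  unfolding d Xe fst_conv bar_obj_eq using Fa_id[OF M(1), of p] by (simp add: tc.cofree_eq)
 fix Y :: "('k, 'a, 'm) rep" assume Y: "Y \<in> Ob (SU)"
 obtain N q where Ye: "Y = (N,q)" by (cases Y)
 have Y': "surep (N,q)" using Y unfolding d Ye .
 note N = su_repD[OF Y']
 show "f \<in> Arr (SU) X Y \<longleftrightarrow> f \<in> CCu R B (Hom (fst X) (fst Y)) 1 \<and> Fa X Y f \<in> Arr (CDGComod R KB) (bobj X) (bobj Y)" for f
  using mor_iff_Arr[of X Y f] X' Y' unfolding Xe Ye SURep_def by simp
 show "inj_on (Fa X Y) (CCu R B (Hom (fst X) (fst Y)) 1)" unfolding Xe Ye fst_conv by (rule inj_onI) (rule nadj_inj[OF M(1) N(1)])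
 fix Z :: "('k, 'a, 'm) rep" and f g assume Z: "Z \<in> Ob (SU)" and fg: "f \<in> CCu R B (Hom (fst X) (fst Y)) 1" "g \<in> CCu R B (Hom (fst Y) (fst Z)) 1"
 obtain P r where Ze: "Z = (P,r)" by (cases Z)
 have Z': "surep (P,r)" using Z unfolding d Ze .
 show "Cmp (SU) X Y Z g f \<in> CCu R B (Hom (fst X) (fst Z)) 1 \<and> Fa X Z (Cmp (SU) X Y Z g f) =
   Cmp (CDGComod R KB) (bobj X) (bobj Y) (bobj Z) (Fa Y Z g) (Fa X Y f)"
  unfolding d Xe Ye Ze fst_conv bar_obj_eq using Fa_comp[OF M(1) N(1) su_repD(1)[OF Z']] fg by (simp add: Xe Ye Ze tc.cofree_eq)
qed

lemma bar_fully_faithful: "fully_faithful (SU :: (('k, 'a, 'm) rep, _) precat) (CDGComod R KB) (bobj) Fa" unfolding fully_faithful_def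
proof (intro ballI)
 fix X Y :: "('k, 'a, 'm) rep" assume "X \<in> Ob (SU)" "Y \<in> Ob (SU)"
 then have X: "surep X" and Y: "surep Y" by (simp_all add: SURep_def)
 have M: "gm (fst X)" "gm (fst Y)" using su_repD(1)[of "fst X" "snd X"] su_repD(1)[of "fst Y" "snd Y"] X Y by auto
 have A: "Arr (SU) X Y = rmor X Y" by (simp add: SURep_def)
 show "bij_betw (Fa X Y) (Arr (SU) X Y) (Arr (CDGComod R KB) (bobj X) (bobj Y))" unfolding A bij_betw_def
 proof (intro conjI inj_onI equalityI subsetI)
  fix f g assume fg: "f \<in> rmor X Y" "g \<in> rmor X Y" "Fa X Y f = Fa X Y g"
  show "f = g" by (rule nadj_inj[OF M _ _ fg(3)]) (use fg(1,2) mor_iff_Arr[OF X Y] in auto)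
 next
  fix g assume "g \<in> Fa X Y ` rmor X Y"
  then show "g \<in> Arr (CDGComod R KB) (bobj X) (bobj Y)" using mor_iff_Arr[OF X Y] by auto
 next
  fix g assume "g \<in> Arr (CDGComod R KB) (bobj X) (bobj Y)"
  from Arr_surj[OF X Y this] show "g \<in> Fa X Y ` rmor X Y" by auto
 qed
qed

text \<open>The substantial inclusion combines two facts: a coderivation of a cofree comodule is
  \<open>phi_inv\<close> of its projection (\<open>tc.coder_eq\<close>), and each such projection is
  the adjoint of a cochain (\<open>adj_surj\<close>). The representation axioms are then recovered
  by \<open>bar_obj_cdg\<close>.\<close>

lemma bar_image:
 "bobj ` Ob (SU) = {X \<in> Ob (CDGComod R KB). \<exists>M. gm M \<and> fst X = cofree_comod R KB M}"
proof (intro equalityI subsetI)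
 fix X assume "X \<in> bobj ` Ob (SU)"
 then obtain M p where Y: "surep (M,p)" "X = bobj (M,p)" by (auto simp: SURep_def)
 note M = su_repD[OF Y(1)]
 show "X \<in> {X \<in> Ob (CDGComod R KB). \<exists>M. gm M \<and> fst X = cofree_comod R KB M}"
  using bar_obj_cdg[OF M] Y M(1) by (auto simp: CDGComod_def bar_obj_eq)
next
 fix X assume "X \<in> {X \<in> Ob (CDGComod R KB). \<exists>M. gm M \<and> fst X = cofree_comod R KB M}"
 then obtain M D where M: "gm M" and X: "X = (cofree_comod R KB M, D)" and c: "cdg_comodule R KB X" by (cases X) (auto simp: CDGComod_def)
 have cd: "is_coderivation R KB (cofree_comod R KB M) D" using c unfolding X cdg_comodule_def Let_def by (auto simp: tc.cofree_eq)
 have T: "gm (CT M)" using M by simp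
 have "gcomp (CT M) (-1) (tc.ppi M) D <: Hom (CT M) M (-1)" by (rule gcomp_HOM[OF T tc.coderD(1)[OF M cd] tc.ppi_HOM[OF M]]) simp
 from adj_surj[OF M M this, of 0] obtain p where p: "p \<in> CH M M 0" "adj M M 0 p = gcomp (CT M) (-1) (tc.ppi M) D" by auto
 have Xe: "X = bobj (M,p)" unfolding X bar_obj_eq p(2) using tc.coder_eq[OF M cd] by simp
 then have "surep (M,p)" using c bar_obj_cdg[OF M p(1)] by simp
 then show "X \<in> bobj ` Ob (SU)" unfolding Xe SURep_def by auto
qed

text \<open>An isomorphism of the underlying comodules is enough: after transport the object is
  cofree on the nose, so that \<open>bar_image\<close> yields the representation, and the given
  isomorphism commutes with the differentials by construction.\<close>

lemma bar_essential_image: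
 "{X \<in> Ob (CDGComod R KB). \<exists>Y\<in>Ob (SU :: (('k, 'a, 'm) rep, _) precat). isomorphic_in (CDGComod R KB) X (bobj Y)} =
  {X \<in> Ob (CDGComod R KB). \<exists>M :: ('k,'m) gmod. gm M \<and> isomorphic_in (Comod R KB) (fst X) (cofree_comod R KB M)}"
proof (intro equalityI subsetI; clarify)
 fix P \<rho> D and M :: "('k,'m) gmod" and p
 assume X: "((P, \<rho>), D) \<in> Ob (CDGComod R KB)" and Y: "(M,p) \<in> Ob (SU)"
  and iso: "isomorphic_in (CDGComod R KB) ((P, \<rho>), D) (bobj (M,p))"
 have "surep (M,p)" using Y by (simp add: SURep_def)
 note M = su_repD[OF this]
 have "isomorphic_in (Comod R KB) (P, \<rho>) (cofree_comod R KB M)"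
  using iso unfolding isomorphic_in_def CDGComod_def Comod_def bar_obj_eq by auto
 then show "\<exists>M. gm M \<and> isomorphic_in (Comod R KB) (fst ((P, \<rho>), D)) (cofree_comod R KB M)" using M by auto
next
 fix P \<rho> D and M :: "('k,'m) gmod"
 assume X: "((P, \<rho>), D) \<in> Ob (CDGComod R KB)" and M: "gm M"
  and iso: "isomorphic_in (Comod R KB) (fst ((P, \<rho>), D)) (cofree_comod R KB M)"
 from iso obtain f g where fg: "f \<in> comodule_mor R KB (P, \<rho>) (CT M, tc.rho M)" "g \<in> comodule_mor R KB (CT M, tc.rho M) (P, \<rho>)"
  "gcomp P 0 g f = gid P" "gcomp (CT M) 0 f g = gid (CT M)" unfolding isomorphic_in_def Comod_def tc.cofree_eq by auto
 have c: "cdg_comodule R KB ((P, \<rho>), D)" using X by (simp add: CDGComod_def)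
 note G = tc.cofree_graded_comodule[OF M, unfolded tc.cofree_eq]
 define D' where "D' = gcomp (CT M) (-1) f (gcomp (CT M) 0 D g)"
 note t = tc.transport_cdg[OF c G fg, folded D'_def]
 have "((CT M, tc.rho M), D') \<in> bobj ` Ob (SU)" unfolding bar_image using t(1) M by (auto simp: CDGComod_def tc.cofree_eq)
 then obtain Y where Y: "Y \<in> Ob (SU)" "bobj Y = ((CT M, tc.rho M), D')" by auto
 have "isomorphic_in (CDGComod R KB) ((P, \<rho>), D) ((CT M, tc.rho M), D')"
  unfolding isomorphic_in_def CDGComod_def using fg t(2,3) by (auto intro!: bexI[of _ f] bexI[of _ g])
 then show "\<exists>Y\<in>Ob (SU). isomorphic_in (CDGComod R KB) ((P, \<rho>), D) (bobj Y)"
  unfolding Y(2)[symmetric] by (rule bexI[OF _ Y(1)])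
qed

end

theorem corollary5p17:
  fixes R :: "'k ring"
    and A :: "('k, 'a) gmod"
    and e :: 'a
    and \<epsilon> :: "('a, 'k) gmap"
    and \<mu> :: "('k, 'a, 'a) cochain"
    and h :: "('k, 'a, 'k) cochain"
  assumes "cring R"
    and "Ainf_algebra_split_unit R A e \<epsilon> \<mu> h"
  shows
    "let K = Bar_u R A \<epsilon> \<mu> h;
         Rep = (SURep R A e \<epsilon> \<mu> h ::
           (('k, 'a, 'm) rep, ('k, 'a, ('m, 'm) gmap) cochain) precat);
         CDG = CDGComod R K;
         F = bar_obj R A \<epsilon> \<mu> h
     in \<exists>Fa.
          is_functor Rep CDG F Fa \<and>
          fully_faithful Rep CDG F Fa \<and>
          F ` Ob Rep =
            {X \<in> Ob CDG. \<exists>M :: ('k, 'm) gmod. gmodule R M \<and> fst X = cofree_comod R K M} \<and>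
          {X \<in> Ob CDG. \<exists>Y\<in>Ob Rep. isomorphic_in CDG X (F Y)} =
            {X \<in> Ob CDG. \<exists>M :: ('k, 'm) gmod. gmodule R M \<and>
               isomorphic_in (Comod R K) (fst X) (cofree_comod R K M)}"
proof -
  have a: "ainf R A e \<epsilon> \<mu> h"
    by (rule ainf.intro[OF ground.intro[OF assms(1)] ainf_axioms.intro[OF assms(2)]])
  show ?thesis
    unfolding Let_def
    by (intro exI[of _ "\<lambda>X Y f. tcoalg.Phi R (susp (bar_mod R A \<epsilon>)) (Bar_u R A \<epsilon> \<mu> h) (fst X) (fst Y) 0 (ainf.nadj R A \<epsilon> (fst X) (fst Y) f)"] conjI ainf.bar_functor[OF a] ainf.bar_fully_faithful[OF a]
        ainf.bar_image[OF a] ainf.bar_essential_image[OF a])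
qed

end
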